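(* Let $\psi:[0,1]\to\mathrm{Sp}(\mathbb{R}^{2n},\Omega_0)$ be a continuous path of symplectic matrices. For $i=0,1$ decompose $\psi(i)=\psi^\star(i)\diamond\psi^{(1)}(i)$, where $\psi^\star(i)$ does not admit $1$ as an eigenvalue and $\psi^{(1)}(i)$ is the restriction of $\psi(i)$ to its generalized eigenspace of eigenvalue $1$. Consider a continuous extension $\Psi:[-1,2]\to\mathrm{Sp}(\mathbb{R}^{2n},\Omega_0)$ of $\psi$ such that - $\Psi(t)=\psi(t)$ for $t\in[0,1]$; - $\Psi(-\tfrac12)=\psi^\star(0)\diamond\begin{pmatrix}e^{-1}\mathrm{Id}&0\\ 0&e\,\mathrm{Id}\end{pmatrix}$, and $\Psi(t)=\psi^\star(0)\diamond\phi_0(t)$, where $\phi_0(t)$ has only real positive eigenvalues, for $t\in[-\tfrac12,0]$; - $\Psi(\tfrac32)=\psi^\star(1)\diamond\begin{pmatrix}e^{-1}\mathrm{Id}&0\\ 0&e\,\mathrm{Id}\end{pmatrix}$, and $\Psi(t)=\psi^\star(1)\diamond\phi_1(t)$, where $\phi_1(t)$ has only real positive eigenvalues, for $t\in[1,\tfrac32]$; - $\Psi(-1)\in\{W^+,W^-\}$, $\Psi(2)\in\{W^+,W^-\}$, and $\Psi(t)$ does not admit $1$ as an eigenvalue for $t\in[-1,-\tfrac12]$ and for $t\in[\tfrac32,2]$. Let $\tilde\rho:\mathrm{Sp}(\mathbb{R}^{2n},\Omega_0)\to S^1$ be any continuous map such that (1) $\tilde\rho=\det_{\mathbb C}$ on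 $U(n)=O(\mathbb{R}^{2n})\cap\mathrm{Sp}(\mathbb{R}^{2n},\Omega_0)$; (2) $\tilde\rho(W^-)\in\{\pm1\}$; (3) $\deg(\tilde\rho^{\,2}\circ\psi_{2-})=n-1$ for the path $$\psi_{2-}:t\in[0,1]\mapsto \exp\left(t\pi J_0\begin{pmatrix}0&0&-\frac{\log 2}{\pi}&0\\ 0&\mathrm{Id}_{n-1}&0&0\\ -\frac{\log 2}{\pi}&0&0&0\\ 0&0&0&\mathrm{Id}_{n-1}\end{pmatrix}\right).$$ Then the Robbin-Salamon index of $\psi$ is $$\mu_{RS}(\psi)=\deg(\tilde\rho^{\,2}\circ\Psi)+\tfrac12\sum_{k\ge1}\mathrm{Sign}\bigl(\hat Q_k^{\psi(0)}\bigr)-\tfrac12\sum_{k\ge1}\mathrm{Sign}\bigl(\hat Q_k^{\psi(1)}\bigr),$$ where for $A\in\mathrm{Sp}(\mathbb{R}^{2n},\Omega_0)$ and $k\ge 1$, $\hat Q_k^{A}$ is the symmetric bilinear form $$\hat Q_k^{A}:\ker\bigl((A-\mathrm{Id})^{2k}\bigr)\times\ker\bigl((A-\mathrm{Id})^{2k}\bigr)\to\mathbb{R},\qquad (v,w)\mapsto\Omega_0\bigl((A-\mathrm{Id})^kv,(A-\mathrm{Id})^{k-1}w\bigr).$$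
   Context: Notation. $\Omega_0=\begin{pmatrix}0&\mathrm{Id}_n\\ -\mathrm{Id}_n&0\end{pmatrix}$, $\Omega_0(v,w)=v^\tau\Omega_0w$, on $\mathbb{R}^{2n}$; $\mathrm{Sp}(\mathbb{R}^{2n},\Omega_0)$ is the group of symplectic $2n\times2n$ matrices; $J_0=\begin{pmatrix}0&-\mathrm{Id}_n\\ \mathrm{Id}_n&0\end{pmatrix}$. $U(n)$ consists of matrices $\begin{pmatrix}X&-Y\\ Y&X\end{pmatrix}$ and $\det_{\mathbb C}$ of it is $\det(X+iY)$. $W^+=-\mathrm{Id}$ and $W^-=\mathrm{diag}(2,-1,\ldots,-1,\tfrac12,-1,\ldots,-1)$ with $2$ in position $1$ and $\frac12$ in position $n+1$. In the matrix defining $\psi_{2-}$ the block sizes are $1,n-1,1,n-1$. The signature $\mathrm{Sign}$ of a (possibly degenerate) symmetric form is the number of positive minus the number of negative eigenvalues. Degree. For a continuous $f:[a,b]\to S^1$ with $f(a)=f(b)$, write $f(t)=e^{2\pi i\theta(t)}$ with $\theta$ continuous; $\deg f:=\theta(b)-\theta(a)$. Symplectic direct sum. $A\diamond B$ denotes the symplectic direct sum of symplectic endomorphisms, via the identification of $\mathrm{Sp}(V',\Omega')\times\mathrm{Sp}(V'',\Omega'')$ with a subgroup of $\mathrm{Sp}(V'\oplus V'',\Omega'\oplus\Omega'')$. For $A\in \mathrm{Sp}(\mathbb{R}^{2n},\Omega_0)$, let $V_{[1]}$ be the generalized eigenspace for the eigenvalue $1$ (possibly $\{0\}$); it is a symplectic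 subspace, and $\mathbb{R}^{2n}=V^\star\oplus V_{[1]}$ with $V^\star$ its $\Omega_0$-orthogonal, which is $A$-invariant; the decomposition $\psi(i)=\psi^\star(i)\diamond\psi^{(1)}(i)$ is with respect to this splitting for $A=\psi(i)$. The $\phi_i(t)$ are symplectic endomorphisms of the generalized $1$-eigenspace of $\psi(i)$, and $\begin{pmatrix}e^{-1}\mathrm{Id}&0\\ 0&e\,\mathrm{Id}\end{pmatrix}$ is the matrix of a symplectic endomorphism of that space in a symplectic basis of it. Robbin-Salamon index of a path of Lagrangians. Let $(W,\Omega)$ be a finite-dimensional real symplectic vector space and $L\subset W$ a fixed Lagrangian subspace. For a smooth path $\Lambda:[a,b]\to\mathcal{L}_{(W,\Omega)}$ in the space of Lagrangian subspaces and $t_0\in[a,b]$, choose a Lagrangian $M$ with $\Lambda_{t_0}\oplus M=W$; for $t$ near $t_0$ write $\Lambda_t=\{v+\alpha_t(v)\mid v\in\Lambda_{t_0}\}$ with $\alpha_t:\Lambda_{t_0}\to M$ linear, and let $Q(\Lambda_{t_0},\dot\Lambda_{t_0})(v,v')=\frac{d}{dt}\Omega(v,\alpha_t(v'))|_{t=t_0}$, a symmetric bilinear form on $\Lambda_{t_0}$ independent of $M$. A crossing is a $t$ with $\Lambda_t\cap L\ne\{0\}$; its crossing form is $\Gamma(\Lambda,L,t)=Q(\Lambda_t,\dot\Lambda_t)|_{\Lambda_t\cap L}$; it is regular if this form is nondegenerate. For a path with only regular crossings, $$\mu_{RS}(\Lambda,L)=\tfrac12\mathrm{Sign}\,\Gamma(\Lambda,L,a)+\sum_{a<t<b,\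 t\text{ crossing}}\mathrm{Sign}\,\Gamma(\Lambda,L,t)+\tfrac12\mathrm{Sign}\,\Gamma(\Lambda,L,b).$$ Every continuous path of Lagrangians is homotopic with fixed end points to one with only regular crossings, and two paths with only regular crossings homotopic with fixed end points have the same index; this defines $\mu_{RS}(\Lambda,L)$ for every continuous path. Robbin-Salamon index of a path of symplectic matrices. For a continuous $\psi:[a,b]\to\mathrm{Sp}(\mathbb{R}^{2n},\Omega_0)$, $\mu_{RS}(\psi):=\mu_{RS}(\mathrm{Gr}\,\psi,\Delta)$, where $\mathrm{Gr}\,\psi_t=\{(x,\psi_tx)\mid x\in\mathbb{R}^{2n}\}$ and $\Delta=\{(x,x)\mid x\in\mathbb{R}^{2n}\}$ are Lagrangians in $(\mathbb{R}^{2n}\times\mathbb{R}^{2n},\overline\Omega=-\Omega_0\times\Omega_0)$. *)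

theory Defs
  imports "HOL-Analysis.Analysis"
begin

section \<open>Linear algebra\<close>

text \<open>
  \<open>\<real>\<^sup>2\<^sup>n\<close> is \<open>real ^ ('n + 'n)\<close> with \<open>n = CARD('n)\<close>: the index \<open>Inl i\<close> is position \<open>i\<close> and
  \<open>Inr i\<close> is position \<open>n + i\<close>. Endomorphisms of a subspace \<open>V\<close> are functions on the ambient space
  of which only the restriction to \<open>V\<close> matters.
\<close>

definition block_mat ::
    "'a^'n^'n \<Rightarrow> 'a^'n^'n \<Rightarrow> 'a^'n^'n \<Rightarrow> 'a^'n^'n \<Rightarrow> 'a^('n + 'n)^('n + 'n)" where
  "block_mat A B C D = (\<chi> i j. case i of
      Inl k \<Rightarrow> (case j of Inl l \<Rightarrow> A $ k $ l | Inr l \<Rightarrow> B $ k $ l)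
    | Inr k \<Rightarrow> (case j of Inl l \<Rightarrow> C $ k $ l | Inr l \<Rightarrow> D $ k $ l))"

definition diag_mat :: "('n \<Rightarrow> 'a::zero) \<Rightarrow> 'a^'n^'n" where
  "diag_mat d = (\<chi> i j. if i = j then d i else 0)"

text \<open>The exponential series is spelled out because \<open>*\<close> on \<open>real^'n^'n\<close> is entrywise.\<close>

definition mat_exp :: "real^'n^'n \<Rightarrow> real^'n^'n" where
  "mat_exp A = (\<Sum>k. (1 / fact k) *\<^sub>R ((\<lambda>B. A ** B) ^^ k) (mat 1))"

text \<open>
  Complex eigenvalues of a real endomorphism \<open>f\<close> of \<open>V\<close>: the complexification of \<open>f\<close> sends the
  nonzero vector \<open>x + \<i> y\<close> (\<open>x, y \<in> V\<close>) to \<open>c (x + \<i> y)\<close>, separated into real and imaginary part.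
\<close>

definition eigenvalue_on :: "'a::real_vector set \<Rightarrow> ('a \<Rightarrow> 'a) \<Rightarrow> complex \<Rightarrow> bool" where
  "eigenvalue_on V f c \<longleftrightarrow> (\<exists>x\<in>V. \<exists>y\<in>V. (x \<noteq> 0 \<or> y \<noteq> 0) \<and>
     f x = Re c *\<^sub>R x - Im c *\<^sub>R y \<and> f y = Im c *\<^sub>R x + Re c *\<^sub>R y)"

text \<open>
  Eigenspaces of a bilinear form on a subspace are those of its Gram matrix in an orthonormal basis
  of the subspace; eigenvalues are counted with multiplicity.
\<close>

definition form_eigenspace ::
    "'a::euclidean_space set \<Rightarrow> ('a \<Rightarrow> 'a \<Rightarrow> real) \<Rightarrow> real \<Rightarrow> 'a set" where
  "form_eigenspace V B c = {v \<in> V. \<forall>w\<in>V. B v w = c * (v \<bullet> w)}"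

definition signature :: "'a::euclidean_space set \<Rightarrow> ('a \<Rightarrow> 'a \<Rightarrow> real) \<Rightarrow> int" where
  "signature V B =
     (\<Sum>c | c > 0 \<and> form_eigenspace V B c \<noteq> {0}. int (dim (form_eigenspace V B c))) -
     (\<Sum>c | c < 0 \<and> form_eigenspace V B c \<noteq> {0}. int (dim (form_eigenspace V B c)))"

definition nondegenerate_on :: "'a::zero set \<Rightarrow> ('a \<Rightarrow> 'a \<Rightarrow> real) \<Rightarrow> bool" where
  "nondegenerate_on V B \<longleftrightarrow> (\<forall>v\<in>V. (\<forall>w\<in>V. B v w = 0) \<longrightarrow> v = 0)"

definition complementary :: "'a::real_vector set \<Rightarrow> 'a set \<Rightarrow> bool" where
  "complementary V V' \<longleftrightarrow> V \<inter> V' = {0} \<and> (\<forall>x. \<exists>v\<in>V. \<exists>v'\<in>V'. x = v + v')"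


section \<open>The degree of a map to the circle\<close>

definition circle_degree :: "real \<Rightarrow> real \<Rightarrow> (real \<Rightarrow> complex) \<Rightarrow> real" where
  "circle_degree a b f = (THE d. \<exists>\<theta>. continuous_on {a..b} \<theta> \<and>
     (\<forall>t\<in>{a..b}. f t = exp (2 * pi * \<i> * complex_of_real (\<theta> t))) \<and> d = \<theta> b - \<theta> a)"


section \<open>The Robbin-Salamon index of a path of Lagrangians\<close>

definition form_orthogonal :: "('a \<Rightarrow> 'a \<Rightarrow> real) \<Rightarrow> 'a set \<Rightarrow> 'a set" where
  "form_orthogonal \<Omega> V = {w. \<forall>v\<in>V. \<Omega> v w = 0}"

definition lagrangian :: "('a::real_vector \<Rightarrow> 'a \<Rightarrow> real) \<Rightarrow> 'a set \<Rightarrow> bool" where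
  "lagrangian \<Omega> L \<longleftrightarrow> subspace L \<and> form_orthogonal \<Omega> L = L"

text \<open>
  The Lagrangian Grassmannian is embedded as a compact submanifold of the space of endomorphisms by
  sending \<open>L\<close> to the orthogonal projection \<open>closest_point L\<close>; its topology and smooth structure are
  the induced ones. On linear maps, the topology of pointwise convergence on \<open>'a \<Rightarrow> 'a\<close> is
  the norm topology.
\<close>

definition lagrangian_topology :: "('a::euclidean_space \<Rightarrow> 'a \<Rightarrow> real) \<Rightarrow> 'a set topology" where
  "lagrangian_topology \<Omega> = pullback_topology {L. lagrangian \<Omega> L} closest_point euclidean"

definition smooth_on_interval :: "real \<Rightarrow> real \<Rightarrow> (real \<Rightarrow> 'a::real_normed_vector) \<Rightarrow> bool" where
  "smooth_on_interval a b f \<longleftrightarrow> (\<exists>D. D 0 = f \<and>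
     (\<forall>k::nat. \<forall>t\<in>{a..b}. (D k has_vector_derivative D (Suc k) t) (at t within {a..b})))"

definition smooth_lagrangian_path ::
    "('a::euclidean_space \<Rightarrow> 'a \<Rightarrow> real) \<Rightarrow> real \<Rightarrow> real \<Rightarrow> (real \<Rightarrow> 'a set) \<Rightarrow> bool" where
  "smooth_lagrangian_path \<Omega> a b \<Lambda> \<longleftrightarrow> (\<forall>t\<in>{a..b}. lagrangian \<Omega> (\<Lambda> t)) \<and>
     (\<forall>v. smooth_on_interval a b (\<lambda>t. closest_point (\<Lambda> t) v))"

text \<open>
  \<open>graph_map (\<Lambda> t) M\<close> is the linear map whose graph over \<open>\<Lambda> t\<^sub>0\<close> is \<open>\<Lambda> t\<close>, for \<open>t\<close> near \<open>t\<^sub>0\<close> and \<open>M\<close>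
  complementary to \<open>\<Lambda> t\<^sub>0\<close>; the derivative below does not depend on the choice of \<open>M\<close>.
\<close>

definition graph_map :: "'a::real_vector set \<Rightarrow> 'a set \<Rightarrow> 'a \<Rightarrow> 'a" where
  "graph_map L M v = (THE u. u \<in> M \<and> v + u \<in> L)"

definition lagrangian_velocity ::
    "('a::real_vector \<Rightarrow> 'a \<Rightarrow> real) \<Rightarrow> real \<Rightarrow> real \<Rightarrow> (real \<Rightarrow> 'a set) \<Rightarrow> real \<Rightarrow> 'a \<Rightarrow> 'a \<Rightarrow> real" where
  "lagrangian_velocity \<Omega> a b \<Lambda> t\<^sub>0 v v' =
     (let M = (SOME M. lagrangian \<Omega> M \<and> complementary (\<Lambda> t\<^sub>0) M)
      in vector_derivative (\<lambda>t. \<Omega> v (graph_map (\<Lambda> t) M v')) (at t\<^sub>0 within {a..b}))"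

definition crossing :: "(real \<Rightarrow> 'a::zero set) \<Rightarrow> 'a set \<Rightarrow> real \<Rightarrow> bool" where
  "crossing \<Lambda> L t \<longleftrightarrow> \<Lambda> t \<inter> L \<noteq> {0}"

definition regular_crossings ::
    "('a::real_vector \<Rightarrow> 'a \<Rightarrow> real) \<Rightarrow> real \<Rightarrow> real \<Rightarrow> (real \<Rightarrow> 'a set) \<Rightarrow> 'a set \<Rightarrow> bool" where
  "regular_crossings \<Omega> a b \<Lambda> L \<longleftrightarrow> (\<forall>t\<in>{a..b}. crossing \<Lambda> L t \<longrightarrow>
     nondegenerate_on (\<Lambda> t \<inter> L) (lagrangian_velocity \<Omega> a b \<Lambda> t))"

definition crossing_sign ::
    "('a::euclidean_space \<Rightarrow> 'a \<Rightarrow> real) \<Rightarrow> real \<Rightarrow> real \<Rightarrow> (real \<Rightarrow> 'a set) \<Rightarrow> 'a set \<Rightarrow> real \<Rightarrow> real" where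
  "crossing_sign \<Omega> a b \<Lambda> L t =
     of_int (signature (\<Lambda> t \<inter> L) (lagrangian_velocity \<Omega> a b \<Lambda> t))"

definition regular_rs_index ::
    "('a::euclidean_space \<Rightarrow> 'a \<Rightarrow> real) \<Rightarrow> real \<Rightarrow> real \<Rightarrow> (real \<Rightarrow> 'a set) \<Rightarrow> 'a set \<Rightarrow> real" where
  "regular_rs_index \<Omega> a b \<Lambda> L =
     1/2 * crossing_sign \<Omega> a b \<Lambda> L a
     + (\<Sum>t | a < t \<and> t < b \<and> crossing \<Lambda> L t. crossing_sign \<Omega> a b \<Lambda> L t)
     + 1/2 * crossing_sign \<Omega> a b \<Lambda> L b"

text \<open>
  The index of a continuous path is that of any smooth path with regular crossings
  homotopic to it with fixed end points.
\<close>

definition lagrangian_rs_index ::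
    "('a::euclidean_space \<Rightarrow> 'a \<Rightarrow> real) \<Rightarrow> real \<Rightarrow> real \<Rightarrow> (real \<Rightarrow> 'a set) \<Rightarrow> 'a set \<Rightarrow> real" where
  "lagrangian_rs_index \<Omega> a b \<Lambda> L = (THE m. \<exists>\<Lambda>'.
     smooth_lagrangian_path \<Omega> a b \<Lambda>' \<and> regular_crossings \<Omega> a b \<Lambda>' L \<and>
     homotopic_with (\<lambda>\<gamma>. \<gamma> a = \<Lambda> a \<and> \<gamma> b = \<Lambda> b)
       (top_of_set {a..b}) (lagrangian_topology \<Omega>) \<Lambda> \<Lambda>' \<and>
     m = regular_rs_index \<Omega> a b \<Lambda>' L)"


section \<open>Symplectic matrices\<close>

definition Omega0_mat :: "real^('n::finite + 'n)^('n + 'n)" where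
  "Omega0_mat = block_mat 0 (mat 1) (- mat 1) 0"

definition Omega0 :: "real^('n::finite + 'n) \<Rightarrow> real^('n + 'n) \<Rightarrow> real" where
  "Omega0 v w = v \<bullet> (Omega0_mat *v w)"

definition J0 :: "real^('n::finite + 'n)^('n + 'n)" where
  "J0 = block_mat 0 (- mat 1) (mat 1) 0"

definition Sp :: "(real^('n::finite + 'n)^('n + 'n)) set" where
  "Sp = {A. transpose A ** Omega0_mat ** A = Omega0_mat}"

text \<open>\<open>X + \<i> Y\<close> is read off from the first block column of \<open>((X, -Y), (Y, X))\<close>.\<close>

definition det_C :: "real^('n::finite + 'n)^('n + 'n) \<Rightarrow> complex" where
  "det_C U = det (\<chi> i j. Complex (U $ Inl i $ Inl j) (U $ Inr i $ Inl j))"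

definition first_index :: "'n::{finite,linorder}" where
  "first_index = Min UNIV"

definition W_plus :: "real^('n::finite + 'n)^('n + 'n)" where
  "W_plus = - mat 1"

definition W_minus :: "real^('n::{finite,linorder} + 'n)^('n + 'n)" where
  "W_minus = block_mat (diag_mat (\<lambda>i. if i = first_index then 2 else - 1)) 0
                       0 (diag_mat (\<lambda>i. if i = first_index then 1/2 else - 1))"

definition psi2_minus :: "real \<Rightarrow> real^('n::{finite,linorder} + 'n)^('n + 'n)" where
  "psi2_minus t =
     (let D = diag_mat (\<lambda>i::'n. if i = first_index then 0 else 1);
          E = diag_mat (\<lambda>i::'n. if i = first_index then - (ln 2 / pi) else 0)
      in mat_exp ((t * pi) *\<^sub>R (J0 ** block_mat D E E D)))"

definition admits_eigenvalue_1 :: "real^'n^'n \<Rightarrow> bool" where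
  "admits_eigenvalue_1 A \<longleftrightarrow> eigenvalue_on UNIV ((*v) A) 1"

definition gen_eigenspace_1 :: "real^'n^'n \<Rightarrow> (real^'n) set" where
  "gen_eigenspace_1 A = {v. \<exists>k. (((*v) (A - mat 1)) ^^ k) v = 0}"

definition star_space :: "real^('n::finite + 'n)^('n + 'n) \<Rightarrow> (real^('n + 'n)) set" where
  "star_space A = form_orthogonal Omega0 (gen_eigenspace_1 A)"

definition symplectic_endo_on ::
    "(real^('n::finite + 'n)) set \<Rightarrow> (real^('n + 'n) \<Rightarrow> real^('n + 'n)) \<Rightarrow> bool" where
  "symplectic_endo_on V f \<longleftrightarrow> f ` V \<subseteq> V \<and>
     (\<forall>v\<in>V. \<forall>w\<in>V. f (v + w) = f v + f w) \<and> (\<forall>r. \<forall>v\<in>V. f (r *\<^sub>R v) = r *\<^sub>R f v) \<and>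
     (\<forall>v\<in>V. \<forall>w\<in>V. Omega0 (f v) (f w) = Omega0 v w)"

text \<open>The matrix of the map that is \<open>f\<close> on \<open>V\<close> and \<open>g\<close> on \<open>V'\<close>, for complementary \<open>V\<close> and \<open>V'\<close>.\<close>

definition diamond ::
    "(real^'n) set \<Rightarrow> (real^'n \<Rightarrow> real^'n) \<Rightarrow> (real^'n) set \<Rightarrow> (real^'n \<Rightarrow> real^'n) \<Rightarrow> real^'n^'n" where
  "diamond V f V' g =
     matrix (\<lambda>x. THE y. \<exists>v\<in>V. \<exists>v'\<in>V'. x = v + v' \<and> y = f v + g v')"

definition symplectic_basis ::
    "(real^('n::finite + 'n)) set \<Rightarrow> nat \<Rightarrow> (nat \<Rightarrow> real^('n + 'n)) \<Rightarrow> (nat \<Rightarrow> real^('n + 'n)) \<Rightarrow> bool" where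
  "symplectic_basis V m p q \<longleftrightarrow> span (p ` {..<m} \<union> q ` {..<m}) = V \<and>
     (\<forall>i<m. \<forall>j<m. Omega0 (p i) (p j) = 0 \<and> Omega0 (q i) (q j) = 0 \<and>
        Omega0 (p i) (q j) = (if i = j then 1 else 0))"

text \<open>\<open>f\<close> has the matrix \<open>diag (e\<^sup>-\<^sup>1 Id, e Id)\<close> in some symplectic basis of \<open>V\<close>.\<close>

definition standard_hyperbolic_on ::
    "(real^('n::finite + 'n)) set \<Rightarrow> (real^('n + 'n) \<Rightarrow> real^('n + 'n)) \<Rightarrow> bool" where
  "standard_hyperbolic_on V f \<longleftrightarrow> (\<exists>m p q. symplectic_basis V m p q \<and>
     (\<forall>i<m. f (p i) = exp (- 1) *\<^sub>R p i \<and> f (q i) = exp 1 *\<^sub>R q i))"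

definition Qhat ::
    "real^('n::finite + 'n)^('n + 'n) \<Rightarrow> nat \<Rightarrow> real^('n + 'n) \<Rightarrow> real^('n + 'n) \<Rightarrow> real" where
  "Qhat A k v w =
     Omega0 ((((*v) (A - mat 1)) ^^ k) v) ((((*v) (A - mat 1)) ^^ (k - 1)) w)"

definition Qhat_sign :: "real^('n::finite + 'n)^('n + 'n) \<Rightarrow> nat \<Rightarrow> int" where
  "Qhat_sign A k = signature {v. (((*v) (A - mat 1)) ^^ (2 * k)) v = 0} (Qhat A k)"


section \<open>The Robbin-Salamon index of a path of symplectic matrices\<close>

definition Omega_bar ::
    "(real^('n::finite + 'n)) \<times> (real^('n + 'n)) \<Rightarrow> (real^('n + 'n)) \<times> (real^('n + 'n)) \<Rightarrow> real" where
  "Omega_bar v w = - Omega0 (fst v) (fst w) + Omega0 (snd v) (snd w)"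

definition rs_index ::
    "real \<Rightarrow> real \<Rightarrow> (real \<Rightarrow> real^('n::finite + 'n)^('n + 'n)) \<Rightarrow> real" where
  "rs_index a b \<psi> =
     lagrangian_rs_index Omega_bar a b (\<lambda>t. range (\<lambda>x. (x, \<psi> t *v x))) (range (\<lambda>x. (x, x)))"

end

theory Submission
  imports Defs
begin

text \<open>
  Diagonalising a Lagrangian \<open>V\<close> against \<open>L\<close> gives angles \<open>\<theta>\<^sub>j\<close> in \<open>[0, \<pi>)\<close>. The function \<open>souriau V = \<Prod> exp (2 \<i> \<theta>\<^sub>j)\<close>
  is continuous, and a lift of it along a path, corrected by the sum of \<open>1/2 - \<theta>\<^sub>j / \<pi>\<close> over \<open>\<theta>\<^sub>j \<noteq> 0\<close>, is
  constant away from crossings and jumps by half the signature of the crossing form on each side of a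
  crossing. So its increment is the Robbin-Salamon index of the path, regular or not.

  On graphs of unitary matrices \<open>souriau\<close> is the square of \<open>det_C\<close>; as \<open>Sp\<close> retracts onto \<open>U(n)\<close>, it is \<open>\<rho>\<^sup>2\<close> times the
  exponential of a continuous function, whose values at \<open>W_plus\<close> and \<open>W_minus\<close> are read off from the paths
  \<open>exp (t \<pi> J0)\<close> and \<open>psi2_minus\<close>. Hence the corrected lift grows by the degree along \<open>\<Psi>\<close>. It is constant where 1 is no
  eigenvalue. On the two remaining pieces, scaling the Cayley transform \<open>Y\<close> of \<open>\<phi>\<close> to 0 shows that each end
  contributes half the signature of \<open>\<Omega>\<^sub>0(x, Y x)\<close>. This is 0 at the hyperbolic end; at the other end \<open>Y\<close> is
  nilpotent, and splitting off the kernels of \<open>Y\<^sup>2\<^sup>k\<close> one by one gives the sum over the forms \<open>Qhat\<close>.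
\<close>

text \<open>Two obstacles shape the proof. The angles of a Lagrangian carry no continuous numbering,
  so they enter only through symmetric functions: determinants for continuity, counts for
  signatures. And the index is defined by a description over smooth regular representatives, so at
  least one must be produced for a merely continuous path. This is done by hand: a smoothed path is
  multiplied from both sides by \<open>rotm (K * t * (1 - t))\<close>, which adds a large definite
  term to every crossing form except near t = 1/2, where the choice of K excludes crossings. The
  correction is a sawtooth with value 0 at its jump; this is the origin of the halves in the end
  terms. Jumps are found without following eigenvalues: first-order perturbation bounds both inertia
  indices from below, and a dimension count leaves no slack. The crossing form may be degenerate
  there, provided that nearby kernels are at least as large as its radical. This permits the Cayley
  scaling, along which a kernel persists, and with it a deformation of the outer pieces of the
  extended path, whose crossings are otherwise uncontrolled.\<close>

type_synonym 'n spvec = "real^('n + 'n)"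
type_synonym 'n spmat = "real^('n + 'n)^('n + 'n)"

abbreviation circ :: "real \<Rightarrow> complex" where
  "circ x \<equiv> exp (2 * pi * \<i> * complex_of_real x)"


section \<open>Signatures of symmetric forms\<close>

definition symform :: "'a::euclidean_space set \<Rightarrow> ('a \<Rightarrow> 'a \<Rightarrow> real) \<Rightarrow> bool" where
  "symform V B \<longleftrightarrow> subspace V \<and> bilinear B \<and> (\<forall>v\<in>V. \<forall>w\<in>V. B v w = B w v)"

definition radical :: "'a::euclidean_space set \<Rightarrow> ('a \<Rightarrow> 'a \<Rightarrow> real) \<Rightarrow> 'a set" where
  "radical V B = {v \<in> V. \<forall>w\<in>V. B v w = 0}"

definition pos_def_on :: "'a::euclidean_space set \<Rightarrow> ('a \<Rightarrow> 'a \<Rightarrow> real) \<Rightarrow> bool" where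
  "pos_def_on U B \<longleftrightarrow> (\<forall>u\<in>U. u \<noteq> 0 \<longrightarrow> B u u > 0)"

text \<open>Definite subspaces instead of eigenvalues make the index independent of the inner
  product: it is bounded below by exhibiting one subspace, and it can be compared under arbitrary
  linear maps.\<close>

definition pos_index :: "'a::euclidean_space set \<Rightarrow> ('a \<Rightarrow> 'a \<Rightarrow> real) \<Rightarrow> nat" where
  "pos_index V B = Max {dim U |U. subspace U \<and> U \<subseteq> V \<and> pos_def_on U B}"

definition neg_index :: "'a::euclidean_space set \<Rightarrow> ('a \<Rightarrow> 'a \<Rightarrow> real) \<Rightarrow> nat" where
  "neg_index V B = pos_index V (\<lambda>v w. - B v w)"

lemma bilinear_uminus: "bilinear B \<Longrightarrow> bilinear (\<lambda>v w. - B v w)" for B :: "'a::real_vector \<Rightarrow> 'a \<Rightarrow> real"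
  unfolding bilinear_def by (auto intro: linear_compose_neg)

lemma symform_uminus: "symform V B \<Longrightarrow> symform V (\<lambda>v w. - B v w)"
  by (auto simp: symform_def bilinear_uminus)

lemma symform_subspace: "symform V B \<Longrightarrow> subspace U \<Longrightarrow> U \<subseteq> V \<Longrightarrow> symform U B"
  by (auto simp: symform_def subset_iff)

lemma radical_uminus: "radical V (\<lambda>v w. - B v w) = radical V B"
  by (auto simp: radical_def)

lemma subspace_radical: assumes "symform V B" shows "subspace (radical V B)"
proof -
  have "bilinear B" "subspace V" using assms by (auto simp: symform_def)
  then show ?thesis
    unfolding radical_def subspace_def by (auto simp: bilinear_lzero bilinear_ladd bilinear_lmul)
qed

section \<open>Spectral theorem for symmetric forms\<close>

lemma psd_null:
  fixes B :: "'a::euclidean_space \<Rightarrow> 'a \<Rightarrow> real"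
  assumes B: "symform V B" and psd: "\<And>v. v \<in> V \<Longrightarrow> B v v \<ge> 0"
    and v: "v \<in> V" "B v v = 0" and w: "w \<in> V"
  shows "B v w = 0"
proof (rule ccontr)
  assume ne: "B v w \<noteq> 0"
  have bl: "bilinear B" and V: "subspace V" and sym: "B w v = B v w" using B v w by (auto simp: symform_def)
  \<comment> \<open>As \<open>B v v = 0\<close>, this is affine in t. If its slope were not 0, the t
    used below would give the value -1.\<close>
  have exp: "B (w + t *\<^sub>R v) (w + t *\<^sub>R v) = B w w + 2 * t * B v w" for t
    using v(2) sym bl by (simp add: bilinear_ladd bilinear_radd bilinear_lmul bilinear_rmul algebra_simps)
  have "0 \<le> B w w + 2 * t * B v w" for t
    unfolding exp[symmetric] using V v w by (intro psd) (simp add: subspace_add subspace_scale)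
  from this[of "- (B w w + 1) / (2 * B v w)"] ne show False by (simp add: field_simps)
qed

text \<open>At a maximiser x of the quadratic form on the unit sphere, with value l, the form
  \<open>l * (v \<bullet> w) - B v w\<close> is positive semidefinite and vanishes at x; by
  \<open>psd_null\<close>, x then lies in its radical.\<close>

lemma form_max_eigenvector:
  fixes B :: "'a::euclidean_space \<Rightarrow> 'a \<Rightarrow> real"
  assumes B: "symform V B" and ne: "V \<noteq> {0}"
  obtains x l where "x \<in> V" "norm x = 1" "\<And>w. w \<in> V \<Longrightarrow> B x w = l * (x \<bullet> w)"
proof -
  have bl: "bilinear B" and V: "subspace V" using B by (auto simp: symform_def)
  let ?S = "V \<inter> sphere 0 1"
  obtain z where z: "z \<in> V" "z \<noteq> 0" using ne V by (auto simp: subspace_0)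
  have "z /\<^sub>R norm z \<in> ?S" using z V by (simp add: subspace_scale)
  then have nS: "?S \<noteq> {}" by blast
  have cS: "compact ?S" by (simp add: V closed_Int_compact closed_subspace)
  have bb: "bounded_bilinear B" using bl bilinear_conv_bounded_bilinear by blast
  have co: "continuous_on ?S (\<lambda>x. B x x)"
    using bounded_bilinear.continuous_on[OF bb continuous_on_id continuous_on_id] by simp
  obtain x where x: "x \<in> ?S" and mx: "\<And>y. y \<in> ?S \<Longrightarrow> B y y \<le> B x x"
    using continuous_attains_sup[OF cS nS co] by blast
  define l where "l = B x x"
  define D where "D v w = l * (v \<bullet> w) - B v w" for v w
  have bD: "bilinear D" unfolding bilinear_def D_def
    using bl by (auto intro!: linearI simp: bilinear_ladd bilinear_radd bilinear_lmul bilinear_rmul inner_add algebra_simps)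
  have sD: "symform V D" using B bD by (auto simp: symform_def D_def inner_commute)
  have psd: "D v v \<ge> 0" if "v \<in> V" for v
  proof (cases "v = 0")
    case True then show ?thesis using bD by (simp add: bilinear_lzero)
  next
    case False
    have "v /\<^sub>R norm v \<in> ?S" using that V False by (simp add: subspace_scale)
    from mx[OF this] have "B v v / (norm v)^2 \<le> l"
      using bl by (simp add: l_def bilinear_lmul bilinear_rmul power2_eq_square divide_inverse algebra_simps)
    then show ?thesis using False by (simp add: D_def power2_norm_eq_inner[symmetric] field_simps)
  qed
  have "D x x = 0" using x by (simp add: D_def l_def norm_eq_1)
  then have "B x w = l * (x \<bullet> w)" if "w \<in> V" for w
    using psd_null[OF sD psd, of x w] x that by (simp add: D_def)
  then show ?thesis using that x by auto
qed

definition eigenframe :: "'a::euclidean_space set \<Rightarrow> ('a \<Rightarrow> 'a \<Rightarrow> real) \<Rightarrow> 'a set \<Rightarrow> ('a \<Rightarrow> real) \<Rightarrow> bool" where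
  "eigenframe V B S l \<longleftrightarrow> finite S \<and> pairwise orthogonal S \<and> (\<forall>s\<in>S. norm s = 1) \<and> span S = V \<and>
     (\<forall>s\<in>S. \<forall>w\<in>V. B s w = l s * (s \<bullet> w))"

text \<open>Induction on the dimension: what is orthogonal to an eigenvector is also orthogonal to
  it for \<open>B\<close>, so the form restricts to the complement and the frames fit
  together.\<close>

theorem spectral_form:
  fixes B :: "'a::euclidean_space \<Rightarrow> 'a \<Rightarrow> real"
  assumes "symform V B"
  shows "\<exists>S l. eigenframe V B S l"
  using assms
proof (induction "dim V" arbitrary: V rule: less_induct)
  case less
  have V: "subspace V" and bl: "bilinear B" using less.prems by (auto simp: symform_def)
  show ?case
  proof (cases "V = {0}")
    case True
    then have "eigenframe V B {} (\<lambda>_. 0)" by (simp add: eigenframe_def)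
    then show ?thesis by blast
  next
    case False
    obtain x l where x: "x \<in> V" "norm x = 1" "\<And>w. w \<in> V \<Longrightarrow> B x w = l * (x \<bullet> w)"
      using form_max_eigenvector[OF less.prems False] by metis
    define U where "U = {w \<in> V. x \<bullet> w = 0}"
    have U: "subspace U" unfolding U_def using V by (auto simp: subspace_def inner_add)
    have UV: "U \<subseteq> V" by (auto simp: U_def)
    have "x \<notin> U" using x by (auto simp: U_def norm_eq_1)
    then have "dim U < dim V" using x UV U V by (metis dim_subset le_neq_implies_less span_eq_iff subspace_dim_equal order_refl)
    then obtain S m where S: "eigenframe U B S m" using less.hyps[of U] symform_subspace[OF less.prems U UV] by blast
    have xS: "x \<bullet> s = 0" if "s \<in> S" for s
      using S that span_base by (fastforce simp: eigenframe_def U_def)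
    have SU: "S \<subseteq> U" using S by (auto simp: eigenframe_def intro: span_base)
    have xnS: "x \<notin> S" using \<open>x \<notin> U\<close> SU by auto
    have dec: "w = (x \<bullet> w) *\<^sub>R x + (w - (x \<bullet> w) *\<^sub>R x)" "w - (x \<bullet> w) *\<^sub>R x \<in> U" if "w \<in> V" for w
      using that x V by (auto simp: U_def norm_eq_1 inner_diff_right subspace_diff subspace_scale)
    have "span (insert x S) = V"
    proof
      show "span (insert x S) \<subseteq> V" using x SU UV V by (intro span_minimal) auto
      show "V \<subseteq> span (insert x S)"
      proof
        fix w assume w: "w \<in> V"
        have "w - (x \<bullet> w) *\<^sub>R x \<in> span S" using dec(2)[OF w] S by (simp add: eigenframe_def)
        then show "w \<in> span (insert x S)" by (subst span_insert) blast
      qed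
    qed
    moreover have "B s w = m s * (s \<bullet> w)" if s: "s \<in> S" and w: "w \<in> V" for s w
    proof -
      have sx: "s \<in> V" "s \<bullet> x = 0" using s SU UV xS[OF s] by (auto simp: inner_commute)
      have "B s x = B x s" using less.prems sx x by (auto simp: symform_def)
      then have "B s x = 0" using x(3)[OF sx(1)] sx by (simp add: inner_commute)
      moreover have "B s w = B s ((x \<bullet> w) *\<^sub>R x + (w - (x \<bullet> w) *\<^sub>R x))" by simp
      ultimately have "B s w = B s (w - (x \<bullet> w) *\<^sub>R x)" using bl by (simp add: bilinear_radd bilinear_rmul bilinear_rsub)
      also have "\<dots> = m s * (s \<bullet> (w - (x \<bullet> w) *\<^sub>R x))" using S s dec(2)[OF w] by (simp add: eigenframe_def)
      finally show ?thesis using sx by (simp add: inner_diff_right)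
    qed
    ultimately have "eigenframe V B (insert x S) (\<lambda>s. if s = x then l else m s)"
      using S x xS xnS unfolding eigenframe_def
      by (auto simp: pairwise_insert orthogonal_def inner_commute)
    then show ?thesis by blast
  qed
qed

lemma finite_pos_dims: "finite {dim U |U. subspace U \<and> U \<subseteq> W \<and> pos_def_on U C}" for W :: "'a::euclidean_space set"
  by (rule finite_subset[of _ "{..DIM('a)}"]) (auto simp: dim_subset_UNIV)

context
  fixes V :: "'a::euclidean_space set" and B S l
  assumes B: "symform V B" and fr: "eigenframe V B S l"
begin

lemma eigenframe_inner: "s \<in> S \<Longrightarrow> t \<in> S \<Longrightarrow> s \<bullet> t = (if s = t then 1 else 0)"
  using fr by (auto simp: eigenframe_def pairwise_def orthogonal_def norm_eq_1)

lemma eigenframe_independent: "T \<subseteq> S \<Longrightarrow> independent T"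
  using fr by (intro pairwise_orthogonal_independent) (fastforce simp: eigenframe_def intro: pairwise_subset)+

lemma eigenframe_dim: "T \<subseteq> S \<Longrightarrow> dim (span T) = card T"
  using eigenframe_independent by (simp add: dim_eq_card_independent)

lemma eigenframe_expand: assumes "T \<subseteq> S" "v \<in> span T" shows "v = (\<Sum>s\<in>T. (v \<bullet> s) *\<^sub>R s)"
proof -
  have fT: "finite T" using assms fr by (auto simp: eigenframe_def intro: finite_subset)
  obtain c where c: "v = (\<Sum>s\<in>T. c s *\<^sub>R s)" using assms(2) span_finite[OF fT] by auto
  have "v \<bullet> t = c t" if t: "t \<in> T" for t
  proof -
    have "v \<bullet> t = (\<Sum>s\<in>T. c s * (if s = t then 1 else 0))" unfolding c inner_sum_left
      using assms(1) t by (intro sum.cong) (auto simp: eigenframe_inner subset_iff)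
    also have "\<dots> = (\<Sum>s\<in>T. if s = t then c s else 0)" by (intro sum.cong) auto
    finally show ?thesis using fT t by simp
  qed
  then show ?thesis using c by simp
qed

lemma eigenframe_form: assumes "T \<subseteq> S" "v \<in> span T" "w \<in> V"
  shows "B v w = (\<Sum>s\<in>T. l s * (v \<bullet> s) * (w \<bullet> s))"
proof -
  have bl: "linear (\<lambda>x. B x w)" using B by (auto simp: symform_def bilinear_def)
  have "B v w = B (\<Sum>s\<in>T. (v \<bullet> s) *\<^sub>R s) w" using eigenframe_expand[OF assms(1,2)] by simp
  also have "\<dots> = (\<Sum>s\<in>T. (v \<bullet> s) *\<^sub>R B s w)" by (simp add: linear_sum[OF bl] linear_cmul[OF bl])
  also have "\<dots> = (\<Sum>s\<in>T. l s * (v \<bullet> s) * (w \<bullet> s))"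
    using assms fr by (intro sum.cong) (auto simp: eigenframe_def inner_commute)
  finally show ?thesis .
qed

lemma eigenframe_sub: "T \<subseteq> S \<Longrightarrow> span T \<subseteq> V" using fr span_mono by (auto simp: eigenframe_def)

lemma eigenframe_coord0: assumes "T \<subseteq> S" "v \<in> V" "\<And>s. s \<in> S - T \<Longrightarrow> v \<bullet> s = 0" shows "v \<in> span T"
proof -
  have fS: "finite S" using fr by (auto simp: eigenframe_def)
  have "v = (\<Sum>s\<in>S. (v \<bullet> s) *\<^sub>R s)" using assms fr by (intro eigenframe_expand) (auto simp: eigenframe_def)
  also have "\<dots> = (\<Sum>s\<in>T. (v \<bullet> s) *\<^sub>R s)" using assms fS by (intro sum.mono_neutral_right) auto
  also have "\<dots> \<in> span T" by (intro span_sum span_scale span_base)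
  finally show ?thesis .
qed


lemma eigenframe_radical: "radical V B = span {s \<in> S. l s = 0}"
proof
  show "radical V B \<subseteq> span {s \<in> S. l s = 0}"
  proof
    fix v assume v: "v \<in> radical V B"
    have "v \<bullet> s = 0" if s: "s \<in> S - {s \<in> S. l s = 0}" for s
    proof -
      have sV: "s \<in> V" using s fr by (auto simp: eigenframe_def intro: span_base)
      have "B s v = B v s" using v sV B by (auto simp: radical_def symform_def)
      then have "l s * (s \<bullet> v) = 0" using v sV s fr by (auto simp: radical_def eigenframe_def)
      then show ?thesis using s by (auto simp: inner_commute)
    qed
    then show "v \<in> span {s \<in> S. l s = 0}" using v by (intro eigenframe_coord0) (auto simp: radical_def)
  qed
  show "span {s \<in> S. l s = 0} \<subseteq> radical V B"
  proof
    fix v assume v: "v \<in> span {s \<in> S. l s = 0}"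
    have "B v w = 0" if "w \<in> V" for w
      by (subst eigenframe_form[OF _ v that]) (auto)
    then show "v \<in> radical V B" using v eigenframe_sub[of "{s \<in> S. l s = 0}"] by (auto simp: radical_def)
  qed
qed

lemma eigenframe_eigenspace: "form_eigenspace V B c = span {s \<in> S. l s = c}"
proof
  show "form_eigenspace V B c \<subseteq> span {s \<in> S. l s = c}"
  proof
    fix v assume v: "v \<in> form_eigenspace V B c"
    have "v \<bullet> s = 0" if s: "s \<in> S - {s \<in> S. l s = c}" for s
    proof -
      have sV: "s \<in> V" using s fr by (auto simp: eigenframe_def intro: span_base)
      have "B s v = B v s" using v sV B by (auto simp: form_eigenspace_def symform_def)
      then have "l s * (s \<bullet> v) = c * (v \<bullet> s)" using v sV s fr by (auto simp: form_eigenspace_def eigenframe_def)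
      then show ?thesis using s by (auto simp: inner_commute)
    qed
    then show "v \<in> span {s \<in> S. l s = c}" using v by (intro eigenframe_coord0) (auto simp: form_eigenspace_def)
  qed
  show "span {s \<in> S. l s = c} \<subseteq> form_eigenspace V B c"
  proof
    fix v assume v: "v \<in> span {s \<in> S. l s = c}"
    let ?T = "{s \<in> S. l s = c}"
    have "B v w = c * (v \<bullet> w)" if "w \<in> V" for w
    proof -
      have "B v w = (\<Sum>s\<in>?T. l s * (v \<bullet> s) * (w \<bullet> s))" using v that by (intro eigenframe_form) auto
      also have "\<dots> = c * ((\<Sum>s\<in>?T. (v \<bullet> s) *\<^sub>R s) \<bullet> w)"
        by (simp add: inner_sum_left sum_distrib_left inner_commute[of w] mult.assoc)
      also have "(\<Sum>s\<in>?T. (v \<bullet> s) *\<^sub>R s) = v" using eigenframe_expand[OF _ v] by auto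
      finally show ?thesis .
    qed
    then show "v \<in> form_eigenspace V B c" using v eigenframe_sub[of ?T] by (auto simp: form_eigenspace_def)
  qed
qed

text \<open>A positive definite subspace meets the span of the frame vectors with eigenvalue at most
  0 only in 0, which bounds its dimension; the span of the remaining frame vectors attains the
  bound.\<close>

lemma eigenframe_pos_index: "pos_index V B = card {s \<in> S. l s > 0}"
  unfolding pos_index_def
proof (rule Max_eqI[OF finite_pos_dims])
  let ?P = "{s \<in> S. l s > 0}"
  fix d assume "d \<in> {dim U |U. subspace U \<and> U \<subseteq> V \<and> pos_def_on U B}"
  then obtain U where U: "d = dim U" "subspace U" "U \<subseteq> V" "pos_def_on U B" by auto
  let ?N = "{s \<in> S. \<not> l s > 0}"
  have "x = 0" if x: "x \<in> U" "x \<in> span ?N" for x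
  proof (rule ccontr)
    assume "x \<noteq> 0"
    then have "B x x > 0" using U x by (auto simp: pos_def_on_def)
    moreover have "B x x = (\<Sum>s\<in>?N. l s * (x \<bullet> s) * (x \<bullet> s))" using x U by (intro eigenframe_form) auto
    moreover have "\<dots> \<le> 0" by (intro sum_nonpos) (auto simp: mult_nonpos_nonneg mult.assoc not_less)
    ultimately show False by simp
  qed
  then have "U \<inter> span ?N = {0}" using U by (auto simp: subspace_0 span_0)
  then have "dim {x + y |x y. x \<in> U \<and> y \<in> span ?N} = dim U + dim (span ?N)"
    using dim_sums_Int[OF U(2) subspace_span, of ?N] by (simp del: dim_span)
  moreover have "dim {x + y |x y. x \<in> U \<and> y \<in> span ?N} \<le> dim V"
    using U eigenframe_sub[of ?N] B by (intro dim_subset) (auto simp: symform_def intro!: subspace_add)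
  moreover have "dim V = card S" using eigenframe_dim[of S] fr by (auto simp: eigenframe_def simp del: dim_span)
  moreover have "card S = card ?P + card ?N"
    using fr by (subst card_Un_disjoint[symmetric]) (auto simp: eigenframe_def intro!: arg_cong[where f=card])
  ultimately show "d \<le> card ?P" using U eigenframe_dim[of ?N] by auto
next
  let ?P = "{s \<in> S. l s > 0}"
  have "pos_def_on (span ?P) B" unfolding pos_def_on_def
  proof safe
    fix v assume v: "v \<in> span ?P" "v \<noteq> 0"
    have eq: "B v v = (\<Sum>s\<in>?P. l s * (v \<bullet> s) * (v \<bullet> s))" using v eigenframe_sub[of ?P] by (intro eigenframe_form) auto
    have fP: "finite ?P" using fr by (auto simp: eigenframe_def)
    have "\<exists>s\<in>?P. v \<bullet> s \<noteq> 0"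
    proof (rule ccontr)
      assume "\<not> ?thesis"
      then have "(\<Sum>s\<in>?P. (v \<bullet> s) *\<^sub>R s) = 0" by simp
      then show False using eigenframe_expand[OF _ v(1)] v(2) by auto
    qed
    then obtain s where s: "s \<in> ?P" "v \<bullet> s \<noteq> 0" by blast
    show "B v v > 0" unfolding eq
      using s by (intro sum_pos2[OF fP s(1)]) (auto simp: zero_less_mult_iff mult.assoc)
  qed
  then show "card ?P \<in> {dim U |U. subspace U \<and> U \<subseteq> V \<and> pos_def_on U B}"
    using eigenframe_sub[of ?P] eigenframe_dim[of ?P] by (auto intro!: exI[of _ "span ?P"])
qed

text \<open>Connects the sums over eigenvalues in \<open>signature\<close> with a count of frame
  vectors. The predicate P serves the positive and the negative eigenvalues at once.\<close>

lemma eigenframe_sum: "(\<Sum>c | P c \<and> form_eigenspace V B c \<noteq> {0}. int (dim (form_eigenspace V B c))) = int (card {s \<in> S. P (l s)})"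
proof -
  have fS: "finite S" using fr by (auto simp: eigenframe_def)
  have ne: "form_eigenspace V B c \<noteq> {0} \<longleftrightarrow> c \<in> l ` S" for c
  proof -
    have "form_eigenspace V B c = {0} \<longleftrightarrow> dim (form_eigenspace V B c) = 0"
      unfolding eigenframe_eigenspace dim_eq_0 using span_0 by auto
    also have "\<dots> \<longleftrightarrow> card {s \<in> S. l s = c} = 0" unfolding eigenframe_eigenspace using eigenframe_dim[of "{s \<in> S. l s = c}"] by auto
    also have "\<dots> \<longleftrightarrow> c \<notin> l ` S" using fS by auto
    finally show ?thesis by blast
  qed
  have "(\<Sum>c | P c \<and> form_eigenspace V B c \<noteq> {0}. int (dim (form_eigenspace V B c)))
      = (\<Sum>c\<in>l ` {s \<in> S. P (l s)}. int (card {s \<in> {s \<in> S. P (l s)}. l s = c}))"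
  proof (intro sum.cong)
    show "{c. P c \<and> form_eigenspace V B c \<noteq> {0}} = l ` {s \<in> S. P (l s)}" by (auto simp: ne)
    fix c assume "c \<in> l ` {s \<in> S. P (l s)}"
    then have "{s \<in> {s \<in> S. P (l s)}. l s = c} = {s \<in> S. l s = c}" by auto
    then show "int (dim (form_eigenspace V B c)) = int (card {s \<in> {s \<in> S. P (l s)}. l s = c})"
      unfolding eigenframe_eigenspace using eigenframe_dim[of "{s \<in> S. l s = c}"] by simp
  qed
  also have "\<dots> = int (\<Sum>c\<in>l ` {s \<in> S. P (l s)}. \<Sum>s | s \<in> {s \<in> S. P (l s)} \<and> l s = c. 1)"
    by (simp add: of_nat_sum)
  also have "(\<Sum>c\<in>l ` {s \<in> S. P (l s)}. \<Sum>s | s \<in> {s \<in> S. P (l s)} \<and> l s = c. 1) = (\<Sum>s\<in>{s \<in> S. P (l s)}. 1::nat)"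
    using fS sum.image_gen[of "{s \<in> S. P (l s)}" "\<lambda>_. 1::nat" l] by auto
  finally show ?thesis by simp
qed

end

lemma eigenframe_uminus: "eigenframe V B S l \<Longrightarrow> eigenframe V (\<lambda>v w. - B v w) S (\<lambda>s. - l s)"
  by (auto simp: eigenframe_def)

lemma eigenframe_neg_index: assumes "symform V B" "eigenframe V B S l" shows "neg_index V B = card {s \<in> S. l s < 0}"
  using eigenframe_pos_index[OF symform_uminus[OF assms(1)] eigenframe_uminus[OF assms(2)]]
  by (simp add: neg_index_def)

lemma signature_eq: assumes "symform V B" shows "signature V B = int (pos_index V B) - int (neg_index V B)"
proof -
  obtain S l where fr: "eigenframe V B S l" using spectral_form[OF assms] by blast
  show ?thesis unfolding signature_def
    using eigenframe_sum[OF assms fr, of "\<lambda>c. c > 0"] eigenframe_sum[OF assms fr, of "\<lambda>c. c < 0"]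
    by (simp add: eigenframe_pos_index[OF assms fr] eigenframe_neg_index[OF assms fr])
qed

text \<open>Sylvester's law of inertia as a counting tool: whenever the two indices and the radical
  are each bounded on one side and the dimensions match, all the bounds are equalities. Most later
  signature computations end in this way.\<close>

lemma index_sum: assumes "symform V B" shows "pos_index V B + neg_index V B + dim (radical V B) = dim V"
proof -
  obtain S l where fr: "eigenframe V B S l" using spectral_form[OF assms] by blast
  have fS: "finite S" using fr by (auto simp: eigenframe_def)
  have "dim V = card S" using eigenframe_dim[OF assms fr, of S] fr by (auto simp: eigenframe_def simp del: dim_span)
  also have "card S = card {s \<in> S. l s > 0} + card {s \<in> S. l s < 0} + card {s \<in> S. l s = 0}"
    using fS by (subst card_Un_disjoint[symmetric], simp, simp, force, subst card_Un_disjoint[symmetric])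
      (auto intro!: arg_cong[where f=card])
  finally show ?thesis
    using eigenframe_dim[OF assms fr, of "{s \<in> S. l s = 0}"]
    by (simp add: eigenframe_pos_index[OF assms fr] eigenframe_neg_index[OF assms fr] eigenframe_radical[OF assms fr])
qed

lemma pos_index_ge: assumes "subspace U" "U \<subseteq> V" "pos_def_on U B" shows "dim U \<le> pos_index V B"
  unfolding pos_index_def using assms by (intro Max_ge finite_pos_dims) auto

lemma neg_index_ge: assumes "subspace U" "U \<subseteq> V" "pos_def_on U (\<lambda>v w. - B v w)" shows "dim U \<le> neg_index V B"
  unfolding neg_index_def using assms by (rule pos_index_ge)

lemma pos_index_attained:
  assumes "subspace V" obtains U where "subspace U" "U \<subseteq> V" "pos_def_on U B" "dim U = pos_index V B"
proof -
  have "pos_index V B \<in> {dim U |U. subspace U \<and> U \<subseteq> V \<and> pos_def_on U B}" unfolding pos_index_def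
    by (intro Max_in finite_pos_dims) (auto intro!: exI[of _ "{0}"] simp: pos_def_on_def assms subspace_0)
  then show ?thesis using that by auto
qed


lemma signature_cong:
  assumes "\<And>v w. v \<in> V \<Longrightarrow> w \<in> V \<Longrightarrow> B v w = B' v w" shows "signature V B = signature V B'"
proof -
  have "form_eigenspace V B c = form_eigenspace V B' c" for c using assms by (auto simp: form_eigenspace_def)
  then show ?thesis by (simp add: signature_def)
qed

lemma pos_index_scale:
  assumes "c > 0" shows "pos_index V (\<lambda>v w. c * B v w) = pos_index V B"
  using assms by (simp add: pos_index_def pos_def_on_def zero_less_mult_iff)

lemma signature_scale:
  assumes "symform V B" "c > 0" shows "signature V (\<lambda>v w. c * B v w) = signature V B"
proof -
  have "bilinear (\<lambda>v w. c * B v w)" using assms(1) unfolding symform_def bilinear_def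
    by (auto intro: linear_compose_scale_right[where 'b=real, simplified])
  then have "symform V (\<lambda>v w. c * B v w)" using assms by (auto simp: symform_def)
  then show ?thesis using assms pos_index_scale[of c V B] pos_index_scale[of c V "\<lambda>v w. - B v w"]
    by (simp add: signature_eq neg_index_def)
qed

lemma signature_uminus: assumes "symform V B" shows "signature V (\<lambda>v w. - B v w) = - signature V B"
  using assms by (simp add: signature_eq symform_uminus neg_index_def)

text \<open>T may have a kernel on V, where the form vanishes. In one direction T is injective on
  positive definite subspaces; in the other a linear section of T over a basis carries a positive
  definite subspace back.\<close>

lemma pos_index_pullback:
  fixes T :: "'a::euclidean_space \<Rightarrow> 'b::euclidean_space"
  assumes T: "linear T" "T ` V = W" and V: "subspace V"
    and eq: "\<And>v. v \<in> V \<Longrightarrow> B v v = C (T v) (T v)" and C0: "C 0 0 = 0"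
  shows "pos_index V B = pos_index W C"
proof (rule antisym)
  have W: "subspace W" using T V linear_subspace_image by blast
  obtain U where U: "subspace U" "U \<subseteq> V" "pos_def_on U B" "dim U = pos_index V B" using pos_index_attained[OF V] by blast
  have inj: "inj_on T U" unfolding linear_inj_on_iff_eq_0[OF T(1) U(1)]
  proof safe
    fix x assume "x \<in> U" "T x = 0"
    then show "x = 0" using eq[of x] C0 U by (force simp: pos_def_on_def)
  qed
  have "pos_def_on (T ` U) C" using U eq T by (force simp: pos_def_on_def linear_0)
  then have "dim (T ` U) \<le> pos_index W C"
    using U T linear_subspace_image[OF T(1) U(1)] by (intro pos_index_ge) auto
  then show "pos_index V B \<le> pos_index W C" using dim_image_eq[OF T(1), of U] inj U by (simp add: span_eq_iff[THEN iffD2])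
next
  have W: "subspace W" using T V linear_subspace_image by blast
  obtain U where U: "subspace U" "U \<subseteq> W" "pos_def_on U C" "dim U = pos_index W C" using pos_index_attained[OF W] by blast
  obtain b where b: "b \<subseteq> U" "independent b" "U \<subseteq> span b" "card b = dim U" using basis_exists by blast
  have "\<forall>x\<in>b. \<exists>y\<in>V. T y = x" using b U T by (metis imageE subsetD)
  then obtain h where h: "\<And>x. x \<in> b \<Longrightarrow> h x \<in> V \<and> T (h x) = x" by metis
  obtain g where g: "linear g" "\<And>x. x \<in> b \<Longrightarrow> g x = h x" using linear_independent_extend[OF b(2), of h] by blast
  have sp: "span b = U" using b U by (metis span_minimal subset_antisym)
  have Tg: "T (g x) = x" if "x \<in> U" for x
    using linear_eq_on_span[of "T \<circ> g" id b x] T g h that sp by (auto simp: linear_compose linear_id)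
  have gU: "g ` U = span (h ` b)" using span_linear_image[OF g(1), of b] g sp by (metis image_cong)
  have sub: "g ` U \<subseteq> V" unfolding gU using h V by (intro span_minimal) auto
  have "pos_def_on (g ` U) B" unfolding pos_def_on_def
  proof safe
    fix x assume x: "x \<in> U" "g x \<noteq> 0"
    then have "x \<noteq> 0" using g by (auto simp: linear_0)
    then show "B (g x) (g x) > 0" using eq[of "g x"] x sub U Tg by (auto simp: pos_def_on_def)
  qed
  then have "dim (g ` U) \<le> pos_index V B" using sub gU by (intro pos_index_ge) auto
  moreover have "inj_on g U" by (metis Tg inj_onI)
  then have "dim (g ` U) = dim U" using dim_image_eq[OF g(1), of U] U by (simp add: span_eq_iff[THEN iffD2])
  ultimately show "pos_index W C \<le> pos_index V B" using U by simp
qed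

lemma signature_pullback:
  fixes T :: "'a::euclidean_space \<Rightarrow> 'b::euclidean_space"
  assumes T: "linear T" "T ` V = W" and B: "symform V B" and C: "symform W C"
    and eq: "\<And>v. v \<in> V \<Longrightarrow> B v v = C (T v) (T v)"
  shows "signature V B = signature W C"
proof -
  have V: "subspace V" and c0: "C 0 0 = 0" using B C by (auto simp: symform_def bilinear_lzero)
  show ?thesis unfolding signature_eq[OF B] signature_eq[OF C] neg_index_def
    using pos_index_pullback[OF T V, of B C] pos_index_pullback[OF T V, of "\<lambda>v w. - B v w" "\<lambda>v w. - C v w"] eq c0 by simp
qed

section \<open>Dimension counts and orthogonal decompositions of forms\<close>

lemma rank_nullity_on:
  fixes T :: "'a::euclidean_space \<Rightarrow> 'b::euclidean_space"
  assumes T: "linear T" and V: "subspace V"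
  shows "dim (T ` V) + dim {v \<in> V. T v = 0} = dim V"
proof -
  define K where "K = {v \<in> V. T v = 0}"
  have K: "subspace K" "K \<subseteq> V"
    unfolding K_def using T V by (auto simp: subspace_def linear_add linear_cmul linear_0)
  define V' where "V' = {y \<in> V. \<forall>x\<in>K. orthogonal x y}"
  have V': "subspace V'" unfolding V'_def using V by (auto simp: subspace_def orthogonal_def inner_add)
  have dims: "dim V' + dim K = dim V" unfolding V'_def by (rule dim_subspace_orthogonal_to_vectors[OF K(1) V K(2)])
  have "x = 0" if "x \<in> V'" "T x = 0" for x
    using that by (auto simp: V'_def K_def orthogonal_def)
  then have inj: "inj_on T V'" using linear_inj_on_iff_eq_0[OF T V'] by blast
  have "T ` V = T ` V'"
  proof
    show "T ` V' \<subseteq> T ` V" by (auto simp: V'_def)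
    show "T ` V \<subseteq> T ` V'"
    proof safe
      fix v assume v: "v \<in> V"
      obtain y z where yz: "y \<in> span K" "\<And>w. w \<in> span K \<Longrightarrow> orthogonal z w" "v = y + z"
        using orthogonal_subspace_decomp_exists[of K v] by metis
      then have "z \<in> V'" using K V v by (auto simp: V'_def orthogonal_commute span_eq_iff[THEN iffD2] subset_iff)
         (metis add_diff_cancel_left' subspace_diff)
      moreover have "T v = T z" using yz T K by (auto simp: linear_add span_eq_iff[THEN iffD2] K_def)
      ultimately show "T v \<in> T ` V'" by blast
    qed
  qed
  then have "dim (T ` V) = dim V'" using dim_image_eq[OF T, of V'] inj V' by (simp add: span_eq_iff[THEN iffD2])
  then show ?thesis using dims by (simp add: K_def)
qed

text \<open>Let \<open>T v\<close> in K represent the functional \<open>B v\<close> on K. Its kernel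
  on V is the orthogonal complement of K, and the part of K orthogonal to its image is what V
  annihilates; rank and nullity do the rest. Neither symmetry nor nondegeneracy enters.\<close>

lemma dim_bilinear_perp:
  fixes B :: "'a::euclidean_space \<Rightarrow> 'a \<Rightarrow> real"
  assumes B: "bilinear B" and V: "subspace V" and K: "subspace K" "K \<subseteq> V"
  shows "dim {v \<in> V. \<forall>k\<in>K. B v k = 0} + dim K = dim V + dim {k \<in> K. \<forall>v\<in>V. B v k = 0}"
proof -
  obtain S where S: "S \<subseteq> K" "pairwise orthogonal S" "\<And>s. s \<in> S \<Longrightarrow> norm s = 1" "independent S" "card S = dim K" "span S = K"
    using orthonormal_basis_subspace[OF K(1)] by blast
  have fS: "finite S" using S(4) independent_imp_finite by blast
  define T where "T v = (\<Sum>s\<in>S. B v s *\<^sub>R s)" for v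
  have T: "linear T" unfolding T_def using B
    by (intro linear_compose_sum ballI linearI) (auto simp: bilinear_ladd bilinear_lmul algebra_simps)
  have Tk: "T v \<bullet> k = B v k" if "k \<in> K" for v k
  proof -
    have ss: "s \<bullet> t = (if s = t then 1 else 0)" if "s \<in> S" "t \<in> S" for s t
      using S that by (auto simp: pairwise_def orthogonal_def norm_eq_1)
    have "T v \<bullet> s = B v s" if "s \<in> S" for s
    proof -
      have "T v \<bullet> s = (\<Sum>t\<in>S. if t = s then B v t else 0)" unfolding T_def inner_sum_left
        using ss that by (intro sum.cong) auto
      then show ?thesis using fS that by simp
    qed
    then have "T v \<bullet> k = B v k" if "k \<in> span S"
      using linear_eq_on_span[of "\<lambda>k. T v \<bullet> k" "\<lambda>k. B v k" S k] B that
      by (auto simp: bilinear_def bounded_linear.linear[OF bounded_linear_inner_right])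
    then show ?thesis using that S by auto
  qed
  have TK: "T ` V \<subseteq> K" unfolding T_def S(6)[symmetric] by (auto intro!: span_sum span_scale intro: span_base)
  have ker: "{v \<in> V. T v = 0} = {v \<in> V. \<forall>k\<in>K. B v k = 0}"
  proof -
    have "T v = 0 \<longleftrightarrow> (\<forall>k\<in>K. B v k = 0)" if "v \<in> V" for v
      using Tk TK that by (metis imageI inner_eq_zero_iff inner_zero_left subsetD)
    then show ?thesis by auto
  qed
  have "{k \<in> K. \<forall>x\<in>T ` V. orthogonal x k} = {k \<in> K. \<forall>v\<in>V. B v k = 0}" using Tk by (auto simp: orthogonal_def)
  then have "dim {k \<in> K. \<forall>v\<in>V. B v k = 0} + dim (T ` V) = dim K"
    using dim_subspace_orthogonal_to_vectors[OF linear_subspace_image[OF T V] K(1) TK] by simp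
  then show ?thesis using rank_nullity_on[OF T V] unfolding ker by linarith
qed

lemma dim_sum_le_direct:
  fixes A B V :: "'a::euclidean_space set"
  assumes "subspace A" "subspace B" "A \<inter> B \<subseteq> {0}" "A \<subseteq> V" "B \<subseteq> V" "subspace V"
  shows "dim {x + y |x y. x \<in> A \<and> y \<in> B} = dim A + dim B" "dim A + dim B \<le> dim V"
proof -
  have "dim (A \<inter> B) = 0" using assms by (simp add: dim_eq_0)
  then show "dim {x + y |x y. x \<in> A \<and> y \<in> B} = dim A + dim B" using dim_sums_Int[OF assms(1,2)] by linarith
  moreover have "dim {x + y |x y. x \<in> A \<and> y \<in> B} \<le> dim V" using assms by (intro dim_subset) (auto intro: subspace_add)
  ultimately show "dim A + dim B \<le> dim V" by simp
qed

lemma pos_def_on_orthogonal_sum: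
  assumes B: "symform V B" and U: "subspace U" "U \<subseteq> V" "pos_def_on U B" and W: "subspace W" "W \<subseteq> V" "pos_def_on W B"
    and orth: "\<And>u w. u \<in> U \<Longrightarrow> w \<in> W \<Longrightarrow> B u w = 0"
  shows "dim U + dim W \<le> pos_index V B"
proof -
  have bl: "bilinear B" and V: "subspace V" and sym: "\<And>v w. v \<in> V \<Longrightarrow> w \<in> V \<Longrightarrow> B v w = B w v" using B by (auto simp: symform_def)
  let ?S = "{x + y |x y. x \<in> U \<and> y \<in> W}"
  have "U \<inter> W \<subseteq> {0}" using U W orth by (force simp: pos_def_on_def)
  then have d: "dim ?S = dim U + dim W" using dim_sum_le_direct U W V by blast
  have "pos_def_on ?S B" unfolding pos_def_on_def
  proof safe
    fix x y assume xy: "x \<in> U" "y \<in> W" "x + y \<noteq> 0"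
    have "B y x = 0" using sym[of x y] orth xy U W by auto
    then have "B (x + y) (x + y) = B x x + B y y" using orth[OF xy(1,2)] bl by (simp add: bilinear_ladd bilinear_radd)
    moreover have "B x x \<ge> 0" "B y y \<ge> 0" "x \<noteq> 0 \<Longrightarrow> B x x > 0" "y \<noteq> 0 \<Longrightarrow> B y y > 0"
      using xy U W bl by (cases "x = 0"; cases "y = 0"; force simp: pos_def_on_def bilinear_lzero)+
    ultimately show "B (x + y) (x + y) > 0" using xy(3) by (cases "x = 0") auto
  qed
  then show ?thesis using pos_index_ge[of ?S V B] U W V d subspace_sums by (auto intro: subspace_add)
qed

lemma pos_index_orthogonal_sum:
  assumes B: "symform V B" and A: "subspace A" "A \<subseteq> V" and C: "subspace C" "C \<subseteq> V"
    and orth: "\<And>a c. a \<in> A \<Longrightarrow> c \<in> C \<Longrightarrow> B a c = 0"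
  shows "pos_index A B + pos_index C B \<le> pos_index V B"
proof -
  obtain U where U: "subspace U" "U \<subseteq> A" "pos_def_on U B" "dim U = pos_index A B" using pos_index_attained[OF A(1)] by blast
  obtain W where W: "subspace W" "W \<subseteq> C" "pos_def_on W B" "dim W = pos_index C B" using pos_index_attained[OF C(1)] by blast
  show ?thesis using pos_def_on_orthogonal_sum[OF B U(1) _ U(3) W(1) _ W(3)] U W A C orth by (auto simp: subset_iff)
qed

lemma pos_index_mono: "subspace A \<Longrightarrow> A \<subseteq> V \<Longrightarrow> pos_index A B \<le> pos_index V B"
  using pos_index_attained[of A B] pos_index_ge[of _ V B] by (metis order_trans)

lemma neg_index_mono: "subspace A \<Longrightarrow> A \<subseteq> V \<Longrightarrow> neg_index A B \<le> neg_index V B"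
  unfolding neg_index_def by (rule pos_index_mono)

text \<open>Positive index, negative index and radical are all superadditive for an orthogonal sum.
  Since they add up to the dimension by \<open>index_sum\<close>, each of them is additive.\<close>

lemma signature_direct_sum:
  assumes B: "symform V B" and A: "subspace A" "A \<subseteq> V" and C: "subspace C" "C \<subseteq> V"
    and orth: "\<And>a c. a \<in> A \<Longrightarrow> c \<in> C \<Longrightarrow> B a c = 0" and "A \<inter> C \<subseteq> {0}" and dims: "dim V \<le> dim A + dim C"
  shows "signature V B = signature A B + signature C B"
proof -
  have V: "subspace V" and bl: "bilinear B" and sym: "\<And>v w. v \<in> V \<Longrightarrow> w \<in> V \<Longrightarrow> B v w = B w v"
    using B by (auto simp: symform_def)
  note BA = symform_subspace[OF B A] and BC = symform_subspace[OF B C]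
  have p: "pos_index A B + pos_index C B \<le> pos_index V B" by (rule pos_index_orthogonal_sum[OF B A C orth])
  have n: "neg_index A B + neg_index C B \<le> neg_index V B" unfolding neg_index_def
    by (rule pos_index_orthogonal_sum[OF symform_uminus[OF B] A C]) (simp add: orth)
  note D = dim_sum_le_direct[OF A(1) C(1) assms(7) A(2) C(2) V]
  have "dim {x + y |x y. x \<in> A \<and> y \<in> C} = dim V" using D dims by simp
  then have VS: "V = {x + y |x y. x \<in> A \<and> y \<in> C}"
    using A C V by (intro subspace_dim_equal[symmetric] subspace_sums) (auto intro: subspace_add)
  have sub: "radical A B \<subseteq> radical V B" "radical C B \<subseteq> radical V B"
  proof -
    show "radical A B \<subseteq> radical V B"
    proof
      fix a assume a: "a \<in> radical A B"
      have "B a (x + y) = 0" if "x \<in> A" "y \<in> C" for x y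
        using a that orth bl by (auto simp: radical_def bilinear_radd)
      then have "\<forall>w\<in>V. B a w = 0" using VS by blast
      then show "a \<in> radical V B" using a A by (auto simp: radical_def)
    qed
    show "radical C B \<subseteq> radical V B"
    proof
      fix a assume a: "a \<in> radical C B"
      have "B x a = 0" if "x \<in> A" for x using orth a that by (auto simp: radical_def)
      then have "B a x = 0" if "x \<in> A" for x using that sym[of a x] a A C by (auto simp: radical_def)
      then have "B a (x + y) = 0" if "x \<in> A" "y \<in> C" for x y
        using a that bl by (auto simp: radical_def bilinear_radd)
      then have "\<forall>w\<in>V. B a w = 0" using VS by blast
      then show "a \<in> radical V B" using a C by (auto simp: radical_def)
    qed
  qed
  have "radical A B \<inter> radical C B \<subseteq> {0}" using assms(7) by (auto simp: radical_def)
  then have "dim (radical A B) + dim (radical C B) \<le> dim (radical V B)"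
    using dim_sum_le_direct(2)[OF subspace_radical[OF BA] subspace_radical[OF BC] _ sub subspace_radical[OF B]] by blast
  then have "pos_index A B + pos_index C B = pos_index V B" "neg_index A B + neg_index C B = neg_index V B"
    using index_sum[OF B] index_sum[OF BA] index_sum[OF BC] p n D dims by linarith+
  then show ?thesis unfolding signature_eq[OF B] signature_eq[OF BA] signature_eq[OF BC] by linarith
qed

text \<open>Intersecting a positive definite subspace with U costs at most the codimension of
  U.\<close>

lemma pos_index_inter_ge:
  assumes "symform V B" "subspace U" "U \<subseteq> V"
  shows "pos_index V B + dim U \<le> pos_index U B + dim V"
proof -
  have V: "subspace V" using assms by (auto simp: symform_def)
  obtain P where P: "subspace P" "P \<subseteq> V" "pos_def_on P B" "dim P = pos_index V B" using pos_index_attained[OF V] by blast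
  have "dim {x + y |x y. x \<in> P \<and> y \<in> U} \<le> dim V" using P assms V by (intro dim_subset) (auto intro: subspace_add)
  moreover have "dim (P \<inter> U) \<le> pos_index U B" using P assms
    by (intro pos_index_ge subspace_inter) (auto simp: pos_def_on_def)
  ultimately show ?thesis using dim_sums_Int[OF P(1) assms(2)] P by linarith
qed

lemma subspace_perp_on: "bilinear B \<Longrightarrow> subspace V \<Longrightarrow> subspace {v \<in> V. \<forall>k\<in>K. B v k = 0}"
  for B :: "'a::euclidean_space \<Rightarrow> 'a \<Rightarrow> real"
  by (auto simp: subspace_def bilinear_lzero bilinear_ladd bilinear_lmul)

text \<open>Passing to the complement of K lowers each index by at most its codimension, while the
  radical grows to contain K. By \<open>index_sum\<close> both indices drop by exactly the
  codimension, so that their difference survives.\<close>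

lemma signature_isotropic_reduction:
  assumes B: "symform V B" and K: "subspace K" "K \<subseteq> V" and iso: "\<And>x y. x \<in> K \<Longrightarrow> y \<in> K \<Longrightarrow> B x y = 0"
  shows "signature {v \<in> V. \<forall>k\<in>K. B v k = 0} B = signature V B"
proof -
  have V: "subspace V" and bl: "bilinear B" and sym: "\<And>v w. v \<in> V \<Longrightarrow> w \<in> V \<Longrightarrow> B v w = B w v"
    using B by (auto simp: symform_def)
  define P where "P = {v \<in> V. \<forall>k\<in>K. B v k = 0}"
  have P: "subspace P" "P \<subseteq> V" "K \<subseteq> P" unfolding P_def using subspace_perp_on[OF bl V] iso K by auto
  note BP = symform_subspace[OF B P(1,2)]
  have KR: "{k \<in> K. \<forall>v\<in>V. B v k = 0} = K \<inter> radical V B" using K sym by (auto simp: radical_def)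
  have d1: "dim P + dim K = dim V + dim (K \<inter> radical V B)"
    using dim_bilinear_perp[OF bl V K] unfolding KR P_def .
  note R = subspace_radical[OF B]
  have RP: "radical V B \<subseteq> radical P B" using K P by (auto simp: radical_def P_def subset_iff)
  moreover have KP: "K \<subseteq> radical P B" using P sym K by (auto simp: radical_def P_def subset_iff)
  ultimately have "dim {x + y |x y. x \<in> K \<and> y \<in> radical V B} \<le> dim (radical P B)"
    using subspace_radical[OF BP] by (intro dim_subset) (auto intro: subspace_add)
  then have d2: "dim K + dim (radical V B) \<le> dim (radical P B) + dim (K \<inter> radical V B)"
    using dim_sums_Int[OF K(1) R] by linarith
  have p: "pos_index V B + dim P \<le> pos_index P B + dim V" by (rule pos_index_inter_ge[OF B P(1,2)])
  have n: "neg_index V B + dim P \<le> neg_index P B + dim V" unfolding neg_index_def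
    by (rule pos_index_inter_ge[OF symform_uminus[OF B] P(1,2)])
  have "int (pos_index P B) = int (pos_index V B) + int (dim P) - int (dim V)"
     "int (neg_index P B) = int (neg_index V B) + int (dim P) - int (dim V)"
    using index_sum[OF B] index_sum[OF BP] p n d1 d2 by linarith+
  then show ?thesis unfolding P_def[symmetric] signature_eq[OF B] signature_eq[OF BP] by linarith
qed

lemma nondegenerate_complement:
  assumes B: "symform V B"
  obtains C where "subspace C" "C \<subseteq> V" "radical V B \<inter> C \<subseteq> {0}" "dim V = dim (radical V B) + dim C"
    "\<And>c. c \<in> C \<Longrightarrow> (\<And>d. d \<in> C \<Longrightarrow> B c d = 0) \<Longrightarrow> c = 0"
proof -
  have V: "subspace V" and bl: "bilinear B" and sym: "\<And>v w. v \<in> V \<Longrightarrow> w \<in> V \<Longrightarrow> B v w = B w v"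
    using B by (auto simp: symform_def)
  define R where "R = radical V B"
  have R: "subspace R" "R \<subseteq> V" unfolding R_def using subspace_radical[OF B] by (auto simp: radical_def)
  define C where "C = {y \<in> V. \<forall>x\<in>R. orthogonal x y}"
  have C: "subspace C" unfolding C_def using V by (auto simp: subspace_def orthogonal_def inner_add)
  have CV: "C \<subseteq> V" by (auto simp: C_def)
  have RC: "R \<inter> C \<subseteq> {0}" by (auto simp: C_def orthogonal_def)
  have d: "dim V = dim R + dim C" using dim_subspace_orthogonal_to_vectors[OF R(1) V R(2)] by (simp add: C_def)
  then have "V = {x + y |x y. x \<in> R \<and> y \<in> C}"
    using dim_sum_le_direct(1)[OF R(1) C RC R(2) CV V] R C CV V
    by (intro subspace_dim_equal[symmetric] subspace_sums) (auto intro: subspace_add)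
  then have VS: "\<exists>x y. x \<in> R \<and> y \<in> C \<and> v = x + y" if "v \<in> V" for v using that by auto
  have "c = 0" if c: "c \<in> C" "\<And>d. d \<in> C \<Longrightarrow> B c d = 0" for c
  proof -
    have "B c v = 0" if v: "v \<in> V" for v
    proof -
      obtain x y where xy: "x \<in> R" "y \<in> C" "v = x + y" using VS[OF v] by blast
      have "B x c = 0" using xy c CV by (auto simp: R_def radical_def)
      then have "B c x = 0" using sym[of x c] xy c CV R by auto
      then show ?thesis using xy c bl by (simp add: bilinear_radd)
    qed
    then have "c \<in> R" using c CV by (auto simp: R_def radical_def)
    then show ?thesis using RC c by auto
  qed
  then show ?thesis using that[OF C CV] RC d unfolding R_def by blast
qed

lemma signature_radical: assumes "symform V B" shows "signature (radical V B) B = 0"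
proof -
  have *: "B v w = 0" if "v \<in> radical V B" "w \<in> radical V B" for v w using that by (auto simp: radical_def)
  note R = subspace_radical[OF assms]
  have BR: "symform (radical V B) B" using symform_subspace[OF assms R] by (auto simp: radical_def)
  have "radical (radical V B) B = radical V B" using * by (auto simp: radical_def[of "radical V B"])
  then have "pos_index (radical V B) B = 0" "neg_index (radical V B) B = 0" using index_sum[OF BR] by auto
  then show ?thesis using signature_eq[OF BR] by simp
qed

lemma signature_complement:
  assumes B: "symform V B" and C: "subspace C" "C \<subseteq> V" "radical V B \<inter> C \<subseteq> {0}" "dim V = dim (radical V B) + dim C"
  shows "signature V B = signature C B"
proof -
  have "signature V B = signature (radical V B) B + signature C B"
    using subspace_radical[OF B] C by (intro signature_direct_sum[OF B]) (auto simp: radical_def)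
  then show ?thesis using signature_radical[OF B] by simp
qed

text \<open>Reason for the two stages: K may be degenerate. A nondegenerate complement C of its
  radical R splits off as a direct summand. Inside the complement of C the subspace R is isotropic,
  and its reduction leaves precisely the complement of K.\<close>

theorem signature_split:
  assumes B: "symform V B" and K: "subspace K" "K \<subseteq> V"
  shows "signature V B = signature K B + signature {v \<in> V. \<forall>k\<in>K. B v k = 0} B"
proof -
  have V: "subspace V" and bl: "bilinear B" and sym: "\<And>v w. v \<in> V \<Longrightarrow> w \<in> V \<Longrightarrow> B v w = B w v"
    using B by (auto simp: symform_def)
  note BK = symform_subspace[OF B K]
  define R where "R = radical K B"
  have R: "subspace R" "R \<subseteq> K" unfolding R_def using subspace_radical[OF BK] by (auto simp: radical_def)
  obtain C where C: "subspace C" "C \<subseteq> K" "R \<inter> C \<subseteq> {0}" "dim K = dim R + dim C"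
    "\<And>c. c \<in> C \<Longrightarrow> (\<And>d. d \<in> C \<Longrightarrow> B c d = 0) \<Longrightarrow> c = 0"
    using nondegenerate_complement[OF BK] unfolding R_def by blast
  have CV: "C \<subseteq> V" using C K by auto
  have sK: "signature K B = signature C B" using signature_complement[OF BK C(1,2)] C unfolding R_def by blast
  define P where "P = {v \<in> V. \<forall>k\<in>C. B v k = 0}"
  have P: "subspace P" "P \<subseteq> V" unfolding P_def using subspace_perp_on[OF bl V] by auto
  have CP: "C \<inter> P \<subseteq> {0}" using C(5) by (auto simp: P_def)
  have d: "dim V \<le> dim C + dim P"
    using dim_bilinear_perp[OF bl V C(1) CV] unfolding P_def by linarith
  have s1: "signature V B = signature C B + signature P B"
    using CP sym CV by (intro signature_direct_sum[OF B C(1) CV P _ CP d]) (auto simp: P_def subset_iff)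
  note BP = symform_subspace[OF B P]
  have RP: "R \<subseteq> P" using R K C by (auto simp: P_def R_def radical_def)
  have KS: "\<exists>x y. x \<in> R \<and> y \<in> C \<and> k = x + y" if "k \<in> K" for k
  proof -
    have "K = {x + y |x y. x \<in> R \<and> y \<in> C}"
      using dim_sum_le_direct(1)[OF R(1) C(1,3) R(2) C(2) K(1)] R C K
      by (intro subspace_dim_equal[symmetric] subspace_sums) (auto intro: subspace_add)
    then show ?thesis using that by auto
  qed
  have "{v \<in> P. \<forall>k\<in>R. B v k = 0} = {v \<in> V. \<forall>k\<in>K. B v k = 0}"
  proof safe
    fix v k assume v: "v \<in> P" "\<forall>k\<in>R. B v k = 0" "k \<in> K"
    obtain x y where "x \<in> R" "y \<in> C" "k = x + y" using KS[OF v(3)] by blast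
    then show "B v k = 0" using v bl by (auto simp: P_def bilinear_radd)
  qed (use P R C in \<open>auto simp: P_def\<close>)
  moreover have "signature {v \<in> P. \<forall>k\<in>R. B v k = 0} B = signature P B"
    using R by (intro signature_isotropic_reduction[OF BP R(1) RP]) (auto simp: R_def radical_def)
  ultimately show ?thesis using s1 sK by simp
qed

text \<open>U already represents all of V modulo the radical. The indices of U are at most those of
  V, and the dimensions and radicals differ by the same amount, so \<open>index_sum\<close> forces
  equality.\<close>

lemma signature_add_radical:
  assumes B: "symform V B" and U: "subspace U" "U \<subseteq> V" and R: "\<And>v. v \<in> V \<Longrightarrow> \<exists>u\<in>U. v - u \<in> radical V B"
  shows "signature V B = signature U B"
proof -
  have V: "subspace V" and bl: "bilinear B" using B by (auto simp: symform_def)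
  note BU = symform_subspace[OF B U]
  have rU: "radical U B = U \<inter> radical V B"
  proof safe
    fix x assume x: "x \<in> radical U B"
    have "B x w = 0" if w: "w \<in> V" for w
    proof -
      obtain u where u: "u \<in> U" "w - u \<in> radical V B" using R[OF w] by blast
      have "B x (w - u) = B (w - u) x" using B x U u by (auto simp: symform_def radical_def)
      then have "B x (w - u) = 0" using u x U by (auto simp: radical_def)
      then show ?thesis using x u bl by (auto simp: radical_def bilinear_rsub)
    qed
    then show "x \<in> radical V B" using x U by (auto simp: radical_def)
  qed (use U in \<open>auto simp: radical_def\<close>)
  have "{x + y |x y. x \<in> U \<and> y \<in> radical V B} = V"
  proof (intro subset_antisym subsetI)
    fix v assume "v \<in> V"
    then obtain u where "u \<in> U" "v - u \<in> radical V B" using R by blast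
    moreover have "v = u + (v - u)" by simp
    ultimately show "v \<in> {x + y |x y. x \<in> U \<and> y \<in> radical V B}" by blast
  qed (use U V in \<open>auto simp: radical_def intro!: subspace_add\<close>)
  then have d: "dim V + dim (radical U B) = dim U + dim (radical V B)"
    using dim_sums_Int[OF U(1) subspace_radical[OF B]] rU by simp
  have "pos_index U B \<le> pos_index V B" "neg_index U B \<le> neg_index V B" using U by (auto intro: pos_index_mono neg_index_mono)
  then have "pos_index U B = pos_index V B" "neg_index U B = neg_index V B"
    using d index_sum[OF B] index_sum[OF BU] by linarith+
  then show ?thesis by (simp add: signature_eq[OF B] signature_eq[OF BU])
qed

section \<open>Forms built from powers of a skew endomorphism\<close>

context
  fixes Om :: "'a::euclidean_space \<Rightarrow> 'a \<Rightarrow> real" and Y :: "'a \<Rightarrow> 'a" and W :: "'a set"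
  assumes Om: "bilinear Om" and skew: "\<And>x y. Om y x = - Om x y"
    and Y: "linear Y" and skY: "\<And>x y. Om (Y x) y = - Om x (Y y)"
    and W: "subspace W" "Y ` W \<subseteq> W"
    and nd: "\<And>x. x \<in> W \<Longrightarrow> (\<And>y. y \<in> W \<Longrightarrow> Om x y = 0) \<Longrightarrow> x = 0"
begin

lemma linear_funpow_Y: "linear (Y ^^ k)"
  by (induction k) (auto simp: linear_id id_def[symmetric] intro: linear_compose[OF _ Y, unfolded o_def])

lemma funpow_Y_W: "x \<in> W \<Longrightarrow> (Y ^^ k) x \<in> W"
  using W by (induction k) auto

lemma Om_funpow_Y: "Om ((Y ^^ k) x) y = (-1) ^ k * Om x ((Y ^^ k) y)"
proof (induction k arbitrary: y)
  case (Suc k)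
  have "Om ((Y ^^ Suc k) x) y = - Om ((Y ^^ k) x) (Y y)" by (simp add: skY)
  also have "(Y ^^ k) (Y y) = (Y ^^ Suc k) y" by (simp add: funpow_swap1)
  then have "- Om ((Y ^^ k) x) (Y y) = (-1) ^ Suc k * Om x ((Y ^^ Suc k) y)" using Suc.IH[of "Y y"] by simp
  finally show ?case .
qed simp

text \<open>The exponents add up to the odd number \<open>2 * k - 1\<close>: an odd power of a skew
  endomorphism makes the form symmetric. For \<open>k = 1\<close> this is the form whose signature
  is wanted.\<close>

definition nil_form :: "nat \<Rightarrow> 'a \<Rightarrow> 'a \<Rightarrow> real" where
  "nil_form k v w = Om ((Y ^^ (k - 1)) v) ((Y ^^ k) w)"

lemma symform_nil_form: assumes "subspace U" "k \<ge> 1" shows "symform U (nil_form k)"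
proof -
  obtain j where j: "k = Suc j" using assms by (cases k) auto
  have "bilinear (nil_form k)" unfolding bilinear_def nil_form_def
    using linear_funpow_Y[of "k-1"] linear_funpow_Y[of k] Om
    by (auto intro!: linearI simp: linear_add linear_cmul bilinear_ladd bilinear_radd bilinear_lmul bilinear_rmul)
  moreover have "nil_form k v w = nil_form k w v" for v w
    unfolding nil_form_def j using skY[of "(Y ^^ j) v" "(Y ^^ j) w"] skew[of "(Y ^^ j) v" "Y ((Y ^^ j) w)"]
      skew[of "(Y ^^ j) w" "Y ((Y ^^ j) v)"] by simp
  ultimately show ?thesis using assms by (auto simp: symform_def)
qed

lemma nil_form_eq: assumes "k \<ge> 1" shows "nil_form k v w = (-1) ^ k * Om ((Y ^^ (2 * k - 1)) v) w"
proof -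
  have "Om ((Y ^^ k) ((Y ^^ (k - 1)) v)) w = (-1) ^ k * nil_form k v w"
    unfolding nil_form_def by (simp add: Om_funpow_Y)
  moreover have "(Y ^^ k) ((Y ^^ (k - 1)) v) = (Y ^^ (2 * k - 1)) v"
    using assms by (simp add: funpow_add[symmetric, THEN fun_cong, unfolded o_def] mult_2)
  ultimately show ?thesis by (simp add: power_mult_distrib[symmetric] mult.assoc[symmetric])
qed

text \<open>Skewness puts the image of \<open>Y ^^ j\<close> into the complement of the kernel of
  \<open>Y ^^ j\<close>; nondegeneracy on W gives both the same dimension.\<close>

lemma Om_perp_kernel:
  assumes u: "u \<in> W" "\<And>w. w \<in> W \<Longrightarrow> (Y ^^ j) w = 0 \<Longrightarrow> Om u w = 0"
  shows "\<exists>v\<in>W. u = (Y ^^ j) v"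
proof -
  let ?K = "{w \<in> W. (Y ^^ j) w = 0}"
  let ?P = "{v \<in> W. \<forall>k\<in>?K. Om v k = 0}"
  note lY = linear_funpow_Y[of j]
  have K: "subspace ?K" using W lY by (auto simp: subspace_def linear_add linear_cmul linear_0)
  have "k = 0" if "k \<in> W" "\<forall>v\<in>W. Om v k = 0" for k
    using nd[of k] that skew[of k] by auto
  then have "{k \<in> ?K. \<forall>v\<in>W. Om v k = 0} \<subseteq> {0}" by blast
  then have "dim {k \<in> ?K. \<forall>v\<in>W. Om v k = 0} = 0" by (simp add: dim_eq_0)
  then have "dim ?P + dim ?K = dim W" using dim_bilinear_perp[OF Om W(1) K] by auto
  moreover have "dim ((Y ^^ j) ` W) + dim ?K = dim W" by (rule rank_nullity_on[OF lY W(1)])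
  moreover have "(Y ^^ j) ` W \<subseteq> ?P" using funpow_Y_W by (auto simp: Om_funpow_Y bilinear_rzero[OF Om])
  moreover have "subspace ?P" using subspace_perp_on[OF Om W(1)] .
  ultimately have "(Y ^^ j) ` W = ?P"
    by (intro subspace_dim_equal linear_subspace_image[OF lY W(1)]) auto
  then show ?thesis using u by blast
qed

text \<open>Split along the kernel of \<open>Y ^^ (2 * k)\<close>. Up to the radical, the complement
  is the image of Y, and pulling \<open>nil_form k\<close> back along Y gives
  \<open>nil_form (Suc k)\<close>.\<close>

lemma signature_nil_form_step:
  assumes k: "k \<ge> 1"
  shows "signature W (nil_form k) = signature {v \<in> W. (Y ^^ (2 * k)) v = 0} (nil_form k) + signature W (nil_form (Suc k))"
proof -
  let ?K = "{v \<in> W. (Y ^^ (2 * k)) v = 0}"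
  note lY = linear_funpow_Y[of "2 * k"]
  note BW = symform_nil_form[OF W(1) k]
  have K: "subspace ?K" using W lY by (auto simp: subspace_def linear_add linear_cmul linear_0)
  define P where "P = {v \<in> W. \<forall>k'\<in>?K. nil_form k v k' = 0}"
  have P: "subspace P" unfolding P_def using BW by (intro subspace_perp_on W(1)) (simp add: symform_def)
  have s: "signature W (nil_form k) = signature ?K (nil_form k) + signature P (nil_form k)"
    unfolding P_def by (rule signature_split[OF BW K]) auto
  have YW: "subspace (Y ` W)" by (rule linear_subspace_image[OF Y W(1)])
  have k2: "2 * k = Suc (2 * k - 1)" using k by simp
  have YWP: "Y ` W \<subseteq> P"
  proof
    fix y assume "y \<in> Y ` W"
    then obtain w where w: "w \<in> W" "y = Y w" by blast
    have "(Y ^^ (2 * k - 1)) y = (Y ^^ (2 * k)) w" using w by (subst k2) (simp add: funpow_swap1)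
    then have "nil_form k y k' = 0" if "k' \<in> ?K" for k'
      using that Om_funpow_Y[of "2 * k" w k'] bilinear_rzero[OF Om] by (simp add: nil_form_eq[OF k])
    then show "y \<in> P" using w W by (auto simp: P_def)
  qed
  have "signature P (nil_form k) = signature (Y ` W) (nil_form k)"
  proof (rule signature_add_radical[OF symform_nil_form[OF P k] YW YWP])
    \<comment> \<open>By \<open>Om_perp_kernel\<close> the vector
      \<open>(Y ^^ (2 * k - 1)) v\<close> has the form \<open>(Y ^^ (2 * k)) u\<close>, so
      \<open>v - Y u\<close> is killed by \<open>Y ^^ (2 * k - 1)\<close> and lies in the
      radical.\<close>
    fix v assume v: "v \<in> P"
    have "Om ((Y ^^ (2 * k - 1)) v) w = 0" if "w \<in> W" "(Y ^^ (2 * k)) w = 0" for w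
      using v that by (auto simp: P_def nil_form_eq[OF k])
    then obtain u where u: "u \<in> W" "(Y ^^ (2 * k - 1)) v = (Y ^^ (2 * k)) u"
      using Om_perp_kernel[of "(Y ^^ (2 * k - 1)) v" "2 * k"] funpow_Y_W v by (auto simp: P_def)
    then have "(Y ^^ (2 * k - 1)) v = (Y ^^ (2 * k - 1)) (Y u)" by (subst (asm) (2) k2) (simp add: funpow_swap1)
    then have "(Y ^^ (2 * k - 1)) (v - Y u) = 0" using linear_funpow_Y by (simp add: linear_diff)
    then have "nil_form k (v - Y u) w = 0" for w by (simp add: nil_form_eq[OF k] bilinear_lzero[OF Om])
    moreover have "v - Y u \<in> P" using v u YWP P by (intro subspace_diff) auto
    ultimately show "\<exists>u\<in>Y ` W. v - u \<in> radical P (nil_form k)" using u by (auto simp: radical_def)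
  qed
  also have "\<dots> = signature W (nil_form (Suc k))"
  proof (rule signature_pullback[OF Y refl, symmetric])
    show "symform W (nil_form (Suc k))" "symform (Y ` W) (nil_form k)" using symform_nil_form W YW k by auto
    show "nil_form (Suc k) v v = nil_form k (Y v) (Y v)" for v
      using k by (cases k) (auto simp: nil_form_def funpow_swap1)
  qed
  finally show ?thesis using s by simp
qed

text \<open>The step telescopes, and by nilpotency the remainder \<open>nil_form (Suc p)\<close> is
  zero.\<close>

theorem signature_nilpotent_sum:
  assumes nil: "\<And>w. w \<in> W \<Longrightarrow> (Y ^^ p) w = 0"
  shows "signature W (\<lambda>v w. Om v (Y w)) = (\<Sum>k=1..p. signature {v \<in> W. (Y ^^ (2 * k)) v = 0} (nil_form k))"
proof -
  have "signature W (nil_form 1) = (\<Sum>k=1..q. signature {v \<in> W. (Y ^^ (2 * k)) v = 0} (nil_form k)) + signature W (nil_form (Suc q))" for q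
  proof (induction q)
    case (Suc q)
    then show ?case using signature_nil_form_step[of "Suc q"] by simp
  qed simp
  from this[of p] have "signature W (nil_form 1) = (\<Sum>k=1..p. signature {v \<in> W. (Y ^^ (2 * k)) v = 0} (nil_form k)) + signature W (nil_form (Suc p))" .
  moreover have "signature W (nil_form (Suc p)) = 0"
  proof -
    have "nil_form (Suc p) v w = 0" if "v \<in> W" "w \<in> W" for v w
      using nil that by (simp add: nil_form_def bilinear_lzero[OF Om])
    then have "radical W (nil_form (Suc p)) = W" by (auto simp: radical_def)
    then show ?thesis using signature_radical[OF symform_nil_form[OF W(1), of "Suc p"]] by simp
  qed
  ultimately show ?thesis by (simp add: nil_form_def[abs_def])
qed

end

section \<open>Lagrangian subspaces and their angles\<close>

lemma closest_point_subspaceI: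
  fixes V :: "'a::euclidean_space set"
  assumes V: "subspace V" and y: "y \<in> V" and orth: "\<And>v. v \<in> V \<Longrightarrow> (x - y) \<bullet> v = 0"
  shows "closest_point V x = y"
proof (rule closest_point_unique[symmetric])
  show "convex V" "closed V" using V by (auto simp: subspace_imp_convex closed_subspace)
  show "\<forall>z\<in>V. dist x y \<le> dist x z"
  proof
    fix z assume z: "z \<in> V"
    have "x - z = (x - y) + (y - z)" "(x - y) \<bullet> (y - z) = 0" using V y z orth by (auto simp: subspace_diff)
    then have "norm (x - z) ^ 2 = norm (x - y) ^ 2 + norm (y - z) ^ 2" using norm_add_Pythagorean[of "x - y" "y - z"] by (simp add: orthogonal_def)
    then have "norm (x - y) ^ 2 \<le> norm (x - z) ^ 2" by simp
    then show "dist x y \<le> dist x z" by (simp add: dist_norm)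
  qed
qed (use y in auto)

lemma closest_point_subspace:
  fixes V :: "'a::euclidean_space set"
  assumes "subspace V"
  shows "closest_point V x \<in> V" "v \<in> V \<Longrightarrow> (x - closest_point V x) \<bullet> v = 0" "linear (closest_point V)"
proof -
  have ex: "\<exists>y. y \<in> V \<and> (\<forall>v\<in>V. (x - y) \<bullet> v = 0)" for x
  proof -
    obtain y z where yz: "y \<in> span V" "\<And>w. w \<in> span V \<Longrightarrow> orthogonal z w" "x = y + z"
      using orthogonal_subspace_decomp_exists[of V x] by metis
    then show ?thesis using assms by (intro exI[of _ y]) (auto simp: span_eq_iff[THEN iffD2] orthogonal_def)
  qed
  have P: "closest_point V x \<in> V \<and> (\<forall>v\<in>V. (x - closest_point V x) \<bullet> v = 0)" for x
    using ex[of x] closest_point_subspaceI[OF assms, of _ x] by metis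
  then show "closest_point V x \<in> V" "v \<in> V \<Longrightarrow> (x - closest_point V x) \<bullet> v = 0" by auto
  show "linear (closest_point V)"
  proof (rule linearI)
    fix x y
    show "closest_point V (x + y) = closest_point V x + closest_point V y"
    proof (rule closest_point_subspaceI[OF assms])
      show "closest_point V x + closest_point V y \<in> V" using P assms subspace_add by blast
      fix v assume "v \<in> V"
      then have "(x - closest_point V x) \<bullet> v = 0" "(y - closest_point V y) \<bullet> v = 0" using P by blast+
      moreover have "(x + y - (closest_point V x + closest_point V y)) \<bullet> v = (x - closest_point V x) \<bullet> v + (y - closest_point V y) \<bullet> v"
        by (simp add: inner_diff_left inner_add_left)
      ultimately show "(x + y - (closest_point V x + closest_point V y)) \<bullet> v = 0" by simp
    qed
  next
    fix r x
    show "closest_point V (r *\<^sub>R x) = r *\<^sub>R closest_point V x"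
    proof (rule closest_point_subspaceI[OF assms])
      show "r *\<^sub>R closest_point V x \<in> V" using P assms subspace_scale by blast
      fix v assume "v \<in> V"
      then have "(x - closest_point V x) \<bullet> v = 0" using P by blast
      moreover have "(r *\<^sub>R x - r *\<^sub>R closest_point V x) \<bullet> v = r * ((x - closest_point V x) \<bullet> v)"
        by (simp add: inner_diff_left algebra_simps)
      ultimately show "(r *\<^sub>R x - r *\<^sub>R closest_point V x) \<bullet> v = 0" by simp
    qed
  qed
qed

lemma continuous_on_det:
  fixes A :: "'b::topological_space \<Rightarrow> 'c::{real_normed_field}^'n^'n"
  assumes "\<And>i j. continuous_on S (\<lambda>x. A x $ i $ j)"
  shows "continuous_on S (\<lambda>x. det (A x))"
  unfolding det_def by (intro continuous_on_sum continuous_on_mult continuous_on_const continuous_on_prod assms)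

lemma linear_inner_left: "linear (\<lambda>x. x \<bullet> a)" and linear_inner_right: "linear (\<lambda>x. a \<bullet> x)" for a :: "'a::euclidean_space"
  by (auto intro: bounded_linear.linear bounded_linear_inner_left bounded_linear_inner_right)

text \<open>Different logarithms of one number are at least 2 pi apart, so h has discrete range on a
  connected set.\<close>

lemma continuous_exp_eq_const:
  fixes h :: "'a::real_normed_vector \<Rightarrow> complex"
  assumes S: "connected S" and h: "continuous_on S h" and eq: "\<And>t. t \<in> S \<Longrightarrow> exp (h t) = c"
    and "s \<in> S" "t \<in> S"
  shows "h s = h t"
proof -
  have "h constant_on S"
  proof (rule continuous_discrete_range_constant[OF S h])
    fix x assume x: "x \<in> S"
    have "2 * pi \<le> norm (h y - h x)" if y: "y \<in> S" "h y \<noteq> h x" for y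
    proof -
      have "exp (h y) = exp (h x)" using eq x y by simp
      then obtain n :: int where n: "h y = h x + of_int (2 * n) * pi * \<i>" using exp_eq by blast
      with y have "n \<noteq> 0" by auto
      then have "1 \<le> \<bar>real_of_int n\<bar>" by linarith
      then show ?thesis unfolding n by (simp add: norm_mult)
    qed
    then show "\<exists>e>0. \<forall>y. y \<in> S \<and> h y \<noteq> h x \<longrightarrow> e \<le> norm (h y - h x)" using pi_gt_zero
      by (intro exI[of _ "2 * pi"]) auto
  qed
  then show ?thesis using assms by (auto simp: constant_on_def)
qed

lemma det_orthogonal_diagonalization:
  fixes Q :: "'m::finite \<Rightarrow> 'm \<Rightarrow> real" and d :: "'m \<Rightarrow> complex"
  assumes "\<And>j l. (\<Sum>k\<in>UNIV. Q j k * Q l k) = (if j = l then 1 else 0)"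
  shows "det (\<chi> j l. \<Sum>k\<in>UNIV. complex_of_real (Q j k) * complex_of_real (Q l k) * d k) = (\<Prod>k\<in>UNIV. d k)"
proof -
  define M :: "complex^'m^'m" where "M = (\<chi> j k. complex_of_real (Q j k))"
  define D :: "complex^'m^'m" where "D = (\<chi> j k. if j = k then d j else 0)"
  have MM: "M ** transpose M = mat 1"
    unfolding M_def matrix_matrix_mult_def transpose_def mat_def
    using assms by (simp add: vec_eq_iff flip: of_real_mult of_real_sum)
  have "(M ** D) $ j $ k = complex_of_real (Q j k) * d k" for j k
    by (simp add: M_def D_def matrix_matrix_mult_def if_distrib[where f="\<lambda>x. _ * x"] cong: if_cong)
  then have "(M ** D ** transpose M) = (\<chi> j l. \<Sum>k\<in>UNIV. complex_of_real (Q j k) * complex_of_real (Q l k) * d k)"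
    unfolding matrix_matrix_mult_def[of "M ** D"] by (simp add: transpose_def M_def mult_ac)
  moreover have "det (M ** D ** transpose M) = det (M ** transpose M) * det D" by (simp add: det_mul mult_ac)
  moreover have "det D = (\<Prod>k\<in>UNIV. d k)" by (subst det_diagonal) (auto simp: D_def)
  ultimately show ?thesis by (simp add: MM)
qed

lemma orthonormal_family:
  fixes u :: "'m::finite \<Rightarrow> 'a::euclidean_space"
  assumes u: "\<And>i j. u i \<bullet> u j = (if i = j then 1 else 0)"
  shows "inj u" "independent (range u)" "pairwise orthogonal (range u)" "dim (span (range u)) = CARD('m)"
proof -
  show inj: "inj u" using u by (metis injI zero_neq_one)
  show po: "pairwise orthogonal (range u)" using u by (auto simp: pairwise_def orthogonal_def)
  have "u i \<noteq> 0" for i using u[of i i] by auto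
  then show ind: "independent (range u)" using pairwise_orthogonal_independent[OF po] by force
  show "dim (span (range u)) = CARD('m)" using ind inj by (simp add: dim_eq_card_independent card_image)
qed

lemma orthonormal_family_expand:
  fixes u :: "'m::finite \<Rightarrow> 'a::euclidean_space"
  assumes u: "\<And>i j. u i \<bullet> u j = (if i = j then 1 else 0)" and x: "x \<in> span (range u)"
  shows "x = (\<Sum>i\<in>UNIV. (x \<bullet> u i) *\<^sub>R u i)"
proof -
  let ?f = "\<lambda>x. \<Sum>i\<in>UNIV. (x \<bullet> u i) *\<^sub>R u i"
  have "linear ?f" by (intro linearI) (simp_all add: inner_add_left scaleR_left.add sum.distrib scaleR_sum_right)
  moreover have "?f (u j) = u j" for j by (simp add: u if_distrib[where f="\<lambda>x. x *\<^sub>R _"] cong: if_cong)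
  ultimately have "?f x = x" using linear_eq_on_span[of "?f" "\<lambda>x. x" "range u" x] x by (auto simp: linear_ident)
  then show ?thesis by simp
qed

text \<open>A line in a Lagrangian does not see a sign, so rotation angles matter only modulo pi; c
  records the sign.\<close>

lemma angle_mod_pi: obtains \<theta> c where "0 \<le> \<theta>" "\<theta> < pi" "c = 1 \<or> c = (-1::real)" "cos t = c * cos \<theta>" "sin t = c * sin \<theta>"
proof -
  define k where "k = \<lfloor>t / pi\<rfloor>"
  define \<theta> where "\<theta> = t - k * pi"
  have "k \<le> t / pi" "t / pi < k + 1" unfolding k_def by linarith+
  then have b: "0 \<le> \<theta>" "\<theta> < pi" unfolding \<theta>_def by (simp_all add: field_simps)
  have t: "t = \<theta> + k * pi" by (simp add: \<theta>_def)
  have "sin (k * pi) = 0" by (simp add: sin_times_pi_eq_0 sin_zero_iff_int2)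
  moreover from this have "cos (k * pi) = 1 \<or> cos (k * pi) = -1" by (metis cos_one_sin_zero sin_zero_abs_cos_one abs_eq_iff' abs_1)
  ultimately show ?thesis using that[OF b, of "cos (k * pi)"] unfolding t by (simp add: cos_add sin_add mult.commute)
qed

text \<open>A Hermitian space with complex structure \<open>J\<close> and a real form spanned by the
  orthonormal vectors \<open>E i\<close>. Below, \<open>re\<close> and \<open>im\<close> are the
  coordinates along \<open>L\<close> and \<open>J L\<close>, and \<open>rot t\<close> is
  multiplication by the complex number \<open>cis t\<close>. The only instance is the doubled space
  containing the graphs, but the arguments stay free of blocks and coordinates.\<close>

locale lagrangian_frame =
  fixes J :: "'a::euclidean_space \<Rightarrow> 'a" and E :: "'m::finite \<Rightarrow> 'a"
  assumes linear_J: "linear J" and JJ: "J (J x) = - x" and J_isom: "J x \<bullet> J y = x \<bullet> y"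
    and E_orth: "E i \<bullet> E j = (if i = j then 1 else 0)" and E_J: "E i \<bullet> J (E j) = 0"
    and E_dim: "DIM('a) = 2 * CARD('m)"
begin

definition Om :: "'a \<Rightarrow> 'a \<Rightarrow> real" where "Om x y = J x \<bullet> y"
definition L :: "'a set" where "L = span (range E)"
definition re :: "'a \<Rightarrow> 'a" where "re x = (\<Sum>i\<in>UNIV. (x \<bullet> E i) *\<^sub>R E i)"
definition im :: "'a \<Rightarrow> 'a" where "im x = (\<Sum>i\<in>UNIV. (x \<bullet> J (E i)) *\<^sub>R E i)"
definition rot :: "real \<Rightarrow> 'a \<Rightarrow> 'a" where "rot t x = cos t *\<^sub>R x + sin t *\<^sub>R J x"

lemma J_add: "J (x + y) = J x + J y" and J_scale: "J (r *\<^sub>R x) = r *\<^sub>R J x" and J_0: "J 0 = 0"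
  and J_diff: "J (x - y) = J x - J y" and J_minus: "J (- x) = - J x" and J_sum: "J (sum g A) = (\<Sum>a\<in>A. J (g a))"
  using linear_J by (auto simp: linear_add linear_cmul linear_0 linear_diff linear_neg linear_sum)

lemma J_adj: "x \<bullet> J y = - (J x \<bullet> y)"
  using J_isom[of x "J y"] by (simp add: JJ)

lemma J_self: "x \<bullet> J x = 0" "J x \<bullet> x = 0"
  using J_adj[of x x] by (auto simp: inner_commute)

lemma bilinear_Om: "bilinear Om"
  unfolding bilinear_def Om_def by (auto intro!: linearI simp: J_add J_scale inner_add)

lemma Om_skew: "Om y x = - Om x y"
  unfolding Om_def using J_adj[of x y] by (simp add: inner_commute)

lemma linear_re: "linear re" and linear_im: "linear im"
  by (intro linearI; simp add: re_def im_def inner_add_left scaleR_left.add sum.distrib scaleR_sum_right)+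

lemma subspace_L: "subspace L" by (simp add: L_def)

lemma dim_L: "dim L = CARD('m)" unfolding L_def using orthonormal_family(4)[OF E_orth] .

lemma re_in_L: "re x \<in> L" and im_in_L: "im x \<in> L"
  unfolding re_def im_def L_def by (auto intro!: span_sum span_scale intro: span_base)

lemma L_J: "x \<in> L \<Longrightarrow> y \<in> L \<Longrightarrow> x \<bullet> J y = 0"
proof -
  assume x: "x \<in> L" and y: "y \<in> L"
  have "x \<bullet> J (E j) = 0" for j
    using x linear_eq_0_on_span[of "\<lambda>x. x \<bullet> J (E j)" "range E" x] E_J
    by (auto simp: L_def linear_inner_left)
  then show ?thesis
    using y linear_eq_0_on_span[of "\<lambda>y. x \<bullet> J y" "range E" y]
      linear_compose[OF linear_J linear_inner_right[of x]] by (auto simp: L_def o_def)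
qed

lemma L_J': "x \<in> L \<Longrightarrow> y \<in> L \<Longrightarrow> J x \<bullet> y = 0"
  using L_J[of y x] by (simp add: inner_commute)

lemma re_im: "x = re x + J (im x)"
proof -
  let ?z = "x - (re x + J (im x))"
  have re_E: "re x \<bullet> E j = x \<bullet> E j" and im_E: "im x \<bullet> E j = x \<bullet> J (E j)" for j
    by (simp_all add: re_def im_def inner_sum_left E_orth if_distrib[where f="\<lambda>x. _ * x"] cong: if_cong)
  have E_L: "E j \<in> L" for j by (simp add: L_def span_base)
  have z: "?z \<bullet> E j = 0" "?z \<bullet> J (E j) = 0" for j
    using L_J'[OF im_in_L E_L, of x j] L_J[OF re_in_L E_L, of x j]
    by (simp_all add: inner_diff_left inner_add_left re_E im_E J_isom)
  let ?B = "range E \<union> J ` range E"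
  have JE: "J (E i) \<bullet> J (E j) = (if i = j then 1 else 0)" for i j by (simp add: J_isom E_orth)
  have disj: "range E \<inter> J ` range E = {}"
  proof (rule ccontr)
    assume "\<not> ?thesis"
    then obtain i j where "E i = J (E j)" by auto
    then show False using E_orth[of i i] E_J[of i j] by simp
  qed
  have "pairwise orthogonal ?B"
    using E_orth E_J JE by (auto simp: pairwise_def orthogonal_def inner_commute)
  moreover have "0 \<notin> ?B" using E_orth JE by auto (metis inner_zero_left zero_neq_one)+
  ultimately have ind: "independent ?B" by (rule pairwise_orthogonal_independent)
  have "card ?B = 2 * CARD('m)"
    using disj orthonormal_family(1)[OF E_orth] orthonormal_family(1)[OF JE]
    by (subst card_Un_disjoint) (auto simp: card_image image_image)
  then have "dim ?B = DIM('a)" using dim_eq_card_independent[OF ind] E_dim by simp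
  then have "span ?B = UNIV" by (simp add: dim_eq_full)
  moreover have "?z \<bullet> y = 0" if "y \<in> span ?B" for y
    by (rule linear_eq_0_on_span[OF linear_inner_right _ that]) (use z in auto)
  ultimately have "?z \<bullet> ?z = 0" by blast
  then show ?thesis by simp
qed

lemma L_re: assumes "x \<in> L" shows "re x = x" "im x = 0"
proof -
  show "im x = 0" using L_J[OF assms] by (simp add: im_def L_def span_base)
  then show "re x = x" using re_im[of x] by (simp add: J_0)
qed

lemma L_iff: "x \<in> L \<longleftrightarrow> im x = 0"
  using L_re re_im[of x] re_in_L[of x] by (auto simp: J_0)

lemma JL_re: assumes "x \<in> L" shows "re (J x) = 0" "im (J x) = x"
proof -
  show "re (J x) = 0" using L_J'[OF assms] by (simp add: re_def L_def span_base)
  have "im (J x) = re x" by (simp add: im_def re_def J_isom)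
  then show "im (J x) = x" using L_re[OF assms] by simp
qed

lemma rot_add: "rot s (rot t x) = rot (s + t) x"
  by (simp add: rot_def J_add J_scale JJ cos_add sin_add algebra_simps scaleR_add_left)

lemma rot_0: "rot 0 x = x" by (simp add: rot_def)

lemma rot_J: "rot t (J x) = J (rot t x)" by (simp add: rot_def J_add J_scale)

lemma linear_rot: "linear (rot t)"
  by (intro linearI) (simp_all add: rot_def J_add J_scale algebra_simps)

lemma inner_rot: "rot t x \<bullet> rot t y = x \<bullet> y"
proof -
  have "rot t x \<bullet> rot t y = cos t * cos t * (x \<bullet> y) + cos t * sin t * (x \<bullet> J y) + sin t * cos t * (J x \<bullet> y) + sin t * sin t * (J x \<bullet> J y)"
    by (simp add: rot_def inner_add_left inner_add_right algebra_simps)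
  then have "rot t x \<bullet> rot t y = (cos t * cos t + sin t * sin t) * (x \<bullet> y)"
    unfolding J_isom J_adj[of x y] by (simp add: algebra_simps del: sin_cos_squared_add3)
  then show ?thesis by (simp only: sin_cos_squared_add3 mult_1)
qed

lemma re_rot: "e \<in> L \<Longrightarrow> re (rot t e) = cos t *\<^sub>R e" and im_rot: "e \<in> L \<Longrightarrow> im (rot t e) = sin t *\<^sub>R e"
  by (simp_all add: rot_def linear_add[OF linear_re] linear_add[OF linear_im] linear_cmul[OF linear_re]
      linear_cmul[OF linear_im] L_re JL_re)

text \<open>The dimension comes from V being the orthogonal complement of \<open>J V\<close>, since
  \<open>Om\<close> is the inner product composed with \<open>J\<close>.\<close>

lemma lagrangianD: assumes "lagrangian Om V"
  shows "subspace V" "x \<in> V \<Longrightarrow> y \<in> V \<Longrightarrow> J x \<bullet> y = 0" "(\<And>v. v \<in> V \<Longrightarrow> J v \<bullet> w = 0) \<Longrightarrow> w \<in> V" "dim V = CARD('m)"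
proof -
  show V: "subspace V" using assms by (simp add: lagrangian_def)
  have eq: "V = {w. \<forall>v\<in>V. J v \<bullet> w = 0}" using assms by (auto simp: lagrangian_def form_orthogonal_def Om_def)
  then show "x \<in> V \<Longrightarrow> y \<in> V \<Longrightarrow> J x \<bullet> y = 0" "(\<And>v. v \<in> V \<Longrightarrow> J v \<bullet> w = 0) \<Longrightarrow> w \<in> V" by auto
  have JV: "subspace (J ` V)" by (rule linear_subspace_image[OF linear_J V])
  have "{y \<in> UNIV. \<forall>x\<in>J ` V. orthogonal x y} = V" by (subst (2) eq) (auto simp: orthogonal_def)
  then have "dim V + dim (J ` V) = DIM('a)"
    using dim_subspace_orthogonal_to_vectors[OF JV subspace_UNIV] by simp
  moreover have "inj J" using JJ by (metis injI minus_equation_iff)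
  then have "dim (J ` V) = dim V" by (intro dim_image_eq linear_J) (auto intro: inj_on_subset)
  ultimately show "dim V = CARD('m)" using E_dim by simp
qed

lemma lagrangianI:
  assumes V: "subspace V" and iso: "\<And>x y. x \<in> V \<Longrightarrow> y \<in> V \<Longrightarrow> J x \<bullet> y = 0" and d: "dim V = CARD('m)"
  shows "lagrangian Om V"
proof -
  let ?P = "{w. \<forall>v\<in>V. J v \<bullet> w = 0}"
  have P: "subspace ?P" by (auto simp: subspace_def inner_add)
  have JV: "subspace (J ` V)" by (rule linear_subspace_image[OF linear_J V])
  have "{y \<in> UNIV. \<forall>x\<in>J ` V. orthogonal x y} = ?P" by (auto simp: orthogonal_def)
  then have "dim ?P + dim (J ` V) = DIM('a)"
    using dim_subspace_orthogonal_to_vectors[OF JV subspace_UNIV] by simp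
  moreover have "inj J" using JJ by (metis injI minus_equation_iff)
  then have "dim (J ` V) = dim V" by (intro dim_image_eq linear_J) (auto intro: inj_on_subset)
  ultimately have "V = ?P" using E_dim d iso V P by (intro subspace_dim_equal) auto
  then show ?thesis using V by (auto simp: lagrangian_def form_orthogonal_def Om_def)
qed

lemma lagrangian_L: "lagrangian Om L"
  using subspace_L L_J' dim_L by (rule lagrangianI)

lemma lagrangian_rot: assumes "lagrangian Om V" shows "lagrangian Om (rot t ` V)"
proof (rule lagrangianI)
  note D = lagrangianD[OF assms]
  show "subspace (rot t ` V)" by (rule linear_subspace_image[OF linear_rot D(1)])
  show "J x \<bullet> y = 0" if "x \<in> rot t ` V" "y \<in> rot t ` V" for x y
    using that D(2) by (auto simp: rot_J[symmetric] inner_rot)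
  have "inj (rot t)" by (rule injI) (metis rot_add rot_0 add.left_inverse)
  then show "dim (rot t ` V) = CARD('m)" using D(4) dim_image_eq[OF linear_rot] by (metis inj_on_subset subset_UNIV)
qed

text \<open>Suppose that all angles are bad, and pick a nonzero vector of V in each rotated copy of
  L. Isotropy of V makes \<open>sin (b - a)\<close> times the inner product of the underlying
  vectors of L vanish, so the picked vectors are pairwise orthogonal: an infinite orthogonal family
  in finite dimension.\<close>

lemma generic_angle:
  assumes "lagrangian Om V"
  obtains \<alpha> where "0 < \<alpha>" "\<alpha> < pi" "V \<inter> rot \<alpha> ` L = {0}"
proof (rule ccontr)
  assume neg: "\<not> thesis"
  note witness = that
  have V0: "0 \<in> V" using lagrangianD(1)[OF assms] by (rule subspace_0)
  have L0: "0 \<in> rot a ` L" for a using subspace_0[OF subspace_L] linear_0[OF linear_rot] by (metis image_eqI)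
  have "\<exists>x. x \<in> L \<and> rot a x \<in> V \<and> rot a x \<noteq> 0" if "a \<in> {0<..<pi}" for a
  proof (rule ccontr)
    assume "\<not> ?thesis"
    then have "V \<inter> rot a ` L \<subseteq> {0}" by blast
    then have "V \<inter> rot a ` L = {0}" using V0 L0 by blast
    then show False using neg that by (auto intro: witness)
  qed
  then obtain x where x: "\<And>a. a \<in> {0<..<pi} \<Longrightarrow> x a \<in> L \<and> rot a (x a) \<in> V \<and> rot a (x a) \<noteq> 0" by metis
  let ?u = "\<lambda>a. rot a (x a)"
  have orth: "?u a \<bullet> ?u b = 0" if ab: "a \<in> {0<..<pi}" "b \<in> {0<..<pi}" "a \<noteq> b" for a b
  proof -
    have xx: "x a \<bullet> J (x b) = 0" "J (x a) \<bullet> x b = 0" using x ab L_J L_J' by auto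
    have "J (?u a) \<bullet> ?u b = 0" using lagrangianD(2)[OF assms] x ab by blast
    moreover have "J (?u a) \<bullet> ?u b = sin (b - a) * (x a \<bullet> x b)"
      by (simp add: rot_def J_add J_scale JJ inner_add xx J_isom sin_diff algebra_simps)
    moreover have "sin (b - a) \<noteq> 0" using ab sin_gt_zero[of "b - a"] sin_gt_zero[of "a - b"] sin_minus[of "a - b"]
      by (cases "a < b") auto
    ultimately have "x a \<bullet> x b = 0" by simp
    then show ?thesis by (simp add: rot_def inner_add xx J_isom)
  qed
  have inj: "inj_on ?u {0<..<pi}" using orth x by (intro inj_onI) (metis inner_eq_zero_iff)
  have "pairwise orthogonal (?u ` {0<..<pi})" using orth by (auto simp: pairwise_def orthogonal_def) metis
  then have "finite (?u ` {0<..<pi})" by (rule pairwise_orthogonal_imp_finite)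
  then have "finite {0<..<pi}" using inj finite_imageD by blast
  then show False using infinite_Ioo[of 0 pi] by simp
qed

text \<open>The normal form of the pair of Lagrangians L and V: for dimension reasons the rotated
  vectors span V. The half-open range makes the angle 0 account exactly for the intersection of V
  and L.\<close>

definition diag :: "'a set \<Rightarrow> ('m \<Rightarrow> 'a) \<Rightarrow> ('m \<Rightarrow> real) \<Rightarrow> bool" where
  "diag V e \<theta> \<longleftrightarrow> (\<forall>i j. e i \<bullet> e j = (if i = j then 1 else 0)) \<and> (\<forall>j. e j \<in> L) \<and>
     (\<forall>j. 0 \<le> \<theta> j \<and> \<theta> j < pi \<and> rot (\<theta> j) (e j) \<in> V)"

text \<open>A Lagrangian transverse to \<open>J L\<close> is the graph over L of a linear map into
  \<open>J L\<close>, and isotropy makes that map symmetric. An eigenvector with eigenvalue l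
  belongs to the angle \<open>arctan l\<close>.\<close>

lemma diag_exists_aux:
  assumes V: "lagrangian Om V" and tr: "V \<inter> J ` L = {0}"
  shows "\<exists>e t. (\<forall>i j. e i \<bullet> e j = (if i = j then 1 else 0)) \<and> (\<forall>j::'m. e j \<in> L \<and> rot (t j) (e j) \<in> V)"
proof -
  note D = lagrangianD[OF V]
  have "v = 0" if "v \<in> V" "re v = 0" for v
  proof -
    have "v = J (im v)" using that by (metis add_0 re_im)
    then have "v \<in> J ` L" using im_in_L by blast
    then show ?thesis using that tr by blast
  qed
  then have inj: "inj_on re V" using linear_inj_on_iff_eq_0[OF linear_re D(1)] by blast
  then obtain g where g: "g ` UNIV \<subseteq> V" "linear g" "\<And>v. v \<in> V \<Longrightarrow> g (re v) = v"
    using linear_exists_left_inverse_on[OF linear_re D(1)] by blast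
  have "dim (re ` V) = dim L"
    using dim_image_eq[OF linear_re, of V] inj D(1,4) dim_L by (simp add: span_eq_iff[THEN iffD2])
  then have reV: "re ` V = L" using re_in_L linear_subspace_image[OF linear_re D(1)] subspace_L
    by (intro subspace_dim_equal) auto
  have reg: "re (g x) = x" if "x \<in> L" for x using that g reV by (metis imageE)
  have gx: "g x = x + J (im (g x))" if "x \<in> L" for x using re_im[of "g x"] reg[OF that] by simp
  define S where "S x y = im (g x) \<bullet> y" for x y
  have bS: "bilinear S" unfolding bilinear_def S_def
    by (auto intro!: linearI simp: linear_add[OF g(2)] linear_cmul[OF g(2)] linear_add[OF linear_im] linear_cmul[OF linear_im] inner_add_left inner_add_right)
  have "S x y = S y x" if xy: "x \<in> L" "y \<in> L" for x y
  proof -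
    have "J (g x) \<bullet> g y = 0" using D(2) g(1) by blast
    moreover have "J (g x) \<bullet> g y = (J x - im (g x)) \<bullet> (y + J (im (g y)))"
      by (subst gx[OF xy(1)], subst gx[OF xy(2)]) (simp add: J_add JJ)
    ultimately have "J x \<bullet> y + J x \<bullet> J (im (g y)) - (im (g x) \<bullet> y + im (g x) \<bullet> J (im (g y))) = 0"
      by (simp only: inner_add_right inner_diff_left)
    then have "x \<bullet> im (g y) = im (g x) \<bullet> y"
      using L_J'[OF xy] L_J[OF im_in_L im_in_L, of "g x" "g y"] by (simp add: J_isom)
    then show ?thesis by (simp add: S_def inner_commute)
  qed
  then have sS: "symform L S" using bS subspace_L by (auto simp: symform_def)
  obtain F l where F: "eigenframe L S F l" using spectral_form[OF sS] by blast
  have cF: "card F = CARD('m)" using eigenframe_dim[OF sS F, of F] F dim_L by (auto simp: eigenframe_def simp del: dim_span)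
  then obtain e where e: "bij_betw e (UNIV::'m set) F"
    using F finite_same_card_bij[of "UNIV::'m set" F] by (auto simp: eigenframe_def)
  have eF: "e j \<in> F" for j using e by (auto simp: bij_betw_def)
  have FL: "s \<in> L" if "s \<in> F" for s using F that by (auto simp: eigenframe_def intro: span_base)
  have "e i \<bullet> e j = (if i = j then 1 else 0)" for i j
    using eigenframe_inner[OF sS F eF eF, of i j] e by (auto simp: bij_betw_def inj_eq)
  moreover have "rot (arctan (l s)) s \<in> V" if s: "s \<in> F" for s
  proof -
    let ?z = "im (g s) - l s *\<^sub>R s"
    have "?z \<bullet> y = 0" if "y \<in> L" for y
      using F s that by (simp add: eigenframe_def S_def inner_diff_left)
    moreover have "?z \<in> L" using FL[OF s] im_in_L subspace_L by (simp add: subspace_diff subspace_scale)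
    ultimately have "im (g s) = l s *\<^sub>R s" by (metis eq_iff_diff_eq_0 inner_eq_zero_iff)
    then have "g s = s + l s *\<^sub>R J s" using gx[OF FL[OF s]] by (simp add: J_scale)
    then have "rot (arctan (l s)) s = cos (arctan (l s)) *\<^sub>R g s"
      by (simp add: rot_def scaleR_add_right cos_arctan sin_arctan)
    then show ?thesis using g(1) subspace_scale[OF D(1)] by auto
  qed
  ultimately show ?thesis using eF FL by (intro exI[of _ e] exI[of _ "\<lambda>j. arctan (l (e j))"]) auto
qed

lemma diag_exists: assumes V: "lagrangian Om V" shows "\<exists>e \<theta>. diag V e \<theta>"
proof -
  obtain \<alpha> where a: "V \<inter> rot \<alpha> ` L = {0}" using generic_angle[OF V] by blast
  \<comment> \<open>Rotation by \<open>- b\<close> carries the copy of L at angle \<alpha>, to which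
    V is transverse, to the copy at angle pi/2, which is \<open>J L\<close>.\<close>
  define b where "b = \<alpha> - pi / 2"
  have J_rot: "J x = rot (pi / 2) x" for x by (simp add: rot_def)
  have V': "lagrangian Om (rot (- b) ` V)" by (rule lagrangian_rot[OF V])
  have "rot (- b) ` V \<inter> J ` L \<subseteq> {0}"
  proof safe
    fix v x assume vx: "v \<in> V" "x \<in> L" "rot (- b) v = J x"
    then have "rot b (rot (- b) v) = rot b (rot (pi / 2) x)" by (simp add: J_rot)
    then have "v = rot \<alpha> x" by (simp add: rot_add rot_0 b_def)
    then have "v = 0" using a vx by blast
    then show "rot (- b) v = 0" using linear_0[OF linear_rot] by simp
  qed
  moreover have "0 \<in> rot (- b) ` V \<inter> J ` L"
    using subspace_0[OF lagrangianD(1)[OF V']] subspace_0[OF linear_subspace_image[OF linear_J subspace_L]] by blast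
  ultimately obtain e t where et: "\<And>i j. e i \<bullet> e j = (if i = j then 1 else 0)" "\<And>j::'m. e j \<in> L \<and> rot (t j) (e j) \<in> rot (- b) ` V"
    using diag_exists_aux[OF V'] by (metis subset_singletonD empty_iff)
  have "\<exists>\<theta>. 0 \<le> \<theta> \<and> \<theta> < pi \<and> rot \<theta> (e j) \<in> V" for j
  proof -
    obtain v where v: "v \<in> V" "rot (t j) (e j) = rot (- b) v" using et(2)[of j] by auto
    then have "rot (b + t j) (e j) = v" by (simp add: rot_add[symmetric]) (simp add: rot_add rot_0)
    moreover obtain \<theta> c where th: "0 \<le> \<theta>" "\<theta> < pi" "c = 1 \<or> c = -1" "cos (b + t j) = c * cos \<theta>" "sin (b + t j) = c * sin \<theta>"
      using angle_mod_pi by blast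
    ultimately have "v = c *\<^sub>R rot \<theta> (e j)" by (auto simp: rot_def scaleR_add_right)
    then have "rot \<theta> (e j) = c *\<^sub>R v" using th(3) by auto
    then show ?thesis using v th lagrangianD(1)[OF V] by (auto simp: subspace_scale subspace_neg)
  qed
  then obtain \<theta> where "\<And>j. 0 \<le> \<theta> j \<and> \<theta> j < pi \<and> rot (\<theta> j) (e j) \<in> V" by metis
  then show ?thesis using et unfolding diag_def by blast
qed

end

section \<open>The Souriau determinant and forms that count angles\<close>

context lagrangian_frame
begin

text \<open>The complex coordinates of the reflections of the \<open>E j\<close> in \<open>V\<close>: as reflection in \<open>V\<close> is antilinear, both summands agree.\<close>

definition souriau_mat :: "'a set \<Rightarrow> complex^'m^'m" where
  "souriau_mat V = (\<chi> j l. let P = closest_point V in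
     Complex (P (E j) \<bullet> E l - P (J (E j)) \<bullet> J (E l)) (P (E j) \<bullet> J (E l) + P (J (E j)) \<bullet> E l))"

definition souriau :: "'a set \<Rightarrow> complex" where "souriau V = det (souriau_mat V)"

text \<open>On \<open>rot t e\<close> with e a unit vector of L the value is
  \<open>sin t * sin (\<alpha> - t)\<close>. The signature on a Lagrangian therefore counts its
  angles between 0 and \<alpha> minus those between \<alpha> and pi; it is a Maslov triple form for
  L, V and the copy of L at angle \<alpha>.\<close>

definition qform :: "real \<Rightarrow> 'a \<Rightarrow> 'a \<Rightarrow> real" where
  "qform \<alpha> u v = sin \<alpha> * (im u \<bullet> re v) - cos \<alpha> * (im u \<bullet> im v)"

text \<open>A sum of sawtooth functions of the angles modulo pi. Away from 0 each summand cancels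
  the change of \<open>\<theta> j / pi\<close> in a lift of the Souriau determinant; at 0, where the
  sawtooth jumps from -1/2 to 1/2, it takes the mean value.\<close>

definition angle_defect :: "('m \<Rightarrow> real) \<Rightarrow> real" where
  "angle_defect \<theta> = (\<Sum>j\<in>UNIV. if \<theta> j = 0 then 0 else 1/2 - \<theta> j / pi)"

text \<open>An arbitrary numbering with no continuity in V; only expressions symmetric in the angles
  are formed from it.\<close>

definition angles :: "'a set \<Rightarrow> 'm \<Rightarrow> real" where "angles V = (SOME \<theta>. \<exists>e. diag V e \<theta>)"

lemma diag_angles: "lagrangian Om V \<Longrightarrow> \<exists>e. diag V e (angles V)"
  unfolding angles_def using diag_exists someI_ex[of "\<lambda>\<theta>. \<exists>e. diag V e \<theta>"] by blast

lemma bilinear_qform: "bilinear (qform \<alpha>)"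
  unfolding bilinear_def qform_def
  by (auto intro!: linearI simp: linear_add[OF linear_im] linear_add[OF linear_re]
      linear_cmul[OF linear_im] linear_cmul[OF linear_re] inner_add_left inner_add_right algebra_simps)

lemma re_im_sym: assumes "lagrangian Om V" "u \<in> V" "v \<in> V" shows "im u \<bullet> re v = re u \<bullet> im v"
proof -
  have "J u \<bullet> v = 0" by (rule lagrangianD(2)[OF assms])
  moreover have "J u \<bullet> v = (J (re u) - im u) \<bullet> (re v + J (im v))"
    using re_im[of u] re_im[of v] by (metis J_add JJ diff_conv_add_uminus)
  ultimately have "J (re u) \<bullet> re v + J (re u) \<bullet> J (im v) - (im u \<bullet> re v + im u \<bullet> J (im v)) = 0"
    by (simp only: inner_add_right inner_diff_left)
  then show ?thesis using L_J'[OF re_in_L re_in_L, of u v] L_J[OF im_in_L im_in_L, of u v] by (simp add: J_isom)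
qed

lemma symform_qform: assumes "lagrangian Om V" shows "symform V (qform \<alpha>)"
  unfolding symform_def
proof (intro conjI ballI bilinear_qform lagrangianD(1)[OF assms])
  fix v w assume "v \<in> V" "w \<in> V"
  then show "qform \<alpha> v w = qform \<alpha> w v"
    using re_im_sym[OF assms, of v w] by (simp add: qform_def inner_commute)
qed

context
  fixes V e \<theta>
  assumes V: "lagrangian Om V" and dg: "diag V e \<theta>"
begin

lemma e_orth: "e i \<bullet> e j = (if i = j then 1 else 0)" and e_L: "e j \<in> L" and th: "0 \<le> \<theta> j" "\<theta> j < pi"
  and u_V: "rot (\<theta> j) (e j) \<in> V"
  using dg unfolding diag_def by blast+

lemma u_orth: "rot (\<theta> i) (e i) \<bullet> rot (\<theta> j) (e j) = (if i = j then 1 else 0)"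
proof (cases "i = j")
  case False
  then have "e i \<bullet> e j = 0" "e i \<bullet> J (e j) = 0" "J (e i) \<bullet> e j = 0" using e_orth L_J L_J' e_L by auto
  then show ?thesis using False by (simp add: rot_def inner_add_left inner_add_right J_isom)
qed (simp add: inner_rot e_orth)

lemma u_span: "span (range (\<lambda>k. rot (\<theta> k) (e k))) = V"
proof (rule subspace_dim_equal)
  show "span (range (\<lambda>k. rot (\<theta> k) (e k))) \<subseteq> V" using u_V lagrangianD(1)[OF V] by (intro span_minimal) auto
  show "dim V \<le> dim (span (range (\<lambda>k. rot (\<theta> k) (e k))))"
    unfolding lagrangianD(4)[OF V] orthonormal_family(4)[OF u_orth] ..
qed (use lagrangianD(1)[OF V] in auto)

lemma e_span: "span (range e) = L"
proof (rule subspace_dim_equal)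
  show "span (range e) \<subseteq> L" using e_L subspace_L by (intro span_minimal) auto
  show "dim L \<le> dim (span (range e))" unfolding dim_L orthonormal_family(4)[OF e_orth] ..
qed (use subspace_L in auto)

lemma E_e: "(\<Sum>k\<in>UNIV. (E j \<bullet> e k) * (E l \<bullet> e k)) = (if j = l then 1 else 0)"
proof -
  have "E j \<in> span (range e)" unfolding e_span by (simp add: L_def span_base)
  from orthonormal_family_expand[OF e_orth this] have "E j \<bullet> E l = (\<Sum>k\<in>UNIV. (E j \<bullet> e k) *\<^sub>R e k) \<bullet> E l" by simp
  then show ?thesis by (simp add: inner_sum_left E_orth inner_commute[of "E l"])
qed

lemma closest_diag: "closest_point V x = (\<Sum>k\<in>UNIV. (x \<bullet> rot (\<theta> k) (e k)) *\<^sub>R rot (\<theta> k) (e k))"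
proof (rule closest_point_subspaceI[OF lagrangianD(1)[OF V]])
  let ?u = "\<lambda>k. rot (\<theta> k) (e k)"
  let ?y = "\<Sum>k\<in>UNIV. (x \<bullet> ?u k) *\<^sub>R ?u k"
  show "?y \<in> V" using u_V lagrangianD(1)[OF V] by (auto intro!: subspace_sum subspace_scale)
  fix v assume v: "v \<in> V"
  have "?y \<bullet> ?u j = x \<bullet> ?u j" for j
    by (simp add: inner_sum_left u_orth if_distrib[where f="\<lambda>x. _ * x"] cong: if_cong)
  then have "(x - ?y) \<bullet> ?u j = 0" for j by (simp add: inner_diff_left)
  then show "(x - ?y) \<bullet> v = 0"
    using v linear_eq_0_on_span[OF linear_inner_right[of "x - ?y"], of "range ?u" v] unfolding u_span by auto
qed

lemma souriau_mat_diag: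
  "souriau_mat V $ j $ l = (\<Sum>k\<in>UNIV. complex_of_real (E j \<bullet> e k) * complex_of_real (E l \<bullet> e k) * cis (2 * \<theta> k))"
proof -
  let ?u = "\<lambda>k. rot (\<theta> k) (e k)"
  have E_L: "E j \<in> L" for j by (simp add: L_def span_base)
  have 1: "E j \<bullet> ?u k = cos (\<theta> k) * (E j \<bullet> e k)" "J (E j) \<bullet> ?u k = sin (\<theta> k) * (E j \<bullet> e k)" for j k
    using L_J[OF E_L e_L, of j k] L_J'[OF E_L e_L, of j k] by (simp_all add: rot_def inner_add_right J_isom)
  have 2: "?u k \<bullet> E j = cos (\<theta> k) * (E j \<bullet> e k)" "?u k \<bullet> J (E j) = sin (\<theta> k) * (E j \<bullet> e k)" for j k
    using 1[of j k] by (simp_all add: inner_commute)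
  have r1: "cos (\<theta> k) * (E j \<bullet> e k) * (cos (\<theta> k) * (E l \<bullet> e k)) - sin (\<theta> k) * (E j \<bullet> e k) * (sin (\<theta> k) * (E l \<bullet> e k))
      = (E j \<bullet> e k) * (E l \<bullet> e k) * cos (2 * \<theta> k)" for k
    unfolding cos_double power2_eq_square by (simp add: algebra_simps)
  have r2: "cos (\<theta> k) * (E j \<bullet> e k) * (sin (\<theta> k) * (E l \<bullet> e k)) + sin (\<theta> k) * (E j \<bullet> e k) * (cos (\<theta> k) * (E l \<bullet> e k))
      = (E j \<bullet> e k) * (E l \<bullet> e k) * sin (2 * \<theta> k)" for k
    unfolding sin_double by (simp add: algebra_simps)
  from r2 have r3: "2 * (cos (\<theta> k) * (sin (\<theta> k) * ((E j \<bullet> e k) * (E l \<bullet> e k)))) = (E j \<bullet> e k) * (E l \<bullet> e k) * sin (2 * \<theta> k)" for k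
    unfolding r2[symmetric] by (simp add: algebra_simps)
  show ?thesis
    unfolding souriau_mat_def Let_def closest_diag
    by (simp add: complex_eq_iff inner_sum_left 1 2 sum_subtractf[symmetric] sum.distrib[symmetric] r1 r2 r3 del: mult_eq_0_iff mult_cancel_left mult_cancel_right)
qed

text \<open>A real orthogonal change of basis from E to e makes \<open>souriau_mat\<close> diagonal
  and does not disturb multiples of the identity. The pencil, and not just the determinant, is what
  deforms continuously to 1 in \<open>lift_local\<close>.\<close>

lemma souriau_pencil:
  "det (\<chi> j l. (if j = l then a else 0) + b * souriau_mat V $ j $ l) = (\<Prod>k\<in>UNIV. a + b * cis (2 * \<theta> k))"
proof -
  have "(if j = l then a else 0) + b * souriau_mat V $ j $ l =
      (\<Sum>k\<in>UNIV. complex_of_real (E j \<bullet> e k) * complex_of_real (E l \<bullet> e k) * (a + b * cis (2 * \<theta> k)))" for j l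
  proof -
    have "(if j = l then a else 0) = (\<Sum>k\<in>UNIV. complex_of_real (E j \<bullet> e k) * complex_of_real (E l \<bullet> e k)) * a"
      using E_e[of j l] by (simp flip: of_real_mult of_real_sum)
    then show ?thesis
      unfolding souriau_mat_diag by (simp add: sum_distrib_left sum_distrib_right algebra_simps sum.distrib)
  qed
  then show ?thesis using det_orthogonal_diagonalization[of "\<lambda>j k. E j \<bullet> e k" "\<lambda>k. a + b * cis (2 * \<theta> k)"] E_e by simp
qed

lemma souriau_diag: "souriau V = (\<Prod>k\<in>UNIV. cis (2 * \<theta> k))"
proof -
  have "(\<chi> j l. (if j = l then 0 else 0) + 1 * souriau_mat V $ j $ l) = souriau_mat V" by (simp add: vec_eq_iff)
  then show ?thesis using souriau_pencil[of 0 1] by (simp add: souriau_def)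
qed

lemma angle_ne: assumes "V \<inter> rot \<alpha> ` L = {0}" shows "\<theta> k \<noteq> \<alpha>"
proof
  assume "\<theta> k = \<alpha>"
  then have "rot (\<theta> k) (e k) = 0" using u_V[of k] e_L[of k] assms by blast
  then show False using u_orth[of k k] by simp
qed

lemma eigenframe_qform:
  "eigenframe V (qform \<alpha>) (range (\<lambda>k. rot (\<theta> k) (e k))) (\<lambda>u. sin (\<theta> (inv (\<lambda>k. rot (\<theta> k) (e k)) u)) * sin (\<alpha> - \<theta> (inv (\<lambda>k. rot (\<theta> k) (e k)) u)))"
proof -
  let ?u = "\<lambda>k. rot (\<theta> k) (e k)"
  have inj: "inj ?u" by (rule orthonormal_family(1)[OF u_orth])
  have q: "qform \<alpha> (?u j) (?u k) = sin (\<theta> j) * sin (\<alpha> - \<theta> j) * (?u j \<bullet> ?u k)" for j k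
    unfolding u_orth by (simp add: qform_def re_rot[OF e_L] im_rot[OF e_L] e_orth sin_diff algebra_simps)
  have "qform \<alpha> (?u j) w = sin (\<theta> j) * sin (\<alpha> - \<theta> j) * (?u j \<bullet> w)" if "w \<in> V" for j w
  proof (rule linear_eq_on_span[of "qform \<alpha> (?u j)" "\<lambda>w. sin (\<theta> j) * sin (\<alpha> - \<theta> j) * (?u j \<bullet> w)" "range ?u"])
    show "linear (qform \<alpha> (?u j))" using bilinear_qform by (simp add: bilinear_def)
    show "linear (\<lambda>w. sin (\<theta> j) * sin (\<alpha> - \<theta> j) * (?u j \<bullet> w))" by (intro linearI) (simp_all add: inner_add_right algebra_simps)
  qed (use that u_span q in auto)
  then show ?thesis unfolding eigenframe_def
    using inj u_span orthonormal_family(3)[OF u_orth] by (auto simp: norm_eq_1 u_orth inv_f_f[OF inj])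
qed

lemma signature_qform:
  assumes a: "0 < \<alpha>" "\<alpha> < pi"
  shows "signature V (qform \<alpha>) = (\<Sum>k\<in>UNIV. if \<theta> k = 0 \<or> \<theta> k = \<alpha> then 0 else if \<theta> k < \<alpha> then 1 else -1)"
proof -
  let ?u = "\<lambda>k. rot (\<theta> k) (e k)"
  let ?l = "\<lambda>u. sin (\<theta> (inv ?u u)) * sin (\<alpha> - \<theta> (inv ?u u))"
  have inj: "inj ?u" by (rule orthonormal_family(1)[OF u_orth])
  have sg: "sin (\<theta> k) * sin (\<alpha> - \<theta> k) > 0 \<longleftrightarrow> \<theta> k \<noteq> 0 \<and> \<theta> k < \<alpha>"
     "sin (\<theta> k) * sin (\<alpha> - \<theta> k) < 0 \<longleftrightarrow> \<alpha> < \<theta> k" for k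
  proof -
    consider "\<theta> k = 0" | "\<theta> k \<noteq> 0" "\<theta> k < \<alpha>" | "\<theta> k = \<alpha>" | "\<theta> k > \<alpha>" by linarith
    then have "(sin (\<theta> k) * sin (\<alpha> - \<theta> k) > 0 \<longleftrightarrow> \<theta> k \<noteq> 0 \<and> \<theta> k < \<alpha>) \<and>
      (sin (\<theta> k) * sin (\<alpha> - \<theta> k) < 0 \<longleftrightarrow> \<alpha> < \<theta> k)"
    proof cases
      case 2
      then have "sin (\<theta> k) > 0" "sin (\<alpha> - \<theta> k) > 0" using th[of k] a by (auto intro!: sin_gt_zero)
      then show ?thesis using 2 by (auto simp: zero_less_mult_iff mult_less_0_iff)
    next
      case 4
      have "sin (\<alpha> - \<theta> k) = - sin (\<theta> k - \<alpha>)" using sin_minus[of "\<theta> k - \<alpha>"] by simp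
      moreover have "sin (\<theta> k) > 0" "sin (\<theta> k - \<alpha>) > 0" using 4 th[of k] a by (auto intro!: sin_gt_zero)
      ultimately show ?thesis using 4 by (auto simp: zero_less_mult_iff mult_less_0_iff)
    qed (use a in auto)
    then show "sin (\<theta> k) * sin (\<alpha> - \<theta> k) > 0 \<longleftrightarrow> \<theta> k \<noteq> 0 \<and> \<theta> k < \<alpha>"
      "sin (\<theta> k) * sin (\<alpha> - \<theta> k) < 0 \<longleftrightarrow> \<alpha> < \<theta> k" by auto
  qed
  have cP: "card {s \<in> range ?u. P (?l s)} = card {k. P (sin (\<theta> k) * sin (\<alpha> - \<theta> k))}" for P
  proof -
    have "{s \<in> range ?u. P (?l s)} = ?u ` {k. P (sin (\<theta> k) * sin (\<alpha> - \<theta> k))}" by (auto simp: inv_f_f[OF inj])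
    then show ?thesis using card_image[OF inj_on_subset[OF inj subset_UNIV]] by simp
  qed
  have cp: "card {s \<in> range ?u. ?l s > 0} = card {k. \<theta> k \<noteq> 0 \<and> \<theta> k < \<alpha>}" by (subst cP) (simp only: sg)
  have cn: "card {s \<in> range ?u. ?l s < 0} = card {k. \<alpha> < \<theta> k}" by (subst cP) (simp only: sg)
  have "signature V (qform \<alpha>) = int (card {k. \<theta> k \<noteq> 0 \<and> \<theta> k < \<alpha>}) - int (card {k. \<alpha> < \<theta> k})"
    unfolding signature_eq[OF symform_qform[OF V]] eigenframe_pos_index[OF symform_qform[OF V] eigenframe_qform]
      eigenframe_neg_index[OF symform_qform[OF V] eigenframe_qform] cp cn ..
  also have "\<dots> = (\<Sum>k\<in>UNIV. (if \<theta> k \<noteq> 0 \<and> \<theta> k < \<alpha> then 1 else 0) - (if \<alpha> < \<theta> k then 1 else 0))"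
    by (simp add: sum_subtractf sum.If_cases)
  also have "\<dots> = (\<Sum>k\<in>UNIV. if \<theta> k = 0 \<or> \<theta> k = \<alpha> then 0 else if \<theta> k < \<alpha> then 1 else -1)"
    using a by (intro sum.cong) auto
  finally show ?thesis .
qed

end

text \<open>The argument in (-pi, pi) of \<open>- cis (2 * (t - \<alpha>))\<close>. The branch cut
  sits at t = \<alpha>, an angle that does not occur when V is transverse to the copy of L at angle
  \<alpha>.\<close>

definition phase :: "real \<Rightarrow> real \<Rightarrow> real" where
  "phase \<alpha> t = 2 * (t - \<alpha>) + (if t < \<alpha> then pi else - pi)"

text \<open>Each angle contributes the same constant \<open>1/2 - \<alpha> / pi\<close>, whether it
  is 0, below \<alpha> or above \<alpha>: the case distinctions in phase, sawtooth and signature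
  cancel.\<close>

lemma phase_sum:
  assumes V: "lagrangian Om V" and a: "0 < \<alpha>" "\<alpha> < pi" and tr: "V \<inter> rot \<alpha> ` L = {0}"
  shows "(\<Sum>k\<in>UNIV. phase \<alpha> (angles V k)) / (2 * pi) + angle_defect (angles V) - signature V (qform \<alpha>) / 2 = CARD('m) * (1/2 - \<alpha> / pi)"
proof -
  obtain e where dg: "diag V e (angles V)" using diag_angles[OF V] by blast
  let ?t = "angles V"
  have "(\<Sum>k\<in>UNIV. phase \<alpha> (?t k)) / (2 * pi) + angle_defect ?t - signature V (qform \<alpha>) / 2
    = (\<Sum>k\<in>UNIV. phase \<alpha> (?t k) / (2 * pi) + (if ?t k = 0 then 0 else 1/2 - ?t k / pi)
        - (if ?t k = 0 \<or> ?t k = \<alpha> then 0 else if ?t k < \<alpha> then 1 else -1) / 2)"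
    unfolding signature_qform[OF V dg a] angle_defect_def
    by (simp add: sum_divide_distrib sum.distrib sum_subtractf of_int_sum if_distrib[of real_of_int] cong: if_cong)
  also have "\<dots> = (\<Sum>k\<in>(UNIV::'m set). 1/2 - \<alpha> / pi)"
  proof (intro sum.cong refl)
    fix k
    have "?t k \<noteq> \<alpha>" by (rule angle_ne[OF V dg tr])
    then show "phase \<alpha> (?t k) / (2 * pi) + (if ?t k = 0 then 0 else 1/2 - ?t k / pi)
        - (if ?t k = 0 \<or> ?t k = \<alpha> then 0 else if ?t k < \<alpha> then 1 else -1) / 2 = 1/2 - \<alpha> / pi"
      using a by (auto simp: phase_def field_simps)
  qed
  finally show ?thesis by simp
qed

lemma cis_phase: "cis (phase \<alpha> t) = - cis (- 2 * \<alpha>) * cis (2 * t)"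
proof -
  have "cis (phase \<alpha> t) = cis (2 * t) * cis (- 2 * \<alpha>) * cis (if t < \<alpha> then pi else - pi)"
    unfolding phase_def by (simp add: cis_mult algebra_simps)
  moreover have "cis (if t < \<alpha> then pi else - pi) = -1" by (simp add: complex_eq_iff)
  ultimately show ?thesis by (simp add: mult_ac)
qed

lemma phase_bounds: assumes "0 < \<alpha>" "\<alpha> < pi" "0 \<le> t" "t < pi" "t \<noteq> \<alpha>"
  shows "- pi < phase \<alpha> t" "phase \<alpha> t < pi"
  using assms by (auto simp: phase_def)

lemma segment_slit:
  assumes "- pi < p" "p < pi" "0 \<le> s" "s \<le> 1"
  shows "(1 - of_real s) + of_real s * cis p \<notin> \<real>\<^sub>\<le>\<^sub>0"
proof
  let ?z = "(1 - of_real s) + of_real s * cis p"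
  assume "?z \<in> \<real>\<^sub>\<le>\<^sub>0"
  then have z: "Re ?z \<le> 0" "Im ?z = 0" by (auto simp: complex_nonpos_Reals_iff)
  then have "s * sin p = 0" by simp
  then have "s = 0 \<or> p = 0" using assms sin_gt_zero[of p] sin_gt_zero[of "-p"] by (cases "p > 0"; cases "p < 0") auto
  then show False using z assms by auto
qed

text \<open>As long as no angle reaches \<alpha>, the sum of the phases should be a continuous
  argument of the Souriau determinant up to a constant. Since the angles themselves are not known to
  be continuous, this is derived from the determinants \<open>H (s, t)\<close>, products of points
  on the segments from 1 to \<open>cis\<close> of the phases. These segments avoid the nonpositive
  reals, so H has a continuous logarithm on the rectangle. Then \<open>phase_sum\<close> replaces
  phases by sawtooth and signature.\<close>

lemma lift_local:
  fixes \<Lambda> :: "real \<Rightarrow> 'a set" and \<theta> :: "real \<Rightarrow> real"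
  assumes V: "\<And>t. t \<in> {a..b} \<Longrightarrow> lagrangian Om (\<Lambda> t)"
    and cont: "\<And>x. continuous_on {a..b} (\<lambda>t. closest_point (\<Lambda> t) x)"
    and al: "0 < \<alpha>" "\<alpha> < pi" and tr: "\<And>t. t \<in> {a..b} \<Longrightarrow> \<Lambda> t \<inter> rot \<alpha> ` L = {0}"
    and th: "continuous_on {a..b} \<theta>" "\<And>t. t \<in> {a..b} \<Longrightarrow> souriau (\<Lambda> t) = circ (\<theta> t)"
    and s: "s \<in> {a..b}" and t: "t \<in> {a..b}"
  shows "\<theta> s + angle_defect (angles (\<Lambda> s)) - signature (\<Lambda> s) (qform \<alpha>) / 2
       = \<theta> t + angle_defect (angles (\<Lambda> t)) - signature (\<Lambda> t) (qform \<alpha>) / 2"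
proof -
  \<comment> \<open>This factor turns \<open>cis (2 * t)\<close> into
    \<open>cis (phase \<alpha> t)\<close>, see \<open>cis_phase\<close>.\<close>
  define z where "z = - cis (- 2 * \<alpha>)"
  define H where "H p = det (\<chi> j l. (if j = l then 1 - of_real (fst p) else 0) + (of_real (fst p) * z) * souriau_mat (\<Lambda> (snd p)) $ j $ l)"
    for p :: "real \<times> real"
  define ph where "ph t k = phase \<alpha> (angles (\<Lambda> t) k)" for t k
  have ph: "- pi < ph t k" "ph t k < pi" "z * cis (2 * angles (\<Lambda> t) k) = cis (ph t k)" if tt: "t \<in> {a..b}" for t k
  proof -
    obtain e where dg: "diag (\<Lambda> t) e (angles (\<Lambda> t))" using diag_angles[OF V[OF tt]] by blast
    then have "0 \<le> angles (\<Lambda> t) k" "angles (\<Lambda> t) k < pi" by (auto simp: diag_def)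
    then show "- pi < ph t k" "ph t k < pi"
      unfolding ph_def using phase_bounds[OF al _ _ angle_ne[OF V[OF tt] dg tr[OF tt]]] by auto
    show "z * cis (2 * angles (\<Lambda> t) k) = cis (ph t k)" unfolding ph_def cis_phase z_def by simp
  qed
  have H: "H (s, t) = (\<Prod>k\<in>UNIV. (1 - of_real s) + of_real s * cis (ph t k))" if tt: "t \<in> {a..b}" for s t
  proof -
    obtain e where dg: "diag (\<Lambda> t) e (angles (\<Lambda> t))" using diag_angles[OF V[OF tt]] by blast
    show ?thesis unfolding H_def fst_conv snd_conv souriau_pencil[OF V[OF tt] dg] by (simp add: mult.assoc ph(3)[OF tt])
  qed
  have Hne: "H p \<noteq> 0" if p: "p \<in> {0..1} \<times> {a..b}" for p
  proof -
    obtain u v where uv: "p = (u, v)" "0 \<le> u" "u \<le> 1" "v \<in> {a..b}" using p by auto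
    have "(1 - of_real u) + of_real u * cis (ph v k) \<noteq> 0" for k
      using segment_slit[OF ph(1,2)[OF uv(4)] uv(2,3), of k] by (metis complex_nonpos_Reals_iff order_refl zero_complex.sel)
    then show ?thesis unfolding uv(1) H[OF uv(4)] by simp
  qed
  have cS: "continuous_on ({0..1::real} \<times> {a..b}) (\<lambda>p. souriau_mat (\<Lambda> (snd p)) $ j $ l)" for j l
  proof -
    have cc: "continuous_on ({0..1::real} \<times> {a..b}) (\<lambda>p. closest_point (\<Lambda> (snd p)) x \<bullet> y)" for x y
      by (intro continuous_intros continuous_on_compose2[OF cont]) auto
    show ?thesis unfolding souriau_mat_def Let_def Complex_eq vec_lambda_beta
      by (intro continuous_on_add continuous_on_diff continuous_on_mult continuous_on_of_real continuous_on_const cc)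
  qed
  have cH: "continuous_on ({0..1} \<times> {a..b}) H"
  proof -
    have c1: "continuous_on ({0..1} \<times> {a..b}) (\<lambda>p. if j = l then 1 - of_real (fst p) else (0::complex))" for j l :: 'm
      by (cases "j = l") (auto intro!: continuous_intros)
    have c2: "continuous_on ({0..1::real} \<times> {a..b}) (\<lambda>p. complex_of_real (fst p) * z)" by (intro continuous_intros)
    show ?thesis unfolding H_def
      by (intro continuous_on_det) (simp only: vec_lambda_beta, intro continuous_on_add continuous_on_mult c1 c2 cS)
  qed
  have "contractible ({0..1::real} \<times> {a..b})" by (intro convex_imp_contractible convex_Times) auto
  then obtain g where g: "continuous_on ({0..1} \<times> {a..b}) g" "\<And>p. p \<in> {0..1} \<times> {a..b} \<Longrightarrow> H p = exp (g p)"
    using continuous_logarithm_on_contractible[OF cH _ Hne] by blast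
  \<comment> \<open>At s = 0 the determinant is 1 for every t, so the logarithm starts from one and
    the same value.\<close>
  have g0: "g (0, u) = g (0, v)" if "u \<in> {a..b}" "v \<in> {a..b}" for u v
  proof (rule continuous_exp_eq_const[of "{a..b}" "\<lambda>t. g (0, t)" 1])
    show "continuous_on {a..b} (\<lambda>t. g (0, t))" by (intro continuous_on_compose2[OF g(1)] continuous_intros) auto
    show "exp (g (0, t)) = 1" if "t \<in> {a..b}" for t using g(2)[of "(0, t)"] H[OF that, of 0] that by simp
  qed (use that in auto)
  \<comment> \<open>For fixed t the logarithm grows along each segment as the principal one does,
    hence by i times the phase.\<close>
  have g1: "g (1, t) = g (0, t) + \<i> * of_real (\<Sum>k\<in>UNIV. ph t k)" if t: "t \<in> {a..b}" for t
  proof -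
    let ?d = "\<lambda>s. g (s, t) - (\<Sum>k\<in>UNIV. Ln ((1 - of_real s) + of_real s * cis (ph t k)))"
    have "?d 1 = ?d 0"
    proof (rule continuous_exp_eq_const[of "{0..1::real}" ?d 1])
      show "continuous_on {0..1} ?d"
        using segment_slit[OF ph(1,2)[OF t]] t
        by (intro continuous_intros continuous_on_compose2[OF g(1)] continuous_on_Ln) auto
      fix s :: real assume s: "s \<in> {0..1}"
      have "exp (Ln ((1 - of_real s) + of_real s * cis (ph t k))) = (1 - of_real s) + of_real s * cis (ph t k)" for k
        using segment_slit[OF ph(1,2)[OF t], of s k] s by (intro exp_Ln) (metis atLeastAtMost_iff complex_nonpos_Reals_iff order_refl zero_complex.sel)
      then show "exp (?d s) = 1" using g(2)[of "(s, t)"] H[OF t, of s] s t Hne[of "(s, t)"]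
        by (simp add: exp_diff exp_sum)
    qed auto
    moreover have "Ln (cis (ph t k)) = \<i> * of_real (ph t k)" for k
      unfolding cis_conv_exp using ph(1,2)[OF t, of k] by (intro Ln_exp) auto
    ultimately show ?thesis by (simp add: sum_distrib_left algebra_simps)
  qed
  have "g (1, s) - 2 * pi * \<i> * \<theta> s = g (1, t) - 2 * pi * \<i> * \<theta> t"
  proof (rule continuous_exp_eq_const[of "{a..b}" "\<lambda>t. g (1, t) - 2 * pi * \<i> * \<theta> t" "z ^ CARD('m)"])
    show "continuous_on {a..b} (\<lambda>t. g (1, t) - 2 * pi * \<i> * \<theta> t)"
      by (intro continuous_intros th continuous_on_compose2[OF g(1)]) auto
    fix t assume t: "t \<in> {a..b}"
    obtain e where dg: "diag (\<Lambda> t) e (angles (\<Lambda> t))" using diag_angles[OF V[OF t]] by blast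
    have "exp (g (1, t)) = (\<Prod>k\<in>UNIV. cis (ph t k))" using g(2)[of "(1, t)"] H[OF t, of 1] t by simp
    also have "\<dots> = z ^ CARD('m) * souriau (\<Lambda> t)"
      unfolding souriau_diag[OF V[OF t] dg] ph(3)[OF t, symmetric] by (simp add: prod.distrib)
    finally show "exp (g (1, t) - 2 * pi * \<i> * \<theta> t) = z ^ CARD('m)"
      unfolding th(2)[OF t] by (simp add: exp_diff)
  qed (use s t in auto)
  then have "\<i> * of_real (\<Sum>k\<in>UNIV. ph s k) - 2 * pi * \<i> * \<theta> s = \<i> * of_real (\<Sum>k\<in>UNIV. ph t k) - 2 * pi * \<i> * \<theta> t"
    unfolding g1[OF s] g1[OF t] using g0[OF s t] by (simp add: algebra_simps)
  then have "(\<Sum>k\<in>UNIV. ph s k) - 2 * pi * \<theta> s = (\<Sum>k\<in>UNIV. ph t k) - 2 * pi * \<theta> t"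
    by (auto simp: complex_eq_iff)
  then have "\<theta> s - (\<Sum>k\<in>UNIV. ph s k) / (2 * pi) = \<theta> t - (\<Sum>k\<in>UNIV. ph t k) / (2 * pi)" by (simp add: field_simps)
  then show ?thesis
    using phase_sum[OF V[OF s] al tr[OF s]] phase_sum[OF V[OF t] al tr[OF t]] unfolding ph_def by simp
qed

end

section \<open>First-order perturbation of the angle form at a crossing\<close>

lemma eventually_uniform_small:
  fixes T :: "real \<Rightarrow> 'a::euclidean_space \<Rightarrow> 'b::euclidean_space"
  assumes K: "subspace K" and lin: "\<forall>\<^sub>F \<tau> in F. linear (T \<tau>)" and lim: "\<And>k. k \<in> K \<Longrightarrow> ((\<lambda>\<tau>. T \<tau> k) \<longlongrightarrow> 0) F" and e: "0 < \<epsilon>"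
  shows "\<forall>\<^sub>F \<tau> in F. \<forall>k\<in>K. norm (T \<tau> k) \<le> \<epsilon> * norm k"
proof -
  obtain S where S: "S \<subseteq> K" "pairwise orthogonal S" "\<And>s. s \<in> S \<Longrightarrow> norm s = 1" "independent S" "card S = dim K" "span S = K"
    using orthonormal_basis_subspace[OF K] by blast
  have fS: "finite S" using S(4) independent_imp_finite by blast
  \<comment> \<open>On an orthonormal basis the coordinates of k are bounded by its norm, so
    smallness on the finitely many basis vectors yields a uniform bound; the added 1 covers an empty
    basis.\<close>
  define \<delta> where "\<delta> = \<epsilon> / (real (card S) + 1)"
  have d: "\<delta> > 0" using e by (simp add: \<delta>_def)
  have "\<forall>\<^sub>F \<tau> in F. \<forall>s\<in>S. norm (T \<tau> s) < \<delta>"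
  proof (intro eventually_ball_finite[OF fS] ballI)
    fix s assume "s \<in> S"
    then show "\<forall>\<^sub>F \<tau> in F. norm (T \<tau> s) < \<delta>" using tendstoD[OF lim d, of s] S(1) by (auto simp: dist_norm)
  qed
  with lin show ?thesis
  proof eventually_elim
    case (elim \<tau>)
    show ?case
    proof
      fix k assume k: "k \<in> K"
      then obtain c where c: "k = (\<Sum>s\<in>S. c s *\<^sub>R s)" using S(6) span_finite[OF fS] by auto
      have "c s = k \<bullet> s" if "s \<in> S" for s
      proof -
        have "k \<bullet> s = (\<Sum>t\<in>S. if t = s then c t else 0)" unfolding c inner_sum_left
          using S that by (intro sum.cong) (auto simp: pairwise_def orthogonal_def norm_eq_1)
        then show ?thesis using fS that by simp
      qed
      then have cn: "\<bar>c s\<bar> \<le> norm k" if "s \<in> S" for s using Cauchy_Schwarz_ineq2[of k s] S(3) that by simp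
      have "T \<tau> k = (\<Sum>s\<in>S. c s *\<^sub>R T \<tau> s)" unfolding c by (simp add: linear_sum[OF elim(1)] linear_cmul[OF elim(1)])
      then have "norm (T \<tau> k) \<le> (\<Sum>s\<in>S. \<bar>c s\<bar> * norm (T \<tau> s))" using norm_sum[of "\<lambda>s. c s *\<^sub>R T \<tau> s" S] by simp
      also have "\<dots> \<le> (\<Sum>s\<in>S. norm k * \<delta>)" using elim(2) cn d by (intro sum_mono mult_mono) (auto simp: less_imp_le)
      also have "\<dots> = real (card S) * \<delta> * norm k" by simp
      also have "\<dots> \<le> \<epsilon> * norm k" using e by (intro mult_right_mono) (auto simp: \<delta>_def field_simps)
      finally show "norm (T \<tau> k) \<le> \<epsilon> * norm k" .
    qed
  qed
qed

lemma pos_def_on_bound: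
  fixes B :: "'a::euclidean_space \<Rightarrow> 'a \<Rightarrow> real"
  assumes B: "bilinear B" and U: "subspace U" and pd: "pos_def_on U B"
  obtains c where "c > 0" "\<And>u. u \<in> U \<Longrightarrow> c * (norm u)\<^sup>2 \<le> B u u"
proof (cases "U \<subseteq> {0}")
  case True
  then have "B u u = 0" "norm u = 0" if "u \<in> U" for u using that bilinear_lzero[OF B] by auto
  then show ?thesis using that[of 1] by auto
next
  case False
  let ?S = "U \<inter> sphere 0 1"
  obtain z where z: "z \<in> U" "z \<noteq> 0" using False by auto
  have "z /\<^sub>R norm z \<in> ?S" using z U by (simp add: subspace_scale)
  then have nS: "?S \<noteq> {}" by blast
  have cS: "compact ?S" by (simp add: U closed_Int_compact closed_subspace)
  have bb: "bounded_bilinear B" using B bilinear_conv_bounded_bilinear by blast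
  have co: "continuous_on ?S (\<lambda>x. B x x)"
    using bounded_bilinear.continuous_on[OF bb continuous_on_id continuous_on_id] by simp
  obtain x where x: "x \<in> ?S" and mn: "\<And>y. y \<in> ?S \<Longrightarrow> B x x \<le> B y y"
    using continuous_attains_inf[OF cS nS co] by blast
  have "x \<noteq> 0" using x by auto
  then have pos: "B x x > 0" using x pd by (auto simp: pos_def_on_def)
  have "B x x * (norm u)\<^sup>2 \<le> B u u" if "u \<in> U" for u
  proof (cases "u = 0")
    case False
    have "u /\<^sub>R norm u \<in> ?S" using that U False by (simp add: subspace_scale)
    from mn[OF this] have "B x x \<le> B u u / (norm u)^2"
      using B by (simp add: bilinear_lmul bilinear_rmul power2_eq_square divide_inverse algebra_simps)
    then show ?thesis using False by (simp add: field_simps)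
  qed (use bilinear_lzero[OF B] in simp)
  then show ?thesis using that pos by blast
qed

text \<open>The mixed term and the \<open>k\<close> term are both of first order in \<tau>, so the
  discriminant is negative for small \<tau>. The identity in the proof completes the square.\<close>

lemma quadratic_pos:
  fixes a b c p k \<tau> :: real
  assumes "a > 0" "c > 0" "\<tau> > 0" "\<tau> * b\<^sup>2 < a * c" "p \<noteq> 0 \<or> k \<noteq> 0"
  shows "a * p\<^sup>2 - 2 * b * \<tau> * p * k + c * \<tau> * k\<^sup>2 > 0"
proof -
  have "a * (a * p\<^sup>2 - 2 * b * \<tau> * p * k + c * \<tau> * k\<^sup>2) = (a * p - b * \<tau> * k)\<^sup>2 + \<tau> * (a * c - \<tau> * b\<^sup>2) * k\<^sup>2"
    by (simp add: power2_eq_square algebra_simps)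
  also have "\<dots> > 0"
  proof (cases "k = 0")
    case True
    then show ?thesis using assms by simp
  next
    case False
    then have "\<tau> * (a * c - \<tau> * b\<^sup>2) * k\<^sup>2 > 0" using assms by simp
    then show ?thesis by (simp add: add_nonneg_pos)
  qed
  finally show ?thesis using assms(1) by (simp add: zero_less_mult_iff)
qed

context lagrangian_frame
begin

lemma qform_L: assumes "k \<in> L" shows "qform \<alpha> k v = 0" "qform \<alpha> w k = sin \<alpha> * (J k \<bullet> w)"
proof -
  have k: "im k = 0" "re k = k" using L_re[OF assms] by auto
  then show "qform \<alpha> k v = 0" by (simp add: qform_def)
  have "J k \<bullet> w = J k \<bullet> re w + J k \<bullet> J (im w)" using re_im[of w] by (metis inner_add_right)
  then have "J k \<bullet> w = k \<bullet> im w" using L_J'[OF assms re_in_L] by (simp add: J_isom)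
  then show "qform \<alpha> w k = sin \<alpha> * (J k \<bullet> w)" using k by (simp add: qform_def inner_commute)
qed

text \<open>Vectors of \<open>V \<inter> L\<close> lie in the radical of \<open>qform\<close>, and
  there the moved form grows linearly in \<tau> with slope \<open>sin \<alpha>\<close> times
  \<open>\<Gamma>\<close>. On a maximal definite subspace P for \<open>qform\<close> plus a maximal
  one K for \<open>\<Gamma>\<close> it is therefore bounded below by the quadratic polynomial of
  \<open>quadratic_pos\<close>. The sign \<sigma> yields the positive and the negative index from
  one proof.\<close>

lemma jump_pos:
  fixes A :: "real \<Rightarrow> 'a \<Rightarrow> 'a" and Vt :: "real \<Rightarrow> 'a set"
  assumes V: "lagrangian Om V" and Vt: "\<forall>\<^sub>F \<tau> in at_right 0. lagrangian Om (Vt \<tau>) \<and> linear (A \<tau>) \<and> A \<tau> ` V \<subseteq> Vt \<tau>"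
    and lim: "\<And>v. v \<in> V \<Longrightarrow> ((\<lambda>\<tau>. A \<tau> v) \<longlongrightarrow> v) (at_right 0)"
    and der: "\<And>k. k \<in> V \<inter> L \<Longrightarrow> ((\<lambda>\<tau>. (A \<tau> k - k) /\<^sub>R \<tau>) \<longlongrightarrow> D k) (at_right 0)" and D: "linear D"
    and G: "symform (V \<inter> L) \<Gamma>" "\<And>k. k \<in> V \<inter> L \<Longrightarrow> \<Gamma> k k = J k \<bullet> D k"
    and al: "0 < \<alpha>" "\<alpha> < pi" and sg: "\<sigma> = 1 \<or> \<sigma> = (-1::real)"
  shows "\<forall>\<^sub>F \<tau> in at_right 0. pos_index V (\<lambda>u v. \<sigma> * qform \<alpha> u v) + pos_index (V \<inter> L) (\<lambda>u v. \<sigma> * \<Gamma> u v)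
      \<le> pos_index (Vt \<tau>) (\<lambda>u v. \<sigma> * qform \<alpha> u v)"
proof -
  let ?q = "\<lambda>u v. \<sigma> * qform \<alpha> u v"
  let ?G = "\<lambda>u v. \<sigma> * \<Gamma> u v"
  have bq: "bilinear ?q" using sg bilinear_qform bilinear_uminus[OF bilinear_qform] by auto
  have bG: "bilinear ?G" using sg G(1) bilinear_uminus by (auto simp: symform_def)
  note subV = lagrangianD(1)[OF V]
  have subK: "subspace (V \<inter> L)" using subV subspace_L by (rule subspace_inter)
  obtain P where P: "subspace P" "P \<subseteq> V" "pos_def_on P ?q" "dim P = pos_index V ?q" using pos_index_attained[OF subV] by blast
  obtain K where K: "subspace K" "K \<subseteq> V \<inter> L" "pos_def_on K ?G" "dim K = pos_index (V \<inter> L) ?G" using pos_index_attained[OF subK] by blast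
  obtain cP where cP: "cP > 0" "\<And>u. u \<in> P \<Longrightarrow> cP * (norm u)\<^sup>2 \<le> ?q u u" using pos_def_on_bound[OF bq P(1,3)] by blast
  obtain cK where cK: "cK > 0" "\<And>u. u \<in> K \<Longrightarrow> cK * (norm u)\<^sup>2 \<le> ?G u u" using pos_def_on_bound[OF bG K(1,3)] by blast
  have "bounded_bilinear ?q" using bq bilinear_conv_bounded_bilinear by blast
  then obtain M where M: "M > 0" "\<And>u v. norm (?q u v) \<le> norm u * norm v * M" using bounded_bilinear.pos_bounded by blast
  obtain CD where CD: "CD > 0" "\<And>k. norm (D k) \<le> CD * norm k" using linear_bounded_pos[OF D] by blast
  have sa: "sin \<alpha> > 0" using al by (simp add: sin_gt_zero)
  \<comment> \<open>\<open>\<epsilon>1\<close> keeps the value on P above half of \<open>cP\<close>,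
    since the two error terms add up to \<open>3 * M * \<epsilon>1\<close> times the squared norm.
    \<open>C\<close> bounds the speed of \<open>A \<tau> k\<close>. \<open>c'\<close> is a quarter
    of \<open>sin \<alpha> * cK\<close>: the error of the derivative and the term of second order in
    \<tau> each cost a half. \<open>b\<close> bounds the mixed term.\<close>
  define \<epsilon>1 where "\<epsilon>1 = min 1 (cP / (6 * M))"
  define \<epsilon>2 where "\<epsilon>2 = cK / 2"
  define C where "C = CD + \<epsilon>2"
  define c' where "c' = sin \<alpha> * cK / 4"
  define b where "b = 2 * M * C"
  have pos: "\<epsilon>1 > 0" "\<epsilon>2 > 0" "C > 0" "c' > 0" "b > 0" using cP(1) cK(1) M CD sa by (auto simp: \<epsilon>1_def \<epsilon>2_def C_def c'_def b_def)
  have e1: "\<forall>\<^sub>F \<tau> in at_right 0. \<forall>v\<in>V. norm (A \<tau> v - v) \<le> \<epsilon>1 * norm v"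
  proof (rule eventually_uniform_small[OF subV _ _ pos(1)])
    show "\<forall>\<^sub>F \<tau> in at_right 0. linear (\<lambda>v. A \<tau> v - v)" using Vt
      by eventually_elim (auto intro: linear_compose_sub linear_ident)
    show "((\<lambda>\<tau>. A \<tau> v - v) \<longlongrightarrow> 0) (at_right 0)" if "v \<in> V" for v
      using lim[OF that] LIM_zero by blast
  qed
  have e2: "\<forall>\<^sub>F \<tau> in at_right 0. \<forall>k\<in>V \<inter> L. norm ((A \<tau> k - k) /\<^sub>R \<tau> - D k) \<le> \<epsilon>2 * norm k"
  proof (rule eventually_uniform_small[OF subK _ _ pos(2)])
    show "\<forall>\<^sub>F \<tau> in at_right 0. linear (\<lambda>k. (A \<tau> k - k) /\<^sub>R \<tau> - D k)" using Vt
      by eventually_elim (auto intro!: linear_compose_sub linear_ident linear_compose_scale_right D)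
    show "((\<lambda>\<tau>. (A \<tau> k - k) /\<^sub>R \<tau> - D k) \<longlongrightarrow> 0) (at_right 0)" if "k \<in> V \<inter> L" for k
      using der[OF that] LIM_zero by blast
  qed
  have "\<forall>\<^sub>F \<tau> in at_right (0::real). \<tau> < min (cP / 2 * c' / b\<^sup>2) (c' / (M * C\<^sup>2))"
    using pos cP(1) M(1) by (intro order_tendstoD(2)[OF tendsto_ident_at]) auto
  moreover have "\<forall>\<^sub>F \<tau> in at_right (0::real). 0 < \<tau>" by (simp add: eventually_at_right_less)
  ultimately show ?thesis using e1 e2 Vt
  proof eventually_elim
    case (elim \<tau>)
    then have lag: "lagrangian Om (Vt \<tau>)" and lin: "linear (A \<tau>)" and AV: "A \<tau> ` V \<subseteq> Vt \<tau>" and t0: "\<tau> > 0" by auto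
    have t1: "\<tau> * b\<^sup>2 < cP / 2 * c'" using elim(1) pos by (simp add: field_simps)
    have t2: "M * C\<^sup>2 * \<tau> \<le> c'" using elim(1) pos M by (simp add: field_simps)
    have key: "?q (A \<tau> (p + k)) (A \<tau> (p + k)) > 0" if p: "p \<in> P" and k: "k \<in> K" and ne: "p \<noteq> 0 \<or> k \<noteq> 0" for p k
    proof -
      have kL: "k \<in> L" "k \<in> V" and pV: "p \<in> V" using p k P K by auto
      let ?Ap = "A \<tau> p" and ?Ak = "A \<tau> k"
      have np: "norm (?Ap - p) \<le> \<epsilon>1 * norm p" using elim(3) pV by blast
      have nAp: "norm ?Ap \<le> 2 * norm p"
      proof -
        have "norm ?Ap \<le> norm (?Ap - p) + norm p" using norm_triangle_sub[of ?Ap p] by simp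
        moreover have "\<epsilon>1 * norm p \<le> 1 * norm p" by (intro mult_right_mono) (auto simp: \<epsilon>1_def)
        ultimately show ?thesis using np by simp
      qed
      have dk: "norm ((?Ak - k) /\<^sub>R \<tau> - D k) \<le> \<epsilon>2 * norm k" using elim(4) kL by blast
      define w where "w = (?Ak - k) /\<^sub>R \<tau>"
      have wk: "?Ak - k = \<tau> *\<^sub>R w" using t0 by (simp add: w_def)
      have nk: "norm (?Ak - k) \<le> \<tau> * C * norm k"
      proof -
        have "norm w \<le> norm (D k) + norm (w - D k)" by (rule norm_triangle_sub)
        also have "\<dots> \<le> C * norm k" using dk CD(2)[of k] by (simp add: C_def w_def algebra_simps)
        finally show ?thesis unfolding wk using t0 by simp
      qed
      have qpp: "?q ?Ap ?Ap \<ge> cP / 2 * (norm p)\<^sup>2"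
      proof -
        have "?q ?Ap ?Ap = ?q p p + ?q (?Ap - p) ?Ap + ?q p (?Ap - p)"
          by (simp only: bilinear_lsub[OF bq] bilinear_rsub[OF bq])
        moreover have "\<bar>?q (?Ap - p) ?Ap\<bar> \<le> (\<epsilon>1 * norm p) * (2 * norm p) * M"
          using np nAp M(1) pos by (intro order_trans[OF M(2)[unfolded real_norm_def]] mult_mono) auto
        moreover have "\<bar>?q p (?Ap - p)\<bar> \<le> norm p * (\<epsilon>1 * norm p) * M"
          using np M(1) pos by (intro order_trans[OF M(2)[unfolded real_norm_def]] mult_mono) auto
        moreover have "(\<epsilon>1 * norm p) * (2 * norm p) * M + norm p * (\<epsilon>1 * norm p) * M = 3 * M * \<epsilon>1 * (norm p)\<^sup>2"
          by (simp add: power2_eq_square)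
        moreover have "3 * M * \<epsilon>1 * (norm p)\<^sup>2 \<le> cP / 2 * (norm p)\<^sup>2"
        proof (rule mult_right_mono)
          have "\<epsilon>1 \<le> cP / (6 * M)" by (simp add: \<epsilon>1_def)
          then show "3 * M * \<epsilon>1 \<le> cP / 2" using M(1) by (simp add: field_simps)
        qed simp
        ultimately show ?thesis using cP(2)[OF p] by linarith
      qed
      have qkp: "\<bar>?q ?Ak ?Ap\<bar> \<le> b * \<tau> * norm p * norm k"
      proof -
        have qeq: "qform \<alpha> ?Ak ?Ap = qform \<alpha> (?Ak - k) ?Ap" using qform_L(1)[OF kL(1)] by (simp add: bilinear_lsub[OF bilinear_qform])
        have "\<bar>?q (?Ak - k) ?Ap\<bar> \<le> (\<tau> * C * norm k) * (2 * norm p) * M"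
          using nk nAp M(1) t0 pos by (intro order_trans[OF M(2)[unfolded real_norm_def]] mult_mono) auto
        then show ?thesis unfolding qeq by (simp add: b_def mult_ac)
      qed
      have "A \<tau> p \<in> Vt \<tau>" "A \<tau> k \<in> Vt \<tau>" using AV pV kL by auto
      then have qsym: "?q ?Ap ?Ak = ?q ?Ak ?Ap" using symform_qform[OF lag, of \<alpha>] by (auto simp: symform_def)
      have qkk: "?q ?Ak ?Ak \<ge> c' * \<tau> * (norm k)\<^sup>2"
      proof -
        have "qform \<alpha> ?Ak ?Ak = qform \<alpha> (?Ak - k) k + qform \<alpha> (?Ak - k) (?Ak - k)"
          using qform_L(1)[OF kL(1)] by (simp add: bilinear_lsub[OF bilinear_qform] bilinear_rsub[OF bilinear_qform])
        then have "?q ?Ak ?Ak = ?q (?Ak - k) k + ?q (?Ak - k) (?Ak - k)" by (simp only: distrib_left)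
        moreover have "?q (?Ak - k) (?Ak - k) \<ge> - (M * C\<^sup>2 * \<tau> * \<tau> * (norm k)\<^sup>2)"
        proof -
          have "\<bar>?q (?Ak - k) (?Ak - k)\<bar> \<le> (\<tau> * C * norm k) * (\<tau> * C * norm k) * M"
            using nk M(1) t0 pos by (intro order_trans[OF M(2)[unfolded real_norm_def]] mult_mono) auto
          then show ?thesis by (simp add: power2_eq_square mult_ac)
        qed
        moreover have "?q (?Ak - k) k \<ge> 2 * c' * \<tau> * (norm k)\<^sup>2"
        proof -
          let ?r = "w - D k"
          have "J k \<bullet> (?Ak - k) = \<tau> * (J k \<bullet> D k + J k \<bullet> ?r)" unfolding wk by (simp add: inner_diff_right)
          then have eq: "?q (?Ak - k) k = sin \<alpha> * \<tau> * (?G k k + \<sigma> * (J k \<bullet> ?r))"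
            unfolding qform_L(2)[OF kL(1)] using G(2)[of k] kL by (simp add: algebra_simps)
          have "\<bar>\<sigma> * (J k \<bullet> ?r)\<bar> \<le> norm (J k) * norm ?r" using sg Cauchy_Schwarz_ineq2[of "J k" ?r] by (auto simp: abs_mult)
          also have "norm (J k) = norm k" by (simp add: norm_eq_sqrt_inner J_isom)
          also have "norm k * norm ?r \<le> norm k * (\<epsilon>2 * norm k)" using dk by (intro mult_left_mono) (auto simp: w_def)
          finally have "?G k k + \<sigma> * (J k \<bullet> ?r) \<ge> cK * (norm k)\<^sup>2 - \<epsilon>2 * (norm k)\<^sup>2"
            using cK(2)[OF k] by (simp add: power2_eq_square algebra_simps)
          then have "?G k k + \<sigma> * (J k \<bullet> ?r) \<ge> cK / 2 * (norm k)\<^sup>2" by (simp add: \<epsilon>2_def algebra_simps)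
          then have "sin \<alpha> * \<tau> * (cK / 2 * (norm k)\<^sup>2) \<le> ?q (?Ak - k) k" unfolding eq using sa t0 by (intro mult_left_mono) auto
          then show ?thesis by (simp add: c'_def mult_ac)
        qed
        moreover have "M * C\<^sup>2 * \<tau> * \<tau> * (norm k)\<^sup>2 \<le> c' * \<tau> * (norm k)\<^sup>2"
          using t2 t0 by (intro mult_right_mono) auto
        ultimately show ?thesis by linarith
      qed
      have "?q (A \<tau> (p + k)) (A \<tau> (p + k)) = ?q ?Ap ?Ap + 2 * ?q ?Ak ?Ap + ?q ?Ak ?Ak"
        using qsym by (simp add: linear_add[OF lin] bilinear_ladd[OF bilinear_qform] bilinear_radd[OF bilinear_qform] algebra_simps)
      also have "\<dots> \<ge> cP / 2 * (norm p)\<^sup>2 - 2 * b * \<tau> * norm p * norm k + c' * \<tau> * (norm k)\<^sup>2"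
        using qpp qkp qkk by linarith
      finally show ?thesis using quadratic_pos[of "cP / 2" c' \<tau> b "norm p" "norm k"] cP(1) pos t0 t1 ne by simp
    qed
    let ?U = "{p + k |p k. p \<in> P \<and> k \<in> K}"
    \<comment> \<open>K lies in L, where \<open>qform\<close> vanishes, while it is definite on
      P.\<close>
    have "P \<inter> K \<subseteq> {0}"
    proof
      fix x assume x: "x \<in> P \<inter> K"
      then have "?q x x = 0" using qform_L(1) K by auto
      then show "x \<in> {0}" using x P(3) by (force simp: pos_def_on_def)
    qed
    then have dU: "dim ?U = dim P + dim K" using dim_sum_le_direct(1)[OF P(1) K(1) _ P(2)] K subV by blast
    have sU: "subspace ?U" using P K by (intro subspace_sums)
    have UV: "?U \<subseteq> V" using P K subV by (auto intro: subspace_add)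
    have inj: "inj_on (A \<tau>) ?U" unfolding linear_inj_on_iff_eq_0[OF lin sU]
    proof safe
      fix p k assume pk: "p \<in> P" "k \<in> K" "A \<tau> (p + k) = 0"
      then show "p + k = 0" using key[OF pk(1,2)] bilinear_lzero[OF bq] by force
    qed
    have "pos_def_on (A \<tau> ` ?U) ?q" unfolding pos_def_on_def
    proof safe
      fix p k assume pk: "p \<in> P" "k \<in> K" "A \<tau> (p + k) \<noteq> 0"
      then have "p \<noteq> 0 \<or> k \<noteq> 0" using linear_0[OF lin] by auto
      then show "0 < ?q (A \<tau> (p + k)) (A \<tau> (p + k))" using key pk by blast
    qed
    then have "dim (A \<tau> ` ?U) \<le> pos_index (Vt \<tau>) ?q"
      using order_trans[OF image_mono[OF UV] AV] by (intro pos_index_ge linear_subspace_image[OF lin sU])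
    moreover have "dim (A \<tau> ` ?U) = dim ?U" using inj sU by (intro dim_image_eq[OF lin]) (simp add: span_eq_iff[THEN iffD2])
    ultimately show ?case using dU P(4) K(4) by simp
  qed
qed

text \<open>Minus the imaginary part of \<open>rot (- \<alpha>) u\<close>, so its kernel is the copy
  of L at angle \<alpha>; also \<open>qform \<alpha> u v\<close> is the inner product of
  \<open>im u\<close> and \<open>nmap \<alpha> v\<close>.\<close>

definition nmap :: "real \<Rightarrow> 'a \<Rightarrow> 'a" where "nmap \<alpha> u = sin \<alpha> *\<^sub>R re u - cos \<alpha> *\<^sub>R im u"

lemma linear_nmap: "linear (nmap \<alpha>)" unfolding nmap_def
  by (intro linear_compose_sub linear_compose_scale_right linear_re linear_im)

lemma nmap_0_iff: assumes "0 < \<alpha>" "\<alpha> < pi" shows "nmap \<alpha> u = 0 \<longleftrightarrow> u \<in> rot \<alpha> ` L"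
proof
  have sa: "sin \<alpha> > 0" using assms by (simp add: sin_gt_zero)
  assume "nmap \<alpha> u = 0"
  then have "sin \<alpha> *\<^sub>R re u = cos \<alpha> *\<^sub>R im u" by (simp add: nmap_def)
  then have "inverse (sin \<alpha>) *\<^sub>R (sin \<alpha> *\<^sub>R re u) = inverse (sin \<alpha>) *\<^sub>R (cos \<alpha> *\<^sub>R im u)" by simp
  then have r: "re u = cos \<alpha> *\<^sub>R (im u /\<^sub>R sin \<alpha>)" using sa by (simp add: mult.commute)
  have "rot \<alpha> (im u /\<^sub>R sin \<alpha>) = re u + J (im u)" unfolding rot_def r using sa by (simp add: J_scale)
  then have "u = rot \<alpha> (im u /\<^sub>R sin \<alpha>)" using re_im[of u] by simp
  then show "u \<in> rot \<alpha> ` L" using im_in_L[of u] subspace_scale[OF subspace_L] by blast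
next
  assume "u \<in> rot \<alpha> ` L"
  then show "nmap \<alpha> u = 0" by (auto simp: nmap_def re_rot im_rot)
qed

text \<open>Transversality makes \<open>nmap \<alpha>\<close> an isomorphism from V onto L. A vector
  u of the radical thus has \<open>im u\<close> orthogonal to L as well as in L.\<close>

lemma radical_qform:
  assumes V: "lagrangian Om V" and al: "0 < \<alpha>" "\<alpha> < pi" and tr: "V \<inter> rot \<alpha> ` L = {0}"
  shows "radical V (qform \<alpha>) = V \<inter> L"
proof
  show "V \<inter> L \<subseteq> radical V (qform \<alpha>)" using qform_L(1) by (auto simp: radical_def)
  show "radical V (qform \<alpha>) \<subseteq> V \<inter> L"
  proof
    fix u assume u: "u \<in> radical V (qform \<alpha>)"
    then have uV: "u \<in> V" by (simp add: radical_def)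
    note D = lagrangianD(1,4)[OF V]
    have "inj_on (nmap \<alpha>) V"
      unfolding linear_inj_on_iff_eq_0[OF linear_nmap D(1)] using nmap_0_iff[OF al] tr by blast
    then have "dim (nmap \<alpha> ` V) = dim L" using D dim_L by (subst dim_image_eq[OF linear_nmap]) (simp_all add: span_eq_iff[THEN iffD2])
    moreover have "nmap \<alpha> ` V \<subseteq> L" unfolding nmap_def using re_in_L im_in_L subspace_L by (auto intro!: subspace_diff subspace_scale)
    ultimately have "nmap \<alpha> ` V = L" by (intro subspace_dim_equal linear_subspace_image linear_nmap D subspace_L) auto
    then obtain v where v: "v \<in> V" "im u = nmap \<alpha> v" using im_in_L by blast
    have "qform \<alpha> u v = im u \<bullet> nmap \<alpha> v" by (simp add: qform_def nmap_def inner_diff_right)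
    then have "im u \<bullet> im u = 0" using u v by (simp add: radical_def)
    then show "u \<in> V \<inter> L" using uV L_iff by auto
  qed
qed

theorem signature_jump:
  fixes A :: "real \<Rightarrow> 'a \<Rightarrow> 'a" and Vt :: "real \<Rightarrow> 'a set"
  assumes V: "lagrangian Om V" and Vt: "\<forall>\<^sub>F \<tau> in at_right 0. lagrangian Om (Vt \<tau>) \<and> linear (A \<tau>) \<and> A \<tau> ` V \<subseteq> Vt \<tau>"
    and lim: "\<And>v. v \<in> V \<Longrightarrow> ((\<lambda>\<tau>. A \<tau> v) \<longlongrightarrow> v) (at_right 0)"
    and der: "\<And>k. k \<in> V \<inter> L \<Longrightarrow> ((\<lambda>\<tau>. (A \<tau> k - k) /\<^sub>R \<tau>) \<longlongrightarrow> D k) (at_right 0)" and D: "linear D"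
    and G: "symform (V \<inter> L) \<Gamma>" "\<And>k. k \<in> V \<inter> L \<Longrightarrow> \<Gamma> k k = J k \<bullet> D k"
    and al: "0 < \<alpha>" "\<alpha> < pi" and tr: "V \<inter> rot \<alpha> ` L = {0}"
    and rk: "\<forall>\<^sub>F \<tau> in at_right 0. dim (radical (V \<inter> L) \<Gamma>) \<le> dim (Vt \<tau> \<inter> L)"
  shows "\<forall>\<^sub>F \<tau> in at_right 0. Vt \<tau> \<inter> rot \<alpha> ` L = {0} \<and> dim (Vt \<tau> \<inter> L) = dim (radical (V \<inter> L) \<Gamma>) \<and>
      signature (Vt \<tau>) (qform \<alpha>) = signature V (qform \<alpha>) + signature (V \<inter> L) \<Gamma>"
proof -
  note D1 = lagrangianD(1,4)[OF V]
  have p: "\<forall>\<^sub>F \<tau> in at_right 0. pos_index V (qform \<alpha>) + pos_index (V \<inter> L) \<Gamma> \<le> pos_index (Vt \<tau>) (qform \<alpha>)"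
    using jump_pos[OF V Vt lim der D G al, of 1] by simp
  have n: "\<forall>\<^sub>F \<tau> in at_right 0. neg_index V (qform \<alpha>) + neg_index (V \<inter> L) \<Gamma> \<le> neg_index (Vt \<tau>) (qform \<alpha>)"
    unfolding neg_index_def using jump_pos[OF V Vt lim der D G al, of "-1"] by simp
  obtain M where M: "M > 0" "\<And>u. norm (nmap \<alpha> u) \<le> M * norm u" using linear_bounded_pos[OF linear_nmap] by blast
  obtain c where c: "c > 0" "\<And>v. v \<in> V \<Longrightarrow> c * norm v \<le> norm (nmap \<alpha> v)"
  proof -
    have "\<forall>x\<in>V. nmap \<alpha> x = 0 \<longrightarrow> x = 0" using nmap_0_iff[OF al] tr by blast
    from injective_imp_isometric[OF closed_subspace[OF D1(1)] D1(1) linear_conv_bounded_linear[THEN iffD1, OF linear_nmap] this]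
    show ?thesis using that by (auto simp: mult.commute)
  qed
  \<comment> \<open>The first bound preserves transversality, since \<open>nmap\<close> then changes
    by at most half of its lower bound c; the second makes \<open>A \<tau>\<close> injective on
    V.\<close>
  have "0 < min (c / (2 * M)) (1/2)" using c M by simp
  note e0 = this
  have e1: "\<forall>\<^sub>F \<tau> in at_right 0. \<forall>v\<in>V. norm (A \<tau> v - v) \<le> min (c / (2 * M)) (1/2) * norm v"
  proof -
    have "\<forall>\<^sub>F \<tau> in at_right 0. linear (\<lambda>v. A \<tau> v - v)" using Vt
      by eventually_elim (auto intro: linear_compose_sub linear_ident)
    moreover have "((\<lambda>\<tau>. A \<tau> v - v) \<longlongrightarrow> 0) (at_right 0)" if "v \<in> V" for v
      using lim[OF that] LIM_zero by blast
    ultimately show ?thesis by (rule eventually_uniform_small[OF D1(1) _ _ e0])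
  qed
  show ?thesis using p n e1 rk Vt
  proof eventually_elim
    case (elim \<tau>)
    then have lag: "lagrangian Om (Vt \<tau>)" and lin: "linear (A \<tau>)" and AV: "A \<tau> ` V \<subseteq> Vt \<tau>" by auto
    note D2 = lagrangianD(1,4)[OF lag]
    have small: "norm (A \<tau> v - v) \<le> c / (2 * M) * norm v" "norm (A \<tau> v - v) \<le> 1/2 * norm v" if "v \<in> V" for v
    proof -
      have "norm (A \<tau> v - v) \<le> min (c / (2 * M)) (1/2) * norm v" using elim(3) that by blast
      moreover have "min (c / (2 * M)) (1/2) * norm v \<le> c / (2 * M) * norm v" "min (c / (2 * M)) (1/2) * norm v \<le> 1/2 * norm v"
        by (intro mult_right_mono; simp)+
      ultimately show "norm (A \<tau> v - v) \<le> c / (2 * M) * norm v" "norm (A \<tau> v - v) \<le> 1/2 * norm v" by linarith+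
    qed
    have "inj_on (A \<tau>) V" unfolding linear_inj_on_iff_eq_0[OF lin D1(1)] using small(2) by fastforce
    then have "dim (A \<tau> ` V) = dim (Vt \<tau>)" using D1 D2 by (subst dim_image_eq[OF lin]) (simp_all add: span_eq_iff[THEN iffD2])
    then have AVt: "A \<tau> ` V = Vt \<tau>" using AV by (intro subspace_dim_equal linear_subspace_image lin D1 D2) auto
    have "u = 0" if u: "u \<in> Vt \<tau>" "u \<in> rot \<alpha> ` L" for u
    proof -
      obtain v where v: "v \<in> V" "u = A \<tau> v" using u AVt by blast
      have "nmap \<alpha> v = nmap \<alpha> (v - u) + nmap \<alpha> u" by (simp add: linear_diff[OF linear_nmap])
      then have "nmap \<alpha> v = nmap \<alpha> (v - u)" using nmap_0_iff[OF al] u by simp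
      then have "c * norm v \<le> M * norm (A \<tau> v - v)" using c(2)[OF v(1)] M(2)[of "v - u"] v(2) by (simp add: norm_minus_commute)
      also have "\<dots> \<le> M * (c / (2 * M) * norm v)" using small(1)[OF v(1)] M(1) by (intro mult_left_mono) auto
      also have "\<dots> = c / 2 * norm v" using M(1) by simp
      finally have "norm v \<le> 0" using c(1) by (simp add: algebra_simps)
      then show ?thesis using v linear_0[OF lin] by simp
    qed
    then have tr': "Vt \<tau> \<inter> rot \<alpha> ` L = {0}" using subspace_0[OF D2(1)] nmap_0_iff[OF al, of 0] linear_0[OF linear_nmap] by blast
    have i1: "pos_index V (qform \<alpha>) + neg_index V (qform \<alpha>) + dim (V \<inter> L) = CARD('m)"
      using index_sum[OF symform_qform[OF V]] D1(2) radical_qform[OF V al tr] by metis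
    have i2: "pos_index (Vt \<tau>) (qform \<alpha>) + neg_index (Vt \<tau>) (qform \<alpha>) + dim (Vt \<tau> \<inter> L) = CARD('m)"
      using index_sum[OF symform_qform[OF lag]] D2(2) radical_qform[OF lag al tr'] by metis
    have i3: "pos_index (V \<inter> L) \<Gamma> + neg_index (V \<inter> L) \<Gamma> + dim (radical (V \<inter> L) \<Gamma>) = dim (V \<inter> L)" by (rule index_sum[OF G(1)])
    have "pos_index (Vt \<tau>) (qform \<alpha>) = pos_index V (qform \<alpha>) + pos_index (V \<inter> L) \<Gamma>"
      "neg_index (Vt \<tau>) (qform \<alpha>) = neg_index V (qform \<alpha>) + neg_index (V \<inter> L) \<Gamma>"
      "dim (Vt \<tau> \<inter> L) = dim (radical (V \<inter> L) \<Gamma>)"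
      using i1 i2 i3 elim(1,2,4) by linarith+
    then show ?case using tr' unfolding signature_eq[OF symform_qform[OF V]] signature_eq[OF symform_qform[OF lag]] signature_eq[OF G(1)]
      by simp
  qed
qed

end

section \<open>One-sided limits, summation of jumps, lifts to the line\<close>

lemma at_left_filtermap: "at_left a = filtermap (\<lambda>\<tau>. a - \<tau>) (at_right (0::real))"
proof -
  have "at_left a = filtermap uminus (at_right (- a))" by (rule at_left_minus)
  also have "at_right (- a) = filtermap (\<lambda>x. x + - a) (at_right 0)" by (rule at_right_to_0)
  finally show ?thesis by (simp add: filtermap_filtermap)
qed

lemma at_right_le_within: assumes "a \<le> t" "t < b" shows "at_right t \<le> at t within {a..b :: real}"
  using at_le[of "{t..b}" "{a..b}" t] assms by (auto simp: at_within_Icc_at_right)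

lemma at_left_le_within: assumes "a < t" "t \<le> b" shows "at_left t \<le> at t within {a..b :: real}"
  using at_le[of "{a..t}" "{a..b}" t] assms by (auto simp: at_within_Icc_at_left)

lemma has_vector_derivative_within_slope:
  "(f has_vector_derivative D) (at x within S) \<longleftrightarrow> ((\<lambda>t. (f t - f x) /\<^sub>R (t - x)) \<longlongrightarrow> D) (at x within S)"
proof -
  have "(f has_vector_derivative D) (at x within S) \<longleftrightarrow>
      ((\<lambda>y. (1 / norm (y - x)) *\<^sub>R (f y - (f x + (y - x) *\<^sub>R D))) \<longlongrightarrow> 0) (at x within S)"
    unfolding has_vector_derivative_def has_derivative_within by (simp add: bounded_linear_scaleR_left)
  also have "\<dots> \<longleftrightarrow> ((\<lambda>y. norm ((1 / norm (y - x)) *\<^sub>R (f y - (f x + (y - x) *\<^sub>R D)))) \<longlongrightarrow> 0) (at x within S)"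
    by (rule tendsto_norm_zero_iff[symmetric])
  also have "\<dots> \<longleftrightarrow> ((\<lambda>y. norm ((f y - f x) /\<^sub>R (y - x) - D)) \<longlongrightarrow> 0) (at x within S)"
  proof (rule tendsto_cong)
    have "norm ((1 / norm (y - x)) *\<^sub>R (f y - (f x + (y - x) *\<^sub>R D))) = norm ((f y - f x) /\<^sub>R (y - x) - D)" if "y \<noteq> x" for y
    proof -
      have "f y - (f x + (y - x) *\<^sub>R D) = (y - x) *\<^sub>R ((f y - f x) /\<^sub>R (y - x) - D)" using that by (simp add: scaleR_diff_right)
      then show ?thesis using that by simp
    qed
    then show "\<forall>\<^sub>F y in at x within S. norm ((1 / norm (y - x)) *\<^sub>R (f y - (f x + (y - x) *\<^sub>R D))) = norm ((f y - f x) /\<^sub>R (y - x) - D)"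
      by (simp add: eventually_at_filter)
  qed
  also have "\<dots> \<longleftrightarrow> ((\<lambda>y. (f y - f x) /\<^sub>R (y - x) - D) \<longlongrightarrow> 0) (at x within S)" by (rule tendsto_norm_zero_iff)
  also have "\<dots> \<longleftrightarrow> ((\<lambda>t. (f t - f x) /\<^sub>R (t - x)) \<longlongrightarrow> D) (at x within S)" by (rule LIM_zero_iff)
  finally show ?thesis .
qed

text \<open>Subtracting the step function H from M leaves a locally constant function. An interior
  jump is crossed on both sides and counts twice; a jump at an end point counts once.\<close>

lemma jump_sum:
  fixes M j :: "real \<Rightarrow> real"
  assumes ab: "a \<le> b" and C: "C \<subseteq> {a..b}" and jC: "\<And>t. t \<notin> C \<Longrightarrow> j t = 0"
    and right: "\<And>t. a \<le> t \<Longrightarrow> t < b \<Longrightarrow> \<forall>\<^sub>F s in at_right t. s \<notin> C \<and> M s - M t = j t"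
    and left: "\<And>t. a < t \<Longrightarrow> t \<le> b \<Longrightarrow> \<forall>\<^sub>F s in at_left t. s \<notin> C \<and> M t - M s = j t"
  shows "finite C" "a < b \<Longrightarrow> M b - M a = j a + 2 * (\<Sum>t\<in>C \<inter> {a<..<b}. j t) + j b"
proof -
  have out: "\<forall>\<^sub>F s in at_right b. s \<notin> C" "\<forall>\<^sub>F s in at_left a. s \<notin> C"
  proof -
    have "\<forall>\<^sub>F s in at_right b. s > b" by (rule eventually_at_right_less)
    then show "\<forall>\<^sub>F s in at_right b. s \<notin> C" by eventually_elim (use C in auto)
    have "\<forall>\<^sub>F s in at_left a. s < a" by (rule eventually_at_leftI[of "a - 1"]) auto
    then show "\<forall>\<^sub>F s in at_left a. s \<notin> C" by eventually_elim (use C in auto)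
  qed
  have nC: "\<forall>\<^sub>F s in at x. s \<notin> C" if x: "x \<in> {a..b}" for x
  proof -
    have "\<forall>\<^sub>F s in at_right x. s \<notin> C" using right[of x] out(1) x by (cases "x = b") (auto elim: eventually_mono)
    moreover have "\<forall>\<^sub>F s in at_left x. s \<notin> C" using left[of x] out(2) x by (cases "x = a") (auto elim: eventually_mono)
    ultimately show ?thesis by (simp add: eventually_at_split)
  qed
  \<comment> \<open>Otherwise C would accumulate in the compact interval, but every point there has
    a punctured neighbourhood without points of C.\<close>
  show fC: "finite C"
  proof (rule ccontr)
    assume "infinite C"
    then obtain x where "x \<in> {a..b}" "x islimpt C"
      using compact_eq_Bolzano_Weierstrass[of "{a..b}"] C compact_Icc by blast
    then show False using nC[of x] by (simp add: islimpt_iff_eventually)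
  qed
  \<comment> \<open>At a jump point H has received only half of the jump, in accordance with the
    equal one-sided jumps of M.\<close>
  define H where "H x = (\<Sum>t\<in>C \<inter> {..<x}. 2 * j t) + j x" for x
  define G where "G x = M x - H x" for x
  have loc: "\<forall>\<^sub>F s in at x within {a..b}. G s = G x" if x: "x \<in> {a..b}" for x
  proof -
    have r: "\<forall>\<^sub>F s in at_right x. G s = G x" if "x < b"
    proof -
      obtain d where d: "d > x" "\<And>s. x < s \<Longrightarrow> s < d \<Longrightarrow> s \<notin> C \<and> M s - M x = j x"
        using right[of x] x \<open>x < b\<close> unfolding eventually_at_right_field by auto
      have "\<forall>\<^sub>F s in at_right x. s \<in> {x<..<d}" using d(1) by (rule eventually_at_right_real)
      then show ?thesis
      proof eventually_elim
        case (elim s)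
        have eq: "C \<inter> {..<s} = C \<inter> {..<x} \<union> C \<inter> {x}"
          proof (intro subset_antisym subsetI)
            fix y assume "y \<in> C \<inter> {..<s}"
            then show "y \<in> C \<inter> {..<x} \<union> C \<inter> {x}" using d(2)[of y] elim by (cases y x rule: linorder_cases) auto
          qed (use elim in auto)
        have "(\<Sum>t\<in>C \<inter> {..<s}. 2 * j t) = (\<Sum>t\<in>C \<inter> {..<x}. 2 * j t) + (\<Sum>t\<in>C \<inter> {x}. 2 * j t)"
          unfolding eq using fC by (intro sum.union_disjoint) auto
        also have "(\<Sum>t\<in>C \<inter> {x}. 2 * j t) = 2 * j x" using jC[of x] by (cases "x \<in> C") auto
        finally have "H s = H x + j x" using jC[of s] d(2)[of s] elim by (simp add: H_def)
        then show ?case using d(2)[of s] elim by (simp add: G_def)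
      qed
    qed
    have l: "\<forall>\<^sub>F s in at_left x. G s = G x" if "a < x"
    proof -
      obtain d where d: "d < x" "\<And>s. d < s \<Longrightarrow> s < x \<Longrightarrow> s \<notin> C \<and> M x - M s = j x"
        using left[of x] x \<open>a < x\<close> unfolding eventually_at_left_field by auto
      have "\<forall>\<^sub>F s in at_left x. s \<in> {d<..<x}" using d(1) by (rule eventually_at_left_real)
      then show ?thesis
      proof eventually_elim
        case (elim s)
        have eq: "C \<inter> {..<x} = C \<inter> {..<s}" using d(2) elim by (force simp: not_less)
        have "H x = H s + j x" using jC[of s] d(2)[of s] elim by (simp add: H_def eq)
        then show ?case using d(2)[of s] elim by (simp add: G_def)
      qed
    qed
    have "\<forall>\<^sub>F s in at x. s \<in> {a..b} \<longrightarrow> G s = G x"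
      unfolding eventually_at_split
    proof
      show "\<forall>\<^sub>F s in at_left x. s \<in> {a..b} \<longrightarrow> G s = G x"
      proof (cases "a < x")
        case False
        then have "\<forall>\<^sub>F s in at_left x. s < a" using x by (intro eventually_at_leftI[of "x - 1"]) auto
        then show ?thesis by eventually_elim auto
      qed (use l in \<open>auto elim: eventually_mono\<close>)
      show "\<forall>\<^sub>F s in at_right x. s \<in> {a..b} \<longrightarrow> G s = G x"
      proof (cases "x < b")
        case False
        then have "\<forall>\<^sub>F s in at_right x. s > b" using x eventually_at_right_less[of b] by (cases "x = b") auto
        then show ?thesis by eventually_elim auto
      qed (use r in \<open>auto elim: eventually_mono\<close>)
    qed
    then show ?thesis by (simp add: eventually_at_filter eventually_mono)
  qed
  have "\<exists>c. \<forall>x\<in>{a..b}. G x = c"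
  proof (rule has_field_derivative_zero_constant)
    fix x assume x: "x \<in> {a..b}"
    have "((\<lambda>_. G x) has_field_derivative 0) (at x within {a..b})" by simp
    then show "(G has_field_derivative 0) (at x within {a..b})"
      using has_field_derivative_cong_eventually[of G "\<lambda>_. G x" x "{a..b}" 0] loc[OF x] by simp
  qed simp
  then have "G a = G b" using ab by auto
  then have *: "M b - M a = H b - H a" by (simp add: G_def)
  assume "a < b"
  have "C \<inter> {..<a} = {}" using C by auto
  then have "H a = j a" by (simp add: H_def)
  moreover have eqC: "C \<inter> {..<b} = C \<inter> {a} \<union> C \<inter> {a<..<b}" using C \<open>a < b\<close> by auto
  have "(\<Sum>t\<in>C \<inter> {..<b}. 2 * j t) = (\<Sum>t\<in>C \<inter> {a}. 2 * j t) + (\<Sum>t\<in>C \<inter> {a<..<b}. 2 * j t)"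
    unfolding eqC using fC by (intro sum.union_disjoint) auto
  moreover have "(\<Sum>t\<in>C \<inter> {a}. 2 * j t) = 2 * j a" using jC[of a] by (cases "a \<in> C") auto
  ultimately show "M b - M a = j a + 2 * (\<Sum>t\<in>C \<inter> {a<..<b}. j t) + j b"
    using * by (simp add: H_def sum_distrib_left)
qed

lemma circle_lift:
  fixes f :: "'a::real_normed_vector \<Rightarrow> complex"
  assumes f: "continuous_on S f" and S: "convex S" and n: "\<And>x. x \<in> S \<Longrightarrow> norm (f x) = 1"
  obtains \<theta> where "continuous_on S \<theta>" "\<And>x. x \<in> S \<Longrightarrow> f x = circ (\<theta> x)"
proof -
  have "f x \<noteq> 0" if "x \<in> S" for x using n[OF that] by auto
  then obtain g where g: "continuous_on S g" "\<And>x. x \<in> S \<Longrightarrow> f x = exp (g x)"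
    using continuous_logarithm_on_contractible[OF f convex_imp_contractible[OF S]] by metis
  have Re: "Re (g x) = 0" if "x \<in> S" for x using n[OF that] g(2)[OF that] by simp
  have "f x = circ (Im (g x) / (2 * pi))" if "x \<in> S" for x
  proof -
    have "g x = \<i> * of_real (Im (g x))" using Re[OF that] by (simp add: complex_eq_iff)
    then show ?thesis using g(2)[OF that] by simp
  qed
  moreover have "continuous_on S (\<lambda>x. Im (g x) / (2 * pi))" by (intro continuous_intros g) auto
  ultimately show ?thesis using that by blast
qed

lemma circle_lift_diff_unique:
  fixes \<theta> \<theta>' :: "'a::real_normed_vector \<Rightarrow> real"
  assumes S: "connected S" and th: "continuous_on S \<theta>" "continuous_on S \<theta>'"
    and eq: "\<And>t. t \<in> S \<Longrightarrow> circ (\<theta> t) = c * circ (\<theta>' t)"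
    and st: "s \<in> S" "t \<in> S"
  shows "\<theta> s - \<theta>' s = \<theta> t - \<theta>' t"
proof -
  let ?h = "\<lambda>t. 2 * pi * \<i> * complex_of_real (\<theta> t) - 2 * pi * \<i> * complex_of_real (\<theta>' t)"
  have "?h s = ?h t"
  proof (rule continuous_exp_eq_const[OF S _ _ st])
    show "continuous_on S ?h" by (intro continuous_intros th)
    show "exp (?h t) = c" if "t \<in> S" for t using eq[OF that] by (simp add: exp_diff)
  qed
  then have "2 * pi * (\<theta> s - \<theta>' s) = 2 * pi * (\<theta> t - \<theta>' t)" by (auto simp: complex_eq_iff algebra_simps)
  then show ?thesis by simp
qed

lemma circle_degree_eq:
  assumes ab: "a \<le> b" and th: "continuous_on {a..b} \<theta>" "\<And>t. t \<in> {a..b} \<Longrightarrow> f t = circ (\<theta> t)"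
  shows "circle_degree a b f = \<theta> b - \<theta> a"
  unfolding circle_degree_def
proof (rule the_equality)
  show "\<exists>\<theta>'. continuous_on {a..b} \<theta>' \<and> (\<forall>t\<in>{a..b}. f t = circ (\<theta>' t)) \<and> \<theta> b - \<theta> a = \<theta>' b - \<theta>' a"
    using th by blast
next
  fix d assume "\<exists>\<theta>'. continuous_on {a..b} \<theta>' \<and> (\<forall>t\<in>{a..b}. f t = circ (\<theta>' t)) \<and> d = \<theta>' b - \<theta>' a"
  then obtain \<theta>' where t': "continuous_on {a..b} \<theta>'" "\<And>t. t \<in> {a..b} \<Longrightarrow> f t = circ (\<theta>' t)" "d = \<theta>' b - \<theta>' a" by blast
  have "\<theta> a - \<theta>' a = \<theta> b - \<theta>' b"
    by (rule circle_lift_diff_unique[of "{a..b}" \<theta> \<theta>' 1]) (use th t' ab in auto)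
  then show "d = \<theta> b - \<theta> a" using t'(3) by simp
qed

section \<open>Jumps of the corrected lift and the index of a regular path\<close>

context lagrangian_frame
begin

definition correction :: "'a set \<Rightarrow> real" where "correction V = angle_defect (angles V)"

lemma norm_souriau: assumes "lagrangian Om V" shows "norm (souriau V) = 1"
proof -
  obtain e where "diag V e (angles V)" using diag_angles[OF assms] by blast
  then show ?thesis using souriau_diag[OF assms] by (simp add: prod_norm[symmetric])
qed

lemma continuous_souriau:
  fixes \<Lambda> :: "'b::topological_space \<Rightarrow> 'a set"
  assumes "\<And>x. continuous_on S (\<lambda>t. closest_point (\<Lambda> t) x)"
  shows "continuous_on S (\<lambda>t. souriau (\<Lambda> t))"
  unfolding souriau_def
proof (rule continuous_on_det)
  fix j l
  have "continuous_on S (\<lambda>t. closest_point (\<Lambda> t) x \<bullet> y)" for x y by (intro continuous_intros assms)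
  then show "continuous_on S (\<lambda>t. souriau_mat (\<Lambda> t) $ j $ l)"
    unfolding souriau_mat_def Let_def Complex_eq vec_lambda_beta
    by (intro continuous_on_add continuous_on_diff continuous_on_mult continuous_on_of_real continuous_on_const)
qed

text \<open>An angle \<alpha> that is generic at time 0 stays generic for a short time. On this
  interval \<open>lift_local\<close> equates the change of the corrected lift with half the change
  of the signature of \<open>qform\<close>, which \<open>signature_jump\<close> computes. The maps
  \<open>A \<tau>\<close> are moving frames.\<close>

lemma signature_jump_index:
  fixes \<Lambda> :: "real \<Rightarrow> 'a set" and A :: "real \<Rightarrow> 'a \<Rightarrow> 'a" and \<theta> :: "real \<Rightarrow> real"
  assumes V: "\<And>\<tau>. \<tau> \<in> {0..c} \<Longrightarrow> lagrangian Om (\<Lambda> \<tau>)" and c: "0 < c"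
    and cont: "\<And>x. continuous_on {0..c} (\<lambda>t. closest_point (\<Lambda> t) x)"
    and th: "continuous_on {0..c} \<theta>" "\<And>t. t \<in> {0..c} \<Longrightarrow> souriau (\<Lambda> t) = circ (\<theta> t)"
    and fr: "\<forall>\<^sub>F \<tau> in at_right 0. linear (A \<tau>) \<and> A \<tau> ` \<Lambda> 0 \<subseteq> \<Lambda> \<tau>"
    and lim: "\<And>v. v \<in> \<Lambda> 0 \<Longrightarrow> ((\<lambda>\<tau>. A \<tau> v) \<longlongrightarrow> v) (at_right 0)"
    and der: "\<And>k. k \<in> \<Lambda> 0 \<inter> L \<Longrightarrow> ((\<lambda>\<tau>. (A \<tau> k - k) /\<^sub>R \<tau>) \<longlongrightarrow> D k) (at_right 0)" and D: "linear D"
    and G: "symform (\<Lambda> 0 \<inter> L) \<Gamma>" "\<And>k. k \<in> \<Lambda> 0 \<inter> L \<Longrightarrow> \<Gamma> k k = J k \<bullet> D k"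
    and rk: "\<forall>\<^sub>F \<tau> in at_right 0. dim (radical (\<Lambda> 0 \<inter> L) \<Gamma>) \<le> dim (\<Lambda> \<tau> \<inter> L)"
  shows "\<forall>\<^sub>F \<tau> in at_right 0. dim (\<Lambda> \<tau> \<inter> L) = dim (radical (\<Lambda> 0 \<inter> L) \<Gamma>) \<and>
      (\<theta> \<tau> + correction (\<Lambda> \<tau>)) - (\<theta> 0 + correction (\<Lambda> 0)) = signature (\<Lambda> 0 \<inter> L) \<Gamma> / 2"
proof -
  have V0: "lagrangian Om (\<Lambda> 0)" using V c by simp
  obtain \<alpha> where al: "0 < \<alpha>" "\<alpha> < pi" and tr: "\<Lambda> 0 \<inter> rot \<alpha> ` L = {0}" using generic_angle[OF V0] by blast
  have cc: "\<forall>\<^sub>F \<tau> in at_right (0::real). \<tau> \<in> {0<..<c}" using c by (rule eventually_at_right_real)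
  have "\<forall>\<^sub>F \<tau> in at_right 0. lagrangian Om (\<Lambda> \<tau>) \<and> linear (A \<tau>) \<and> A \<tau> ` \<Lambda> 0 \<subseteq> \<Lambda> \<tau>"
    using cc fr by eventually_elim (use V in auto)
  from signature_jump[OF V0 this lim der D G al tr rk]
  obtain d where d: "d > 0" "\<And>\<tau>. 0 < \<tau> \<Longrightarrow> \<tau> < d \<Longrightarrow> \<Lambda> \<tau> \<inter> rot \<alpha> ` L = {0} \<and> dim (\<Lambda> \<tau> \<inter> L) = dim (radical (\<Lambda> 0 \<inter> L) \<Gamma>) \<and>
      signature (\<Lambda> \<tau>) (qform \<alpha>) = signature (\<Lambda> 0) (qform \<alpha>) + signature (\<Lambda> 0 \<inter> L) \<Gamma>"
    unfolding eventually_at_right_field by blast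
  have "\<forall>\<^sub>F \<tau> in at_right (0::real). \<tau> \<in> {0<..<d}" using d(1) by (rule eventually_at_right_real)
  with cc show ?thesis
  proof eventually_elim
    case (elim \<tau>)
    have sub: "{0..\<tau>} \<subseteq> {0..c}" using elim by auto
    have "\<theta> \<tau> + angle_defect (angles (\<Lambda> \<tau>)) - signature (\<Lambda> \<tau>) (qform \<alpha>) / 2
       = \<theta> 0 + angle_defect (angles (\<Lambda> 0)) - signature (\<Lambda> 0) (qform \<alpha>) / 2"
    proof (rule lift_local[of 0 \<tau> \<Lambda> \<alpha> \<theta> \<tau> 0])
      show "\<Lambda> t \<inter> rot \<alpha> ` L = {0}" if "t \<in> {0..\<tau>}" for t using that elim tr d(2)[of t] by (cases "t = 0") auto
      show "continuous_on {0..\<tau>} (\<lambda>t. closest_point (\<Lambda> t) x)" for x using continuous_on_subset[OF cont sub] .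
      show "continuous_on {0..\<tau>} \<theta>" using continuous_on_subset[OF th(1) sub] .
    qed (use V th(2) al elim in auto)
    then show ?case using d(2)[of \<tau>] elim by (simp add: correction_def add_divide_distrib)
  qed
qed

context
  fixes \<Lambda> :: "real \<Rightarrow> 'a set" and A :: "real \<Rightarrow> 'a \<Rightarrow> 'a" and \<theta> :: "real \<Rightarrow> real" and a b t0 D \<Gamma>
  assumes V: "\<And>t. t \<in> {a..b} \<Longrightarrow> lagrangian Om (\<Lambda> t)"
    and cont: "\<And>x. continuous_on {a..b} (\<lambda>t. closest_point (\<Lambda> t) x)"
    and th: "continuous_on {a..b} \<theta>" "\<And>t. t \<in> {a..b} \<Longrightarrow> souriau (\<Lambda> t) = circ (\<theta> t)" and D: "linear D"
    and G: "symform (\<Lambda> t0 \<inter> L) \<Gamma>" "\<And>k. k \<in> \<Lambda> t0 \<inter> L \<Longrightarrow> \<Gamma> k k = J k \<bullet> D k"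
begin

lemma index_jump_right:
  assumes t0: "a \<le> t0" "t0 < b" and fr: "\<forall>\<^sub>F s in at_right t0. linear (A s) \<and> A s ` \<Lambda> t0 \<subseteq> \<Lambda> s"
    and lim: "\<And>v. v \<in> \<Lambda> t0 \<Longrightarrow> ((\<lambda>s. A s v) \<longlongrightarrow> v) (at_right t0)"
    and der: "\<And>k. k \<in> \<Lambda> t0 \<inter> L \<Longrightarrow> ((\<lambda>s. (A s k - k) /\<^sub>R (s - t0)) \<longlongrightarrow> D k) (at_right t0)"
    and rk: "\<forall>\<^sub>F s in at_right t0. dim (radical (\<Lambda> t0 \<inter> L) \<Gamma>) \<le> dim (\<Lambda> s \<inter> L)"
  shows "\<forall>\<^sub>F s in at_right t0. dim (\<Lambda> s \<inter> L) = dim (radical (\<Lambda> t0 \<inter> L) \<Gamma>) \<and>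
      (\<theta> s + correction (\<Lambda> s)) - (\<theta> t0 + correction (\<Lambda> t0)) = signature (\<Lambda> t0 \<inter> L) \<Gamma> / 2"
proof -
  have cs: "continuous_on {0..b - t0} (\<lambda>\<tau>. g (\<tau> + t0))" if "continuous_on {a..b} g" for g :: "real \<Rightarrow> 'c::topological_space"
    by (rule continuous_on_compose2[OF that]) (use t0 in \<open>auto intro!: continuous_intros\<close>)
  have "\<forall>\<^sub>F \<tau> in at_right 0. dim (\<Lambda> (\<tau> + t0) \<inter> L) = dim (radical (\<Lambda> (0 + t0) \<inter> L) \<Gamma>) \<and>
      (\<theta> (\<tau> + t0) + correction (\<Lambda> (\<tau> + t0))) - (\<theta> (0 + t0) + correction (\<Lambda> (0 + t0))) = signature (\<Lambda> (0 + t0) \<inter> L) \<Gamma> / 2"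
  proof (rule signature_jump_index[where A = "\<lambda>\<tau>. A (\<tau> + t0)" and c = "b - t0" and D = D])
    show "\<forall>\<^sub>F \<tau> in at_right 0. linear (A (\<tau> + t0)) \<and> A (\<tau> + t0) ` \<Lambda> (0 + t0) \<subseteq> \<Lambda> (\<tau> + t0)"
      using fr eventually_at_right_to_0[of _ t0] by simp
    show "((\<lambda>\<tau>. A (\<tau> + t0) v) \<longlongrightarrow> v) (at_right 0)" if "v \<in> \<Lambda> (0 + t0)" for v
      using lim[of v] that by (simp add: filterlim_at_right_to_0[of _ _ t0])
    show "((\<lambda>\<tau>. (A (\<tau> + t0) k - k) /\<^sub>R \<tau>) \<longlongrightarrow> D k) (at_right 0)" if "k \<in> \<Lambda> (0 + t0) \<inter> L" for k
      using der[of k] that by (simp add: filterlim_at_right_to_0[of _ _ t0])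
    show "\<forall>\<^sub>F \<tau> in at_right 0. dim (radical (\<Lambda> (0 + t0) \<inter> L) \<Gamma>) \<le> dim (\<Lambda> (\<tau> + t0) \<inter> L)"
      using rk eventually_at_right_to_0[of _ t0] by simp
  qed (use V t0 cs[OF cont] cs[OF th(1)] th(2) D G in auto)
  then show ?thesis using eventually_at_right_to_0[of _ t0] by simp
qed

text \<open>Reversing time negates the derivative and the crossing form, while the difference on the
  left side is reversed too; so both one-sided jumps agree.\<close>

lemma index_jump_left:
  assumes t0: "a < t0" "t0 \<le> b" and fr: "\<forall>\<^sub>F s in at_left t0. linear (A s) \<and> A s ` \<Lambda> t0 \<subseteq> \<Lambda> s"
    and lim: "\<And>v. v \<in> \<Lambda> t0 \<Longrightarrow> ((\<lambda>s. A s v) \<longlongrightarrow> v) (at_left t0)"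
    and der: "\<And>k. k \<in> \<Lambda> t0 \<inter> L \<Longrightarrow> ((\<lambda>s. (A s k - k) /\<^sub>R (s - t0)) \<longlongrightarrow> D k) (at_left t0)"
    and rk: "\<forall>\<^sub>F s in at_left t0. dim (radical (\<Lambda> t0 \<inter> L) \<Gamma>) \<le> dim (\<Lambda> s \<inter> L)"
  shows "\<forall>\<^sub>F s in at_left t0. dim (\<Lambda> s \<inter> L) = dim (radical (\<Lambda> t0 \<inter> L) \<Gamma>) \<and>
      (\<theta> t0 + correction (\<Lambda> t0)) - (\<theta> s + correction (\<Lambda> s)) = signature (\<Lambda> t0 \<inter> L) \<Gamma> / 2"
proof -
  have cs: "continuous_on {0..t0 - a} (\<lambda>\<tau>. g (t0 - \<tau>))" if "continuous_on {a..b} g" for g :: "real \<Rightarrow> 'c::topological_space"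
    by (rule continuous_on_compose2[OF that]) (use t0 in \<open>auto intro!: continuous_intros\<close>)
  have "\<forall>\<^sub>F \<tau> in at_right 0. dim (\<Lambda> (t0 - \<tau>) \<inter> L) = dim (radical (\<Lambda> (t0 - 0) \<inter> L) (\<lambda>v w. - \<Gamma> v w)) \<and>
      (\<theta> (t0 - \<tau>) + correction (\<Lambda> (t0 - \<tau>))) - (\<theta> (t0 - 0) + correction (\<Lambda> (t0 - 0))) = signature (\<Lambda> (t0 - 0) \<inter> L) (\<lambda>v w. - \<Gamma> v w) / 2"
  proof (rule signature_jump_index[where A = "\<lambda>\<tau>. A (t0 - \<tau>)" and c = "t0 - a" and D = "\<lambda>x. - D x"])
    show "\<forall>\<^sub>F \<tau> in at_right 0. linear (A (t0 - \<tau>)) \<and> A (t0 - \<tau>) ` \<Lambda> (t0 - 0) \<subseteq> \<Lambda> (t0 - \<tau>)"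
      using fr by (simp add: at_left_filtermap eventually_filtermap)
    show "((\<lambda>\<tau>. A (t0 - \<tau>) v) \<longlongrightarrow> v) (at_right 0)" if "v \<in> \<Lambda> (t0 - 0)" for v
      using lim[of v] that by (simp add: at_left_filtermap filterlim_filtermap)
    show "((\<lambda>\<tau>. (A (t0 - \<tau>) k - k) /\<^sub>R \<tau>) \<longlongrightarrow> - D k) (at_right 0)" if "k \<in> \<Lambda> (t0 - 0) \<inter> L" for k
    proof -
      have "((\<lambda>\<tau>. (A (t0 - \<tau>) k - k) /\<^sub>R (- \<tau>)) \<longlongrightarrow> D k) (at_right 0)"
        using der[of k] that by (simp add: at_left_filtermap filterlim_filtermap)
      from tendsto_minus[OF this] show ?thesis by simp
    qed
    show "\<forall>\<^sub>F \<tau> in at_right 0. dim (radical (\<Lambda> (t0 - 0) \<inter> L) (\<lambda>v w. - \<Gamma> v w)) \<le> dim (\<Lambda> (t0 - \<tau>) \<inter> L)"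
      using rk by (simp add: at_left_filtermap eventually_filtermap radical_uminus)
    show "linear (\<lambda>x. - D x)" using D by (rule linear_compose_neg)
    show "symform (\<Lambda> (t0 - 0) \<inter> L) (\<lambda>v w. - \<Gamma> v w)" using symform_uminus G(1) by simp
  qed (use V t0 cs[OF cont] cs[OF th(1)] th(2) D G in auto)
  then show ?thesis unfolding at_left_filtermap eventually_filtermap signature_uminus[OF G(1)] radical_uminus diff_zero
    by (auto elim!: eventually_mono simp: signature_uminus[OF G(1)])
qed

end

text \<open>The derivative of the orthogonal projections replaces the graph map of the definition.
  Differentiating the isotropy of the projected vectors gives symmetry, and isotropy again relates
  the graph map to the projections, whatever complement M was picked.\<close>

lemma velocity_form:
  fixes \<Lambda> :: "real \<Rightarrow> 'a set"
  assumes V: "\<And>t. t \<in> {a..b} \<Longrightarrow> lagrangian Om (\<Lambda> t)" and ab: "a < b" and t0: "t0 \<in> {a..b}"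
    and der: "\<And>x. ((\<lambda>t. closest_point (\<Lambda> t) x) has_vector_derivative P' x) (at t0 within {a..b})"
  shows "v \<in> \<Lambda> t0 \<Longrightarrow> v' \<in> \<Lambda> t0 \<Longrightarrow> Om v (P' v') = Om v' (P' v)"
    "v \<in> \<Lambda> t0 \<Longrightarrow> v' \<in> \<Lambda> t0 \<Longrightarrow> lagrangian_velocity Om a b \<Lambda> t0 v v' = Om v (P' v')"
    "linear P'"
proof -
  have nt: "at t0 within {a..b} \<noteq> bot"
    using t0 ab by (auto simp: trivial_limit_within intro!: islimpt_closure_open[where s = "{a<..<b}"])
  note uniq = vector_derivative_unique_within[OF nt]
  note V0 = V[OF t0]
  have sub: "subspace (\<Lambda> t)" if "t \<in> {a..b}" for t using lagrangianD(1)[OF V[OF that]] .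
  let ?P = "\<lambda>t. closest_point (\<Lambda> t)"
  have P0: "?P t0 v = v" if "v \<in> \<Lambda> t0" for v using that by (rule closest_point_self)
  have bb: "bounded_bilinear Om" using bilinear_Om bilinear_conv_bounded_bilinear by blast
  show lin: "linear P'"
  proof (rule linearI)
    fix x y
    show "P' (x + y) = P' x + P' y"
    proof (rule uniq[OF der[of "x + y"]])
      have "((\<lambda>t. ?P t x + ?P t y) has_vector_derivative P' x + P' y) (at t0 within {a..b})"
        by (intro has_vector_derivative_add der)
      then show "((\<lambda>t. ?P t (x + y)) has_vector_derivative P' x + P' y) (at t0 within {a..b})"
        by (rule has_vector_derivative_transform[OF t0, rotated]) (simp add: linear_add[OF closest_point_subspace(3)[OF sub]])
    qed
  next
    fix r x
    show "P' (r *\<^sub>R x) = r *\<^sub>R P' x"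
    proof (rule uniq[OF der[of "r *\<^sub>R x"]])
      have "((\<lambda>t. r *\<^sub>R ?P t x) has_vector_derivative r *\<^sub>R P' x) (at t0 within {a..b})"
        using has_vector_derivative_scaleR[of "\<lambda>_. r" 0 t0 "{a..b}", OF _ der[of x]] by simp
      then show "((\<lambda>t. ?P t (r *\<^sub>R x)) has_vector_derivative r *\<^sub>R P' x) (at t0 within {a..b})"
        by (rule has_vector_derivative_transform[OF t0, rotated]) (simp add: linear_cmul[OF closest_point_subspace(3)[OF sub]])
    qed
  qed
  have sym: "Om v (P' w) + Om (P' v) w = 0" if v: "v \<in> \<Lambda> t0" and w: "w \<in> \<Lambda> t0" for v w
  proof -
    have "((\<lambda>t. Om (?P t v) (?P t w)) has_vector_derivative Om (?P t0 v) (P' w) + Om (P' v) (?P t0 w)) (at t0 within {a..b})"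
      by (rule bounded_bilinear.has_vector_derivative[OF bb der der])
    moreover have "((\<lambda>t. Om (?P t v) (?P t w)) has_vector_derivative 0) (at t0 within {a..b})"
      by (rule has_vector_derivative_transform[OF t0 _ has_vector_derivative_const[of 0]])
        (use lagrangianD(2)[OF V] closest_point_subspace(1)[OF sub] in \<open>auto simp: Om_def\<close>)
    ultimately show ?thesis using uniq P0 v w by fastforce
  qed
  show s: "Om v (P' v') = Om v' (P' v)" if "v \<in> \<Lambda> t0" "v' \<in> \<Lambda> t0" for v v'
    using sym[OF that] Om_skew[of "P' v" v'] by simp
  define M where "M = (SOME M. lagrangian Om M \<and> complementary (\<Lambda> t0) M)"
  \<comment> \<open>The image of \<open>\<Lambda> t0\<close> under J is its orthogonal complement
    and again Lagrangian, so the choice operator does pick a Lagrangian complement.\<close>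
  have M: "lagrangian Om M" "complementary (\<Lambda> t0) M"
  proof -
    have "\<exists>M. lagrangian Om M \<and> complementary (\<Lambda> t0) M"
    proof (intro exI[of _ "J ` \<Lambda> t0"] conjI)
      have "J = rot (pi / 2)" by (auto simp: rot_def)
      then show lJ: "lagrangian Om (J ` \<Lambda> t0)" using lagrangian_rot[OF V0, of "pi / 2"] by metis
      have i: "\<Lambda> t0 \<inter> J ` \<Lambda> t0 = {0}"
      proof -
        have "x = 0" if "x \<in> \<Lambda> t0" "y \<in> \<Lambda> t0" "x = J y" for x y
          using lagrangianD(2)[OF V0, of y x] that by simp
        then show ?thesis using subspace_0[OF sub[OF t0]] subspace_0[OF lagrangianD(1)[OF lJ]] by blast
      qed
      have "{x + y |x y. x \<in> \<Lambda> t0 \<and> y \<in> J ` \<Lambda> t0} = UNIV"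
        using dim_sum_le_direct(1)[OF sub[OF t0] lagrangianD(1)[OF lJ] _ _ _ subspace_UNIV] i
          lagrangianD(4)[OF V0] lagrangianD(4)[OF lJ] E_dim
        by (intro subspace_dim_equal subspace_sums sub t0 lagrangianD(1)[OF lJ]) auto
      then show "complementary (\<Lambda> t0) (J ` \<Lambda> t0)" using i unfolding complementary_def by blast
    qed
    from someI_ex[OF this] show "lagrangian Om M" "complementary (\<Lambda> t0) M" unfolding M_def by auto
  qed
  note sM = lagrangianD(1)[OF M(1)]
  \<comment> \<open>Subtraction is injective on \<open>\<Lambda> t0 \<times> M\<close>, so c bounds
    the angle between the two subspaces from below.\<close>
  obtain c where c: "c > 0" "\<And>x y. x \<in> \<Lambda> t0 \<Longrightarrow> y \<in> M \<Longrightarrow> c * norm x \<le> norm (x - y) \<and> c * norm y \<le> norm (x - y)"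
  proof -
    have sT: "subspace (\<Lambda> t0 \<times> M)" using subspace_Times[OF sub[OF t0] sM] .
    have bl: "bounded_linear (\<lambda>p::'a \<times> 'a. fst p - snd p)" by (intro bounded_linear_intros)
    have "\<forall>p\<in>\<Lambda> t0 \<times> M. fst p - snd p = 0 \<longrightarrow> p = 0" using M(2) by (auto simp: complementary_def zero_prod_def)
    from injective_imp_isometric[OF closed_subspace[OF sT] sT bl this]
    obtain e where e: "e > 0" "\<And>p. p \<in> \<Lambda> t0 \<times> M \<Longrightarrow> norm p * e \<le> norm (fst p - snd p)" by (auto simp: mult.commute)
    have "e * norm x \<le> norm (x - y) \<and> e * norm y \<le> norm (x - y)" if "x \<in> \<Lambda> t0" "y \<in> M" for x y
    proof -
      have "norm (x, y) * e \<le> norm (x - y)" using e(2)[of "(x, y)"] that by simp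
      moreover have "e * norm x \<le> norm (x, y) * e" "e * norm y \<le> norm (x, y) * e"
        using e(1) norm_fst_le[of x y] norm_snd_le[of y x] by (simp_all add: mult.commute)
      ultimately show ?thesis by linarith
    qed
    then show ?thesis using that e(1) by blast
  qed
  have tin: "\<forall>\<^sub>F t in at t0 within {a..b}. t \<in> {a..b}" by (simp add: eventually_at_topological) (use open_UNIV in blast)
  have plim: "((\<lambda>t. ?P t x) \<longlongrightarrow> ?P t0 x) (at t0 within {a..b})" for x
    using has_vector_derivative_continuous[OF der[of x]] by (simp add: continuous_within)
  have small: "\<forall>\<^sub>F t in at t0 within {a..b}. \<forall>w\<in>\<Lambda> t0. norm (?P t w - w) \<le> \<epsilon> * norm w" if e: "\<epsilon> > 0" for \<epsilon>
  proof (rule eventually_uniform_small[OF sub[OF t0] _ _ e])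
    show "\<forall>\<^sub>F t in at t0 within {a..b}. linear (\<lambda>w. ?P t w - w)"
      using tin by eventually_elim (intro linear_compose_sub closest_point_subspace(3) sub linear_ident)
    show "((\<lambda>t. ?P t k - k) \<longlongrightarrow> 0) (at t0 within {a..b})" if "k \<in> \<Lambda> t0" for k
      using plim[of k] P0[OF that] LIM_zero by metis
  qed
  \<comment> \<open>Near \<open>t0\<close> the projection maps \<open>\<Lambda> t0\<close>
    isomorphically onto \<open>\<Lambda> t\<close>, which is so close that it still meets M only in
    0. Hence the description in \<open>graph_map\<close> has exactly one solution, of size
    controlled by \<epsilon>.\<close>
  have good: "\<forall>\<^sub>F t in at t0 within {a..b}. graph_map (\<Lambda> t) M v' \<in> M \<and> v' + graph_map (\<Lambda> t) M v' \<in> \<Lambda> t \<and>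
      norm (graph_map (\<Lambda> t) M v') \<le> 2 * \<epsilon> / c * norm v'"
    if e: "0 < \<epsilon>" "\<epsilon> \<le> c / 2" "\<epsilon> \<le> 1/2" and v': "v' \<in> \<Lambda> t0" for \<epsilon> v'
    using small[OF e(1)] tin
  proof eventually_elim
    case (elim t)
    note Vt = V[OF elim(2)] and st = sub[OF elim(2)]
    have linP: "linear (?P t)" using closest_point_subspace(3)[OF st] .
    have "w = 0" if "w \<in> \<Lambda> t0" "?P t w = 0" for w
    proof -
      have "norm w \<le> 1/2 * norm w" using elim(1) that e(3) by (metis mult_right_mono norm_ge_zero norm_minus_cancel diff_0 order_trans)
      then show ?thesis by simp
    qed
    then have "inj_on (?P t) (\<Lambda> t0)" unfolding linear_inj_on_iff_eq_0[OF linP sub[OF t0]] by blast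
    then have "dim (?P t ` \<Lambda> t0) = dim (\<Lambda> t)"
      using lagrangianD(4)[OF V0] lagrangianD(4)[OF Vt] sub[OF t0] by (subst dim_image_eq[OF linP]) (simp_all add: span_eq_iff[THEN iffD2])
    then have PV: "?P t ` \<Lambda> t0 = \<Lambda> t"
      using closest_point_subspace(1)[OF st] by (intro subspace_dim_equal linear_subspace_image linP sub t0 st) auto
    have i: "z = 0" if z: "z \<in> \<Lambda> t" "z \<in> M" for z
    proof -
      obtain w where w: "w \<in> \<Lambda> t0" "z = ?P t w" using z PV by blast
      have "c * norm w \<le> norm (w - z)" using c(2)[OF w(1) z(2)] by blast
      also have "\<dots> \<le> \<epsilon> * norm w" using elim(1) w by (simp add: norm_minus_commute)
      also have "\<dots> \<le> c / 2 * norm w" using e by (intro mult_right_mono) auto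
      finally have "norm w \<le> 0" using c(1) by simp
      then show ?thesis using w linear_0[OF linP] by simp
    qed
    have "\<Lambda> t \<inter> M \<subseteq> {0}" using i by blast
    then have "{x + y |x y. x \<in> \<Lambda> t \<and> y \<in> M} = UNIV"
      using dim_sum_le_direct(1)[OF st sM _ _ _ subspace_UNIV] i lagrangianD(4)[OF Vt] lagrangianD(4)[OF M(1)] E_dim
      by (intro subspace_dim_equal subspace_sums st sM) auto
    then obtain x y where xy: "x \<in> \<Lambda> t" "y \<in> M" "v' = x + y" by blast
    have gm: "graph_map (\<Lambda> t) M v' = - y" unfolding graph_map_def
    proof (rule the_equality)
      show "- y \<in> M \<and> v' + - y \<in> \<Lambda> t" using xy sM by (auto simp: subspace_neg)
      fix u assume u: "u \<in> M \<and> v' + u \<in> \<Lambda> t"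
      then have "(v' + u) - x \<in> \<Lambda> t" "u + y \<in> M" using xy(1,2) subspace_diff[OF st, of "v' + u" x] subspace_add[OF sM, of u y] by auto
      moreover have "(v' + u) - x = u + y" using xy(3) by simp
      ultimately have "u + y = 0" using i[of "u + y"] by simp
      then show "u = - y" by (simp add: eq_neg_iff_add_eq_0)
    qed
    obtain w where w: "w \<in> \<Lambda> t0" "x = ?P t w" using xy PV by blast
    have wv: "w - v' \<in> \<Lambda> t0" "- y \<in> M" using w v' sub[OF t0] xy sM by (auto intro: subspace_diff subspace_neg)
    have nx: "norm (x - w) \<le> \<epsilon> * norm w" using elim(1) w by simp
    have "(w - v') - (- y) = w - x" using xy(3) by simp
    then have b: "c * norm (w - v') \<le> norm (x - w)" "c * norm y \<le> norm (x - w)"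
      using c(2)[OF wv] by (metis norm_minus_cancel norm_minus_commute)+
    have "c * norm w \<le> c * norm (w - v') + c * norm v'" using norm_triangle_sub[of w v'] c(1) by (simp flip: distrib_left)
    then have "c * norm w \<le> c / 2 * norm w + c * norm v'"
      using b nx e mult_right_mono[OF e(2) norm_ge_zero[of w]] by linarith
    then have "c * norm w \<le> c * (2 * norm v')" by simp
    then have nw: "norm w \<le> 2 * norm v'" using c(1) by simp
    have "c * norm y \<le> \<epsilon> * (2 * norm v')" using b(2) nx mult_left_mono[OF nw, of \<epsilon>] e by linarith
    then have "norm y \<le> 2 * \<epsilon> / c * norm v'" using c(1) by (simp add: field_simps)
    then show ?case using gm xy sM by (auto simp: subspace_neg)
  qed
  show "lagrangian_velocity Om a b \<Lambda> t0 v v' = Om v (P' v')" if v: "v \<in> \<Lambda> t0" and v': "v' \<in> \<Lambda> t0"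
  proof -
    let ?g = "\<lambda>t. graph_map (\<Lambda> t) M v'"
    have g0: "?g t0 = 0" unfolding graph_map_def
    proof (rule the_equality)
      show "0 \<in> M \<and> v' + 0 \<in> \<Lambda> t0" using v' sM by (auto simp: subspace_0)
      fix u assume u: "u \<in> M \<and> v' + u \<in> \<Lambda> t0"
      then have "(v' + u) - v' \<in> \<Lambda> t0" using v' sub[OF t0] subspace_diff by blast
      then show "u = 0" using u M(2) by (auto simp: complementary_def)
    qed
    have glim: "(?g \<longlongrightarrow> 0) (at t0 within {a..b})"
    proof (rule tendstoI)
      fix d :: real assume d: "d > 0"
      define K where "K = 2 / c * norm v' + 1"
      have K: "K > 0" using c(1) by (auto simp: K_def intro!: add_nonneg_pos)
      define \<epsilon> where "\<epsilon> = min (min (c / 2) (1/2)) (d / (2 * K))"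
      have e: "0 < \<epsilon>" "\<epsilon> \<le> c / 2" "\<epsilon> \<le> 1/2" using c(1) d K by (auto simp: \<epsilon>_def)
      have "2 * \<epsilon> / c * norm v' = \<epsilon> * (K - 1)" by (simp add: K_def)
      also have "\<dots> \<le> \<epsilon> * K" using e by simp
      also have "\<epsilon> \<le> d / (2 * K)" by (simp add: \<epsilon>_def)
      then have "\<epsilon> * K \<le> d / 2" using K by (simp add: field_simps)
      finally have "2 * \<epsilon> / c * norm v' < d" using d by linarith
      then show "\<forall>\<^sub>F t in at t0 within {a..b}. dist (?g t) 0 < d"
        using good[OF e v'] by (auto elim!: eventually_mono)
    qed
    \<comment> \<open>Isotropy of \<open>\<Lambda> t\<close> and \<open>\<Lambda> t0\<close> moves
      the difference quotient from the graph map to the projection, whose derivative is given; of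
      the graph map only the limit 0 is used.\<close>
    have ev: "\<forall>\<^sub>F t in at t0 within {a..b}. Om v (?g t) = - Om (?P t v - v) (v' + ?g t)"
    proof -
      have "0 < min (c/2) (1/2)" "min (c/2) (1/2) \<le> c / 2" "min (c/2) (1/2) \<le> 1/2" using c(1) by auto
      from good[OF this v'] tin show ?thesis
    proof eventually_elim
      case (elim t)
      have "Om (?P t v) (v' + ?g t) = 0"
        using lagrangianD(2)[OF V[OF elim(2)]] closest_point_subspace(1)[OF sub[OF elim(2)]] elim(1) by (simp add: Om_def)
      moreover have "Om v v' = 0" using lagrangianD(2)[OF V0] v v' by (simp add: Om_def)
      ultimately show ?case by (simp add: bilinear_lsub[OF bilinear_Om] bilinear_radd[OF bilinear_Om])
    qed
    qed
    have "((\<lambda>t. (Om v (?g t) - Om v (?g t0)) /\<^sub>R (t - t0)) \<longlongrightarrow> Om v (P' v')) (at t0 within {a..b})"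
    proof -
      have d1: "((\<lambda>t. (?P t v - v) /\<^sub>R (t - t0)) \<longlongrightarrow> P' v) (at t0 within {a..b})"
        using der[of v] P0[OF v] by (simp add: has_vector_derivative_within_slope)
      have "((\<lambda>t. - Om ((?P t v - v) /\<^sub>R (t - t0)) (v' + ?g t)) \<longlongrightarrow> - Om (P' v) (v' + 0)) (at t0 within {a..b})"
        by (intro tendsto_minus bounded_bilinear.tendsto[OF bb] d1 tendsto_add tendsto_const glim)
      moreover have "- Om (P' v) (v' + 0) = Om v (P' v')" using sym[OF v v'] by simp
      moreover have "\<forall>\<^sub>F t in at t0 within {a..b}. - Om ((?P t v - v) /\<^sub>R (t - t0)) (v' + ?g t) = (Om v (?g t) - Om v (?g t0)) /\<^sub>R (t - t0)"
        using ev by eventually_elim (simp add: g0 bilinear_rzero[OF bilinear_Om] bilinear_lmul[OF bilinear_Om])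
      ultimately show ?thesis using tendsto_cong by force
    qed
    then have "((\<lambda>t. Om v (?g t)) has_vector_derivative Om v (P' v')) (at t0 within {a..b})"
      by (simp add: has_vector_derivative_within_slope)
    then have "vector_derivative (\<lambda>t. Om v (?g t)) (at t0 within {a..b}) = Om v (P' v')"
      by (rule vector_derivative_within[OF nt])
    then show ?thesis unfolding lagrangian_velocity_def Let_def M_def .
  qed
qed

text \<open>The projections serve as moving frames. Regularity says that the radical of each
  crossing form is 0, so the rank condition of the jump lemmas holds trivially and crossings are
  isolated. The halves at the end points come out of \<open>jump_sum\<close> with half signatures as
  jumps.\<close>

theorem regular_index_eq:
  fixes \<Lambda> :: "real \<Rightarrow> 'a set"
  assumes ab: "a < b" and sm: "smooth_lagrangian_path Om a b \<Lambda>" and reg: "regular_crossings Om a b \<Lambda> L"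
    and th: "continuous_on {a..b} \<theta>" "\<And>t. t \<in> {a..b} \<Longrightarrow> souriau (\<Lambda> t) = circ (\<theta> t)"
  shows "regular_rs_index Om a b \<Lambda> L = (\<theta> b + correction (\<Lambda> b)) - (\<theta> a + correction (\<Lambda> a))"
proof -
  have V: "lagrangian Om (\<Lambda> t)" if "t \<in> {a..b}" for t using sm that by (simp add: smooth_lagrangian_path_def)
  have sub: "subspace (\<Lambda> t)" if "t \<in> {a..b}" for t using lagrangianD(1)[OF V[OF that]] .
  have "\<exists>p. \<forall>x. ((\<lambda>t. closest_point (\<Lambda> t) x) has_vector_derivative p x) (at t0 within {a..b})" if t0: "t0 \<in> {a..b}" for t0
  proof -
    have "\<exists>d. ((\<lambda>t. closest_point (\<Lambda> t) x) has_vector_derivative d) (at t0 within {a..b})" for x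
    proof -
      have "smooth_on_interval a b (\<lambda>t. closest_point (\<Lambda> t) x)" using sm by (simp add: smooth_lagrangian_path_def)
      then obtain D where D: "D 0 = (\<lambda>t. closest_point (\<Lambda> t) x)" "\<forall>k::nat. \<forall>t\<in>{a..b}. (D k has_vector_derivative D (Suc k) t) (at t within {a..b})"
        unfolding smooth_on_interval_def by blast
      have "(D 0 has_vector_derivative D (Suc 0) t0) (at t0 within {a..b})" using D(2) t0 by blast
      then show ?thesis unfolding D(1) by blast
    qed
    then show ?thesis by metis
  qed
  then obtain P' where P': "\<And>t0 x. t0 \<in> {a..b} \<Longrightarrow> ((\<lambda>t. closest_point (\<Lambda> t) x) has_vector_derivative P' t0 x) (at t0 within {a..b})"
    by metis
  have cont: "continuous_on {a..b} (\<lambda>t. closest_point (\<Lambda> t) x)" for x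
    using P' has_vector_derivative_continuous continuous_on_eq_continuous_within by blast
  define j where "j t = (if t \<in> {a..b} then crossing_sign Om a b \<Lambda> L t / 2 else 0)" for t
  define C where "C = {t \<in> {a..b}. crossing \<Lambda> L t}"
  define M where "M t = \<theta> t + correction (\<Lambda> t)" for t
  define G where "G t0 v w = Om v (P' t0 w)" for t0 v w
  have linP: "linear (P' t0)" if "t0 \<in> {a..b}" for t0 using velocity_form(3)[OF V ab that P'[OF that]] by blast
  have sG: "symform (\<Lambda> t0 \<inter> L) (G t0)" if t0: "t0 \<in> {a..b}" for t0
  proof -
    have "bilinear (G t0)" unfolding bilinear_def G_def
      by (auto intro!: linearI simp: linear_add[OF linP[OF t0]] linear_cmul[OF linP[OF t0]] bilinear_ladd[OF bilinear_Om]
          bilinear_radd[OF bilinear_Om] bilinear_lmul[OF bilinear_Om] bilinear_rmul[OF bilinear_Om])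
    moreover have "G t0 v w = G t0 w v" if "v \<in> \<Lambda> t0" "w \<in> \<Lambda> t0" for v w
      using velocity_form(1)[OF V ab t0 P'[OF t0] that] by (simp add: G_def)
    ultimately show ?thesis using subspace_inter[OF sub[OF t0] subspace_L] by (auto simp: symform_def)
  qed
  have vel: "lagrangian_velocity Om a b \<Lambda> t0 v w = G t0 v w" if "t0 \<in> {a..b}" "v \<in> \<Lambda> t0 \<inter> L" "w \<in> \<Lambda> t0 \<inter> L" for t0 v w
    using velocity_form(2)[OF V ab that(1) P'[OF that(1)]] that by (simp add: G_def)
  have sg: "crossing_sign Om a b \<Lambda> L t0 = signature (\<Lambda> t0 \<inter> L) (G t0)" if "t0 \<in> {a..b}" for t0
    unfolding crossing_sign_def using signature_cong[of "\<Lambda> t0 \<inter> L"] vel[OF that] by metis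
  have rad: "dim (radical (\<Lambda> t0 \<inter> L) (G t0)) = 0" if t0: "t0 \<in> {a..b}" for t0
  proof -
    have "v = 0" if v: "v \<in> radical (\<Lambda> t0 \<inter> L) (G t0)" for v
    proof (cases "crossing \<Lambda> L t0")
      case True
      then have "nondegenerate_on (\<Lambda> t0 \<inter> L) (lagrangian_velocity Om a b \<Lambda> t0)" using reg t0 by (simp add: regular_crossings_def)
      then show ?thesis using v vel[OF t0] by (auto simp: nondegenerate_on_def radical_def)
    qed (use v in \<open>auto simp: crossing_def radical_def\<close>)
    then show ?thesis by (auto simp: dim_eq_0)
  qed
  have notC: "s \<notin> C" if "s \<in> {a..b} \<Longrightarrow> dim (\<Lambda> s \<inter> L) = 0" for s
    using that subspace_0[OF sub[of s]] subspace_0[OF subspace_L] by (auto simp: C_def crossing_def)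
  have lin: "linear (closest_point (\<Lambda> s))" "closest_point (\<Lambda> s) ` X \<subseteq> \<Lambda> s" if "s \<in> {a..b}" for s X
    using closest_point_subspace[OF sub[OF that]] by auto
  have P0: "closest_point (\<Lambda> t) v = v" if "v \<in> \<Lambda> t" for v t using that by (rule closest_point_self)
  have lims: "v \<in> \<Lambda> t \<Longrightarrow> ((\<lambda>s. closest_point (\<Lambda> s) v) \<longlongrightarrow> v) (at t within {a..b})"
    "v \<in> \<Lambda> t \<Longrightarrow> ((\<lambda>s. (closest_point (\<Lambda> s) v - v) /\<^sub>R (s - t)) \<longlongrightarrow> P' t v) (at t within {a..b})" if t: "t \<in> {a..b}" for t v
    using has_vector_derivative_continuous[OF P'[OF t, of v]] P'[OF t, of v] P0[of v t]
    by (auto simp: continuous_within has_vector_derivative_within_slope)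
  have right: "\<forall>\<^sub>F s in at_right t. s \<notin> C \<and> M s - M t = j t" if t: "a \<le> t" "t < b" for t
  proof -
    have ti: "t \<in> {a..b}" using t by auto
    note at = at_right_le_within[OF t]
    have ev: "\<forall>\<^sub>F s in at_right t. s \<in> {t<..<b}" using t(2) by (rule eventually_at_right_real)
    have "\<forall>\<^sub>F s in at_right t. dim (\<Lambda> s \<inter> L) = dim (radical (\<Lambda> t \<inter> L) (G t)) \<and>
      (\<theta> s + correction (\<Lambda> s)) - (\<theta> t + correction (\<Lambda> t)) = signature (\<Lambda> t \<inter> L) (G t) / 2"
    proof (rule index_jump_right[where A = "\<lambda>s. closest_point (\<Lambda> s)", OF V cont th linP[OF ti] sG[OF ti] _ t])
      show "\<forall>\<^sub>F s in at_right t. linear (closest_point (\<Lambda> s)) \<and> closest_point (\<Lambda> s) ` \<Lambda> t \<subseteq> \<Lambda> s"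
        using ev by eventually_elim (use lin t in auto)
      show "\<forall>\<^sub>F s in at_right t. dim (radical (\<Lambda> t \<inter> L) (G t)) \<le> dim (\<Lambda> s \<inter> L)" unfolding rad[OF ti] by simp
    qed (use tendsto_mono[OF at lims(1)[OF ti]] tendsto_mono[OF at lims(2)[OF ti]] in \<open>auto simp: G_def Om_def\<close>)
    then show ?thesis by (rule eventually_mono) (use notC rad[OF ti] sg[OF ti] ti in \<open>auto simp: M_def j_def\<close>)
  qed
  have left: "\<forall>\<^sub>F s in at_left t. s \<notin> C \<and> M t - M s = j t" if t: "a < t" "t \<le> b" for t
  proof -
    have ti: "t \<in> {a..b}" using t by auto
    note at = at_left_le_within[OF t]
    have ev: "\<forall>\<^sub>F s in at_left t. s \<in> {a<..<t}" using t(1) by (rule eventually_at_left_real)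
    have "\<forall>\<^sub>F s in at_left t. dim (\<Lambda> s \<inter> L) = dim (radical (\<Lambda> t \<inter> L) (G t)) \<and>
      (\<theta> t + correction (\<Lambda> t)) - (\<theta> s + correction (\<Lambda> s)) = signature (\<Lambda> t \<inter> L) (G t) / 2"
    proof (rule index_jump_left[where A = "\<lambda>s. closest_point (\<Lambda> s)", OF V cont th linP[OF ti] sG[OF ti] _ t])
      show "\<forall>\<^sub>F s in at_left t. linear (closest_point (\<Lambda> s)) \<and> closest_point (\<Lambda> s) ` \<Lambda> t \<subseteq> \<Lambda> s"
        using ev by eventually_elim (use lin t in auto)
      show "\<forall>\<^sub>F s in at_left t. dim (radical (\<Lambda> t \<inter> L) (G t)) \<le> dim (\<Lambda> s \<inter> L)" unfolding rad[OF ti] by simp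
    qed (use tendsto_mono[OF at lims(1)[OF ti]] tendsto_mono[OF at lims(2)[OF ti]] in \<open>auto simp: G_def Om_def\<close>)
    then show ?thesis by (rule eventually_mono) (use notC rad[OF ti] sg[OF ti] ti in \<open>auto simp: M_def j_def\<close>)
  qed
  have jC: "j t = 0" if "t \<notin> C" for t
  proof (cases "t \<in> {a..b}")
    case True
    then have 0: "\<Lambda> t \<inter> L = {0}" using that by (auto simp: C_def crossing_def)
    have "signature {0::'a} B = 0" for B
    proof -
      have "form_eigenspace {0::'a} B c \<noteq> {0} \<Longrightarrow> dim (form_eigenspace {0::'a} B c) = 0" for c
        by (auto simp: form_eigenspace_def dim_eq_0)
      then show ?thesis by (simp add: signature_def del: dim_eq_0)
    qed
    then show ?thesis using sg[OF True] 0 by (simp add: j_def)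
  qed (auto simp: j_def)
  have "M b - M a = j a + 2 * (\<Sum>t\<in>C \<inter> {a<..<b}. j t) + j b"
    by (rule jump_sum(2)[OF _ _ jC right left ab]) (use ab in \<open>auto simp: C_def\<close>)
  moreover have "C \<inter> {a<..<b} = {t. a < t \<and> t < b \<and> crossing \<Lambda> L t}" by (auto simp: C_def)
  moreover have "2 * (\<Sum>t | a < t \<and> t < b \<and> crossing \<Lambda> L t. j t) = (\<Sum>t | a < t \<and> t < b \<and> crossing \<Lambda> L t. crossing_sign Om a b \<Lambda> L t)"
    unfolding sum_distrib_left by (intro sum.cong) (auto simp: j_def)
  ultimately show ?thesis using ab by (simp add: M_def regular_rs_index_def j_def)
qed

lemma continuous_closest_homotopy:
  assumes h: "continuous_map (prod_topology (top_of_set {0..1::real}) (top_of_set {a..b::real})) (lagrangian_topology Om) h"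
  shows "continuous_on ({0..1} \<times> {a..b}) (\<lambda>p. closest_point (h p) x)"
    "p \<in> {0..1} \<times> {a..b} \<Longrightarrow> lagrangian Om (h p)"
proof -
  have X: "prod_topology (top_of_set {0..1::real}) (top_of_set {a..b::real}) = top_of_set ({0..1} \<times> {a..b})"
    by (simp add: prod_topology_subtopology_eu)
  have "continuous_map (lagrangian_topology Om) euclidean (id \<circ> closest_point)"
    unfolding lagrangian_topology_def by (rule continuous_map_pullback) (rule continuous_map_id)
  from continuous_map_compose[OF h this]
  have "continuous_on ({0..1} \<times> {a..b}) (\<lambda>p. closest_point (h p))" unfolding X by (simp add: o_def)
  then show "continuous_on ({0..1} \<times> {a..b}) (\<lambda>p. closest_point (h p) x)"
    by (rule continuous_on_product_then_coordinatewise)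
  show "p \<in> {0..1} \<times> {a..b} \<Longrightarrow> lagrangian Om (h p)"
    using continuous_map_image_subset_topspace[OF h] unfolding X lagrangian_topology_def topspace_pullback_topology by auto
qed

text \<open>The Souriau determinant lifts over the whole homotopy square, and the lift is constant
  on the two sides where the end Lagrangians are fixed. So every regular representative yields the
  same number, and the description operator is justified once one representative is at hand.\<close>

theorem lagrangian_rs_index_eq:
  fixes \<Lambda> \<Lambda>' :: "real \<Rightarrow> 'a set"
  assumes ab: "a < b" and sm: "smooth_lagrangian_path Om a b \<Lambda>'" and reg: "regular_crossings Om a b \<Lambda>' L"
    and hom: "homotopic_with (\<lambda>\<gamma>. \<gamma> a = \<Lambda> a \<and> \<gamma> b = \<Lambda> b) (top_of_set {a..b}) (lagrangian_topology Om) \<Lambda> \<Lambda>'"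
    and th: "continuous_on {a..b} \<theta>" "\<And>t. t \<in> {a..b} \<Longrightarrow> souriau (\<Lambda> t) = circ (\<theta> t)"
  shows "lagrangian_rs_index Om a b \<Lambda> L = (\<theta> b + correction (\<Lambda> b)) - (\<theta> a + correction (\<Lambda> a))"
proof -
  have *: "regular_rs_index Om a b \<Gamma> L = (\<theta> b + correction (\<Lambda> b)) - (\<theta> a + correction (\<Lambda> a))"
    if G: "smooth_lagrangian_path Om a b \<Gamma>" "regular_crossings Om a b \<Gamma> L"
      "homotopic_with (\<lambda>\<gamma>. \<gamma> a = \<Lambda> a \<and> \<gamma> b = \<Lambda> b) (top_of_set {a..b}) (lagrangian_topology Om) \<Lambda> \<Gamma>" for \<Gamma>
  proof -
    obtain h where h: "continuous_map (prod_topology (top_of_set {0..1::real}) (top_of_set {a..b})) (lagrangian_topology Om) h"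
      "\<And>x. h (0, x) = \<Lambda> x" "\<And>x. h (1, x) = \<Gamma> x" "\<And>s. s \<in> {0..1} \<Longrightarrow> h (s, a) = \<Lambda> a \<and> h (s, b) = \<Lambda> b"
      using G(3) unfolding homotopic_with_def by auto
    note hc = continuous_closest_homotopy[OF h(1)]
    have cs: "continuous_on ({0..1} \<times> {a..b}) (\<lambda>p. souriau (h p))" by (rule continuous_souriau[OF hc(1)])
    obtain \<Theta> where T: "continuous_on ({0..1} \<times> {a..b}) \<Theta>" "\<And>p. p \<in> {0..1} \<times> {a..b} \<Longrightarrow> souriau (h p) = circ (\<Theta> p)"
      by (rule circle_lift[OF cs]) (use norm_souriau[OF hc(2)] in \<open>auto intro!: convex_Times\<close>)
    have cT: "continuous_on {a..b} (\<lambda>t. \<Theta> (s, t))" if "s \<in> {0..1}" for s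
      by (rule continuous_on_compose2[OF T(1)]) (use that in \<open>auto intro!: continuous_intros\<close>)
    have cS: "continuous_on {0..1} (\<lambda>s. \<Theta> (s, t))" if "t \<in> {a..b}" for t
      by (rule continuous_on_compose2[OF T(1)]) (use that in \<open>auto intro!: continuous_intros\<close>)
    have const: "\<Theta> (1, t) = \<Theta> (0, t)" if t: "t = a \<or> t = b" for t
    proof -
      have ti: "t \<in> {a..b}" using t ab by auto
      have "\<Theta> (0, t) - 0 = \<Theta> (1, t) - 0"
      proof (rule circle_lift_diff_unique[of "{0..1::real}" "\<lambda>s. \<Theta> (s, t)" "\<lambda>_. 0" "souriau (\<Lambda> t)" 0 1])
        show "circ (\<Theta> (s, t)) = souriau (\<Lambda> t) * circ 0" if "s \<in> {0..1}" for s
          using T(2)[of "(s, t)"] h(4)[OF that] that ti t by auto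
      qed (use cS[OF ti] in auto)
      then show ?thesis by simp
    qed
    have "\<theta> a - \<Theta> (0, a) = \<theta> b - \<Theta> (0, b)"
    proof (rule circle_lift_diff_unique[of "{a..b}" \<theta> "\<lambda>t. \<Theta> (0, t)" 1])
      show "circ (\<theta> t) = 1 * circ (\<Theta> (0, t))" if "t \<in> {a..b}" for t
        using T(2)[of "(0, t)"] th(2)[OF that] h(2) that by auto
    qed (use th(1) cT ab in auto)
    moreover have "regular_rs_index Om a b \<Gamma> L = (\<Theta> (1, b) + correction (\<Gamma> b)) - (\<Theta> (1, a) + correction (\<Gamma> a))"
    proof (rule regular_index_eq[OF ab G(1,2) cT])
      show "souriau (\<Gamma> t) = circ (\<Theta> (1, t))" if "t \<in> {a..b}" for t
        using T(2)[of "(1, t)"] h(3) that by auto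
    qed simp
    moreover have "\<Gamma> a = \<Lambda> a" "\<Gamma> b = \<Lambda> b" using h(3) h(4)[of 1] by (metis atLeastAtMost_iff order_refl zero_le_one)+
    ultimately show ?thesis using const by simp
  qed
  show ?thesis unfolding lagrangian_rs_index_def
  proof (rule the_equality)
    show "\<exists>\<Gamma>. smooth_lagrangian_path Om a b \<Gamma> \<and> regular_crossings Om a b \<Gamma> L \<and>
      homotopic_with (\<lambda>\<gamma>. \<gamma> a = \<Lambda> a \<and> \<gamma> b = \<Lambda> b) (top_of_set {a..b}) (lagrangian_topology Om) \<Lambda> \<Gamma> \<and>
      \<theta> b + correction (\<Lambda> b) - (\<theta> a + correction (\<Lambda> a)) = regular_rs_index Om a b \<Gamma> L"
      by (intro exI[of _ \<Lambda>'] conjI sm reg hom *[OF sm reg hom, symmetric])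
  next
    fix m assume "\<exists>\<Gamma>. smooth_lagrangian_path Om a b \<Gamma> \<and> regular_crossings Om a b \<Gamma> L \<and>
      homotopic_with (\<lambda>\<gamma>. \<gamma> a = \<Lambda> a \<and> \<gamma> b = \<Lambda> b) (top_of_set {a..b}) (lagrangian_topology Om) \<Lambda> \<Gamma> \<and>
      m = regular_rs_index Om a b \<Gamma> L"
    then show "m = \<theta> b + correction (\<Lambda> b) - (\<theta> a + correction (\<Lambda> a))" by (elim exE conjE) (simp only: *)
  qed
qed

end

section \<open>Symplectic matrices and their graphs\<close>

lemma sum_UNIV_Plus: "(\<Sum>i\<in>UNIV. f i) = (\<Sum>k\<in>UNIV. f (Inl k)) + (\<Sum>k\<in>UNIV. f (Inr k))"
  for f :: "'a::finite + 'b::finite \<Rightarrow> 'c::comm_monoid_add"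
  using sum.Plus[of "UNIV::'a set" "UNIV::'b set" f] by (simp add: UNIV_Plus_UNIV)

lemma block_mat_mult:
  "block_mat A B C D ** block_mat A' B' C' D' =
   block_mat (A ** A' + B ** C') (A ** B' + B ** D') (C ** A' + D ** C') (C ** B' + D ** D')"
  for A :: "'a::comm_semiring_1^'n::finite^'n"
  by (simp add: vec_eq_iff block_mat_def matrix_matrix_mult_def sum_UNIV_Plus split: sum.split)

lemma block_mat_transpose: "transpose (block_mat A B C D) = block_mat (transpose A) (transpose C) (transpose B) (transpose D)"
  by (simp add: vec_eq_iff block_mat_def transpose_def split: sum.split)

lemma block_mat_add: "block_mat A B C D + block_mat A' B' C' D' = block_mat (A + A') (B + B') (C + C') (D + D')"
  by (simp add: vec_eq_iff block_mat_def split: sum.split)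

lemma block_mat_uminus: "- block_mat A B C D = block_mat (- A) (- B) (- C) (- D)" for A :: "'a::ring_1^'n^'n"
  by (simp add: vec_eq_iff block_mat_def split: sum.split)

lemma block_mat_scaleR: "r *\<^sub>R block_mat A B C D = block_mat (r *\<^sub>R A) (r *\<^sub>R B) (r *\<^sub>R C) (r *\<^sub>R D)" for A :: "real^'n^'n"
  by (simp add: vec_eq_iff block_mat_def split: sum.split)

lemma block_mat_one: "mat 1 = block_mat (mat 1) 0 0 (mat 1)"
  by (simp add: vec_eq_iff block_mat_def mat_def split: sum.split)

lemma matrix_minus_left: "(- A) ** B = - (A ** B)" and matrix_minus_right: "A ** (- B) = - (A ** B)"
  for A :: "real^'n^'m" and B :: "real^'k^'n"
  by (simp_all add: vec_eq_iff matrix_matrix_mult_def sum_negf)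

lemma Omega0_mat_J0: "Omega0_mat = - J0"
  by (simp add: Omega0_mat_def J0_def block_mat_uminus)

lemma J0_J0: "J0 ** J0 = - mat 1"
  by (simp add: J0_def block_mat_mult matrix_minus_left matrix_minus_right block_mat_one block_mat_uminus)

lemma transpose_uminus: "transpose (- A) = - transpose A" for A :: "real^'n^'m"
  by (simp add: vec_eq_iff transpose_def)

lemma transpose_zero: "transpose (0 :: real^'n^'m) = 0"
  by (simp add: vec_eq_iff transpose_def)

lemma transpose_J0: "transpose J0 = - J0"
  by (simp add: J0_def block_mat_transpose block_mat_uminus transpose_uminus transpose_zero)

lemma transpose_adj: "(A *v x) \<bullet> y = x \<bullet> (transpose A *v y)" for A :: "real^'n^'m"
  by (metis dot_lmul_matrix inner_commute transpose_matrix_vector transpose_transpose)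

lemma matrix_vector_uminus_left: "(- A) *v x = - (A *v x)" for A :: "real^'n^'m"
  by (simp add: vec_eq_iff matrix_vector_mult_def sum_negf)

lemma matrix_vector_uminus_right: "A *v (- x) = - (A *v x)" for A :: "real^'n^'m"
  by (simp add: vec_eq_iff matrix_vector_mult_def sum_negf)

lemma J0_J0_v: "J0 *v (J0 *v x) = - x"
  by (simp add: matrix_vector_mul_assoc J0_J0 matrix_vector_uminus_left)

lemma J0_isom: "(J0 *v x) \<bullet> (J0 *v y) = x \<bullet> y"
  by (simp add: transpose_adj transpose_J0 matrix_vector_uminus_left J0_J0_v)

lemma Omega0_eq: "Omega0 v w = (J0 *v v) \<bullet> w"
proof -
  have "(J0 *v v) \<bullet> w = (J0 *v (J0 *v v)) \<bullet> (J0 *v w)" by (simp only: J0_isom)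
  then show ?thesis by (simp add: Omega0_def Omega0_mat_J0 J0_J0_v matrix_vector_uminus_left)
qed

lemma bilinear_Omega0: "bilinear Omega0"
  unfolding bilinear_def Omega0_eq
  by (auto intro!: linearI simp: matrix_vector_right_distrib inner_add_left inner_add_right matrix_vector_mult_scaleR)

lemmas Om_simps = bilinear_ladd[OF bilinear_Omega0] bilinear_radd[OF bilinear_Omega0] bilinear_lsub[OF bilinear_Omega0] bilinear_rsub[OF bilinear_Omega0]
  bilinear_lmul[OF bilinear_Omega0] bilinear_rmul[OF bilinear_Omega0] bilinear_lzero[OF bilinear_Omega0] bilinear_rzero[OF bilinear_Omega0]

lemma Omega0_skew: "Omega0 w v = - Omega0 v w"
  using J0_isom[of v "J0 *v w"] unfolding Omega0_eq J0_J0_v by (simp add: inner_commute)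

lemma Omega0_self: "Omega0 v v = 0" using Omega0_skew[of v v] by simp

lemma Omega0_nondegenerate: "(\<And>y. Omega0 x y = 0) \<Longrightarrow> x = 0"
  unfolding Omega0_eq by (metis J0_J0_v inner_eq_zero_iff matrix_vector_mult_0_right neg_equal_0_iff_equal)

lemma Sp_iff: "A \<in> Sp \<longleftrightarrow> (\<forall>v w. Omega0 (A *v v) (A *v w) = Omega0 v w)"
proof -
  have *: "Omega0 (A *v v) (A *v w) = v \<bullet> ((transpose A ** Omega0_mat ** A) *v w)" for v w
    by (simp add: Omega0_def transpose_adj matrix_vector_mul_assoc matrix_mul_assoc)
  show ?thesis
  proof
    assume "A \<in> Sp" then show "\<forall>v w. Omega0 (A *v v) (A *v w) = Omega0 v w" unfolding * by (simp add: Sp_def Omega0_def)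
  next
    assume a: "\<forall>v w. Omega0 (A *v v) (A *v w) = Omega0 v w"
    have "(transpose A ** Omega0_mat ** A) *v w = Omega0_mat *v w" for w
    proof (rule vector_eq_ldot[THEN iffD1], rule allI)
      fix v
      have "v \<bullet> ((transpose A ** Omega0_mat ** A) *v w) = Omega0 (A *v v) (A *v w)" by (rule *[symmetric])
      also have "\<dots> = Omega0 v w" using a by blast
      finally show "v \<bullet> ((transpose A ** Omega0_mat ** A) *v w) = v \<bullet> (Omega0_mat *v w)" by (simp only: Omega0_def)
    qed
    then show "A \<in> Sp" by (simp add: Sp_def matrix_eq)
  qed
qed

lemma Sp_Omega0: "A \<in> Sp \<Longrightarrow> Omega0 (A *v v) (A *v w) = Omega0 v w" by (simp add: Sp_iff)

lemma Sp_mult: "A \<in> Sp \<Longrightarrow> B \<in> Sp \<Longrightarrow> A ** B \<in> Sp"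
  by (simp add: Sp_iff matrix_vector_mul_assoc[symmetric])

lemma Sp_one: "mat 1 \<in> Sp" by (simp add: Sp_iff)

lemma Sp_uminus: "A \<in> Sp \<Longrightarrow> - A \<in> Sp"
  unfolding Sp_iff matrix_vector_uminus_left Omega0_eq matrix_vector_uminus_right by simp

text \<open>The inverse of a symplectic matrix as a linear expression in its entries; continuity in
  A is then immediate.\<close>

definition sp_inv :: "'n::finite spmat \<Rightarrow> 'n spmat" where
  "sp_inv A = - (J0 ** transpose A ** J0)"

lemma sp_inv: assumes "A \<in> Sp" shows "sp_inv A ** A = mat 1" "A ** sp_inv A = mat 1"
proof -
  have "transpose A ** J0 ** A = J0" using assms by (simp add: Sp_def Omega0_mat_J0 matrix_minus_left matrix_minus_right)
  then have "J0 ** (transpose A ** J0 ** A) = - mat 1" by (simp add: J0_J0)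
  then show "sp_inv A ** A = mat 1" by (simp add: sp_inv_def matrix_minus_left matrix_mul_assoc)
  then show "A ** sp_inv A = mat 1" by (simp add: matrix_left_right_inverse)
qed

lemma sp_inv_v: assumes "A \<in> Sp" shows "sp_inv A *v (A *v x) = x" "A *v (sp_inv A *v x) = x"
  using sp_inv[OF assms] by (simp_all add: matrix_vector_mul_assoc)

lemma Sp_sp_inv: assumes "A \<in> Sp" shows "sp_inv A \<in> Sp"
  unfolding Sp_iff using Sp_Omega0[OF assms] sp_inv_v[OF assms] by metis

lemma Sp_transpose: assumes "A \<in> Sp" shows "transpose A \<in> Sp"
proof -
  have "transpose A = - (J0 ** sp_inv A ** J0)"
  proof -
    have "J0 ** (J0 ** transpose A ** J0) ** J0 = (J0 ** J0) ** transpose A ** (J0 ** J0)" by (simp add: matrix_mul_assoc)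
    then show ?thesis by (simp add: sp_inv_def J0_J0 matrix_minus_left matrix_minus_right)
  qed
  moreover have "J0 \<in> Sp" unfolding Sp_iff Omega0_eq by (simp add: J0_isom)
  ultimately show ?thesis using Sp_mult Sp_uminus Sp_sp_inv[OF assms] by metis
qed

lemma bounded_bilinear_matrix_mult: "bounded_bilinear ((**) :: real^'k::finite^'n::finite \<Rightarrow> real^'m::finite^'k \<Rightarrow> real^'m^'n)"
proof -
  have "bilinear ((**) :: real^'k^'n \<Rightarrow> real^'m^'k \<Rightarrow> real^'m^'n)"
    unfolding bilinear_def by (auto intro!: linearI simp: vec_eq_iff matrix_matrix_mult_def sum.distrib algebra_simps sum_distrib_left)
  then show ?thesis using bilinear_conv_bounded_bilinear by blast
qed

lemma bounded_bilinear_matrix_vector: "bounded_bilinear ((*v) :: real^'k::finite^'n::finite \<Rightarrow> real^'k \<Rightarrow> real^'n)"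
proof -
  have "bilinear ((*v) :: real^'k^'n \<Rightarrow> real^'k \<Rightarrow> real^'n)"
    unfolding bilinear_def by (auto intro!: linearI simp: vec_eq_iff matrix_vector_mult_def sum.distrib algebra_simps sum_distrib_left)
  then show ?thesis using bilinear_conv_bounded_bilinear by blast
qed

lemmas continuous_on_mm = bounded_bilinear.continuous_on[OF bounded_bilinear_matrix_mult]
lemmas continuous_on_mv = bounded_bilinear.continuous_on[OF bounded_bilinear_matrix_vector]

lemma continuous_on_transpose: "continuous_on S f \<Longrightarrow> continuous_on S (\<lambda>t. transpose (f t :: real^'n::finite^'m::finite))"
  unfolding transpose_def by (intro continuous_on_vec_lambda continuous_on_component)

lemma continuous_on_sp_inv: "continuous_on S f \<Longrightarrow> continuous_on S (\<lambda>t. sp_inv (f t))"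
  unfolding sp_inv_def by (intro continuous_on_minus continuous_on_mm continuous_on_const continuous_on_transpose)

text \<open>The sign in the first component makes the form \<open>gr.Om\<close> equal to
  \<open>Omega_bar\<close>; with \<open>Ebar\<close>, an orthonormal basis of the diagonal, a
  crossing of a graph with \<open>gr.L\<close> is a nonzero fixed vector.\<close>

definition Jbar :: "('n::finite spvec) \<times> ('n spvec) \<Rightarrow> ('n spvec) \<times> ('n spvec)" where
  "Jbar p = (- (J0 *v fst p), J0 *v snd p)"

definition Ebar :: "'n::finite + 'n \<Rightarrow> ('n spvec) \<times> ('n spvec)" where
  "Ebar j = ((1 / sqrt 2) *\<^sub>R axis j 1, (1 / sqrt 2) *\<^sub>R axis j 1)"

lemma lagrangian_frame_Jbar:
  "lagrangian_frame (Jbar :: ('n::finite spvec) \<times> ('n spvec) \<Rightarrow> _) (Ebar :: 'n + 'n \<Rightarrow> _)"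
proof (rule lagrangian_frame.intro)
  let ?J = "Jbar :: ('n spvec) \<times> ('n spvec) \<Rightarrow> _" and ?E = "Ebar :: 'n + 'n \<Rightarrow> _"
  show "linear ?J"
    by (intro linearI) (simp_all add: Jbar_def matrix_vector_right_distrib matrix_vector_mult_scaleR)
  show "?J (?J x) = - x" for x
    by (simp add: Jbar_def matrix_vector_uminus_right J0_J0_v prod_eq_iff)
  show "?J x \<bullet> ?J y = x \<bullet> y" for x y
    by (simp add: Jbar_def inner_prod_def J0_isom)
  show "?E i \<bullet> ?E j = (if i = j then 1 else 0)" for i j
    by (simp add: Ebar_def inner_axis_axis)
  show "?E i \<bullet> ?J (?E j) = 0" for i j
    by (simp add: Ebar_def Jbar_def matrix_vector_mult_scaleR)
  show "DIM(('n spvec) \<times> ('n spvec)) = 2 * CARD('n + 'n)" by simp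
qed

interpretation gr: lagrangian_frame
  "Jbar :: ('n::finite spvec) \<times> ('n spvec) \<Rightarrow> ('n spvec) \<times> ('n spvec)"
  "Ebar :: 'n + 'n \<Rightarrow> ('n spvec) \<times> ('n spvec)"
  by (rule lagrangian_frame_Jbar)

lemma gr_Om: "gr.Om = Omega_bar"
  by (intro ext) (simp add: gr.Om_def Omega_bar_def Jbar_def Omega0_eq inner_prod_def)

lemma gr_L: "(gr.L :: (('n::finite spvec) \<times> _) set) = range (\<lambda>x. (x, x))"
proof (rule subspace_dim_equal)
  have lin: "linear (\<lambda>x::'n spvec. (x, x))" by (intro linearI) auto
  show "subspace (range (\<lambda>x::'n spvec. (x, x)))" by (rule linear_subspace_image[OF lin subspace_UNIV])
  show "subspace gr.L" by (rule gr.subspace_L)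
  have "Ebar j \<in> range (\<lambda>x. (x, x))" for j :: "'n + 'n" by (simp add: Ebar_def)
  then show "gr.L \<subseteq> range (\<lambda>x::'n spvec. (x, x))"
    unfolding gr.L_def by (intro span_minimal linear_subspace_image[OF lin subspace_UNIV]) auto
  have "dim (range (\<lambda>x::'n spvec. (x, x))) \<le> dim (UNIV :: ('n spvec) set)" by (rule dim_image_le[OF lin])
  then show "dim (range (\<lambda>x::'n spvec. (x, x))) \<le> dim (gr.L :: (('n spvec) \<times> ('n spvec)) set)"
    unfolding gr.dim_L by simp
qed

definition Gr :: "'n::finite spmat \<Rightarrow> (('n spvec) \<times> ('n spvec)) set" where
  "Gr A = range (\<lambda>x. (x, A *v x))"

lemma Gr_iff: "(x, y) \<in> Gr A \<longleftrightarrow> y = A *v x" by (auto simp: Gr_def)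

lemma lagrangian_Gr: assumes "A \<in> Sp" shows "lagrangian gr.Om (Gr A)"
proof (rule gr.lagrangianI)
  have lin: "linear (\<lambda>x. (x, A *v x))" by (intro linearI) (auto simp: matrix_vector_right_distrib matrix_vector_mult_scaleR)
  show "subspace (Gr A)" unfolding Gr_def by (rule linear_subspace_image[OF lin subspace_UNIV])
  have "inj (\<lambda>x. (x, A *v x))" by (auto intro: injI)
  then show "dim (Gr A) = CARD('a + 'a)" unfolding Gr_def using dim_image_eq[OF lin, of UNIV] by simp
  show "Jbar p \<bullet> q = 0" if "p \<in> Gr A" "q \<in> Gr A" for p q
    using that Sp_Omega0[OF assms] unfolding Gr_def Jbar_def by (auto simp: inner_prod_def Omega0_eq)
qed

text \<open>The matrix of the normal equations for the orthogonal projection onto the graph of A; it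
  is positive definite for every A.\<close>

definition gram :: "real^'n::finite^'n \<Rightarrow> real^'n^'n" where "gram A = mat 1 + transpose A ** A"

lemma det_gram: "det (gram A) \<noteq> 0"
proof -
  have "x = 0" if "gram A *v x = 0" for x
  proof -
    have "0 = x \<bullet> (gram A *v x)" using that by simp
    also have "\<dots> = x \<bullet> x + x \<bullet> (transpose A *v (A *v x))"
      by (simp add: gram_def matrix_vector_mult_add_rdistrib inner_add_right matrix_vector_mul_assoc)
    also have "x \<bullet> (transpose A *v (A *v x)) = (A *v x) \<bullet> (A *v x)" by (simp add: transpose_adj)
    finally have "x \<bullet> x = 0" using inner_ge_zero[of x] inner_ge_zero[of "A *v x"] by linarith
    then show "x = 0" by simp
  qed
  then show ?thesis using invertible_det_nz matrix_left_invertible_ker invertible_left_inverse by blast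
qed

text \<open>The solution of the normal equations by Cramer's rule: the projection onto a graph is
  visibly a rational expression in the entries of A, from which both continuity and smoothness are
  read off.\<close>

definition gr_proj :: "real^'n::finite^'n \<Rightarrow> (real^'n) \<times> (real^'n) \<Rightarrow> real^'n" where
  "gr_proj A p = (\<chi> k. det (\<chi> i j. if j = k then (fst p + transpose A *v snd p) $ i else gram A $ i $ j) / det (gram A))"

lemma closest_point_Gr: "closest_point (Gr A) p = (gr_proj A p, A *v gr_proj A p)"
proof (rule closest_point_subspaceI)
  have lin: "linear (\<lambda>x. (x, A *v x))" by (intro linearI) (auto simp: matrix_vector_right_distrib matrix_vector_mult_scaleR)
  show "subspace (Gr A)" unfolding Gr_def by (rule linear_subspace_image[OF lin subspace_UNIV])
  show "(gr_proj A p, A *v gr_proj A p) \<in> Gr A" by (simp add: Gr_iff)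
  have z: "gram A *v gr_proj A p = fst p + transpose A *v snd p"
    unfolding cramer[OF det_gram] gr_proj_def ..
  fix v assume "v \<in> Gr A"
  then obtain w where v: "v = (w, A *v w)" by (auto simp: Gr_def)
  let ?z = "gr_proj A p"
  have "(p - (?z, A *v ?z)) \<bullet> v = (fst p - ?z) \<bullet> w + (transpose A *v (snd p - A *v ?z)) \<bullet> w"
    by (cases p) (simp add: v inner_prod_def transpose_adj transpose_adj[of A] inner_commute[of _ "A *v w"] inner_commute[of w])
  also have "\<dots> = (fst p + transpose A *v snd p - gram A *v ?z) \<bullet> w"
    by (simp add: gram_def matrix_vector_mult_add_rdistrib matrix_vector_mult_diff_distrib matrix_vector_mul_assoc inner_add_left inner_diff_left)
  finally show "(p - (?z, A *v ?z)) \<bullet> v = 0" using z by simp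
qed

lemma continuous_on_entry: "continuous_on S f \<Longrightarrow> continuous_on S (\<lambda>t. f t $ i $ j)" for f :: "'b::topological_space \<Rightarrow> real^'n::finite^'m::finite"
  by (intro continuous_intros)

lemma continuous_closest_Gr:
  assumes "continuous_on S A" shows "continuous_on S (\<lambda>t. closest_point (Gr (A t)) p)"
proof -
  have g: "continuous_on S (\<lambda>t. gram (A t))" unfolding gram_def
    by (intro continuous_intros continuous_on_mm continuous_on_transpose assms)
  have b: "continuous_on S (\<lambda>t. fst p + transpose (A t) *v snd p)"
    by (intro continuous_intros continuous_on_mv continuous_on_transpose assms)
  have "continuous_on S (\<lambda>t. (if j = k then (fst p + transpose (A t) *v snd p) $ i else gram (A t) $ i $ j))" for i j k
    using continuous_on_entry[OF g] continuous_on_component[OF b] by (cases "j = k") auto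
  then have "continuous_on S (\<lambda>t. gr_proj (A t) p)"
    unfolding gr_proj_def using det_gram continuous_on_entry[OF g]
    by (intro continuous_on_vec_lambda continuous_on_divide continuous_on_det) auto
  then show ?thesis unfolding closest_point_Gr by (intro continuous_on_Pair continuous_on_mv assms)
qed

definition fixspace :: "real^'n::finite^'n \<Rightarrow> (real^'n) set" where "fixspace A = {x. A *v x = x}"

lemma subspace_fixspace: "subspace (fixspace A)"
  by (auto simp: fixspace_def subspace_def matrix_vector_right_distrib matrix_vector_mult_scaleR)

lemma Gr_inter_L: "Gr A \<inter> gr.L = (\<lambda>x. (x, x)) ` fixspace A"
  unfolding gr_L by (auto simp: Gr_def fixspace_def)

lemma dim_diag_image: "dim ((\<lambda>x. (x, x)) ` V) = dim V" if "subspace V" for V :: "(real^'n::finite) set"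
proof -
  have lin: "linear (\<lambda>x::real^'n. (x, x))" by (intro linearI) auto
  show ?thesis by (rule dim_image_eq[OF lin]) (auto intro: inj_onI)
qed

section \<open>The corrected lift along a path of symplectic matrices\<close>

definition sp_index :: "(real \<Rightarrow> real) \<Rightarrow> (real \<Rightarrow> 'n::finite spmat) \<Rightarrow> real \<Rightarrow> real" where
  "sp_index \<theta> \<gamma> t = \<theta> t + gr.correction (Gr (\<gamma> t))"

definition sp_lift :: "real \<Rightarrow> real \<Rightarrow> (real \<Rightarrow> 'n::finite spmat) \<Rightarrow> (real \<Rightarrow> real) \<Rightarrow> bool" where
  "sp_lift a b \<gamma> \<theta> \<longleftrightarrow> continuous_on {a..b} \<theta> \<and>
     (\<forall>t\<in>{a..b}. gr.souriau (Gr (\<gamma> t)) = circ (\<theta> t))"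

lemma symform_Omega_deriv:
  assumes "subspace F" "\<And>x y. x \<in> F \<Longrightarrow> y \<in> F \<Longrightarrow> Omega0 x (D *v y) = Omega0 y (D *v x)"
  shows "symform F (\<lambda>x y. Omega0 x (D *v y))"
proof -
  have "bilinear (\<lambda>x y. Omega0 x (D *v y))" unfolding bilinear_def
    by (auto intro!: linearI simp: matrix_vector_right_distrib matrix_vector_mult_scaleR
      Om_simps)
  then show ?thesis using assms by (simp add: symform_def)
qed

text \<open>The general jump lemmas for graphs, with the crossing form pulled back from the diagonal
  to the fixed vectors. \<open>D\<close> has to be the derivative on fixed vectors only.\<close>

lemma sp_jump:
  fixes \<gamma> :: "real \<Rightarrow> 'n::finite spmat"
  assumes cont: "continuous_on {a..b} \<gamma>" and Sp: "\<And>t. t \<in> {a..b} \<Longrightarrow> \<gamma> t \<in> Sp" and th: "sp_lift a b \<gamma> \<theta>"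
    and t0: "t0 \<in> {a..b}"
    and der: "\<And>x. x \<in> fixspace (\<gamma> t0) \<Longrightarrow> ((\<lambda>s. (\<gamma> s *v x - x) /\<^sub>R (s - t0)) \<longlongrightarrow> D *v x) (at t0 within {a..b})"
    and sym: "\<And>x y. x \<in> fixspace (\<gamma> t0) \<Longrightarrow> y \<in> fixspace (\<gamma> t0) \<Longrightarrow> Omega0 x (D *v y) = Omega0 y (D *v x)"
    and rk: "\<And>t. t \<in> {a..b} \<Longrightarrow> t \<noteq> t0 \<Longrightarrow> dim (radical (fixspace (\<gamma> t0)) (\<lambda>x y. Omega0 x (D *v y))) \<le> dim (fixspace (\<gamma> t))"
  shows "t0 < b \<Longrightarrow> \<forall>\<^sub>F s in at_right t0. sp_index \<theta> \<gamma> s - sp_index \<theta> \<gamma> t0 = signature (fixspace (\<gamma> t0)) (\<lambda>x y. Omega0 x (D *v y)) / 2"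
    "a < t0 \<Longrightarrow> \<forall>\<^sub>F s in at_left t0. sp_index \<theta> \<gamma> t0 - sp_index \<theta> \<gamma> s = signature (fixspace (\<gamma> t0)) (\<lambda>x y. Omega0 x (D *v y)) / 2"
proof -
  let ?F = "fixspace (\<gamma> t0)"
  let ?B = "\<lambda>x y. Omega0 x (D *v y)"
  let ?T = "\<lambda>x::'n spvec. (x, x)"
  let ?G = "\<lambda>u v::('n spvec) \<times> ('n spvec). Omega0 (fst u) (D *v fst v)"
  have linT: "linear ?T" by (intro linearI) auto
  have sB: "symform ?F ?B" by (rule symform_Omega_deriv[OF subspace_fixspace sym])
  have K: "Gr (\<gamma> t0) \<inter> gr.L = ?T ` ?F" by (rule Gr_inter_L)
  have "bilinear ?G" unfolding bilinear_def
    by (auto intro!: linearI simp: matrix_vector_right_distrib matrix_vector_mult_scaleR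
      Om_simps)
  then have sG: "symform (Gr (\<gamma> t0) \<inter> gr.L) ?G"
    unfolding symform_def K using linear_subspace_image[OF linT subspace_fixspace] sym by auto
  have sig: "signature (Gr (\<gamma> t0) \<inter> gr.L) ?G = signature ?F ?B"
    using signature_pullback[OF linT K[symmetric] sB sG] by simp
  have "radical (Gr (\<gamma> t0) \<inter> gr.L) ?G = ?T ` radical ?F ?B" unfolding K radical_def by auto
  then have rad: "dim (radical (Gr (\<gamma> t0) \<inter> gr.L) ?G) = dim (radical ?F ?B)"
    using dim_diag_image[OF subspace_radical[OF sB]] by simp
  have dimK: "dim (Gr (\<gamma> t) \<inter> gr.L) = dim (fixspace (\<gamma> t))" for t
    unfolding Gr_inter_L by (rule dim_diag_image[OF subspace_fixspace])
  \<comment> \<open>A shear in the second component that carries the graph of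
    \<open>\<gamma> t0\<close> into that of \<open>\<gamma> s\<close>; on fixed vectors its
    difference quotient is the one in \<open>der\<close>.\<close>
  define A where "A s p = (fst p, snd p + (\<gamma> s - \<gamma> t0) *v fst p)" for s and p :: "('n spvec) \<times> ('n spvec)"
  have linA: "linear (A s)" for s
    by (intro linearI) (simp_all add: A_def matrix_vector_right_distrib matrix_vector_mult_scaleR algebra_simps)
  have AG: "A s ` Gr (\<gamma> t0) \<subseteq> Gr (\<gamma> s)" for s
    by (auto simp: A_def Gr_def matrix_vector_mult_diff_rdistrib)
  have linD: "linear (\<lambda>p::('n spvec) \<times> ('n spvec). (0::'n spvec, D *v fst p))"
    by (intro linearI) (simp_all add: matrix_vector_right_distrib matrix_vector_mult_scaleR)
  have Alim: "((\<lambda>s. A s v) \<longlongrightarrow> v) (at t0 within {a..b})" for v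
  proof -
    have "(\<gamma> \<longlongrightarrow> \<gamma> t0) (at t0 within {a..b})" using cont t0 by (simp add: continuous_on_def)
    then have "((\<lambda>s. (\<gamma> s - \<gamma> t0) *v fst v) \<longlongrightarrow> (\<gamma> t0 - \<gamma> t0) *v fst v) (at t0 within {a..b})"
      by (intro bounded_bilinear.tendsto[OF bounded_bilinear_matrix_vector] tendsto_intros)
    then have "((\<lambda>s. A s v) \<longlongrightarrow> (fst v, snd v + 0)) (at t0 within {a..b})"
      unfolding A_def by (intro tendsto_Pair tendsto_add tendsto_const) simp
    then show ?thesis by simp
  qed
  have Ader: "((\<lambda>s. (A s k - k) /\<^sub>R (s - t0)) \<longlongrightarrow> (0, D *v fst k)) (at t0 within {a..b})" if k: "k \<in> Gr (\<gamma> t0) \<inter> gr.L" for k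
  proof -
    obtain x where x: "x \<in> ?F" "k = (x, x)" using k K by auto
    have "(A s k - k) /\<^sub>R (s - t0) = (0, (\<gamma> s *v x - x) /\<^sub>R (s - t0))" for s
      using x by (simp add: A_def fixspace_def matrix_vector_mult_diff_rdistrib)
    then show ?thesis using der[OF x(1)] x(2) by (auto intro: tendsto_Pair)
  qed
  note lag = lagrangian_Gr[OF Sp]
  note cc = continuous_closest_Gr[OF cont]
  have th': "continuous_on {a..b} \<theta>" "\<And>t. t \<in> {a..b} \<Longrightarrow> gr.souriau (Gr (\<gamma> t)) = circ (\<theta> t)"
    using th by (auto simp: sp_lift_def)
  have Gk: "?G k k = Jbar k \<bullet> (0, D *v fst k)" if "k \<in> Gr (\<gamma> t0) \<inter> gr.L" for k
    using that unfolding K by (auto simp: Jbar_def inner_prod_def Omega0_eq)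
  show "\<forall>\<^sub>F s in at_right t0. sp_index \<theta> \<gamma> s - sp_index \<theta> \<gamma> t0 = signature ?F ?B / 2" if "t0 < b"
  proof -
    have at: "at_right t0 \<le> at t0 within {a..b}" using that t0 by (intro at_right_le_within) auto
    have "\<forall>\<^sub>F s in at_right t0. s \<in> {t0<..<b}" using that by (rule eventually_at_right_real)
    then have ev: "\<forall>\<^sub>F s in at_right t0. dim (radical (Gr (\<gamma> t0) \<inter> gr.L) ?G) \<le> dim (Gr (\<gamma> s) \<inter> gr.L)"
      unfolding rad dimK by eventually_elim (use rk t0 in auto)
    have "\<forall>\<^sub>F s in at_right t0. dim (Gr (\<gamma> s) \<inter> gr.L) = dim (radical (Gr (\<gamma> t0) \<inter> gr.L) ?G) \<and>
      (\<theta> s + gr.correction (Gr (\<gamma> s))) - (\<theta> t0 + gr.correction (Gr (\<gamma> t0))) = signature (Gr (\<gamma> t0) \<inter> gr.L) ?G / 2"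
      by (rule gr.index_jump_right[where A = A, OF lag cc th' linD sG Gk _ that _ _ _ ev])
        (use t0 linA AG tendsto_mono[OF at Alim] tendsto_mono[OF at Ader] in auto)
    then show ?thesis by (rule eventually_mono) (simp add: sp_index_def sig)
  qed
  show "\<forall>\<^sub>F s in at_left t0. sp_index \<theta> \<gamma> t0 - sp_index \<theta> \<gamma> s = signature ?F ?B / 2" if "a < t0"
  proof -
    have at: "at_left t0 \<le> at t0 within {a..b}" using that t0 by (intro at_left_le_within) auto
    have "\<forall>\<^sub>F s in at_left t0. s \<in> {a<..<t0}" using that by (rule eventually_at_left_real)
    then have ev: "\<forall>\<^sub>F s in at_left t0. dim (radical (Gr (\<gamma> t0) \<inter> gr.L) ?G) \<le> dim (Gr (\<gamma> s) \<inter> gr.L)"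
      unfolding rad dimK by eventually_elim (use rk t0 in auto)
    have "\<forall>\<^sub>F s in at_left t0. dim (Gr (\<gamma> s) \<inter> gr.L) = dim (radical (Gr (\<gamma> t0) \<inter> gr.L) ?G) \<and>
      (\<theta> t0 + gr.correction (Gr (\<gamma> t0))) - (\<theta> s + gr.correction (Gr (\<gamma> s))) = signature (Gr (\<gamma> t0) \<inter> gr.L) ?G / 2"
      by (rule gr.index_jump_left[where A = A, OF lag cc th' linD sG Gk that _ _ _ _ ev])
        (use t0 linA AG tendsto_mono[OF at Alim] tendsto_mono[OF at Ader] in auto)
    then show ?thesis by (rule eventually_mono) (simp add: sp_index_def sig)
  qed
qed

lemma signature_zero_form: assumes "symform V B" "\<And>x y. x \<in> V \<Longrightarrow> y \<in> V \<Longrightarrow> B x y = 0" shows "signature V B = 0"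
proof -
  have "radical V B = V" using assms(2) by (auto simp: radical_def)
  then show ?thesis using signature_radical[OF assms(1)] by simp
qed

lemma signature_zero_deriv: "subspace F \<Longrightarrow> signature F (\<lambda>x y. Omega0 x (0 *v y)) = 0"
  by (rule signature_zero_form[OF symform_Omega_deriv]) (simp_all add: Om_simps)

text \<open>After time a the kernel persists as F and causes no jumps; the whole change occurs on
  the right of a, where the kernel may shrink.\<close>

lemma sp_index_constant_kernel:
  fixes \<gamma> :: "real \<Rightarrow> 'n::finite spmat"
  assumes ab: "a < b" and cont: "continuous_on {a..b} \<gamma>" and Sp: "\<And>t. t \<in> {a..b} \<Longrightarrow> \<gamma> t \<in> Sp" and th: "sp_lift a b \<gamma> \<theta>"
    and F: "\<And>t. t \<in> {a<..b} \<Longrightarrow> fixspace (\<gamma> t) = F"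
    and der: "\<And>x. x \<in> fixspace (\<gamma> a) \<Longrightarrow> ((\<lambda>s. (\<gamma> s *v x - x) /\<^sub>R (s - a)) \<longlongrightarrow> D *v x) (at a within {a..b})"
    and sym: "\<And>x y. x \<in> fixspace (\<gamma> a) \<Longrightarrow> y \<in> fixspace (\<gamma> a) \<Longrightarrow> Omega0 x (D *v y) = Omega0 y (D *v x)"
    and rk: "dim (radical (fixspace (\<gamma> a)) (\<lambda>x y. Omega0 x (D *v y))) \<le> dim F"
    and sub: "F \<subseteq> fixspace (\<gamma> a)"
  shows "sp_index \<theta> \<gamma> b - sp_index \<theta> \<gamma> a = signature (fixspace (\<gamma> a)) (\<lambda>x y. Omega0 x (D *v y)) / 2"
proof -
  define j where "j t = (if t = a then signature (fixspace (\<gamma> a)) (\<lambda>x y. Omega0 x (D *v y)) / 2 else 0)" for t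
  have sF: "subspace F" using F[of b] ab subspace_fixspace by force
  have t1: "t \<in> {a..b} \<Longrightarrow> F \<subseteq> fixspace (\<gamma> t)" for t using F[of t] sub by (cases "t = a") auto
  have z: "(t < b \<longrightarrow> (\<forall>\<^sub>F s in at_right t. sp_index \<theta> \<gamma> s - sp_index \<theta> \<gamma> t = 0)) \<and>
           (\<forall>\<^sub>F s in at_left t. sp_index \<theta> \<gamma> t - sp_index \<theta> \<gamma> s = 0)" if t: "t \<in> {a<..b}" for t
  proof -
    have Ft: "fixspace (\<gamma> t) = F" by (rule F[OF t])
    have ss: "signature (fixspace (\<gamma> t)) (\<lambda>x y. Omega0 x (0 *v y)) = 0"
      unfolding Ft by (rule signature_zero_deriv[OF sF])
    \<comment> \<open>Vectors of F stay fixed, so the difference quotient on F is 0 although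
      \<open>\<gamma>\<close> is only continuous. With D = 0 the crossing form vanishes and its
      radical is F, as the rank condition asks.\<close>
    have dd: "((\<lambda>s. (\<gamma> s *v x - x) /\<^sub>R (s - t)) \<longlongrightarrow> 0 *v x) (at t within {a..b})" if "x \<in> fixspace (\<gamma> t)" for x
    proof -
      have "\<forall>\<^sub>F s in at t within {a..b}. (\<gamma> s *v x - x) /\<^sub>R (s - t) = 0"
        unfolding eventually_at_topological using t1 that Ft by (intro exI[of _ UNIV]) (auto simp: fixspace_def subset_iff)
      then show ?thesis by (simp add: tendsto_eventually)
    qed
    have rr: "dim (radical (fixspace (\<gamma> t)) (\<lambda>x y. Omega0 x (0 *v y))) \<le> dim (fixspace (\<gamma> s))" if "s \<in> {a..b}" for s
      using t1[OF that] unfolding Ft by (intro dim_subset) (auto simp: radical_def)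
    have ta: "t \<in> {a..b}" "a < t" using t by auto
    note sj = sp_jump[OF cont Sp th ta(1) dd _ rr, unfolded ss]
    show ?thesis using sj ta(2) by (auto simp: Om_simps)
  qed
  have aab: "a \<in> {a..b}" using ab by simp
  have "sp_index \<theta> \<gamma> b - sp_index \<theta> \<gamma> a = j a + 2 * (\<Sum>t\<in>{a} \<inter> {a<..<b}. j t) + j b"
  proof (rule jump_sum(2)[where C = "{a}" and j = j])
    show "\<forall>\<^sub>F s in at_right t. s \<notin> {a} \<and> sp_index \<theta> \<gamma> s - sp_index \<theta> \<gamma> t = j t" if t: "a \<le> t" "t < b" for t
    proof -
      have "\<forall>\<^sub>F s in at_right t. s > t" by (rule eventually_at_right_less)
      moreover have "\<forall>\<^sub>F s in at_right t. sp_index \<theta> \<gamma> s - sp_index \<theta> \<gamma> t = j t"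
      proof (cases "t = a")
        case True
        show ?thesis unfolding True j_def
          using sp_jump(1)[OF cont Sp th aab der sym _ ab] rk F by simp
      qed (use z[of t] t in \<open>auto simp: j_def\<close>)
      ultimately show ?thesis by eventually_elim (use t in auto)
    qed
    show "\<forall>\<^sub>F s in at_left t. s \<notin> {a} \<and> sp_index \<theta> \<gamma> t - sp_index \<theta> \<gamma> s = j t" if t: "a < t" "t \<le> b" for t
    proof -
      have "\<forall>\<^sub>F s in at_left t. s \<in> {a<..<t}" using t(1) by (rule eventually_at_left_real)
      moreover have "\<forall>\<^sub>F s in at_left t. sp_index \<theta> \<gamma> t - sp_index \<theta> \<gamma> s = 0" using z[of t] t by auto
      ultimately show ?thesis by eventually_elim (use t in \<open>auto simp: j_def\<close>)
    qed
  qed (use ab in \<open>auto simp: j_def\<close>)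
  then show ?thesis using ab by (simp add: j_def)
qed

lemma sp_index_no_crossing:
  fixes \<gamma> :: "real \<Rightarrow> 'n::finite spmat"
  assumes ab: "a < b" and cont: "continuous_on {a..b} \<gamma>" and Sp: "\<And>t. t \<in> {a..b} \<Longrightarrow> \<gamma> t \<in> Sp" and th: "sp_lift a b \<gamma> \<theta>"
    and F: "\<And>t. t \<in> {a..b} \<Longrightarrow> fixspace (\<gamma> t) = {0}"
  shows "sp_index \<theta> \<gamma> b = sp_index \<theta> \<gamma> a"
proof -
  have Fa: "fixspace (\<gamma> a) = {0}" using F ab by simp
  have "sp_index \<theta> \<gamma> b - sp_index \<theta> \<gamma> a = signature (fixspace (\<gamma> a)) (\<lambda>x y. Omega0 x (0 *v y)) / 2"
    by (rule sp_index_constant_kernel[OF ab cont Sp th, where F = "{0}"])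
      (use F ab in \<open>auto simp: Fa radical_def Om_simps\<close>)
  moreover have "signature (fixspace (\<gamma> a)) (\<lambda>x y. Omega0 x (0 *v y)) = 0"
    unfolding Fa by (rule signature_zero_deriv) simp
  ultimately show ?thesis by simp
qed

lemma sp_lift_exists:
  fixes \<gamma> :: "real \<Rightarrow> 'n::finite spmat"
  assumes cont: "continuous_on {a..b} \<gamma>" and Sp: "\<And>t. t \<in> {a..b} \<Longrightarrow> \<gamma> t \<in> Sp"
  obtains \<theta> where "sp_lift a b \<gamma> \<theta>"
proof -
  have "continuous_on {a..b} (\<lambda>t. gr.souriau (Gr (\<gamma> t)))" by (rule gr.continuous_souriau[OF continuous_closest_Gr[OF cont]])
  then show ?thesis using circle_lift[of "{a..b}" "\<lambda>t. gr.souriau (Gr (\<gamma> t))"] gr.norm_souriau[OF lagrangian_Gr[OF Sp]] that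
    unfolding sp_lift_def by (metis convex_real_interval(5))
qed

section \<open>Regular representatives of a path of symplectic matrices\<close>

text \<open>Differentiability to a finite order admits induction, so the closure properties are
  short. Smoothness in the sense of \<open>smooth_on_interval\<close> asks for one sequence of
  derivatives for all orders, which \<open>smooth_on_intervalI\<close> supplies.\<close>

primrec ck :: "nat \<Rightarrow> real set \<Rightarrow> (real \<Rightarrow> 'a::real_normed_vector) \<Rightarrow> bool" where
  "ck 0 S f = True"
| "ck (Suc k) S f = (\<exists>f'. (\<forall>t\<in>S. (f has_vector_derivative f' t) (at t within S)) \<and> ck k S f')"

lemma ckI: "(\<And>t. t \<in> S \<Longrightarrow> (f has_vector_derivative f' t) (at t within S)) \<Longrightarrow> ck k S f' \<Longrightarrow> ck (Suc k) S f"
  by auto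

lemma ck_cong: "(\<And>t. t \<in> S \<Longrightarrow> f t = g t) \<Longrightarrow> ck k S f = ck k S g"
proof (induction k arbitrary: f g)
  case (Suc k)
  have "(f has_vector_derivative d) (at t within S) \<longleftrightarrow> (g has_vector_derivative d) (at t within S)" if "t \<in> S" for t d
    using Suc.prems that by (metis has_vector_derivative_transform)
  then show ?case by auto
qed simp

lemma ck_Suc_D: "ck (Suc k) S f \<Longrightarrow> ck k S f"
proof (induction k arbitrary: f)
  case (Suc k) then show ?case by (metis ck.simps(2))
qed simp

text \<open>On a nondegenerate interval derivatives are unique, so the witnesses for the different
  orders k agree and the iterates of \<open>vector_derivative\<close> form a common
  sequence.\<close>

lemma smooth_on_intervalI:
  fixes f :: "real \<Rightarrow> 'a::real_normed_vector"
  assumes ab: "a < b" and f: "\<And>k. ck k {a..b} f"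
  shows "smooth_on_interval a b f"
proof -
  define d where "d g t = vector_derivative g (at t within {a..b})" for g :: "real \<Rightarrow> 'a" and t
  have step: "(\<forall>t\<in>{a..b}. (g has_vector_derivative d g t) (at t within {a..b})) \<and> (\<forall>k. ck k {a..b} (d g))" if g: "\<And>k. ck k {a..b} g" for g
  proof -
    have eq: "d g t = g' t" if "t \<in> {a..b}" "(g has_vector_derivative g' t) (at t within {a..b})" for g' t
      unfolding d_def using vector_derivative_within_cbox[OF ab, of t g "g' t"] that by simp
    have "ck k {a..b} (d g)" for k
    proof -
      obtain g' where g': "\<forall>t\<in>{a..b}. (g has_vector_derivative g' t) (at t within {a..b})" "ck k {a..b} g'" using g[of "Suc k"] by auto
      then show ?thesis using eq ck_cong[of "{a..b}" "d g" g' k] by blast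
    qed
    moreover have "\<forall>t\<in>{a..b}. (g has_vector_derivative d g t) (at t within {a..b})"
      using g[of "Suc 0"] eq by fastforce
    ultimately show ?thesis by blast
  qed
  define D where "D n = (d ^^ n) f" for n
  have D: "\<forall>k. ck k {a..b} (D n)" for n
  proof (induction n)
    case (Suc n) then show ?case using step[of "D n"] by (simp add: D_def)
  qed (use f in \<open>simp add: D_def\<close>)
  have "D 0 = f" "\<forall>n. \<forall>t\<in>{a..b}. (D n has_vector_derivative D (Suc n) t) (at t within {a..b})"
    using step[of "D n" for n] D by (auto simp: D_def)
  then show ?thesis unfolding smooth_on_interval_def by blast
qed

lemma ck_const: "ck k S (\<lambda>t. c)"
proof (induction k arbitrary: c)
  case (Suc k)
  show ?case using Suc[of 0] by (auto intro!: exI[of _ "\<lambda>_. 0"])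
qed simp

lemma ck_id: "ck k S (\<lambda>t::real. t)"
proof (cases k)
  case (Suc j)
  show ?thesis unfolding Suc using ck_const[of j S "1::real"] by (auto intro!: exI[of _ "\<lambda>_. 1"])
qed simp

lemma ck_add: "ck k S f \<Longrightarrow> ck k S g \<Longrightarrow> ck k S (\<lambda>t. f t + g t)"
proof (induction k arbitrary: f g)
  case (Suc k)
  then obtain f' g' where "\<forall>t\<in>S. (f has_vector_derivative f' t) (at t within S)" "ck k S f'"
    "\<forall>t\<in>S. (g has_vector_derivative g' t) (at t within S)" "ck k S g'" by auto
  then show ?case using Suc.IH[of f' g'] by (auto intro!: exI[of _ "\<lambda>t. f' t + g' t"] has_vector_derivative_add)
qed simp

lemma ck_sum: "(\<And>i. i \<in> I \<Longrightarrow> ck k S (f i)) \<Longrightarrow> ck k S (\<lambda>t. \<Sum>i\<in>I. f i t)"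
  by (induction I rule: infinite_finite_induct) (auto intro: ck_const ck_add)

lemma ck_scaleR_const: "ck k S f \<Longrightarrow> ck k S (\<lambda>t. f t *\<^sub>R c)" for c :: "'a::real_normed_vector"
proof (induction k arbitrary: f)
  case (Suc k)
  from Suc.prems obtain f' where f'0: "\<forall>t\<in>S. (f has_vector_derivative f' t) (at t within S)" "ck k S f'" by auto
  note f' = f'0(1)[rule_format] f'0(2)
  show ?case
    by (rule ckI[OF bounded_linear.has_vector_derivative[OF bounded_linear_scaleR_left f'(1)] Suc.IH[OF f'(2)]])
qed simp

lemma ck_mult: "ck k S f \<Longrightarrow> ck k S g \<Longrightarrow> ck k S (\<lambda>t. f t * g t)" for f g :: "real \<Rightarrow> real"
proof (induction k arbitrary: f g)
  case (Suc k)
  from Suc.prems(1) obtain f' where f'0: "\<forall>t\<in>S. (f has_vector_derivative f' t) (at t within S)" "ck k S f'" by auto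
  note f' = f'0(1)[rule_format] f'0(2)
  from Suc.prems(2) obtain g' where g'0: "\<forall>t\<in>S. (g has_vector_derivative g' t) (at t within S)" "ck k S g'" by auto
  note g' = g'0(1)[rule_format] g'0(2)
  show ?case
    by (rule ckI[OF has_vector_derivative_mult[OF f'(1) g'(1)]
        ck_add[OF Suc.IH[OF ck_Suc_D[OF Suc.prems(1)] g'(2)] Suc.IH[OF f'(2) ck_Suc_D[OF Suc.prems(2)]]]])
qed simp

lemma ck_prod: "(\<And>i. i \<in> I \<Longrightarrow> ck k S (f i)) \<Longrightarrow> ck k S (\<lambda>t. \<Prod>i\<in>I. f i t)" for f :: "'i \<Rightarrow> real \<Rightarrow> real"
  by (induction I rule: infinite_finite_induct) (auto intro: ck_const ck_mult)

lemma ck_uminus: "ck k S f \<Longrightarrow> ck k S (\<lambda>t. - f t)" for f :: "real \<Rightarrow> real"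
  using ck_mult[OF ck_const[of k S "-1::real"], of f] by simp

lemma ck_diff: "ck k S f \<Longrightarrow> ck k S g \<Longrightarrow> ck k S (\<lambda>t. f t - g t)" for f g :: "real \<Rightarrow> real"
  using ck_add[OF _ ck_uminus, of k S f g] by simp

lemma ck_inverse: "ck k S f \<Longrightarrow> (\<And>t. t \<in> S \<Longrightarrow> f t \<noteq> 0) \<Longrightarrow> ck k S (\<lambda>t. inverse (f t))" for f :: "real \<Rightarrow> real"
proof (induction k arbitrary: f)
  case (Suc k)
  from Suc.prems(1) obtain f' where f'0: "\<forall>t\<in>S. (f has_vector_derivative f' t) (at t within S)" "ck k S f'" by auto
  note f' = f'0(1)[rule_format] f'0(2)
  have i: "ck k S (\<lambda>t. inverse (f t))" by (rule Suc.IH[OF ck_Suc_D[OF Suc.prems(1)] Suc.prems(2)])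
  have "ck k S (\<lambda>t. - (inverse (f t) * f' t * inverse (f t)))" by (intro ck_uminus ck_mult i f'(2))
  moreover have "((\<lambda>t. inverse (f t)) has_vector_derivative - (inverse (f t) * f' t * inverse (f t))) (at t within S)" if "t \<in> S" for t
    using DERIV_inverse'[OF f'(1)[OF that, folded has_real_derivative_iff_has_vector_derivative] Suc.prems(2)[OF that]]
    by (simp only: has_real_derivative_iff_has_vector_derivative)
  ultimately show ?case by (intro ckI)
qed simp

lemma ck_sin_cos: "ck k S f \<Longrightarrow> ck k S (\<lambda>t. sin (f t)) \<and> ck k S (\<lambda>t. cos (f t))" for f :: "real \<Rightarrow> real"
proof (induction k arbitrary: f)
  case (Suc k)
  from Suc.prems(1) obtain f' where f'0: "\<forall>t\<in>S. (f has_vector_derivative f' t) (at t within S)" "ck k S f'" by auto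
  note f' = f'0(1)[rule_format] f'0(2)
  have i: "ck k S (\<lambda>t. sin (f t))" "ck k S (\<lambda>t. cos (f t))" using Suc.IH[OF ck_Suc_D[OF Suc.prems]] by auto
  have d: "((\<lambda>t. sin (f t)) has_vector_derivative cos (f t) * f' t) (at t within S)"
     "((\<lambda>t. cos (f t)) has_vector_derivative - (sin (f t) * f' t)) (at t within S)" if "t \<in> S" for t
    using f'(1)[OF that] unfolding has_real_derivative_iff_has_vector_derivative[symmetric]
    by (auto intro!: derivative_eq_intros)
  show ?case by (rule conjI; rule ckI, erule d) (intro ck_mult ck_uminus i f'(2))+
qed simp

lemma ck_if: "(P \<Longrightarrow> ck k S f) \<Longrightarrow> (\<not> P \<Longrightarrow> ck k S g) \<Longrightarrow> ck k S (\<lambda>t. if P then f t else g t)"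
  by (cases P) auto

definition smooth_mat :: "(real \<Rightarrow> real^'n::finite^'m::finite) \<Rightarrow> bool" where
  "smooth_mat A \<longleftrightarrow> (\<forall>i j k. ck k {0..1} (\<lambda>t. A t $ i $ j))"

lemma smooth_mat_const: "smooth_mat (\<lambda>t. C)" by (simp add: smooth_mat_def ck_const)
lemma smooth_mat_add: "smooth_mat A \<Longrightarrow> smooth_mat B \<Longrightarrow> smooth_mat (\<lambda>t. A t + B t)" by (simp add: smooth_mat_def ck_add)
lemma smooth_mat_diff: "smooth_mat A \<Longrightarrow> smooth_mat B \<Longrightarrow> smooth_mat (\<lambda>t. A t - B t)" by (simp add: smooth_mat_def ck_diff)
lemma smooth_mat_mult: "smooth_mat A \<Longrightarrow> smooth_mat B \<Longrightarrow> smooth_mat (\<lambda>t. A t ** B t)"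
  by (simp add: smooth_mat_def matrix_matrix_mult_def ck_sum ck_mult)
lemma smooth_mat_transpose: "smooth_mat A \<Longrightarrow> smooth_mat (\<lambda>t. transpose (A t))" by (simp add: smooth_mat_def transpose_def)
lemma smooth_mat_scaleR: "(\<And>k. ck k {0..1} f) \<Longrightarrow> smooth_mat A \<Longrightarrow> smooth_mat (\<lambda>t. f t *\<^sub>R A t)" by (simp add: smooth_mat_def ck_mult)

lemma ck_det: "(\<And>i j. ck k S (\<lambda>t. A t $ i $ j)) \<Longrightarrow> ck k S (\<lambda>t. det (A t))" for A :: "real \<Rightarrow> real^'n::finite^'n"
  unfolding det_def by (intro ck_sum ck_mult ck_const ck_prod) auto

text \<open>The inverse by Cramer's rule: its entries are rational in those of M, so the
  \<open>ck\<close> and continuity rules for determinants apply.\<close>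

definition minv :: "real^'n::finite^'n \<Rightarrow> real^'n^'n" where
  "minv M = (\<chi> i j. det (\<chi> r c. if c = i then (if r = j then 1 else 0) else M $ r $ c) / det M)"

lemma minv: assumes "det M \<noteq> 0" shows "M ** minv M = mat 1" "minv M ** M = mat 1"
proof -
  have "M *v column j (minv M) = axis j 1" for j
  proof -
    have "(\<chi> r c. if c = i then axis j 1 $ r else M $ r $ c) = (\<chi> r c. if c = i then (if r = j then 1 else 0) else M $ r $ c)" for i
      by (simp add: vec_eq_iff axis_def)
    then show ?thesis unfolding cramer[OF assms] by (simp add: column_def minv_def vec_eq_iff)
  qed
  then have "(M ** minv M) $ i $ j = mat 1 $ i $ j" for i j
    by (metis (no_types, lifting) axis_def column_def mat_def matrix_matrix_mult_def matrix_vector_mult_def vec_lambda_beta sum.cong)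
  then show "M ** minv M = mat 1" by (simp add: vec_eq_iff)
  then show "minv M ** M = mat 1" by (simp add: matrix_left_right_inverse)
qed

lemma smooth_mat_minv: assumes "smooth_mat A" "\<And>t. t \<in> {0..1} \<Longrightarrow> det (A t) \<noteq> 0" shows "smooth_mat (\<lambda>t. minv (A t))"
proof -
  have "ck k {0..1} (\<lambda>t. det (\<chi> r c. if c = i then (if r = j then 1 else 0) else A t $ r $ c) * inverse (det (A t)))" for k i j
    using assms by (intro ck_mult ck_inverse ck_det) (auto simp: smooth_mat_def intro!: ck_const ck_if)
  then show ?thesis by (simp add: smooth_mat_def minv_def divide_inverse)
qed

lemma continuous_on_minv:
  assumes A: "continuous_on S A" "\<And>t. t \<in> S \<Longrightarrow> det (A t) \<noteq> 0" shows "continuous_on S (\<lambda>t. minv (A t))"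
proof -
  have "continuous_on S (\<lambda>t. (if c = i then (if r = j then 1 else 0) else A t $ r $ c))" for r c i j
    using continuous_on_entry[OF A(1)] by (cases "c = i") auto
  then show ?thesis unfolding minv_def using A(2) continuous_on_entry[OF A(1)]
    by (intro continuous_on_vec_lambda continuous_on_divide continuous_on_det) auto
qed

lemma smooth_mat_has_derivative:
  assumes "smooth_mat A"
  obtains A' where "smooth_mat A'" "\<And>t. t \<in> {0..1} \<Longrightarrow> (A has_vector_derivative A' t) (at t within {0..1})"
proof -
  define A' where "A' t = (\<chi> i j. vector_derivative (\<lambda>t. A t $ i $ j) (at t within {0..1}))" for t
  have d: "((\<lambda>t. A t $ i $ j) has_vector_derivative A' t $ i $ j) (at t within {0..1})" if t: "t \<in> {0..1}" for t i j
  proof -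
    have "ck (Suc 0) {0..1} (\<lambda>t. A t $ i $ j)" using assms unfolding smooth_mat_def by blast
    then obtain f' where "\<forall>t\<in>{0..1}. ((\<lambda>t. A t $ i $ j) has_vector_derivative f' t) (at t within {0..1})" by auto
    from this[rule_format, OF t] show ?thesis unfolding A'_def using vector_derivative_within_cbox[of 0 1 t "\<lambda>t. A t $ i $ j" "f' t"] t by simp
  qed
  have "smooth_mat A'" unfolding smooth_mat_def
  proof (intro allI)
    fix i j k
    have "ck (Suc k) {0..1} (\<lambda>t. A t $ i $ j)" using assms unfolding smooth_mat_def by blast
    then obtain f' where f': "\<forall>t\<in>{0..1}. ((\<lambda>t. A t $ i $ j) has_vector_derivative f' t) (at t within {0..1})" "ck k {0..1} f'" by auto
    have "A' t $ i $ j = f' t" if "t \<in> {0..1}" for t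
      unfolding A'_def using vector_derivative_within_cbox[of 0 1 t "\<lambda>t. A t $ i $ j" "f' t"] that f'(1) by simp
    then show "ck k {0..1} (\<lambda>t. A' t $ i $ j)" using f'(2) ck_cong[of "{0..1}" "\<lambda>t. A' t $ i $ j" f' k] by blast
  qed
  moreover have "(A has_vector_derivative A' t) (at t within {0..1})" if "t \<in> {0..1}" for t
  proof -
    have "((\<lambda>s. (A s - A t) /\<^sub>R (s - t)) \<longlongrightarrow> A' t) (at t within {0..1})"
      using d[OF that] unfolding has_vector_derivative_within_slope
      by (intro vec_tendstoI) (simp add: divide_inverse)
    then show ?thesis by (simp add: has_vector_derivative_within_slope)
  qed
  ultimately show ?thesis using that by blast
qed

lemma smooth_mat_continuous: assumes "smooth_mat A" shows "continuous_on {0..1} A"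
  using smooth_mat_has_derivative[OF assms] has_vector_derivative_continuous continuous_on_eq_continuous_within by metis

lemma ck_gr_proj:
  assumes "smooth_mat A" shows "ck k {0..1} (\<lambda>t. gr_proj (A t) p $ i)"
proof -
  have g: "smooth_mat (\<lambda>t. gram (A t))" unfolding gram_def by (intro smooth_mat_add smooth_mat_const smooth_mat_mult smooth_mat_transpose assms)
  have b: "ck k {0..1} (\<lambda>t. (fst p + transpose (A t) *v snd p) $ r)" for r
    using smooth_mat_transpose[OF assms] unfolding matrix_vector_mult_def smooth_mat_def vector_add_component vec_lambda_beta
    by (intro ck_add ck_const ck_sum ck_mult) auto
  have "ck k {0..1} (\<lambda>t. det (\<chi> r c. if c = i then (fst p + transpose (A t) *v snd p) $ r else gram (A t) $ r $ c) * inverse (det (gram (A t))))"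
  proof (intro ck_mult ck_inverse ck_det)
    show "ck k {0..1} (\<lambda>t. (\<chi> r c. if c = i then (fst p + transpose (A t) *v snd p) $ r else gram (A t) $ r $ c) $ r $ c)" for r c
      unfolding vec_lambda_beta using g b by (intro ck_if) (auto simp: smooth_mat_def)
    show "ck k {0..1} (\<lambda>t. gram (A t) $ r $ c)" for r c using g unfolding smooth_mat_def by blast
  qed (rule det_gram)
  then show ?thesis by (simp add: gr_proj_def divide_inverse)
qed

lemma smooth_path_Gr:
  fixes A :: "real \<Rightarrow> 'n::finite spmat"
  assumes A: "smooth_mat A" "\<And>t. t \<in> {0..1} \<Longrightarrow> A t \<in> Sp"
  shows "smooth_lagrangian_path gr.Om 0 1 (\<lambda>t. Gr (A t))"
  unfolding smooth_lagrangian_path_def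
proof (intro conjI ballI allI lagrangian_Gr A(2) smooth_on_intervalI)
  fix p :: "('n spvec) \<times> ('n spvec)" and k
  let ?z = "\<lambda>t. gr_proj (A t) p"
  have e1: "?z t = (\<Sum>i\<in>UNIV. ?z t $ i *\<^sub>R axis i 1)" for t
    using basis_expansion[of "?z t"] by (simp add: scalar_mult_eq_scaleR)
  have e2: "A t *v ?z t = (\<Sum>i\<in>UNIV. (A t *v ?z t) $ i *\<^sub>R axis i 1)" for t
    using basis_expansion[of "A t *v ?z t"] by (simp add: scalar_mult_eq_scaleR)
  have "closest_point (Gr (A t)) p = (\<Sum>i\<in>UNIV. ?z t $ i *\<^sub>R (axis i 1, 0)) + (\<Sum>i\<in>UNIV. (A t *v ?z t) $ i *\<^sub>R (0, axis i 1))" for t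
    unfolding closest_point_Gr by (subst e1, subst e2) (simp add: prod_eq_iff fst_sum snd_sum)
  moreover have "ck k {0..1} (\<lambda>t. (A t *v ?z t) $ i)" for i
    using A(1) ck_gr_proj[OF A(1)] by (simp add: matrix_vector_mult_def smooth_mat_def ck_sum ck_mult)
  ultimately show "ck k {0..1} (\<lambda>t. closest_point (Gr (A t)) p)"
    using ck_gr_proj[OF A(1)] by (simp only:) (intro ck_add ck_sum ck_scaleR_const)
qed auto

lemma homotopic_Gr:
  fixes A B :: "real \<Rightarrow> 'n::finite spmat" and H :: "real \<times> real \<Rightarrow> 'n spmat"
  assumes H: "continuous_on ({0..1} \<times> {0..1}) H" "\<And>p. p \<in> {0..1} \<times> {0..1} \<Longrightarrow> H p \<in> Sp"
    and e: "\<And>t. t \<in> {0..1} \<Longrightarrow> H (0, t) = A t" "\<And>t. t \<in> {0..1} \<Longrightarrow> H (1, t) = B t"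
      "\<And>s. s \<in> {0..1} \<Longrightarrow> H (s, 0) = a" "\<And>s. s \<in> {0..1} \<Longrightarrow> H (s, 1) = b"
  shows "homotopic_with (\<lambda>\<gamma>. \<gamma> 0 = Gr a \<and> \<gamma> 1 = Gr b) (top_of_set {0..1}) (lagrangian_topology gr.Om) (\<lambda>t. Gr (A t)) (\<lambda>t. Gr (B t))"
proof -
  have X: "prod_topology (top_of_set {0..1::real}) (top_of_set {0..1::real}) = top_of_set ({0..1} \<times> {0..1})"
    by (simp add: prod_topology_subtopology_eu)
  have "continuous_on ({0..1} \<times> {0..1}) (\<lambda>p. closest_point (Gr (H p)))"
    by (rule continuous_on_coordinatewise_then_product) (rule continuous_closest_Gr[OF H(1)])
  then have c: "continuous_map (top_of_set ({0..1} \<times> {0..1})) (lagrangian_topology gr.Om) (\<lambda>p. Gr (H p))"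
    unfolding lagrangian_topology_def using lagrangian_Gr[OF H(2)]
    by (intro continuous_map_pullback') (auto simp: o_def)
  show ?thesis
  proof (subst homotopic_with)
    show "\<exists>h. continuous_map (prod_topology (top_of_set {0..1::real}) (top_of_set {0..1::real})) (lagrangian_topology gr.Om) h \<and>
        (\<forall>x\<in>topspace (top_of_set {0..1::real}). h (0, x) = Gr (A x)) \<and>
        (\<forall>x\<in>topspace (top_of_set {0..1::real}). h (1, x) = Gr (B x)) \<and>
        (\<forall>t\<in>{0..1::real}. h (t, 0) = Gr a \<and> h (t, 1) = Gr b)"
      by (rule exI[of _ "\<lambda>p. Gr (H p)"]) (use c X e in auto)
  qed auto
qed

section \<open>Cayley transform and smoothing of a path\<close>

definition sp_alg :: "'n::finite spmat \<Rightarrow> bool" where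
  "sp_alg Y \<longleftrightarrow> (\<forall>x y. Omega0 (Y *v x) y = - Omega0 x (Y *v y))"

text \<open>The Cayley transform leads from the Lie algebra \<open>sp_alg\<close> to the group. As
  the Lie algebra is a vector space, scalings and segments there become paths of symplectic
  matrices, subject only to the invertibility of \<open>mat 1 - Y\<close>.\<close>

definition cay :: "real^'n::finite^'n \<Rightarrow> real^'n^'n" where "cay Y = (mat 1 + Y) ** minv (mat 1 - Y)"

definition cayinv :: "real^'n::finite^'n \<Rightarrow> real^'n^'n" where "cayinv A = (A - mat 1) ** minv (A + mat 1)"

lemma minv_v: "det M \<noteq> 0 \<Longrightarrow> M *v (minv M *v x) = x" "det M \<noteq> 0 \<Longrightarrow> minv M *v (M *v x) = x"
  by (simp_all add: matrix_vector_mul_assoc minv)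

text \<open>Eliminates the inverse: every vector has the form \<open>u - Y *v u\<close>, and
  computations take place in the parameter u.\<close>

lemma cay_v: "det (mat 1 - Y) \<noteq> 0 \<Longrightarrow> cay Y *v (u - Y *v u) = u + Y *v u"
proof -
  assume d: "det (mat 1 - Y) \<noteq> 0"
  have "u - Y *v u = (mat 1 - Y) *v u" by (simp add: matrix_vector_mult_diff_rdistrib)
  then show ?thesis unfolding cay_def
    by (simp add: matrix_vector_mul_assoc[symmetric] minv_v[OF d] matrix_vector_mult_add_rdistrib)
qed

lemma cayinv_v: "det (A + mat 1) \<noteq> 0 \<Longrightarrow> cayinv A *v (A *v u + u) = A *v u - u"
proof -
  assume d: "det (A + mat 1) \<noteq> 0"
  have "A *v u + u = (A + mat 1) *v u" by (simp add: matrix_vector_mult_add_rdistrib)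
  then show ?thesis unfolding cayinv_def
    by (simp add: matrix_vector_mul_assoc[symmetric] minv_v[OF d] matrix_vector_mult_diff_rdistrib)
qed

lemma det_nz_iff: "det A \<noteq> 0 \<longleftrightarrow> (\<forall>x. A *v x = 0 \<longrightarrow> x = 0)" for A :: "real^'n::finite^'n"
  using invertible_det_nz matrix_left_invertible_ker invertible_left_inverse by metis

lemma cay_Sp: assumes Y: "sp_alg Y" and d: "det (mat 1 - Y) \<noteq> 0" shows "cay Y \<in> Sp"
  unfolding Sp_iff
proof (intro allI)
  fix v w
  have ex: "\<exists>u. x = u - Y *v u" for x
    using minv_v(1)[OF d, of x] by (intro exI[of _ "minv (mat 1 - Y) *v x"]) (simp add: matrix_vector_mult_diff_rdistrib)
  obtain u u' where u: "v = u - Y *v u" "w = u' - Y *v u'" using ex by metis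
  show "Omega0 (cay Y *v v) (cay Y *v w) = Omega0 v w"
    unfolding u cay_v[OF d] using Y by (simp add: Om_simps sp_alg_def)
qed

lemma cayinv_sp_alg: assumes A: "A \<in> Sp" and d: "det (A + mat 1) \<noteq> 0" shows "sp_alg (cayinv A)"
  unfolding sp_alg_def
proof (intro allI)
  fix v w
  have ex: "\<exists>u. x = A *v u + u" for x
    using minv_v(1)[OF d, of x] by (intro exI[of _ "minv (A + mat 1) *v x"]) (simp add: matrix_vector_mult_add_rdistrib)
  obtain u u' where u: "v = A *v u + u" "w = A *v u' + u'" using ex by metis
  show "Omega0 (cayinv A *v v) w = - Omega0 v (cayinv A *v w)"
    unfolding u cayinv_v[OF d] using A by (simp add: Om_simps Sp_Omega0)
qed

lemma cay_cayinv: assumes d: "det (A + mat 1) \<noteq> 0" shows "det (mat 1 - cayinv A) \<noteq> 0" "cay (cayinv A) = A"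
proof -
  have ex: "\<exists>u. x = A *v u + u" for x
    using minv_v(1)[OF d, of x] by (intro exI[of _ "minv (A + mat 1) *v x"]) (simp add: matrix_vector_mult_add_rdistrib)
  have "x = 0" if "(mat 1 - cayinv A) *v x = 0" for x
  proof -
    obtain u where u: "x = A *v u + u" using ex by blast
    have "x - cayinv A *v x = 0" using that by (simp add: matrix_vector_mult_diff_rdistrib)
    then have "2 *\<^sub>R u = 0" unfolding u cayinv_v[OF d] by (simp add: algebra_simps scaleR_2)
    then show ?thesis using u by simp
  qed
  then show d': "det (mat 1 - cayinv A) \<noteq> 0" using det_nz_iff by blast
  have "cay (cayinv A) *v x = A *v x" for x
  proof -
    let ?u = "(1/2) *\<^sub>R x"
    let ?y = "A *v ?u + ?u"
    have "cay (cayinv A) *v (?y - cayinv A *v ?y) = ?y + cayinv A *v ?y" by (rule cay_v[OF d'])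
    moreover have "?y - cayinv A *v ?y = x" unfolding cayinv_v[OF d] by (simp flip: scaleR_left.add)
    moreover have "?y + cayinv A *v ?y = A *v x" unfolding cayinv_v[OF d] by (simp add: matrix_vector_mult_scaleR flip: scaleR_left.add)
    ultimately show ?thesis by simp
  qed
  then show "cay (cayinv A) = A" by (simp add: matrix_eq)
qed

text \<open>A convex condition that implies invertibility of \<open>mat 1 - Y\<close>; it survives
  the interpolations of \<open>smooth_homotopy\<close>.\<close>

definition half_contraction :: "real^'n::finite^'n \<Rightarrow> bool" where "half_contraction Y \<longleftrightarrow> (\<forall>x. norm (Y *v x) \<le> 1/2 * norm x)"

lemma half_contraction_det: assumes "half_contraction Y" shows "det (mat 1 - Y) \<noteq> 0"
  unfolding det_nz_iff
proof (intro allI impI)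
  fix x assume "(mat 1 - Y) *v x = 0"
  then have "Y *v x = x" by (simp add: matrix_vector_mult_diff_rdistrib)
  then have "norm x \<le> 1/2 * norm x" using assms unfolding half_contraction_def by metis
  then show "x = 0" by simp
qed

lemma half_contraction_convex: assumes "half_contraction Y" "half_contraction Z" "0 \<le> a" "0 \<le> b" "a + b \<le> 1" shows "half_contraction (a *\<^sub>R Y + b *\<^sub>R Z)"
  unfolding half_contraction_def
proof
  fix x
  have "(a *\<^sub>R Y + b *\<^sub>R Z) *v x = a *\<^sub>R (Y *v x) + b *\<^sub>R (Z *v x)"
    by (simp add: matrix_vector_mult_add_rdistrib scaleR_matrix_vector_assoc)
  then have "norm ((a *\<^sub>R Y + b *\<^sub>R Z) *v x) \<le> a * norm (Y *v x) + b * norm (Z *v x)"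
    using norm_triangle_ineq[of "a *\<^sub>R (Y *v x)" "b *\<^sub>R (Z *v x)"] assms by simp
  also have "\<dots> \<le> a * (1/2 * norm x) + b * (1/2 * norm x)" using assms by (intro add_mono mult_left_mono) (auto simp: half_contraction_def)
  also have "\<dots> = (a + b) * (1/2 * norm x)" by (simp add: algebra_simps)
  also have "\<dots> \<le> 1 * (1/2 * norm x)" using assms by (intro mult_right_mono) auto
  finally show "norm ((a *\<^sub>R Y + b *\<^sub>R Z) *v x) \<le> 1/2 * norm x" by simp
qed

lemma sp_alg_comb: assumes "sp_alg Y" "sp_alg Z" shows "sp_alg (a *\<^sub>R Y + b *\<^sub>R Z)"
  using assms by (simp add: sp_alg_def matrix_vector_mult_add_rdistrib scaleR_matrix_vector_assoc[symmetric] Om_simps)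

text \<open>For \<open>x = T *v u + u\<close> the norm of x is at least 3/2 of that of u, while
  \<open>T *v u - u\<close> has norm at most 1/2 of it; the quotient 1/3 is within the allowed
  1/2.\<close>

lemma near_one_cayinv:
  assumes T: "\<And>x. norm (T *v x - x) \<le> 1/2 * norm x"
  shows "det (T + mat 1) \<noteq> 0" "half_contraction (cayinv T)"
proof -
  have low: "norm (T *v x + x) \<ge> 3/2 * norm x" for x
  proof -
    have "2 *\<^sub>R x = (T *v x + x) - (T *v x - x)" by (simp add: scaleR_2)
    then have "2 * norm x \<le> norm (T *v x + x) + norm (T *v x - x)" using norm_triangle_ineq4[of "T *v x + x" "T *v x - x"] by (metis norm_scaleR abs_numeral)
    then show ?thesis using T[of x] by simp
  qed
  show d: "det (T + mat 1) \<noteq> 0" unfolding det_nz_iff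
  proof (intro allI impI)
    fix x assume "(T + mat 1) *v x = 0"
    then have "T *v x + x = 0" by (simp add: matrix_vector_mult_add_rdistrib)
    then show "x = 0" using low[of x] by simp
  qed
  show "half_contraction (cayinv T)" unfolding half_contraction_def
  proof
    fix x
    obtain u where u: "x = T *v u + u"
      using minv_v(1)[OF d, of x] matrix_vector_mult_add_rdistrib[of T "mat 1"] by (metis matrix_vector_mul_lid)
    show "norm (cayinv T *v x) \<le> 1/2 * norm x" unfolding u cayinv_v[OF d] using T[of u] low[of u] norm_ge_zero[of u] by linarith
  qed
qed

primrec mat_prod :: "(nat \<Rightarrow> real^'n::finite^'n) \<Rightarrow> nat \<Rightarrow> real^'n^'n" where
  "mat_prod f 0 = mat 1"
| "mat_prod f (Suc k) = mat_prod f k ** f k"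

lemma mat_prod_Sp: "(\<And>i. i < k \<Longrightarrow> f i \<in> Sp) \<Longrightarrow> mat_prod f k \<in> Sp"
  by (induction k) (auto intro: Sp_one Sp_mult)

lemma continuous_on_mat_prod: "(\<And>i. i < k \<Longrightarrow> continuous_on S (\<lambda>t. f t i)) \<Longrightarrow> continuous_on S (\<lambda>t. mat_prod (f t) k)"
  by (induction k) (auto intro: continuous_on_mm)

lemma smooth_mat_mat_prod: "(\<And>i. i < k \<Longrightarrow> smooth_mat (\<lambda>t. f t i)) \<Longrightarrow> smooth_mat (\<lambda>t. mat_prod (f t) k)"
  by (induction k) (auto intro: smooth_mat_mult smooth_mat_const)


lemma cay_0: "cay 0 = mat 1"
proof -
  have "mat 1 ** minv (mat 1 :: real^'n^'n) = mat 1" by (rule minv) simp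
  then show ?thesis by (simp add: cay_def)
qed

text \<open>Write the path as \<open>\<psi> 0\<close> times a product of m increments, each so close
  to the identity that it has a small Cayley transform \<open>Y i t\<close>. A straight-line
  homotopy in the Lie algebra leads to \<open>t *\<^sub>R Y i 1\<close>. All factors then move
  simultaneously over the whole interval, so no corners arise at the subdivision points.\<close>

lemma smooth_homotopy:
  fixes \<psi> :: "real \<Rightarrow> 'n::finite spmat"
  assumes cont: "continuous_on {0..1} \<psi>" and Sp: "\<And>t. t \<in> {0..1} \<Longrightarrow> \<psi> t \<in> Sp"
  obtains H :: "real \<times> real \<Rightarrow> 'n spmat" where "continuous_on ({0..1} \<times> {0..1}) H" "\<And>p. p \<in> {0..1} \<times> {0..1} \<Longrightarrow> H p \<in> Sp"
    "\<And>t. t \<in> {0..1} \<Longrightarrow> H (0, t) = \<psi> t" "smooth_mat (\<lambda>t. H (1, t))"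
    "\<And>s. s \<in> {0..1} \<Longrightarrow> H (s, 0) = \<psi> 0" "\<And>s. s \<in> {0..1} \<Longrightarrow> H (s, 1) = \<psi> 1"
proof -
  define T where "T p = sp_inv (\<psi> (fst p)) ** \<psi> (snd p)" for p
  let ?Q = "{0..1::real} \<times> {0..1::real}"
  have cT: "continuous_on ?Q T" unfolding T_def
    by (intro continuous_on_mm continuous_on_sp_inv continuous_on_compose2[OF cont] continuous_intros) auto
  obtain Kb where Kb: "Kb > 0" "\<And>(M::'n spmat) x. norm (M *v x) \<le> norm M * norm x * Kb"
    using bounded_bilinear.pos_bounded[OF bounded_bilinear_matrix_vector] by blast
  have "uniformly_continuous_on ?Q T" by (intro compact_uniformly_continuous cT compact_Times) auto
  then obtain d where d: "d > 0" "\<And>p q. p \<in> ?Q \<Longrightarrow> q \<in> ?Q \<Longrightarrow> dist q p < d \<Longrightarrow> dist (T q) (T p) < 1 / (2 * Kb)"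
    unfolding uniformly_continuous_on_def using Kb(1) by (metis divide_pos_pos mult_pos_pos zero_less_one zero_less_numeral)
  obtain m :: nat where m: "m > 0" "1 / real m < d"
    using d(1) reals_Archimedean[of d] by (metis inverse_eq_divide of_nat_0_less_iff zero_less_Suc)
  \<comment> \<open>Time stopped at the i-th node. The i-th increment runs from
    \<open>lo t i\<close> to \<open>lo t (Suc i)\<close>: it is the identity until t reaches its
    subinterval and constant afterwards.\<close>
  define lo where "lo t i = min t (real i / real m)" for t :: real and i :: nat
  have lo01: "lo t i \<in> {0..1}" if "t \<in> {0..1}" for t i using that by (auto simp: lo_def)
  have lodist: "dist (lo t i) (lo t (Suc i)) < d" for t i
  proof -
    have "real (Suc i) / real m = real i / real m + 1 / real m" by (simp add: add_divide_distrib)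
    moreover have "0 \<le> 1 / real m" by simp
    moreover have "\<bar>min t x - min t y\<bar> \<le> c" if "y = x + c" "0 \<le> c" for x y c :: real using that by (auto simp: min_def)
    ultimately have "\<bar>lo t i - lo t (Suc i)\<bar> \<le> 1 / real m" unfolding lo_def by blast
    then show ?thesis using m(2) by (simp add: dist_real_def)
  qed
  define Tt where "Tt t i = T (lo t i, lo t (Suc i))" for t i
  have T1: "T (u, u) = mat 1" if "u \<in> {0..1}" for u using sp_inv(1)[OF Sp[OF that]] by (simp add: T_def)
  have Tsm: "norm (Tt t i *v x - x) \<le> 1/2 * norm x" if t: "t \<in> {0..1}" for t i x
  proof -
    have "dist (lo t i, lo t (Suc i)) (lo t i, lo t i) < d" using lodist[of t i] by (simp add: dist_Pair_Pair dist_commute)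
    then have "dist (Tt t i) (T (lo t i, lo t i)) < 1 / (2 * Kb)"
      unfolding Tt_def using lo01[OF t] by (intro d(2)) auto
    then have n: "norm (Tt t i - mat 1) < 1 / (2 * Kb)" using T1[OF lo01[OF t]] by (simp add: dist_norm)
    have "Tt t i *v x - x = (Tt t i - mat 1) *v x" by (simp add: matrix_vector_mult_diff_rdistrib)
    also have "norm \<dots> \<le> norm (Tt t i - mat 1) * norm x * Kb" by (rule Kb(2))
    also have "\<dots> \<le> 1 / (2 * Kb) * norm x * Kb" using n Kb(1) by (intro mult_right_mono) auto
    also have "\<dots> = 1/2 * norm x" using Kb(1) by simp
    finally show ?thesis .
  qed
  have TSp: "Tt t i \<in> Sp" if "t \<in> {0..1}" for t i
    unfolding Tt_def T_def using lo01[OF that] by (auto intro!: Sp_mult Sp_sp_inv Sp)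
  define Y where "Y i t = cayinv (Tt t i)" for i t
  have Y: "sp_alg (Y i t)" "half_contraction (Y i t)" "cay (Y i t) = Tt t i" if "t \<in> {0..1}" for i t
    unfolding Y_def using near_one_cayinv[OF Tsm[OF that]] cayinv_sp_alg[OF TSp[OF that]] cay_cayinv(2) by auto
  have cY: "continuous_on {0..1} (Y i)" for i
  proof -
    have "continuous_on {0..1} (\<lambda>t. Tt t i)" unfolding Tt_def lo_def
      by (rule continuous_on_compose2[OF cT]) (use m(1) in \<open>auto intro!: continuous_intros\<close>)
    then show ?thesis unfolding Y_def[abs_def] cayinv_def
      by (intro continuous_on_mm continuous_on_minv continuous_intros) (use near_one_cayinv(1)[OF Tsm] in auto)
  qed
  have Y0: "Y i 0 = 0" for i
  proof -
    have "Tt 0 i = mat 1" unfolding Tt_def lo_def using T1[of 0] by simp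
    then show ?thesis by (simp add: Y_def cayinv_def)
  qed
  \<comment> \<open>The inverse in each increment cancels the value reached by the previous
    ones.\<close>
  have tele: "\<psi> 0 ** mat_prod (Tt t) k = \<psi> (lo t k)" if t: "t \<in> {0..1}" for t k
  proof (induction k)
    case 0 then show ?case using t by (simp add: lo_def)
  next
    case (Suc k)
    have "\<psi> 0 ** mat_prod (Tt t) (Suc k) = (\<psi> 0 ** mat_prod (Tt t) k) ** Tt t k" by (simp add: matrix_mul_assoc)
    also have "\<dots> = \<psi> (lo t k) ** sp_inv (\<psi> (lo t k)) ** \<psi> (lo t (Suc k))"
      unfolding Suc by (simp add: matrix_mul_assoc Tt_def T_def)
    finally have "\<psi> 0 ** mat_prod (Tt t) (Suc k) = \<psi> (lo t k) ** sp_inv (\<psi> (lo t k)) ** \<psi> (lo t (Suc k))" .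
    then show ?case using sp_inv(2)[OF Sp[OF lo01[OF t]]] by simp
  qed
  \<comment> \<open>The weight \<open>fst p * snd p\<close> keeps the end points fixed: at time 0
    both terms vanish, as \<open>Y i 0 = 0\<close>, and at time 1 the weights add up to 1.\<close>
  define Z where "Z p i = (1 - fst p) *\<^sub>R Y i (snd p) + (fst p * snd p) *\<^sub>R Y i 1" for p i
  have Z: "sp_alg (Z p i)" "half_contraction (Z p i)" if p: "p \<in> ?Q" for p i
  proof -
    have "fst p * snd p \<le> fst p * 1" using p by (intro mult_left_mono) auto
    then have "0 \<le> 1 - fst p" "0 \<le> fst p * snd p" "1 - fst p + fst p * snd p \<le> 1" using p by auto
    then show "sp_alg (Z p i)" "half_contraction (Z p i)" unfolding Z_def using Y[of "snd p" i] Y[of 1 i] p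
      by (auto intro!: sp_alg_comb half_contraction_convex)
  qed
  define H where "H p = \<psi> 0 ** mat_prod (\<lambda>i. cay (Z p i)) m" for p
  show ?thesis
  proof
    have cZ: "continuous_on ?Q (\<lambda>p. Z p i)" for i unfolding Z_def
      by (intro continuous_intros continuous_on_compose2[OF cY]) auto
    show "continuous_on ?Q H" unfolding H_def cay_def
      by (intro continuous_on_mm continuous_on_const continuous_on_mat_prod continuous_on_minv continuous_on_add continuous_on_diff cZ half_contraction_det Z(2))
    show "H p \<in> Sp" if "p \<in> ?Q" for p unfolding H_def
      using Sp[of 0] Z[OF that] by (intro Sp_mult mat_prod_Sp cay_Sp half_contraction_det) auto
    show "H (0, t) = \<psi> t" if t: "t \<in> {0..1}" for t
    proof -
      have "H (0, t) = \<psi> 0 ** mat_prod (Tt t) m" unfolding H_def Z_def using Y(3)[OF t] by simp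
      then show ?thesis using tele[OF t, of m] m(1) t by (simp add: lo_def)
    qed
    show "H (s, 0) = \<psi> 0" if "s \<in> {0..1}" for s
    proof -
      have "mat_prod (\<lambda>i. mat 1 :: 'n spmat) k = mat 1" for k by (induction k) auto
      then show ?thesis unfolding H_def Z_def by (simp add: Y0 cay_0)
    qed
    show "H (s, 1) = \<psi> 1" if "s \<in> {0..1}" for s
    proof -
      have "(1 - s) *\<^sub>R Y i 1 + s *\<^sub>R Y i 1 = Y i 1" for i by (simp flip: scaleR_left.add)
      then have "H (s, 1) = \<psi> 0 ** mat_prod (Tt 1) m" unfolding H_def Z_def using Y(3)[of 1] by simp
      then show ?thesis using tele[of 1 m] m(1) by (simp add: lo_def)
    qed
    have "smooth_mat (\<lambda>t. cay (t *\<^sub>R Y i 1))" for i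
    proof -
      have s: "smooth_mat (\<lambda>t. t *\<^sub>R Y i 1)" by (intro smooth_mat_scaleR ck_id smooth_mat_const)
      have "det (mat 1 - t *\<^sub>R Y i 1) \<noteq> 0" if "t \<in> {0..1}" for t
        using half_contraction_det[OF Z(2)[of "(1, t)" i]] that by (simp add: Z_def)
      then show ?thesis unfolding cay_def by (intro smooth_mat_mult smooth_mat_add smooth_mat_const smooth_mat_minv smooth_mat_diff s)
    qed
    then show "smooth_mat (\<lambda>t. H (1, t))" unfolding H_def Z_def by (simp, intro smooth_mat_mult smooth_mat_const smooth_mat_mat_prod)
  qed
qed

section \<open>Rotations and the construction of regular crossings\<close>

definition rotm :: "real \<Rightarrow> 'n::finite spmat" where "rotm t = cos t *\<^sub>R mat 1 + sin t *\<^sub>R J0"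

lemma rotm_v: "rotm t *v x = cos t *\<^sub>R x + sin t *\<^sub>R (J0 *v x)"
  by (simp add: rotm_def matrix_vector_mult_add_rdistrib scaleR_matrix_vector_assoc[symmetric])

lemma rotm_isom: "(rotm t *v x) \<bullet> (rotm t *v y) = x \<bullet> y"
proof -
  have 1: "x \<bullet> (J0 *v y) = - ((J0 *v x) \<bullet> y)" using Omega0_skew[of x y] by (simp add: Omega0_eq inner_commute)
  have "(rotm t *v x) \<bullet> (rotm t *v y) = cos t * cos t * (x \<bullet> y) + cos t * sin t * (x \<bullet> (J0 *v y)) + sin t * cos t * ((J0 *v x) \<bullet> y) + sin t * sin t * ((J0 *v x) \<bullet> (J0 *v y))"
    by (simp add: rotm_v inner_add_left inner_add_right algebra_simps)
  then have "(rotm t *v x) \<bullet> (rotm t *v y) = (cos t * cos t + sin t * sin t) * (x \<bullet> y)"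
    unfolding J0_isom 1 by (simp add: algebra_simps del: sin_cos_squared_add3)
  then show ?thesis by simp
qed

lemma rotm_J0: "rotm t *v (J0 *v x) = J0 *v (rotm t *v x)"
  by (simp add: rotm_v matrix_vector_right_distrib matrix_vector_mult_scaleR)

lemma rotm_Sp: "rotm t \<in> Sp"
  unfolding Sp_iff Omega0_eq rotm_J0[symmetric] rotm_isom by simp

lemma rotm_0: "rotm 0 = mat 1" by (simp add: rotm_def)

lemma rotm_add_v: "rotm s *v (rotm t *v x) = rotm (s + t) *v x"
  by (simp add: rotm_v matrix_vector_right_distrib matrix_vector_mult_scaleR J0_J0_v cos_add sin_add algebra_simps)

lemma rotm_npi: "rotm (real k * pi + t) = (-1) ^ k *\<^sub>R rotm t"
  by (simp add: rotm_def cos_add sin_add cos_npi sin_npi scaleR_add_right)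

lemma continuous_on_rotm: assumes "continuous_on S f" shows "continuous_on S (\<lambda>t. rotm (f t))"
proof -
  have c: "continuous_on UNIV (cos :: real \<Rightarrow> real)" "continuous_on UNIV (sin :: real \<Rightarrow> real)" by (auto intro!: continuous_intros)
  have "continuous_on S (\<lambda>t. cos (f t))" "continuous_on S (\<lambda>t. sin (f t))"
    using continuous_on_compose2[OF c(1) assms] continuous_on_compose2[OF c(2) assms] by auto
  then show ?thesis unfolding rotm_def by (intro continuous_on_add continuous_on_scaleR continuous_on_const)
qed

lemma smooth_mat_rotm: assumes "\<And>k. ck k {0..1} f" shows "smooth_mat (\<lambda>t. rotm (f t))"
  unfolding rotm_def using ck_sin_cos[OF assms] by (intro smooth_mat_add smooth_mat_scaleR smooth_mat_const) auto

lemma rotm_derivative: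
  assumes "(f has_vector_derivative f') (at t within S)"
  shows "((\<lambda>t. rotm (f t)) has_vector_derivative f' *\<^sub>R (J0 ** rotm (f t))) (at t within S)"
proof -
  have c: "((\<lambda>t. cos (f t)) has_vector_derivative - sin (f t) * f') (at t within S)" "((\<lambda>t. sin (f t)) has_vector_derivative cos (f t) * f') (at t within S)"
    using assms unfolding has_real_derivative_iff_has_vector_derivative[symmetric] by (auto intro!: derivative_eq_intros)
  have "((\<lambda>t. rotm (f t)) has_vector_derivative (- sin (f t) * f') *\<^sub>R mat 1 + (cos (f t) * f') *\<^sub>R J0) (at t within S)"
    unfolding rotm_def
    by (intro has_vector_derivative_add bounded_linear.has_vector_derivative[OF bounded_linear_scaleR_left] c)
  moreover have "(- sin (f t) * f') *\<^sub>R mat 1 + (cos (f t) * f') *\<^sub>R J0 = f' *\<^sub>R (J0 ** rotm (f t))"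
  proof -
    have eq: "J0 ** rotm (f t) = cos (f t) *\<^sub>R J0 - sin (f t) *\<^sub>R mat 1"
      by (simp add: matrix_eq matrix_vector_mul_assoc[symmetric] rotm_v matrix_vector_right_distrib matrix_vector_mult_scaleR J0_J0_v
          matrix_vector_mult_diff_rdistrib scaleR_matrix_vector_assoc[symmetric])
    show ?thesis unfolding eq by (simp add: scaleR_diff_right mult.commute)
  qed
  ultimately show ?thesis by (rule has_vector_derivative_eq_rhs)
qed

lemma gr_rot: "gr.rot a (x, x) = (rotm (- a) *v x, rotm a *v x)"
  by (simp add: gr.rot_def Jbar_def rotm_v)

text \<open>A fixed vector x of the rotated matrix gives the common vector
  \<open>gr.rot \<alpha> (x, x)\<close> of the graph of g and the copy of the diagonal at angle
  \<alpha>, since \<open>gr.rot\<close> turns the two components in opposite directions.\<close>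

lemma fixspace_generic_rotation:
  fixes g :: "'n::finite spmat"
  assumes "g \<in> Sp"
  obtains \<alpha> where "0 < \<alpha>" "\<alpha> < pi" "fixspace (rotm (- \<alpha>) ** g ** rotm (- \<alpha>)) = {0}"
proof -
  obtain \<alpha> where a: "0 < \<alpha>" "\<alpha> < pi" "Gr g \<inter> gr.rot \<alpha> ` gr.L = {0}"
    using gr.generic_angle[OF lagrangian_Gr[OF assms]] by blast
  have "x = 0" if x: "(rotm (- \<alpha>) ** g ** rotm (- \<alpha>)) *v x = x" for x
  proof -
    have "rotm (- \<alpha>) *v (g *v (rotm (- \<alpha>) *v x)) = x" using x by (simp add: matrix_vector_mul_assoc matrix_mul_assoc)
    then have "rotm \<alpha> *v (rotm (- \<alpha>) *v (g *v (rotm (- \<alpha>) *v x))) = rotm \<alpha> *v x" by simp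
    then have "g *v (rotm (- \<alpha>) *v x) = rotm \<alpha> *v x" by (simp add: rotm_add_v rotm_0)
    then have "gr.rot \<alpha> (x, x) \<in> Gr g" by (simp add: gr_rot Gr_iff)
    moreover have "gr.rot \<alpha> (x, x) \<in> gr.rot \<alpha> ` gr.L" unfolding gr_L by blast
    ultimately have "gr.rot \<alpha> (x, x) = 0" using a(3) by blast
    then have "rotm \<alpha> *v x = 0" by (simp add: gr_rot zero_prod_def)
    then show "x = 0" using rotm_isom[of \<alpha> x x] by simp
  qed
  then have "fixspace (rotm (- \<alpha>) ** g ** rotm (- \<alpha>)) = {0}" by (auto simp: fixspace_def)
  then show ?thesis using that a by blast
qed

lemma fixspace_det: "fixspace A = {0} \<longleftrightarrow> det (A - mat 1) \<noteq> 0"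
  unfolding det_nz_iff fixspace_def by (auto simp: matrix_vector_mult_diff_rdistrib)

text \<open>The derivative of the projection onto the graph contains the unknown vector
  \<open>z'\<close>, but its two contributions cancel: \<open>A t\<close> is symplectic and fixes
  x.\<close>

lemma Gr_velocity:
  fixes A :: "real \<Rightarrow> 'n::finite spmat"
  assumes A: "smooth_mat A" "\<And>t. t \<in> {0..1} \<Longrightarrow> A t \<in> Sp" and t: "t \<in> {0..1}"
    and der: "(A has_vector_derivative A') (at t within {0..1})" and xy: "x \<in> fixspace (A t)" "y \<in> fixspace (A t)"
  shows "lagrangian_velocity gr.Om 0 1 (\<lambda>t. Gr (A t)) t (x, x) (y, y) = Omega0 x (A' *v y)"
proof -
  have "\<exists>d. ((\<lambda>s. gr_proj (A s) p) has_vector_derivative d) (at t within {0..1})" for p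
  proof -
    have "\<exists>d. ((\<lambda>s. gr_proj (A s) p $ i) has_vector_derivative d) (at t within {0..1})" for i
      using ck_gr_proj[OF A(1), of "Suc 0" p i] t by auto
    then obtain d where d: "\<And>i. ((\<lambda>s. gr_proj (A s) p $ i) has_vector_derivative d i) (at t within {0..1})" by metis
    have "((\<lambda>s. (gr_proj (A s) p - gr_proj (A t) p) /\<^sub>R (s - t)) \<longlongrightarrow> (\<chi> i. d i)) (at t within {0..1})"
      using d unfolding has_vector_derivative_within_slope
      by (intro vec_tendstoI) (simp add: divide_inverse)
    then show ?thesis unfolding has_vector_derivative_within_slope by blast
  qed
  then obtain z' where z': "\<And>p. ((\<lambda>s. gr_proj (A s) p) has_vector_derivative z' p) (at t within {0..1})" by metis
  define P' where "P' p = (z' p, A t *v z' p + A' *v gr_proj (A t) p)" for p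
  have P': "((\<lambda>s. closest_point (Gr (A s)) p) has_vector_derivative P' p) (at t within {0..1})" for p
    unfolding closest_point_Gr P'_def
    by (intro has_vector_derivative_Pair z' bounded_bilinear.has_vector_derivative[OF bounded_bilinear_matrix_vector der z'])
  have in_Gr: "(x, x) \<in> Gr (A t)" "(y, y) \<in> Gr (A t)" using xy by (auto simp: Gr_iff fixspace_def)
  have "gr_proj (A t) (y, y) = y"
    using closest_point_self[OF in_Gr(2)] unfolding closest_point_Gr by simp
  then have "lagrangian_velocity gr.Om 0 1 (\<lambda>t. Gr (A t)) t (x, x) (y, y) = gr.Om (x, x) (z' (y, y), A t *v z' (y, y) + A' *v y)"
    using gr.velocity_form(2)[of 0 1 "\<lambda>t. Gr (A t)" t P', OF lagrangian_Gr[OF A(2)] _ t P' in_Gr] by (simp add: P'_def)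
  also have "\<dots> = - Omega0 x (z' (y, y)) + Omega0 x (A t *v z' (y, y)) + Omega0 x (A' *v y)"
    by (simp add: gr_Om Omega_bar_def Om_simps)
  also have "Omega0 x (A t *v z' (y, y)) = Omega0 x (z' (y, y))"
    using Sp_Omega0[OF A(2)[OF t], of x "z' (y, y)"] xy by (simp add: fixspace_def)
  finally show ?thesis by simp
qed

text \<open>With \<beta> = \<open>K * t * (1 - t)\<close>, the rotations add twice the derivative of
  \<beta> times the squared norm to the crossing form. This dominates the contribution of
  \<open>g'\<close> except in a short window about t = 1/2. There \<beta> is nearly
  \<open>K / 4\<close>, chosen as a multiple of pi minus a generic angle, so that the window
  contains no crossing at all. The ends are unchanged because \<beta> vanishes there.\<close>

lemma regular_rotation:
  fixes g :: "real \<Rightarrow> 'n::finite spmat"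
  assumes g: "smooth_mat g" "\<And>t. t \<in> {0..1} \<Longrightarrow> g t \<in> Sp"
  obtains K where "regular_crossings gr.Om 0 1 (\<lambda>t. Gr (rotm (K * t * (1 - t)) ** g t ** rotm (K * t * (1 - t)))) gr.L"
proof -
  obtain g' where g': "smooth_mat g'" "\<And>t. t \<in> {0..1} \<Longrightarrow> (g has_vector_derivative g' t) (at t within {0..1})"
    using smooth_mat_has_derivative[OF g(1)] by blast
  obtain Kb where Kb: "Kb > 0" "\<And>(M::'n spmat) x. norm (M *v x) \<le> norm M * norm x * Kb"
    using bounded_bilinear.pos_bounded[OF bounded_bilinear_matrix_vector] by blast
  have "bounded (g' ` {0..1})" by (intro compact_imp_bounded compact_continuous_image smooth_mat_continuous g'(1)) auto
  then obtain B where B: "B > 0" "\<And>t. t \<in> {0..1} \<Longrightarrow> norm (g' t) \<le> B" unfolding bounded_pos by auto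
  \<comment> \<open>One more than a bound for \<open>g'\<close>, so that the domination outside the
    window is strict.\<close>
  define C where "C = B * Kb + 1"
  have C: "C > 0" using B Kb by (simp add: C_def add_pos_pos)
  have gC: "norm (g' t *v x) \<le> (C - 1) * norm x" if "t \<in> {0..1}" for t x
  proof -
    have "norm (g' t *v x) \<le> norm (g' t) * norm x * Kb" by (rule Kb(2))
    also have "\<dots> \<le> B * norm x * Kb" using B(2)[OF that] Kb by (intro mult_right_mono) auto
    finally show ?thesis by (simp add: C_def mult_ac)
  qed
  obtain \<alpha> where al: "0 < \<alpha>" "\<alpha> < pi" "fixspace (rotm (- \<alpha>) ** g (1/2) ** rotm (- \<alpha>)) = {0}"
    using fixspace_generic_rotation[OF g(2)[of "1/2"]] by auto
  define F where "F p = det (rotm (fst p) ** g (snd p) ** rotm (fst p) - mat 1)" for p :: "real \<times> real"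
  have cF: "continuous_on (UNIV \<times> {0..1}) F" unfolding F_def
    by (intro continuous_on_det continuous_on_entry continuous_on_diff continuous_on_mm continuous_on_rotm
        continuous_on_compose2[OF smooth_mat_continuous[OF g(1)]] continuous_on_const continuous_on_fst continuous_on_snd continuous_on_id) auto
  have "F (- \<alpha>, 1/2) \<noteq> 0" using al(3) unfolding fixspace_det F_def by simp
  then have "\<exists>d>0. \<forall>q\<in>UNIV \<times> {0..1}. dist q (- \<alpha>, 1/2) < d \<longrightarrow> dist (F q) (F (- \<alpha>, 1/2)) < \<bar>F (- \<alpha>, 1/2)\<bar>"
    using cF unfolding continuous_on_iff by (auto dest!: bspec[of _ _ "(- \<alpha>, 1/2)"])
  then obtain d where d: "d > 0" "\<And>q. q \<in> UNIV \<times> {0..1} \<Longrightarrow> dist q (- \<alpha>, 1/2) < d \<Longrightarrow> F q \<noteq> 0"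
    by (fastforce simp: dist_real_def)
  \<comment> \<open>Large enough that K exceeds \<open>C / d\<close> and the square of C divided by
    d: the window and the variation of \<beta> in it then stay within distance d of the generic pair
    of angle and time.\<close>
  obtain k :: nat where k: "real k > 1 + C / d + C\<^sup>2 / d" using reals_Archimedean2 by blast
  \<comment> \<open>Makes \<beta> at t = 1/2 equal to \<open>real k * pi - \<alpha>\<close>; the
    multiple of pi changes \<open>rotm\<close> by a sign that occurs twice and cancels.\<close>
  define K where "K = 4 * (real k * pi - \<alpha>)"
  have "real k > 1"
  proof -
    have "C / d > 0" "C\<^sup>2 / d > 0" using C d(1) by auto
    then show ?thesis using k by linarith
  qed
  have kp: "real k * pi - \<alpha> \<ge> real k - 1"
  proof -
    have "real k * pi - \<alpha> \<ge> real k * pi - pi" using al by simp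
    also have "real k * pi - pi = (real k - 1) * pi" by (simp add: algebra_simps)
    finally have "(real k - 1) * pi \<le> real k * pi - \<alpha>" .
    moreover have "(real k - 1) * 1 \<le> (real k - 1) * pi" using \<open>real k > 1\<close> pi_gt3 by (intro mult_left_mono) auto
    ultimately show ?thesis by simp
  qed
  then have Kpos: "K > 0" using \<open>real k > 1\<close> by (simp add: K_def)
  have K1: "C < d * K" and K2: "C\<^sup>2 < d * K"
  proof -
    have "C / d + C\<^sup>2 / d < K" using k kp \<open>real k > 1\<close> by (simp add: K_def)
    moreover have "C / d > 0" "C\<^sup>2 / d > 0" using C d(1) by auto
    ultimately have "C / d < K" "C\<^sup>2 / d < K" by linarith+
    then show "C < d * K" "C\<^sup>2 < d * K" using d(1) by (simp_all add: field_simps)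
  qed
  define \<beta> where "\<beta> t = K * t * (1 - t)" for t
  define A where "A t = rotm (\<beta> t) ** g t ** rotm (\<beta> t)" for t
  have smb: "ck j {0..1} \<beta>" for j unfolding \<beta>_def[abs_def] by (intro ck_mult ck_const ck_id ck_diff)
  have smA: "smooth_mat A" unfolding A_def[abs_def] by (intro smooth_mat_mult smooth_mat_rotm smb g(1))
  have ASp: "A t \<in> Sp" if "t \<in> {0..1}" for t unfolding A_def using g(2)[OF that] by (intro Sp_mult rotm_Sp)
  \<comment> \<open>The premise \<open>small\<close> describes the window, where the derivative of
    \<beta> is too small to dominate.\<close>
  have no_cross: "fixspace (A t) = {0}" if t: "t \<in> {0..1}" and small: "2 * \<bar>K * (1 - 2 * t)\<bar> \<le> C" for t
  proof -
    define s where "s = t - 1/2"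
    have bt: "\<beta> t = real k * pi + (- \<alpha> - K * s\<^sup>2)" by (simp add: \<beta>_def s_def K_def power2_eq_square field_simps)
    have sb: "4 * K * \<bar>s\<bar> \<le> C"
    proof -
      have "K * (1 - 2 * t) = - (2 * K * s)" by (simp add: s_def algebra_simps)
      then show ?thesis using small Kpos by (simp add: abs_mult)
    qed
    have eqA: "A t = rotm (- \<alpha> - K * s\<^sup>2) ** g t ** rotm (- \<alpha> - K * s\<^sup>2)"
    proof -
      have sg: "(-1::real) ^ k * (-1) ^ k = 1" by (simp flip: power_mult_distrib)
      show ?thesis unfolding A_def bt rotm_npi
        by (simp add: matrix_eq matrix_vector_mul_assoc[symmetric] scaleR_matrix_vector_assoc[symmetric] matrix_vector_mult_scaleR sg)
    qed
    have s1: "\<bar>s\<bar> < d / 2"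
    proof -
      have "4 * K * \<bar>s\<bar> < d * K" using sb K1 by linarith
      then have "4 * \<bar>s\<bar> < d" using Kpos by (simp add: mult.commute mult.left_commute)
      then show ?thesis by simp
    qed
    have s2: "K * s\<^sup>2 < d / 2"
    proof -
      have "(4 * K * \<bar>s\<bar>)\<^sup>2 \<le> C\<^sup>2" using sb Kpos by (intro power_mono) auto
      then have "16 * K * (K * s\<^sup>2) < d * K" using K2 by (simp add: power2_eq_square mult_ac)
      then have "16 * (K * s\<^sup>2) < d" using Kpos by (simp add: mult.commute mult.left_commute)
      moreover have "K * s\<^sup>2 \<ge> 0" using Kpos by simp
      ultimately show ?thesis by linarith
    qed
    have "dist (- \<alpha> - K * s\<^sup>2, t) (- \<alpha>, 1/2) \<le> \<bar>K * s\<^sup>2\<bar> + \<bar>s\<bar>"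
    proof -
      have "dist (- \<alpha> - K * s\<^sup>2, t) (- \<alpha>, 1/2) = norm (- (K * s\<^sup>2), s)" by (simp add: dist_norm s_def)
      also have "\<dots> \<le> norm (- (K * s\<^sup>2)) + norm s" by (rule norm_Pair_le)
      finally show ?thesis by simp
    qed
    then have "dist (- \<alpha> - K * s\<^sup>2, t) (- \<alpha>, 1/2) < d" using s1 s2 Kpos by (simp add: abs_mult)
    then have "F (- \<alpha> - K * s\<^sup>2, t) \<noteq> 0" using d(2) t by auto
    then show ?thesis unfolding fixspace_det eqA F_def by simp
  qed
  have "regular_crossings gr.Om 0 1 (\<lambda>t. Gr (A t)) gr.L"
    unfolding regular_crossings_def
  proof (intro ballI impI)
    fix t :: real assume t: "t \<in> {0..1}" and cr: "crossing (\<lambda>t. Gr (A t)) gr.L t"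
    have fx: "fixspace (A t) \<noteq> {0}"
    proof
      assume "fixspace (A t) = {0}"
      then show False using cr unfolding crossing_def Gr_inter_L by (simp add: zero_prod_def)
    qed
    then have big: "2 * \<bar>K * (1 - 2 * t)\<bar> > C" using no_cross[OF t] by fastforce
    obtain b where b: "b = K * (1 - 2 * t)" by blast
    let ?R = "rotm (\<beta> t)"
    have db: "(\<beta> has_vector_derivative b) (at t within {0..1})"
      unfolding \<beta>_def[abs_def] has_real_derivative_iff_has_vector_derivative[symmetric]
      by (auto intro!: derivative_eq_intros simp: algebra_simps b)
    note dR = rotm_derivative[OF db]
    define A' where "A' = (?R ** g t) ** (b *\<^sub>R (J0 ** ?R)) + (?R ** g' t + (b *\<^sub>R (J0 ** ?R)) ** g t) ** ?R"
    have dA: "(A has_vector_derivative A') (at t within {0..1})" unfolding A_def[abs_def] A'_def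
      by (intro bounded_bilinear.has_vector_derivative[OF bounded_bilinear_matrix_mult] dR g'(2) t)
    show "nondegenerate_on (Gr (A t) \<inter> gr.L) (lagrangian_velocity gr.Om 0 1 (\<lambda>t. Gr (A t)) t)"
      unfolding nondegenerate_on_def
    proof (intro ballI impI)
      fix v assume v: "v \<in> Gr (A t) \<inter> gr.L" and 0: "\<forall>w\<in>Gr (A t) \<inter> gr.L. lagrangian_velocity gr.Om 0 1 (\<lambda>t. Gr (A t)) t v w = 0"
      obtain x where x: "x \<in> fixspace (A t)" "v = (x, x)" using v unfolding Gr_inter_L by blast
      have z: "Omega0 x (A' *v x) = 0" using Gr_velocity[OF smA ASp t dA x(1) x(1)] 0 v x(2) by simp
      have Ax: "?R *v (g t *v (?R *v x)) = x" using x(1) by (simp add: fixspace_def A_def matrix_vector_mul_assoc[symmetric])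
      have "A' *v x = b *\<^sub>R (?R *v (g t *v (?R *v (J0 *v x)))) + ?R *v (g' t *v (?R *v x)) + b *\<^sub>R (J0 *v (?R *v (g t *v (?R *v x))))"
        by (simp add: A'_def matrix_vector_mult_add_rdistrib matrix_vector_mul_assoc[symmetric] scaleR_matrix_vector_assoc[symmetric]
            matrix_vector_mult_scaleR rotm_J0 algebra_simps)
      moreover have "Omega0 x (?R *v (g t *v (?R *v (J0 *v x)))) = Omega0 x (J0 *v x)"
      proof -
        have "Omega0 (A t *v x) (A t *v (J0 *v x)) = Omega0 x (J0 *v x)" by (rule Sp_Omega0[OF ASp[OF t]])
        then show ?thesis unfolding A_def matrix_vector_mul_assoc[symmetric] Ax .
      qed
      ultimately have "0 = 2 * b * Omega0 x (J0 *v x) + Omega0 x (?R *v (g' t *v (?R *v x)))"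
        using z Ax by (simp add: Om_simps)
      \<comment> \<open>On a fixed vector of the symplectic matrix \<open>A t\<close> the two
        rotation factors contribute equally, whence the factor 2; the right side is bounded by
        \<open>C - 1\<close> times the squared norm.\<close>
      then have e: "2 * b * (norm x)\<^sup>2 = - Omega0 x (?R *v (g' t *v (?R *v x)))"
        by (simp add: Omega0_eq J0_isom power2_norm_eq_inner)
      have nR: "norm (?R *v w) = norm w" for w by (simp add: norm_eq_sqrt_inner rotm_isom)
      have nJ: "norm (J0 *v w) = norm w" for w :: "'n spvec" by (simp add: norm_eq_sqrt_inner J0_isom)
      have "\<bar>Omega0 x (?R *v (g' t *v (?R *v x)))\<bar> \<le> norm x * ((C - 1) * norm x)"
      proof -
        have "\<bar>Omega0 x (?R *v (g' t *v (?R *v x)))\<bar> \<le> norm (J0 *v x) * norm (?R *v (g' t *v (?R *v x)))"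
          unfolding Omega0_eq by (rule Cauchy_Schwarz_ineq2)
        also have "\<dots> = norm x * norm (g' t *v (?R *v x))" by (simp add: nR nJ)
        also have "\<dots> \<le> norm x * ((C - 1) * norm (?R *v x))" using gC[OF t] by (intro mult_left_mono) auto
        finally show ?thesis by (simp add: nR)
      qed
      then have "2 * \<bar>b\<bar> * (norm x)\<^sup>2 \<le> (C - 1) * (norm x)\<^sup>2"
        using arg_cong[OF e, of abs] by (simp add: abs_mult power2_eq_square mult_ac)
      moreover have "C * (norm x)\<^sup>2 \<le> 2 * \<bar>b\<bar> * (norm x)\<^sup>2" using big b by (intro mult_right_mono) auto
      ultimately have "C * (norm x)\<^sup>2 \<le> (C - 1) * (norm x)\<^sup>2" by (rule order_trans[rotated])
      then have "(norm x)\<^sup>2 \<le> 0" by (simp add: algebra_simps)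
      then show "v = 0" using x(2) by (simp add: zero_prod_def)
    qed
  qed
  then show ?thesis using that[of K] unfolding A_def[abs_def] \<beta>_def by simp
qed

text \<open>The regular representative is reached by two homotopies with fixed ends: smoothing, then
  turning on the rotations with the homotopy parameter as amplitude.\<close>

theorem rs_index_eq:
  fixes \<psi> :: "real \<Rightarrow> 'n::finite spmat"
  assumes cont: "continuous_on {0..1} \<psi>" and Sp: "\<And>t. t \<in> {0..1} \<Longrightarrow> \<psi> t \<in> Sp" and th: "sp_lift 0 1 \<psi> \<theta>"
  shows "rs_index 0 1 \<psi> = sp_index \<theta> \<psi> 1 - sp_index \<theta> \<psi> 0"
proof -
  obtain H where H: "continuous_on ({0..1} \<times> {0..1}) H" "\<And>p. p \<in> {0..1} \<times> {0..1} \<Longrightarrow> H p \<in> Sp"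
    "\<And>t. t \<in> {0..1} \<Longrightarrow> H (0, t) = \<psi> t" "smooth_mat (\<lambda>t. H (1::real, t))"
    "\<And>s. s \<in> {0..1} \<Longrightarrow> H (s, 0) = \<psi> 0" "\<And>s. s \<in> {0..1} \<Longrightarrow> H (s, 1) = \<psi> 1"
    using smooth_homotopy[OF cont Sp] by metis
  define g where "g t = H (1, t)" for t
  have gS: "smooth_mat g" "\<And>t. t \<in> {0..1} \<Longrightarrow> g t \<in> Sp" unfolding g_def[abs_def] using H by auto
  obtain K where K: "regular_crossings gr.Om 0 1 (\<lambda>t. Gr (rotm (K * t * (1 - t)) ** g t ** rotm (K * t * (1 - t)))) gr.L"
    using regular_rotation[OF gS] by blast
  define A where "A t = rotm (K * t * (1 - t)) ** g t ** rotm (K * t * (1 - t))" for t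
  have sA: "smooth_mat A" unfolding A_def[abs_def] by (intro smooth_mat_mult smooth_mat_rotm ck_mult ck_const ck_id ck_diff gS)
  have ASp: "A t \<in> Sp" if "t \<in> {0..1}" for t unfolding A_def using gS(2)[OF that] by (intro Sp_mult rotm_Sp)
  have h1: "homotopic_with (\<lambda>\<gamma>. \<gamma> 0 = Gr (\<psi> 0) \<and> \<gamma> 1 = Gr (\<psi> 1)) (top_of_set {0..1}) (lagrangian_topology gr.Om) (\<lambda>t. Gr (\<psi> t)) (\<lambda>t. Gr (g t))"
    by (rule homotopic_Gr[OF H(1,2,3) _ H(5,6)]) (auto simp: g_def)
  define H2 where "H2 p = rotm (fst p * (K * snd p * (1 - snd p))) ** g (snd p) ** rotm (fst p * (K * snd p * (1 - snd p)))" for p :: "real \<times> real"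
  have h2: "homotopic_with (\<lambda>\<gamma>. \<gamma> 0 = Gr (\<psi> 0) \<and> \<gamma> 1 = Gr (\<psi> 1)) (top_of_set {0..1}) (lagrangian_topology gr.Om) (\<lambda>t. Gr (g t)) (\<lambda>t. Gr (A t))"
  proof (rule homotopic_Gr[where H = H2])
    show "continuous_on ({0..1} \<times> {0..1}) H2" unfolding H2_def
      by (intro continuous_on_mm continuous_on_rotm continuous_on_compose2[OF smooth_mat_continuous[OF gS(1)]] continuous_intros) auto
    show "H2 p \<in> Sp" if "p \<in> {0..1} \<times> {0..1}" for p unfolding H2_def using gS(2)[of "snd p"] that by (intro Sp_mult rotm_Sp) auto
  qed (use H(5,6)[of 1] in \<open>auto simp: H2_def A_def rotm_0 g_def\<close>)
  have hom: "homotopic_with (\<lambda>\<gamma>. \<gamma> 0 = Gr (\<psi> 0) \<and> \<gamma> 1 = Gr (\<psi> 1)) (top_of_set {0..1}) (lagrangian_topology gr.Om) (\<lambda>t. Gr (\<psi> t)) (\<lambda>t. Gr (A t))"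
    by (rule homotopic_with_trans[OF h1 h2])
  have "lagrangian_rs_index gr.Om 0 1 (\<lambda>t. Gr (\<psi> t)) gr.L
      = (\<theta> 1 + gr.correction (Gr (\<psi> 1))) - (\<theta> 0 + gr.correction (Gr (\<psi> 0)))"
    by (rule gr.lagrangian_rs_index_eq[OF _ smooth_path_Gr[OF sA ASp] _ hom])
      (use K th in \<open>auto simp: A_def sp_lift_def\<close>)
  then show ?thesis unfolding rs_index_def sp_index_def gr_Om gr_L Gr_def .
qed

section \<open>Block determinants and the Souriau determinant on the unitary group\<close>

declare transpose_matrix_vector [simp del]

lemma permutes_range_Inl:
  "{p. p permutes (range Inl :: ('a::finite + 'b::finite) set)} = map_permutation UNIV Inl ` {q. q permutes (UNIV :: 'a set)}"
proof (intro subset_antisym subsetI)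
  have bj: "bij_betw (Inl :: 'a \<Rightarrow> 'a + 'b) UNIV (range Inl)" by (simp add: bij_betw_def)
  fix p :: "'a + 'b \<Rightarrow> 'a + 'b"
  assume "p \<in> map_permutation UNIV Inl ` {q. q permutes (UNIV :: 'a set)}"
  then show "p \<in> {p. p permutes range Inl}" using map_permutation_permutes[OF bj] by auto
next
  have bj: "bij_betw (Inl :: 'a \<Rightarrow> 'a + 'b) UNIV (range Inl)" by (simp add: bij_betw_def)
  fix p :: "'a + 'b \<Rightarrow> 'a + 'b"
  assume p: "p \<in> {p. p permutes range Inl}"
  define q where "q = inv_into UNIV Inl \<circ> p \<circ> (Inl :: 'a \<Rightarrow> 'a + 'b)"
  have Iq: "Inl (q x) = p (Inl x)" for x
  proof -
    have "p (Inl x) \<in> range Inl" using p permutes_in_image[of p "range Inl" "Inl x"] by auto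
    then show ?thesis unfolding q_def o_def by (rule f_inv_into_f)
  qed
  have "inj q"
  proof (rule injI)
    fix x y assume "q x = q y"
    then have "p (Inl x) = p (Inl y)" using Iq by metis
    then show "x = y" using p permutes_inj[of p] by (auto dest: injD)
  qed
  then have qp: "q permutes UNIV" by (intro bij_imp_permutes) (auto simp: bij_betw_def finite_UNIV_inj_surj)
  have "map_permutation UNIV Inl q = p"
  proof
    fix y
    show "map_permutation UNIV Inl q y = p y"
    proof (cases y)
      case (Inl x)
      then show ?thesis using map_permutation_apply[of Inl UNIV x q] Iq by (metis UNIV_I inj_Inl)
    next
      case (Inr z)
      have "map_permutation UNIV Inl q permutes range (Inl :: 'a \<Rightarrow> 'a + 'b)" by (rule map_permutation_permutes[OF bj qp])
      then have "map_permutation UNIV Inl q (Inr z) = Inr z" by (rule permutes_not_in) auto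
      moreover have "p (Inr z) = Inr z" using p by (intro permutes_not_in[of p "range Inl"]) auto
      ultimately show ?thesis using Inr by simp
    qed
  qed
  then show "p \<in> map_permutation UNIV Inl ` {q. q permutes UNIV}" using qp by blast
qed

text \<open>The lower rows are those of the identity, so a permutation with nonzero term fixes every
  \<open>Inr k\<close> and comes from a permutation of the upper indices with the same sign.\<close>

lemma det_block_Inl: "det (block_mat A B 0 (mat 1)) = det A" for A :: "'a::comm_ring_1^'n::finite^'n"
proof -
  let ?M = "block_mat A B 0 (mat 1)"
  let ?t = "\<lambda>p. of_int (sign p) * (\<Prod>i\<in>UNIV. ?M $ i $ p i)"
  have fixp: "p permutes range Inl" if p: "p permutes UNIV" and ne: "?t p \<noteq> 0" for p :: "'n + 'n \<Rightarrow> 'n + 'n"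
  proof -
    have "p (Inr k) = Inr k" for k
    proof (rule ccontr)
      assume c: "p (Inr k) \<noteq> Inr k"
      have "?M $ Inr k $ p (Inr k) = 0" using c by (cases "p (Inr k)") (auto simp: block_mat_def mat_def)
      then have "(\<Prod>i\<in>UNIV. ?M $ i $ p i) = 0" by (intro prod_zero) auto
      then show False using ne by simp
    qed
    then show ?thesis using p unfolding permutes_def by (metis rangeI sum.exhaust)
  qed
  have inj: "inj_on (map_permutation UNIV (Inl :: 'n \<Rightarrow> 'n + 'n)) {q. q permutes UNIV}"
    by (intro inj_onI ext) (metis UNIV_I inj_Inl map_permutation_apply sum.inject(1))
  have "det ?M = (\<Sum>p | p permutes UNIV. ?t p)" by (simp add: det_def)
  also have "\<dots> = (\<Sum>p | p permutes range Inl. ?t p)"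
  proof (rule sum.mono_neutral_right)
    show "{p. p permutes range Inl} \<subseteq> {p. p permutes (UNIV :: ('n + 'n) set)}" using permutes_subset by blast
    show "\<forall>p\<in>{p. p permutes UNIV} - {p. p permutes range Inl}. ?t p = 0" using fixp by blast
  qed (simp add: finite_permutations)
  also have "\<dots> = (\<Sum>q | q permutes UNIV. ?t (map_permutation UNIV Inl q))"
    unfolding permutes_range_Inl using sum.reindex[OF inj, of ?t] by (simp add: o_def)
  also have "\<dots> = (\<Sum>q | q permutes UNIV. of_int (sign q) * (\<Prod>i\<in>UNIV. A $ i $ q i))"
  proof (rule sum.cong[OF refl])
    fix q :: "'n \<Rightarrow> 'n" assume "q \<in> {q. q permutes UNIV}"
    then have q: "q permutes UNIV" by simp
    let ?p = "map_permutation UNIV (Inl :: 'n \<Rightarrow> 'n + 'n) q"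
    have bj: "bij_betw (Inl :: 'n \<Rightarrow> 'n + 'n) UNIV (range Inl)" by (simp add: bij_betw_def)
    have pl: "?p (Inl i) = Inl (q i)" for i by (rule map_permutation_apply) auto
    have pr: "?p (Inr k) = Inr k" for k by (rule permutes_not_in[OF map_permutation_permutes[OF bj q]]) auto
    have "(\<Prod>i\<in>UNIV. ?M $ i $ ?p i) = (\<Prod>i\<in>UNIV. ?M $ Inl i $ ?p (Inl i)) * (\<Prod>k\<in>UNIV. ?M $ Inr k $ ?p (Inr k))"
      using prod.Plus[of "UNIV :: 'n set" "UNIV :: 'n set" "\<lambda>i. ?M $ i $ ?p i"] by (simp add: UNIV_Plus_UNIV)
    also have "\<dots> = (\<Prod>i\<in>UNIV. A $ i $ q i)" unfolding pl pr by (simp add: block_mat_def mat_def)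
    finally show "?t ?p = of_int (sign q) * (\<Prod>i\<in>UNIV. A $ i $ q i)"
      using sign_map_permutation[of "Inl :: 'n \<Rightarrow> 'n + 'n" UNIV q] q by simp
  qed
  finally show ?thesis by (simp add: det_def)
qed

text \<open>Rows and columns are exchanged by the same permutation, so its sign occurs
  twice.\<close>

lemma det_block_swap: "det (block_mat A B C D) = det (block_mat D C B A)" for A :: "'a::comm_ring_1^'n::finite^'n"
proof -
  define \<sigma> :: "'n + 'n \<Rightarrow> 'n + 'n" where "\<sigma> x = (case x of Inl i \<Rightarrow> Inr i | Inr i \<Rightarrow> Inl i)" for x
  have ss: "\<sigma> (\<sigma> x) = x" for x by (simp add: \<sigma>_def split: sum.split)
  then have "bij \<sigma>" by (intro o_bij[of \<sigma>]) (auto simp: o_def id_def)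
  then have per: "\<sigma> permutes UNIV" by (intro bij_imp_permutes) auto
  let ?M = "block_mat A B C D"
  have "block_mat D C B A = (\<chi> i. (\<chi> i j. ?M $ i $ \<sigma> j) $ \<sigma> i)"
    by (simp add: vec_eq_iff block_mat_def \<sigma>_def split: sum.split)
  then have "det (block_mat D C B A) = of_int (sign \<sigma>) * (of_int (sign \<sigma>) * det ?M)"
    using det_permute_rows[OF per, of "\<chi> i j. ?M $ i $ \<sigma> j"] det_permute_columns[OF per, of ?M] by simp
  also have "\<dots> = of_int (sign \<sigma> * sign \<sigma>) * det ?M" by (simp only: of_int_mult mult.assoc)
  also have "sign \<sigma> * sign \<sigma> = 1" by (simp add: sign_def)
  finally show ?thesis by simp
qed

lemma transpose_mat_one: "transpose (mat 1 :: 'a::zero_neq_one^'n^'n) = mat 1"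
  by (simp add: vec_eq_iff transpose_def mat_def)

lemma det_block_upper: "det (block_mat A B 0 D) = det A * det D" for A :: "'a::comm_ring_1^'n::finite^'n"
proof -
  have 1: "mat 1 ** A + B ** 0 = A" "mat 1 ** 0 + B ** mat 1 = B" "0 ** A + D ** 0 = 0" "0 ** 0 + D ** mat 1 = D"
    by (simp_all add: vec_eq_iff matrix_matrix_mult_def mat_def if_distrib[of "\<lambda>x. x * _"] if_distrib[of "\<lambda>x. _ * x"] cong: if_cong)
  have "block_mat A B 0 D = block_mat (mat 1) B 0 D ** block_mat A 0 0 (mat 1)" unfolding block_mat_mult 1 ..
  moreover have "det (block_mat (mat 1) B 0 D) = det D"
  proof -
    have z: "transpose (0 :: 'a^'n^'n) = 0" by (simp add: vec_eq_iff transpose_def)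
    have "det (block_mat (mat 1) B 0 D) = det (transpose (block_mat D 0 B (mat 1)))" unfolding det_transpose by (rule det_block_swap)
    also have "\<dots> = det (transpose D)" unfolding block_mat_transpose transpose_mat_one z by (rule det_block_Inl)
    finally show ?thesis by simp
  qed
  ultimately show ?thesis by (simp add: det_mul det_block_Inl mult.commute)
qed

text \<open>Conjugation with a unipotent lower triangular matrix with entries plus and minus i makes
  the matrix block triangular with diagonal blocks \<open>S + D\<close> and
  \<open>S - D\<close>.\<close>

lemma det_block_complex_structure:
  fixes S D :: "complex^'n::finite^'n"
  shows "det (block_mat S (mat (- \<i>) ** D) (mat \<i> ** D) S) = det (S + D) * det (S - D)"
proof -
  have ml: "(mat c ** A) $ i $ j = c * A $ i $ j" and mr: "(A ** mat c) $ i $ j = A $ i $ j * c" for c and A :: "complex^'n^'n" and i j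
    by (simp_all add: matrix_matrix_mult_def mat_def if_distrib[of "\<lambda>x. x * _"] if_distrib[of "\<lambda>x. _ * x"] cong: if_cong)
  have z: "(0 :: complex^'n^'n) ** A = 0" "A ** 0 = 0" for A :: "complex^'n^'n"
    by (simp_all add: vec_eq_iff matrix_matrix_mult_def)
  let ?W = "block_mat S (mat (- \<i>) ** D) (mat \<i> ** D) S"
  have e: "block_mat (mat 1) 0 (mat (- \<i>)) (mat 1) ** ?W ** block_mat (mat 1) 0 (mat \<i>) (mat 1) = block_mat (S + D) (mat (- \<i>) ** D) 0 (S - D)"
    unfolding block_mat_mult z by (simp add: vec_eq_iff block_mat_def ml mr matrix_mul_assoc[symmetric] algebra_simps split: sum.split)
  have d: "det (block_mat (mat 1) 0 (mat c) (mat 1 :: complex^'n^'n)) = 1" for c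
    by (subst det_block_swap) (simp add: det_block_upper)
  have "det ?W = det (block_mat (S + D) (mat (- \<i>) ** D) 0 (S - D))"
    unfolding e[symmetric] by (simp add: det_mul d)
  then show ?thesis by (simp add: det_block_upper)
qed

lemma unitary_commute: assumes "U \<in> Sp" "orthogonal_matrix U" shows "U *v (J0 *v x) = J0 *v (U *v x)"
proof -
  have iso: "(U *v x) \<bullet> (U *v y) = x \<bullet> y" for x y
    using assms(2) by (simp add: transpose_adj matrix_vector_mul_assoc orthogonal_matrix)
  have UU: "U *v (transpose U *v y) = y" for y
    using assms(2) by (simp add: matrix_vector_mul_assoc orthogonal_matrix_def)
  have "(U *v (J0 *v x)) \<bullet> y = (J0 *v (U *v x)) \<bullet> y" for y
  proof -
    have "(U *v (J0 *v x)) \<bullet> (U *v (transpose U *v y)) = (J0 *v (U *v x)) \<bullet> (U *v (transpose U *v y))"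
      unfolding iso using Sp_Omega0[OF assms(1), of x "transpose U *v y"] by (simp add: Omega0_eq)
    then show ?thesis by (simp add: UU)
  qed
  then show ?thesis by (metis vector_eq_rdot)
qed

text \<open>For orthogonal U the normal equations have matrix 2 times the identity, so the
  projection is an average.\<close>

lemma closest_point_Gr_unitary:
  assumes "orthogonal_matrix U"
  shows "closest_point (Gr U) (x, y) = ((1/2) *\<^sub>R (x + transpose U *v y), (1/2) *\<^sub>R (U *v x + y))"
proof (rule closest_point_subspaceI)
  have lin: "linear (\<lambda>x. (x, U *v x))" by (intro linearI) (auto simp: matrix_vector_right_distrib matrix_vector_mult_scaleR)
  show "subspace (Gr U)" unfolding Gr_def by (rule linear_subspace_image[OF lin subspace_UNIV])
  have UU: "U *v (transpose U *v y) = y" and UU': "transpose U *v (U *v y) = y" for y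
    using assms by (simp_all add: matrix_vector_mul_assoc orthogonal_matrix_def)
  show "((1/2) *\<^sub>R (x + transpose U *v y), (1/2) *\<^sub>R (U *v x + y)) \<in> Gr U"
    by (simp add: Gr_iff matrix_vector_mult_scaleR matrix_vector_right_distrib UU)
  fix v assume "v \<in> Gr U"
  then obtain w where w: "v = (w, U *v w)" by (auto simp: Gr_def)
  have "(x - (1/2) *\<^sub>R (x + transpose U *v y)) = (1/2) *\<^sub>R (x - transpose U *v y)" "(y - (1/2) *\<^sub>R (U *v x + y)) = (1/2) *\<^sub>R (y - U *v x)"
    by (simp_all add: scaleR_add_right scaleR_diff_right field_simps flip: scaleR_left.add)
  moreover have "(y - U *v x) \<bullet> (U *v w) = (transpose U *v y - x) \<bullet> w"
    using transpose_adj[of "transpose U" "y - U *v x" w] by (simp add: matrix_vector_mult_diff_distrib UU')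
  ultimately show "((x, y) - ((1/2) *\<^sub>R (x + transpose U *v y), (1/2) *\<^sub>R (U *v x + y))) \<bullet> v = 0"
    by (simp add: w inner_prod_def inner_diff_left add_divide_distrib[symmetric])
qed

lemma J0_axis_inner: "v \<bullet> (J0 *v axis (Inl k) 1) = v $ Inr k" "v \<bullet> (J0 *v axis (Inr k) 1) = - v $ Inl k"
proof -
  have c: "(J0 *v axis l 1) $ i = J0 $ i $ l" for l i
    by (simp add: matrix_vector_mult_def axis_def if_distrib[of "\<lambda>x. _ * x"] cong: if_cong)
  show "v \<bullet> (J0 *v axis (Inl k) 1) = v $ Inr k" "v \<bullet> (J0 *v axis (Inr k) 1) = - v $ Inl k"
    unfolding inner_vec_def sum_UNIV_Plus c
    by (simp_all add: J0_def block_mat_def mat_def if_distrib[of "\<lambda>x. _ * x"] if_distrib[of uminus] cong: if_cong)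
qed

lemma souriau_unitary_entries:
  assumes U: "U \<in> Sp" "orthogonal_matrix U"
  shows "gr.souriau_mat (Gr U) $ j $ l = Complex ((U $ j $ l + U $ l $ j) / 2)
     (((U *v axis j 1) \<bullet> (J0 *v axis l 1) - (transpose U *v axis j 1) \<bullet> (J0 *v axis l 1)) / 2)"
proof -
  let ?a = "\<lambda>j. axis j 1 :: 'a spvec"
  let ?P = "closest_point (Gr U)"
  have lin: "linear ?P" using closest_point_subspace(3)[OF gr.lagrangianD(1)[OF lagrangian_Gr[OF U(1)]]] .
  have E: "Ebar j = (1 / sqrt 2) *\<^sub>R (?a j, ?a j)" for j by (simp add: Ebar_def)
  have JE: "Jbar (Ebar j) = (1 / sqrt 2) *\<^sub>R (- (J0 *v ?a j), J0 *v ?a j)" for j by (simp add: Ebar_def Jbar_def matrix_vector_mult_scaleR)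
  have s2: "(1 / sqrt 2) * ((1 / sqrt 2) * x) = x / 2" for x :: real by (simp add: field_simps flip: power2_eq_square)
  have ax: "(A *v ?a j) \<bullet> ?a l = A $ l $ j" for A j l
  proof -
    have "(A *v ?a j) \<bullet> ?a l = (A *v ?a j) $ l" by (simp add: inner_axis)
    also have "\<dots> = A $ l $ j" by (simp add: matrix_vector_mult_def axis_def if_distrib[of "\<lambda>x. _ * x"] cong: if_cong)
    finally show ?thesis .
  qed
  have UJ: "U *v (J0 *v x) = J0 *v (U *v x)" for x by (rule unitary_commute[OF U])
  have TJ: "transpose U *v (J0 *v x) = J0 *v (transpose U *v x)" for x
  proof -
    have o: "transpose U *v (U *v y) = y" "U *v (transpose U *v y) = y" for y
      using U(2) by (simp_all add: matrix_vector_mul_assoc orthogonal_matrix_def)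
    have "transpose U *v (J0 *v (U *v (transpose U *v x))) = transpose U *v (U *v (J0 *v (transpose U *v x)))" by (simp only: UJ)
    then show ?thesis by (simp only: o)
  qed
  have aa: "?a j \<bullet> ?a l = (if j = l then 1 else 0)" for j l by (simp add: inner_axis_axis)
  have Jl: "(J0 *v x) \<bullet> y = - (x \<bullet> (J0 *v y))" for x y :: "'a spvec"
    using Omega0_skew[of x y] by (simp add: Omega0_eq inner_commute)
  have TT: "(transpose U *v ?a j) \<bullet> ?a l = U $ j $ l" for j l unfolding ax by (simp add: transpose_def)
  have r1: "?P (Ebar j) \<bullet> Ebar l = ((if j = l then 2 else 0) + U $ j $ l + U $ l $ j) / 4"
    unfolding E linear_cmul[OF lin] closest_point_Gr_unitary[OF U(2)]
    by (simp add: inner_add_left s2 aa TT ax transpose_def field_simps)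
  have r2: "?P (Jbar (Ebar j)) \<bullet> Jbar (Ebar l) = ((if j = l then 2 else 0) - U $ j $ l - U $ l $ j) / 4"
    unfolding JE linear_cmul[OF lin] closest_point_Gr_unitary[OF U(2)] matrix_vector_uminus_right UJ TJ
    by (simp add: inner_add_left inner_diff_left s2 aa TT ax J0_isom transpose_def field_simps)
  have i1: "?P (Ebar j) \<bullet> Jbar (Ebar l) = ((U *v ?a j) \<bullet> (J0 *v ?a l) - (transpose U *v ?a j) \<bullet> (J0 *v ?a l)) / 4"
    unfolding JE unfolding E linear_cmul[OF lin] closest_point_Gr_unitary[OF U(2)]
    by (simp add: inner_add_left s2 field_simps)
  have i2: "?P (Jbar (Ebar j)) \<bullet> Ebar l = ((U *v ?a j) \<bullet> (J0 *v ?a l) - (transpose U *v ?a j) \<bullet> (J0 *v ?a l)) / 4"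
    unfolding JE unfolding E linear_cmul[OF lin] closest_point_Gr_unitary[OF U(2)] matrix_vector_uminus_right UJ TJ
    by (simp add: inner_add_left inner_diff_left s2 Jl field_simps)
  show ?thesis unfolding gr.souriau_mat_def Let_def vec_lambda_beta r1 r2 i1 i2 by (simp add: field_simps)
qed

text \<open>With Z the complex matrix of U, the Souriau matrix has the shape of
  \<open>det_block_complex_structure\<close>, where S is the symmetric part of Z and D minus its
  antisymmetric part. The two factors are the determinants of the transpose of Z and of Z; this is
  why the square of \<open>det_C\<close> appears.\<close>

theorem souriau_unitary:
  assumes U: "U \<in> Sp" "orthogonal_matrix U"
  shows "gr.souriau (Gr U) = (det_C U)\<^sup>2"
proof -
  have "(U ** J0) *v x = (J0 ** U) *v x" for x
    using unitary_commute[OF U] by (simp add: matrix_vector_mul_assoc[symmetric])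
  then have c: "(U ** J0) $ i $ j = (J0 ** U) $ i $ j" for i j using matrix_eq by metis
  have JU: "(J0 ** U) $ Inl i $ j = - U $ Inr i $ j" "(J0 ** U) $ Inr i $ j = U $ Inl i $ j"
    "(U ** J0) $ j $ Inl i = U $ j $ Inr i" "(U ** J0) $ j $ Inr i = - U $ j $ Inl i" for i j
    by (simp_all add: matrix_matrix_mult_def sum_UNIV_Plus J0_def block_mat_def mat_def
        if_distrib[of "\<lambda>x. _ * x"] if_distrib[of "\<lambda>x. x * _"] if_distrib[of uminus] cong: if_cong)
  have b1: "U $ Inr i $ Inr j = U $ Inl i $ Inl j" for i j using c[of "Inr i" "Inl j"] unfolding JU by simp
  have b2: "U $ Inl i $ Inr j = - U $ Inr i $ Inl j" for i j using c[of "Inl i" "Inl j"] unfolding JU by simp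
  define Z where "Z = (\<chi> i j. Complex (U $ Inl i $ Inl j) (U $ Inr i $ Inl j))"
  define S where "S = (\<chi> i j. (Z $ i $ j + Z $ j $ i) / 2)"
  define D where "D = (\<chi> i j. (Z $ j $ i - Z $ i $ j) / 2)"
  have ml: "(mat c ** A) $ i $ j = c * A $ i $ j" for c and A :: "complex^'a^'a" and i j
    by (simp add: matrix_matrix_mult_def mat_def if_distrib[of "\<lambda>x. x * _"] cong: if_cong)
  have cv: "(A *v axis j 1) $ i = A $ i $ j" for A :: "'a spmat" and i j
    by (simp add: matrix_vector_mult_def axis_def if_distrib[of "\<lambda>x. _ * x"] cong: if_cong)
  have "gr.souriau_mat (Gr U) $ i $ j = block_mat S (mat (- \<i>) ** D) (mat \<i> ** D) S $ i $ j" for i j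
    unfolding souriau_unitary_entries[OF U]
    by (cases i; cases j; simp add: J0_axis_inner cv block_mat_def ml S_def D_def Z_def b1 b2 transpose_def complex_eq_iff field_simps)
  then have "gr.souriau_mat (Gr U) = block_mat S (mat (- \<i>) ** D) (mat \<i> ** D) S" by (simp add: vec_eq_iff)
  then have "gr.souriau (Gr U) = det (S + D) * det (S - D)" unfolding gr.souriau_def by (simp add: det_block_complex_structure)
  moreover have "S + D = transpose Z" "S - D = Z" by (simp_all add: vec_eq_iff S_def D_def transpose_def field_simps)
  ultimately show ?thesis by (simp add: det_C_def Z_def power2_eq_square)
qed

section \<open>The retraction of the symplectic group onto the unitary group\<close>

definition posdef :: "real^'n::finite^'n \<Rightarrow> bool" where
  "posdef P \<longleftrightarrow> (\<forall>x y. (P *v x) \<bullet> y = x \<bullet> (P *v y)) \<and> (\<forall>x. x \<noteq> 0 \<longrightarrow> 0 < x \<bullet> (P *v x))"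

lemma bilinear_matrix_form: "bilinear (\<lambda>x y. x \<bullet> (A *v y))" for A :: "real^'n::finite^'n"
  unfolding bilinear_def by (auto intro!: linearI simp: matrix_vector_right_distrib matrix_vector_mult_scaleR inner_add_left inner_add_right)

lemma posdef_sqrt_exists:
  assumes Q: "posdef Q" obtains R where "posdef R" "R ** R = Q"
proof -
  have sym: "(Q *v x) \<bullet> y = x \<bullet> (Q *v y)" for x y using Q by (simp add: posdef_def)
  have sB: "symform UNIV (\<lambda>x y. x \<bullet> (Q *v y))"
    unfolding symform_def using sym bilinear_matrix_form[of Q] by (auto simp: inner_commute)
  obtain S l where fr: "eigenframe UNIV (\<lambda>x y. x \<bullet> (Q *v y)) S l" using spectral_form[OF sB] by blast
  have fS: "finite S" and spS: "span S = UNIV" using fr by (auto simp: eigenframe_def)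
  have Qs: "Q *v s = l s *\<^sub>R s" if "s \<in> S" for s
  proof -
    have "(Q *v s) \<bullet> w = (l s *\<^sub>R s) \<bullet> w" for w using fr that by (simp add: eigenframe_def sym)
    then show ?thesis by (metis vector_eq_rdot)
  qed
  have ss: "s \<bullet> t = (if s = t then 1 else 0)" if "s \<in> S" "t \<in> S" for s t by (rule eigenframe_inner[OF sB fr that])
  have lpos: "l s > 0" if "s \<in> S" for s
  proof -
    have "s \<noteq> 0" using ss[OF that that] by auto
    then have "0 < s \<bullet> (Q *v s)" using Q by (simp add: posdef_def)
    then show ?thesis using Qs[OF that] ss[OF that that] by simp
  qed
  define r where "r x = (\<Sum>s\<in>S. (sqrt (l s) * (x \<bullet> s)) *\<^sub>R s)" for x
  have lr: "linear r" unfolding r_def by (intro linearI) (simp_all add: inner_add_left algebra_simps sum.distrib scaleR_sum_right)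
  define R where "R = matrix r"
  have Rv: "R *v x = r x" for x unfolding R_def using matrix_works[of r x] lr by (simp add: linear_linear)
  have rs: "r t = sqrt (l t) *\<^sub>R t" if "t \<in> S" for t
  proof -
    have "r t = (\<Sum>s\<in>S. if s = t then sqrt (l t) *\<^sub>R t else 0)" unfolding r_def
      using ss that by (intro sum.cong) auto
    then show ?thesis using fS that by simp
  qed
  have "posdef R" unfolding posdef_def
  proof (intro conjI allI impI)
    show "(R *v x) \<bullet> y = x \<bullet> (R *v y)" for x y unfolding Rv r_def
      by (simp add: inner_sum_left inner_sum_right inner_commute mult_ac)
    fix x assume "x \<noteq> (0 :: real^'a)"
    have e: "x \<bullet> (R *v x) = (\<Sum>s\<in>S. sqrt (l s) * (x \<bullet> s)\<^sup>2)" unfolding Rv r_def by (simp add: inner_sum_right power2_eq_square mult_ac)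
    have "\<exists>s\<in>S. x \<bullet> s \<noteq> 0"
    proof (rule ccontr)
      assume "\<not> ?thesis"
      then have "x = 0" using eigenframe_expand[OF sB fr subset_refl, of x] spS by simp
      then show False using \<open>x \<noteq> 0\<close> by simp
    qed
    then obtain s where s: "s \<in> S" "x \<bullet> s \<noteq> 0" by blast
    show "0 < x \<bullet> (R *v x)" unfolding e using s lpos
      by (intro sum_pos2[OF fS s(1)]) (auto simp: less_imp_le)
  qed
  moreover have "R ** R = Q"
  proof -
    have "r (r x) = Q *v x" for x
    proof (rule linear_eq_on_span[of "r \<circ> r" "(*v) Q" S x, unfolded o_def])
      show "linear (\<lambda>x. r (r x))" using linear_compose[OF lr lr] by (simp add: o_def)
      show "r (r s) = Q *v s" if "s \<in> S" for s
        using rs[OF that] Qs[OF that] lpos[OF that] by (simp add: linear_cmul[OF lr])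
    qed (use spS in auto)
    then show ?thesis by (simp add: matrix_eq matrix_vector_mul_assoc[symmetric] Rv)
  qed
  ultimately show ?thesis using that by blast
qed

text \<open>For a unit eigenvector s of the difference \<open>R - R'\<close> with eigenvalue l, the
  difference of the squares takes the value
  \<open>l * (s \<bullet> (R *v s) + s \<bullet> (R' *v s))\<close> at s, and the bracket is at
  least c. The estimate yields both uniqueness and continuity of the square root.\<close>

lemma posdef_sqrt_estimate:
  assumes R: "posdef R" and R': "posdef R'" and c: "c > 0" "\<And>x. c * (norm x)\<^sup>2 \<le> x \<bullet> (R *v x)"
    and e: "\<And>x. norm ((R ** R) *v x - (R' ** R') *v x) \<le> \<epsilon> * norm x" and e0: "\<epsilon> \<ge> 0"
  shows "norm (R *v x - R' *v x) \<le> \<epsilon> / c * norm x"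
proof -
  have sR: "(R *v x) \<bullet> y = x \<bullet> (R *v y)" "(R' *v x) \<bullet> y = x \<bullet> (R' *v y)" for x y using R R' by (auto simp: posdef_def)
  let ?D = "R - R'"
  have Dv: "?D *v x = R *v x - R' *v x" for x by (simp add: matrix_vector_mult_diff_rdistrib)
  have sD: "(?D *v x) \<bullet> y = x \<bullet> (?D *v y)" for x y unfolding Dv by (simp add: inner_diff_left inner_diff_right sR)
  have sB: "symform UNIV (\<lambda>x y. x \<bullet> (?D *v y))"
    unfolding symform_def using sD bilinear_matrix_form[of ?D] by (auto simp: inner_commute)
  obtain S l where fr: "eigenframe UNIV (\<lambda>x y. x \<bullet> (?D *v y)) S l" using spectral_form[OF sB] by blast
  have fS: "finite S" and spS: "span S = UNIV" and n1: "\<And>s. s \<in> S \<Longrightarrow> norm s = 1" using fr by (auto simp: eigenframe_def)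
  have Ds: "?D *v s = l s *\<^sub>R s" if "s \<in> S" for s
  proof -
    have "(?D *v s) \<bullet> w = (l s *\<^sub>R s) \<bullet> w" for w using fr that by (simp add: eigenframe_def sD)
    then show ?thesis by (metis vector_eq_rdot)
  qed
  have bd: "\<bar>l s\<bar> \<le> \<epsilon> / c" if s: "s \<in> S" for s
  proof -
    have Rs: "R *v s = R' *v s + l s *\<^sub>R s" using Ds[OF s] unfolding Dv by (simp add: algebra_simps)
    have "s \<bullet> ((R ** R) *v s - (R' ** R') *v s) = (R *v s) \<bullet> (R *v s) - (R' *v s) \<bullet> (R' *v s)"
      by (simp add: inner_diff_right matrix_vector_mul_assoc[symmetric] sR)
    also have "\<dots> = (R *v s - R' *v s) \<bullet> (R *v s + R' *v s)"
      using inner_commute[of "R *v s" "R' *v s"] by (simp only: inner_diff_left inner_add_right)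
    also have "\<dots> = l s * (s \<bullet> (R *v s) + s \<bullet> (R' *v s))" unfolding Dv[symmetric] Ds[OF s] by (simp add: inner_add_right distrib_left)
    finally have eq: "\<bar>l s\<bar> * \<bar>s \<bullet> (R *v s) + s \<bullet> (R' *v s)\<bar> = \<bar>s \<bullet> ((R ** R) *v s - (R' ** R') *v s)\<bar>" by (simp add: abs_mult)
    have "s \<noteq> 0" using n1[OF s] by auto
    then have "0 < s \<bullet> (R' *v s)" using R' by (simp add: posdef_def)
    moreover have "c \<le> s \<bullet> (R *v s)" using c(2)[of s] n1[OF s] by simp
    ultimately have "c \<le> \<bar>s \<bullet> (R *v s) + s \<bullet> (R' *v s)\<bar>" by linarith
    then have "\<bar>l s\<bar> * c \<le> \<bar>s \<bullet> ((R ** R) *v s - (R' ** R') *v s)\<bar>" unfolding eq[symmetric] by (intro mult_left_mono) auto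
    also have "\<dots> \<le> norm s * norm ((R ** R) *v s - (R' ** R') *v s)" by (rule Cauchy_Schwarz_ineq2)
    also have "\<dots> \<le> \<epsilon>" using e[of s] n1[OF s] by simp
    finally show ?thesis using c(1) by (simp add: field_simps)
  qed
  have sq: "(norm v)\<^sup>2 = (\<Sum>s\<in>S. (v \<bullet> s)\<^sup>2)" for v
  proof -
    have "v \<bullet> v = v \<bullet> (\<Sum>s\<in>S. (v \<bullet> s) *\<^sub>R s)" using eigenframe_expand[OF sB fr subset_refl, of v] spS by simp
    then have "v \<bullet> v = (\<Sum>s\<in>S. (v \<bullet> s)\<^sup>2)" by (simp add: inner_sum_right power2_eq_square)
    then show ?thesis by (simp add: power2_norm_eq_inner)
  qed
  have "(norm (?D *v x))\<^sup>2 = (\<Sum>s\<in>S. (l s)\<^sup>2 * (x \<bullet> s)\<^sup>2)"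
    unfolding sq by (intro sum.cong) (auto simp: sD Ds power_mult_distrib)
  also have "\<dots> \<le> (\<Sum>s\<in>S. (\<epsilon> / c)\<^sup>2 * (x \<bullet> s)\<^sup>2)"
    using bd by (intro sum_mono mult_right_mono) (auto simp: power2_le_iff_abs_le intro: abs_le_square_iff[THEN iffD1] order_trans[OF _ abs_ge_self])
  also have "\<dots> = (\<epsilon> / c * norm x)\<^sup>2" by (simp only: power_mult_distrib[of "\<epsilon> / c"] sq[of x] sum_distrib_left)
  finally have "norm (?D *v x) \<le> \<bar>\<epsilon> / c * norm x\<bar>" by (simp add: power2_le_iff_abs_le abs_le_square_iff[symmetric])
  then show ?thesis unfolding Dv using c(1) e0 by simp
qed

lemma posdef_bound: assumes "posdef R" obtains c where "c > 0" "\<And>x. c * (norm x)\<^sup>2 \<le> x \<bullet> (R *v x)"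
  using pos_def_on_bound[OF bilinear_matrix_form subspace_UNIV, of R] assms by (auto simp: posdef_def pos_def_on_def)

lemma posdef_sqrt_unique: assumes "posdef R" "posdef R'" "R ** R = R' ** R'" shows "R = R'"
proof -
  obtain c where c: "c > 0" "\<And>x. c * (norm x)\<^sup>2 \<le> x \<bullet> (R *v x)" using posdef_bound[OF assms(1)] by blast
  have "norm (R *v x - R' *v x) \<le> 0 / c * norm x" for x
    by (rule posdef_sqrt_estimate[OF assms(1,2) c]) (use assms(3) in auto)
  then show ?thesis by (simp add: matrix_eq)
qed

definition sqrtm :: "real^'n::finite^'n \<Rightarrow> real^'n^'n" where
  "sqrtm Q = (SOME R. posdef R \<and> R ** R = Q)"

lemma sqrtm: assumes "posdef Q" shows "posdef (sqrtm Q)" "sqrtm Q ** sqrtm Q = Q"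
proof -
  have "\<exists>R. posdef R \<and> R ** R = Q" using posdef_sqrt_exists[OF assms] by blast
  from someI_ex[OF this] show "posdef (sqrtm Q)" "sqrtm Q ** sqrtm Q = Q" unfolding sqrtm_def by auto
qed

text \<open>The constant c of \<open>posdef_sqrt_estimate\<close> belongs to the base point Q alone,
  so the bound is linear in the distance to Q.\<close>

lemma continuous_on_sqrtm: "continuous_on {Q. posdef Q} (sqrtm :: real^'n::finite^'n \<Rightarrow> _)"
  unfolding continuous_on_def
proof
  fix Q :: "real^'n^'n" assume "Q \<in> {Q. posdef Q}"
  then have Q: "posdef Q" by simp
  obtain c where c: "c > 0" "\<And>x. c * (norm x)\<^sup>2 \<le> x \<bullet> (sqrtm Q *v x)" using posdef_bound[OF sqrtm(1)[OF Q]] by blast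
  obtain K where K: "K > 0" "\<And>(M::real^'n^'n) x. norm (M *v x) \<le> norm M * norm x * K"
    using bounded_bilinear.pos_bounded[OF bounded_bilinear_matrix_vector] by blast
  have est: "\<bar>sqrtm Q' $ i $ j - sqrtm Q $ i $ j\<bar> \<le> K / c * norm (Q' - Q)" if Q': "posdef Q'" for Q' i j
  proof -
    have "norm (sqrtm Q *v axis j 1 - sqrtm Q' *v axis j 1) \<le> (norm (Q - Q') * K) / c * norm (axis j (1::real) :: real^'n)"
    proof (rule posdef_sqrt_estimate[OF sqrtm(1)[OF Q] sqrtm(1)[OF Q'] c])
      show "norm ((sqrtm Q ** sqrtm Q) *v x - (sqrtm Q' ** sqrtm Q') *v x) \<le> norm (Q - Q') * K * norm x" for x
        unfolding sqrtm(2)[OF Q] sqrtm(2)[OF Q'] using K(2)[of "Q - Q'" x] by (simp add: matrix_vector_mult_diff_rdistrib mult_ac)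
    qed (use K in auto)
    moreover have "(sqrtm Q *v axis j 1 - sqrtm Q' *v axis j 1) $ i = sqrtm Q $ i $ j - sqrtm Q' $ i $ j"
      by (simp add: matrix_vector_mult_def axis_def if_distrib[of "\<lambda>x. _ * x"] cong: if_cong)
    ultimately show ?thesis
      using component_le_norm_cart[of "sqrtm Q *v axis j 1 - sqrtm Q' *v axis j 1" i]
      by (simp add: norm_axis_1 abs_minus_commute norm_minus_commute mult_ac)
  qed
  have lim: "((\<lambda>Q'. K / c * norm (Q' - Q)) \<longlongrightarrow> 0) (at Q within {Q. posdef Q})"
  proof -
    have "((\<lambda>Q'. K / c * norm (Q' - Q)) \<longlongrightarrow> K / c * norm (Q - Q)) (at Q within {Q. posdef Q})" by (intro tendsto_intros)
    then show ?thesis by simp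
  qed
  show "(sqrtm \<longlongrightarrow> sqrtm Q) (at Q within {Q. posdef Q})"
  proof (intro vec_tendstoI)
    fix i j
    have "((\<lambda>Q'. sqrtm Q' $ i $ j - sqrtm Q $ i $ j) \<longlongrightarrow> 0) (at Q within {Q. posdef Q})"
    proof (rule Lim_null_comparison[OF _ lim])
      show "\<forall>\<^sub>F Q' in at Q within {Q. posdef Q}. norm (sqrtm Q' $ i $ j - sqrtm Q $ i $ j) \<le> K / c * norm (Q' - Q)"
        unfolding eventually_at_topological using est by (intro exI[of _ UNIV]) auto
    qed
    then show "((\<lambda>Q'. sqrtm Q' $ i $ j) \<longlongrightarrow> sqrtm Q $ i $ j) (at Q within {Q. posdef Q})" by (rule LIM_zero_cancel)
  qed
qed

lemma det_nz_Sp: "A \<in> Sp \<Longrightarrow> det A \<noteq> 0"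
  unfolding det_nz_iff using sp_inv_v(1) by (metis matrix_vector_mult_0_right)

lemma posdef_gram: assumes "A \<in> Sp" shows "posdef (transpose A ** A)"
  unfolding posdef_def
proof (intro conjI allI impI)
  show "((transpose A ** A) *v x) \<bullet> y = x \<bullet> ((transpose A ** A) *v y)" for x y
    by (simp add: matrix_vector_mul_assoc[symmetric] transpose_adj)
  fix x assume "x \<noteq> (0 :: 'a spvec)"
  then have "A *v x \<noteq> 0" using det_nz_Sp[OF assms] det_nz_iff by blast
  then show "0 < x \<bullet> ((transpose A ** A) *v x)" by (simp add: matrix_vector_mul_assoc[symmetric] transpose_adj[symmetric])
qed

lemma posdef_det: "posdef R \<Longrightarrow> det R \<noteq> 0"
  unfolding det_nz_iff posdef_def by (metis inner_zero_right less_irrefl)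

lemma posdef_minv: assumes "posdef R" shows "posdef (minv R)"
proof -
  note d = posdef_det[OF assms]
  have ex: "\<exists>u. x = R *v u" for x using minv_v(1)[OF d, of x] by metis
  show ?thesis unfolding posdef_def
  proof (intro conjI allI impI)
    fix x y
    obtain u w where "x = R *v u" "y = R *v w" using ex by metis
    then show "(minv R *v x) \<bullet> y = x \<bullet> (minv R *v y)" using assms by (simp add: minv_v(2)[OF d] posdef_def)
  next
    fix x :: "real^'a" assume x: "x \<noteq> 0"
    obtain u where u: "x = R *v u" using ex by metis
    then have "u \<noteq> 0" using x by auto
    then show "0 < x \<bullet> (minv R *v x)" using assms u by (simp add: minv_v(2)[OF d] posdef_def)
  qed
qed

text \<open>Both \<open>- (J0 ** R ** J0)\<close> and the inverse of the root R are positive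
  definite roots of the inverse of Q, hence equal by uniqueness; this equality says that R is
  symplectic.\<close>

lemma sqrtm_Sp:
  assumes Q: "posdef Q" "Q \<in> Sp" shows "sqrtm Q \<in> Sp"
proof -
  let ?R = "sqrtm Q"
  note R = sqrtm[OF Q(1)]
  have sR: "(?R *v x) \<bullet> y = x \<bullet> (?R *v y)" for x y using R(1) by (simp add: posdef_def)
  let ?S = "- (J0 ** ?R ** J0)"
  have Sv: "?S *v x = - (J0 *v (?R *v (J0 *v x)))" for x
    by (simp add: matrix_vector_uminus_left matrix_vector_mul_assoc[symmetric])
  have Jl: "(J0 *v x) \<bullet> y = - (x \<bullet> (J0 *v y))" for x y :: "'a spvec"
    using Omega0_skew[of x y] by (simp add: Omega0_eq inner_commute)
  have "posdef ?S" unfolding posdef_def Sv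
  proof (intro conjI allI impI)
    show "- (J0 *v (?R *v (J0 *v x))) \<bullet> y = x \<bullet> - (J0 *v (?R *v (J0 *v y)))" for x y
      by (simp add: Jl sR)
    fix x :: "'a spvec" assume "x \<noteq> 0"
    then have "J0 *v x \<noteq> 0" using J0_J0_v[of x] by auto
    then have "0 < (J0 *v x) \<bullet> (?R *v (J0 *v x))" using R(1) by (simp add: posdef_def)
    then show "0 < x \<bullet> - (J0 *v (?R *v (J0 *v x)))" by (simp add: Jl)
  qed
  moreover have "posdef (minv ?R)" by (rule posdef_minv[OF R(1)])
  moreover have "?S ** ?S = minv ?R ** minv ?R"
  proof -
    have tQ: "transpose Q = Q"
    proof -
      have "x \<bullet> (transpose Q *v y) = x \<bullet> (Q *v y)" for x y using Q(1) by (simp add: transpose_adj[symmetric] posdef_def)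
      then show ?thesis by (simp add: matrix_eq) (metis vector_eq_ldot)
    qed
    have RR: "?R *v (?R *v x) = Q *v x" for x using R(2) by (simp add: matrix_vector_mul_assoc)
    have "?S *v (?S *v x) = sp_inv Q *v x" for x
      by (simp add: Sv RR sp_inv_def tQ J0_J0_v matrix_vector_uminus_left matrix_vector_uminus_right flip: matrix_vector_mul_assoc)
    then have "?S ** ?S = sp_inv Q" by (simp add: matrix_eq flip: matrix_vector_mul_assoc)
    moreover have "minv ?R ** minv ?R = sp_inv Q"
    proof -
      note d = posdef_det[OF R(1)]
      have "minv ?R *v (minv ?R *v (Q *v x)) = x" for x by (simp only: RR[symmetric] minv_v(2)[OF d])
      then have "(minv ?R ** minv ?R) ** Q = mat 1"
        by (simp add: matrix_eq matrix_vector_mul_assoc[symmetric] matrix_vector_mul_lid)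
      then have "(minv ?R ** minv ?R) ** (Q ** sp_inv Q) = sp_inv Q" by (simp add: matrix_mul_assoc)
      then show ?thesis using sp_inv(2)[OF Q(2)] by simp
    qed
    ultimately show ?thesis by simp
  qed
  ultimately have SR: "?S = minv ?R" by (rule posdef_sqrt_unique)
  have JRJR: "J0 *v (?R *v (J0 *v (?R *v x))) = - x" for x
    using arg_cong[OF SR, of "\<lambda>M. M *v (?R *v x)"] minv_v(2)[OF posdef_det[OF R(1)], of x] unfolding Sv by (metis minus_minus)
  have RJR: "?R *v (J0 *v (?R *v x)) = J0 *v x" for x
    using arg_cong[OF JRJR[of x], of "\<lambda>z. J0 *v z"]
    by (simp add: J0_J0_v matrix_vector_uminus_right)
  have "(J0 *v (?R *v x)) \<bullet> (?R *v y) = (J0 *v x) \<bullet> y" for x y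
    using sR[of "J0 *v (?R *v x)" y] by (simp only: RJR)
  then show ?thesis unfolding Sp_iff Omega0_eq by blast
qed

definition unitary_part :: "'n::finite spmat \<Rightarrow> 'n spmat" where
  "unitary_part A = A ** minv (sqrtm (transpose A ** A))"

text \<open>Polar decomposition with the positive factor shrunk to the identity by scaling its
  Cayley transform: a deformation retraction onto the unitary group whose continuity follows from
  that of \<open>sqrtm\<close> and \<open>minv\<close>.\<close>

definition polar_path :: "real \<Rightarrow> 'n::finite spmat \<Rightarrow> 'n spmat" where
  "polar_path s A = unitary_part A ** cay (s *\<^sub>R cayinv (sqrtm (transpose A ** A)))"

lemma minv_Sp: assumes "R \<in> Sp" shows "minv R = sp_inv R"
proof -
  have "minv R ** (R ** sp_inv R) = sp_inv R" using minv(2)[OF det_nz_Sp[OF assms]] by (simp add: matrix_mul_assoc)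
  then show ?thesis using sp_inv(2)[OF assms] by simp
qed

lemma unitary_part: assumes "A \<in> Sp" shows "unitary_part A \<in> Sp" "orthogonal_matrix (unitary_part A)"
proof -
  let ?Q = "transpose A ** A" and ?R = "sqrtm (transpose A ** A)"
  have Q: "posdef ?Q" "?Q \<in> Sp" using posdef_gram[OF assms] Sp_mult[OF Sp_transpose[OF assms] assms] by auto
  note R = sqrtm[OF Q(1)] sqrtm_Sp[OF Q]
  note d = posdef_det[OF R(1)]
  show "unitary_part A \<in> Sp" unfolding unitary_part_def minv_Sp[OF R(3)] using assms Sp_sp_inv[OF R(3)] by (rule Sp_mult)
  have sR: "(?R *v x) \<bullet> y = x \<bullet> (?R *v y)" for x y using R(1) by (simp add: posdef_def)
  have "(unitary_part A *v x) \<bullet> (unitary_part A *v y) = x \<bullet> y" for x y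
  proof -
    let ?u = "minv ?R *v x" and ?v = "minv ?R *v y"
    have "(unitary_part A *v x) \<bullet> (unitary_part A *v y) = (A *v ?u) \<bullet> (A *v ?v)" by (simp add: unitary_part_def matrix_vector_mul_assoc)
    also have "\<dots> = ?u \<bullet> (?Q *v ?v)" by (simp add: transpose_adj matrix_vector_mul_assoc[symmetric])
    also have "?Q *v ?v = ?R *v (?R *v ?v)" using arg_cong[OF R(2), of "\<lambda>M. M *v ?v"] by (simp only: matrix_vector_mul_assoc[symmetric])
    also have "?u \<bullet> (?R *v (?R *v ?v)) = (?R *v ?u) \<bullet> (?R *v ?v)" by (simp add: sR)
    finally show ?thesis by (simp add: minv_v(1)[OF d])
  qed
  then have "orthogonal_transformation ((*v) (unitary_part A))" by (simp add: orthogonal_transformation_def)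
  then show "orthogonal_matrix (unitary_part A)" by (simp add: orthogonal_transformation_matrix)
qed

text \<open>For \<open>x = P *v u + u\<close> in the kernel of
  \<open>mat 1 - s *\<^sub>R cayinv P\<close> one gets \<open>P *v u\<close> =
  \<open>- ((1 + s) / (1 - s))\<close> times u: only a negative eigenvalue of P can obstruct the
  scaling. This serves the polar decomposition and later the generalised eigenspace.\<close>

lemma no_negative_eigenvalue_cay:
  assumes np: "\<And>u r. r < 0 \<Longrightarrow> P *v u = r *\<^sub>R u \<Longrightarrow> u = 0" and s: "0 \<le> s" "s \<le> 1"
  shows "det (P + mat 1) \<noteq> 0" "det (mat 1 - s *\<^sub>R cayinv P) \<noteq> 0"
proof -
  show d: "det (P + mat 1) \<noteq> 0" unfolding det_nz_iff
  proof (intro allI impI)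
    fix x assume "(P + mat 1) *v x = 0"
    then have "P *v x = (-1) *\<^sub>R x" by (simp add: matrix_vector_mult_add_rdistrib eq_neg_iff_add_eq_0)
    then show "x = 0" using np[of "-1" x] by simp
  qed
  show "det (mat 1 - s *\<^sub>R cayinv P) \<noteq> 0" unfolding det_nz_iff
  proof (intro allI impI)
    fix x assume x: "(mat 1 - s *\<^sub>R cayinv P) *v x = 0"
    obtain u where u: "x = P *v u + u"
      using minv_v(1)[OF d, of x] matrix_vector_mult_add_rdistrib[of P "mat 1"] by (metis matrix_vector_mul_lid)
    have "x - s *\<^sub>R (cayinv P *v x) = 0" using x by (simp add: matrix_vector_mult_diff_rdistrib scaleR_matrix_vector_assoc)
    then have e: "(1 - s) *\<^sub>R (P *v u) + (1 + s) *\<^sub>R u = 0" unfolding u cayinv_v[OF d] by (simp add: algebra_simps)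
    have "u = 0"
    proof (cases "s = 1")
      case True then show ?thesis using e by simp
    next
      case False
      then have "1 - s > 0" using s by simp
      have "(1 / (1 - s)) *\<^sub>R ((1 - s) *\<^sub>R (P *v u) + (1 + s) *\<^sub>R u) = 0" using e by simp
      then have "P *v u + ((1 + s) / (1 - s)) *\<^sub>R u = 0" using \<open>1 - s > 0\<close> by (simp add: scaleR_add_right)
      then have "P *v u = (- ((1 + s) / (1 - s))) *\<^sub>R u" by (simp add: eq_neg_iff_add_eq_0)
      moreover have "- ((1 + s) / (1 - s)) < 0" using s \<open>1 - s > 0\<close> by simp
      ultimately show ?thesis using np by blast
    qed
    then show "x = 0" using u by simp
  qed
qed

lemma polar_path:
  assumes A: "A \<in> Sp"
  shows "s \<in> {0..1} \<Longrightarrow> polar_path s A \<in> Sp" "polar_path 1 A = A" "polar_path 0 A = unitary_part A"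
    "s \<in> {0..1} \<Longrightarrow> det (mat 1 - s *\<^sub>R cayinv (sqrtm (transpose A ** A))) \<noteq> 0" "det (sqrtm (transpose A ** A) + mat 1) \<noteq> 0"
    "det (sqrtm (transpose A ** A)) \<noteq> 0"
proof -
  let ?Q = "transpose A ** A" and ?R = "sqrtm (transpose A ** A)"
  have Q: "posdef ?Q" "?Q \<in> Sp" using posdef_gram[OF A] Sp_mult[OF Sp_transpose[OF A] A] by auto
  note R = sqrtm[OF Q(1)] sqrtm_Sp[OF Q]
  show dR: "det ?R \<noteq> 0" by (rule posdef_det[OF R(1)])
  have np: "u = 0" if "r < 0" "?R *v u = r *\<^sub>R u" for u r
  proof (rule ccontr)
    assume "u \<noteq> 0"
    then have "0 < u \<bullet> (r *\<^sub>R u)" using R(1) that by (metis posdef_def)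
    then have "0 < r * (u \<bullet> u)" by simp
    then show False using that(1) inner_ge_zero[of u] by (simp add: zero_less_mult_iff)
  qed
  show d1: "det (?R + mat 1) \<noteq> 0" by (rule no_negative_eigenvalue_cay(1)[of ?R 0]) (use np in auto)
  show d2: "s \<in> {0..1} \<Longrightarrow> det (mat 1 - s *\<^sub>R cayinv ?R) \<noteq> 0" for s
    by (rule no_negative_eigenvalue_cay(2)[of ?R s]) (use np in auto)
  have "sp_alg (s *\<^sub>R cayinv ?R)" for s
    using sp_alg_comb[OF cayinv_sp_alg[OF R(3) d1] cayinv_sp_alg[OF R(3) d1], of s 0] by simp
  then show "s \<in> {0..1} \<Longrightarrow> polar_path s A \<in> Sp" for s
    unfolding polar_path_def using unitary_part(1)[OF A] d2 by (intro Sp_mult cay_Sp) auto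
  show "polar_path 0 A = unitary_part A" by (simp add: polar_path_def cay_0)
  have "polar_path 1 A = A ** (minv ?R ** ?R)" unfolding polar_path_def using cay_cayinv(2)[OF d1]
    by (simp add: unitary_part_def matrix_mul_assoc)
  then show "polar_path 1 A = A" by (simp add: minv(2)[OF dR])
qed

lemma continuous_polar_path: "continuous_on ({0..1} \<times> (Sp :: ('n::finite spmat) set)) (\<lambda>p. polar_path (fst p) (snd p))"
proof -
  let ?D = "{0..1::real} \<times> (Sp :: ('n spmat) set)"
  let ?R = "\<lambda>p :: real \<times> ('n spmat). sqrtm (transpose (snd p) ** snd p)"
  have cR: "continuous_on ?D ?R"
    by (rule continuous_on_compose2[OF continuous_on_sqrtm])
      (use posdef_gram in \<open>auto intro!: continuous_on_mm continuous_on_transpose continuous_intros\<close>)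
  have cC: "continuous_on ?D (\<lambda>p. cayinv (?R p))" unfolding cayinv_def
    by (intro continuous_on_mm continuous_on_minv continuous_on_add continuous_on_diff continuous_on_const cR) (auto simp: polar_path(5))
  show ?thesis unfolding polar_path_def unitary_part_def cay_def
    by (intro continuous_on_mm continuous_on_minv continuous_on_add continuous_on_diff continuous_on_const continuous_on_scaleR
        continuous_on_fst continuous_on_snd continuous_on_id cR cC) (auto simp: polar_path(4,6))
qed

text \<open>The quotient of the Souriau determinant by the square of \<rho> is 1 on the unitary
  group. Along \<open>polar_path\<close> it is homotopic to the constant 1 as a map to the circle,
  and such a map has a continuous logarithm.\<close>

theorem rho_log:
  fixes \<rho> :: "'n::finite spmat \<Rightarrow> complex"
  assumes c: "continuous_on Sp \<rho>" and s: "\<rho> ` Sp \<subseteq> sphere 0 1"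
    and U: "\<forall>U. orthogonal_matrix U \<and> U \<in> Sp \<longrightarrow> \<rho> U = det_C U"
  obtains \<kappa> where "continuous_on Sp \<kappa>" "\<And>A. A \<in> Sp \<Longrightarrow> gr.souriau (Gr A) = (\<rho> A)\<^sup>2 * circ (\<kappa> A)"
proof -
  have n\<rho>: "norm (\<rho> A) = 1" if "A \<in> Sp" for A using s that by auto
  then have nz: "\<rho> A \<noteq> 0" if "A \<in> Sp" for A using that by force
  define u where "u A = gr.souriau (Gr A) / (\<rho> A)\<^sup>2" for A
  have nu: "norm (u A) = 1" if "A \<in> Sp" for A
    using gr.norm_souriau[OF lagrangian_Gr[OF that]] n\<rho>[OF that] by (simp add: u_def norm_divide norm_power)
  have cs: "continuous_on Sp (\<lambda>A. gr.souriau (Gr A))"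
    by (rule gr.continuous_souriau[OF continuous_closest_Gr[OF continuous_on_id]])
  have cu: "continuous_on Sp u" unfolding u_def by (intro continuous_intros cs c) (use nz in auto)
  have u1: "u (unitary_part A) = 1" if "A \<in> Sp" for A
    using souriau_unitary[OF unitary_part[OF that]] U unitary_part[OF that] nz[OF unitary_part(1)[OF that]] by (simp add: u_def)
  have "homotopic_with_canon (\<lambda>h. True) Sp (sphere 0 1) (\<lambda>A. 1) u"
    unfolding homotopic_with_def
  proof (intro exI[of _ "\<lambda>p. if snd p \<in> Sp then u (polar_path (fst p) (snd p)) else if fst p = 0 then 1 else u (snd p)"] conjI)
    \<comment> \<open>The values outside \<open>Sp\<close> are filler:
      \<open>homotopic_with_def\<close> asks for the equations at 0 and 1 at every matrix.\<close>
    let ?h = "\<lambda>p. if snd p \<in> Sp then u (polar_path (fst p) (snd p)) else if fst p = 0 then 1 else u (snd p)"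
    have "continuous_on ({0..1} \<times> Sp) (\<lambda>p. u (polar_path (fst p) (snd p)))"
      by (rule continuous_on_compose2[OF cu continuous_polar_path]) (auto simp: polar_path(1))
    then have "continuous_on ({0..1} \<times> Sp) ?h" by (rule continuous_on_eq) auto
    moreover have "?h p \<in> sphere 0 1" if "p \<in> {0..1} \<times> Sp" for p using that by (auto simp: nu polar_path(1))
    then have "?h ` ({0..1} \<times> Sp) \<subseteq> sphere 0 1" by (rule image_subsetI)
    ultimately show "continuous_map (prod_topology (top_of_set {0..1}) (top_of_set Sp)) (top_of_set (sphere 0 1)) ?h"
      by (simp only: prod_topology_subtopology_eu continuous_map_in_subtopology continuous_map_iff_continuous euclidean_product_topology topspace_euclidean_subtopology image_subset_iff_funcset)
    show "\<forall>x. ?h (0, x) = 1" by (simp add: polar_path(3) u1)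
    show "\<forall>x. ?h (1, x) = u x" by (simp add: polar_path(2))
  qed auto
  then have "homotopic_with_canon (\<lambda>h. True) Sp (sphere 0 1) u (\<lambda>A. 1)" by (rule homotopic_with_symD)
  then obtain g where g: "continuous_on Sp g" "\<And>A. A \<in> Sp \<Longrightarrow> u A = exp (\<i> * of_real (g A))"
    using inessential_eq_continuous_logarithm_circle[of Sp u] by blast
  have "continuous_on Sp (\<lambda>A. g A / (2 * pi))" by (intro continuous_intros g) auto
  moreover have "gr.souriau (Gr A) = (\<rho> A)\<^sup>2 * circ (g A / (2 * pi))" if "A \<in> Sp" for A
    using g(2)[OF that] nz[OF that] by (simp add: u_def field_simps)
  ultimately show ?thesis using that by blast
qed

lemma degree_sp_lift:
  fixes \<gamma> :: "real \<Rightarrow> 'n::finite spmat" and \<rho> :: "'n spmat \<Rightarrow> complex" and \<kappa> :: "'n spmat \<Rightarrow> real"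
  assumes ab: "a \<le> b" and cont: "continuous_on {a..b} \<gamma>" and Sp: "\<And>t. t \<in> {a..b} \<Longrightarrow> \<gamma> t \<in> Sp" and th: "sp_lift a b \<gamma> \<theta>"
    and k: "continuous_on Sp \<kappa>" "\<And>A. A \<in> Sp \<Longrightarrow> gr.souriau (Gr A) = (\<rho> A)\<^sup>2 * circ (\<kappa> A)"
  shows "circle_degree a b (\<lambda>t. (\<rho> (\<gamma> t))\<^sup>2) = (\<theta> b - \<kappa> (\<gamma> b)) - (\<theta> a - \<kappa> (\<gamma> a))"
proof (rule circle_degree_eq[OF ab])
  show "continuous_on {a..b} (\<lambda>t. \<theta> t - \<kappa> (\<gamma> t))"
  proof (rule continuous_on_diff)
    show "continuous_on {a..b} (\<lambda>t. \<kappa> (\<gamma> t))" by (rule continuous_on_compose2[OF k(1) cont]) (use Sp in auto)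
  qed (use th in \<open>auto simp: sp_lift_def\<close>)
  fix t assume t: "t \<in> {a..b}"
  have "circ (\<theta> t) = (\<rho> (\<gamma> t))\<^sup>2 * circ (\<kappa> (\<gamma> t))"
    using th t k(2)[OF Sp[OF t]] by (simp add: sp_lift_def)
  then show "(\<rho> (\<gamma> t))\<^sup>2 = circ (\<theta> t - \<kappa> (\<gamma> t))"
    by (simp add: right_diff_distrib exp_diff)
qed

text \<open>At the identity the whole space is the crossing, and afterwards there is none. P and N
  witness lower bounds for the indices that already exhaust the dimension.\<close>

lemma index_change_from_identity:
  fixes \<gamma> :: "real \<Rightarrow> 'n::finite spmat"
  assumes cont: "continuous_on {0..1} \<gamma>" and Sp: "\<And>t. t \<in> {0..1} \<Longrightarrow> \<gamma> t \<in> Sp" and th: "sp_lift 0 1 \<gamma> \<theta>"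
    and g0: "\<gamma> 0 = mat 1" and F: "\<And>t. t \<in> {0<..1} \<Longrightarrow> fixspace (\<gamma> t) = {0}"
    and der: "(\<gamma> has_vector_derivative D) (at 0 within {0..1})"
    and sym: "\<And>x y. Omega0 x (D *v y) = Omega0 y (D *v x)"
    and P: "subspace P" "pos_def_on P (\<lambda>x y. Omega0 x (D *v y))"
    and N: "subspace N" "pos_def_on N (\<lambda>x y. - Omega0 x (D *v y))"
    and dims: "CARD('n + 'n) \<le> dim P + dim N"
  shows "sp_index \<theta> \<gamma> 1 - sp_index \<theta> \<gamma> 0 = (real (dim P) - real (dim N)) / 2"
proof -
  let ?B = "\<lambda>x y. Omega0 x (D *v y)"
  have f0: "fixspace (\<gamma> 0) = UNIV" by (simp add: g0 fixspace_def)
  have sB: "symform UNIV ?B" by (rule symform_Omega_deriv[OF subspace_UNIV sym])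
  have "pos_index UNIV ?B + neg_index UNIV ?B + dim (radical UNIV ?B) = CARD('n + 'n)"
    using index_sum[OF sB] by simp
  moreover have "dim P \<le> pos_index UNIV ?B" "dim N \<le> neg_index UNIV ?B"
    using pos_index_ge[OF P(1) subset_UNIV P(2)] neg_index_ge[OF N(1) subset_UNIV N(2)] by auto
  ultimately have e: "pos_index UNIV ?B = dim P" "neg_index UNIV ?B = dim N" "dim (radical UNIV ?B) = 0" using dims by linarith+
  have "sp_index \<theta> \<gamma> 1 - sp_index \<theta> \<gamma> 0 = signature (fixspace (\<gamma> 0)) ?B / 2"
  proof (rule sp_index_constant_kernel[OF _ cont Sp th F])
    show "((\<lambda>s. (\<gamma> s *v x - x) /\<^sub>R (s - 0)) \<longlongrightarrow> D *v x) (at 0 within {0..1})" for x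
    proof -
      have "((\<lambda>t. (\<gamma> t - \<gamma> 0) /\<^sub>R (t - 0)) \<longlongrightarrow> D) (at 0 within {0..1})"
        using der unfolding has_vector_derivative_within_slope .
      from bounded_bilinear.tendsto[OF bounded_bilinear_matrix_vector this tendsto_const[of x]]
      have "((\<lambda>t. ((\<gamma> t - \<gamma> 0) /\<^sub>R (t - 0)) *v x) \<longlongrightarrow> D *v x) (at 0 within {0..1})" .
      then show ?thesis
        by (simp add: g0 scaleR_matrix_vector_assoc[symmetric] matrix_vector_mult_diff_rdistrib)
    qed
    show "dim (radical (fixspace (\<gamma> 0)) ?B) \<le> dim {0 :: 'n spvec}" unfolding f0 e(3) by simp
  qed (use sym f0 in auto)
  then show ?thesis using signature_eq[OF sB] e by (simp add: f0)
qed

section \<open>Normalisation at the end points\<close>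

text \<open>The increment of \<open>sp_index\<close> minus the degree is the increment of correction
  plus \<kappa>. Between two normalized matrices it vanishes, so the degree is the increment of the
  corrected lift.\<close>

definition normalized_at :: "('n::finite spmat \<Rightarrow> real) \<Rightarrow> 'n spmat \<Rightarrow> bool" where
  "normalized_at \<kappa> A \<longleftrightarrow> gr.correction (Gr A) + \<kappa> A = gr.correction (Gr (mat 1 :: 'n spmat)) + \<kappa> (mat 1)"

lemma normalized_atI:
  fixes \<gamma> :: "real \<Rightarrow> 'n::finite spmat" and \<rho> :: "'n spmat \<Rightarrow> complex" and \<kappa> :: "'n spmat \<Rightarrow> real"
  assumes cont: "continuous_on {0..1} \<gamma>" and Sp: "\<And>t. t \<in> {0..1} \<Longrightarrow> \<gamma> t \<in> Sp"
    and g0: "\<gamma> 0 = mat 1" and F: "\<And>t. t \<in> {0<..1} \<Longrightarrow> fixspace (\<gamma> t) = {0}"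
    and der: "(\<gamma> has_vector_derivative D) (at 0 within {0..1})"
    and sym: "\<And>x y. Omega0 x (D *v y) = Omega0 y (D *v x)"
    and P: "subspace P" "pos_def_on P (\<lambda>x y. Omega0 x (D *v y))"
    and N: "subspace N" "pos_def_on N (\<lambda>x y. - Omega0 x (D *v y))"
    and dims: "CARD('n + 'n) \<le> dim P + dim N"
    and k: "continuous_on Sp \<kappa>" "\<And>A. A \<in> Sp \<Longrightarrow> gr.souriau (Gr A) = (\<rho> A)\<^sup>2 * circ (\<kappa> A)"
    and deg: "circle_degree 0 1 (\<lambda>t. (\<rho> (\<gamma> t))\<^sup>2) = (real (dim P) - real (dim N)) / 2"
  shows "normalized_at \<kappa> (\<gamma> 1)"
proof -
  obtain \<theta> where th: "sp_lift 0 1 \<gamma> \<theta>" using sp_lift_exists[OF cont Sp] by blast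
  have "sp_index \<theta> \<gamma> 1 - sp_index \<theta> \<gamma> 0 = (\<theta> 1 - \<kappa> (\<gamma> 1)) - (\<theta> 0 - \<kappa> (\<gamma> 0))"
    using index_change_from_identity[OF cont Sp th g0 F der sym P N dims] degree_sp_lift[OF _ cont Sp th k] deg by simp
  then show ?thesis by (simp add: normalized_at_def sp_index_def g0)
qed

lemma det_C_rotm: "det_C (rotm t :: 'n::finite spmat) = cis (real CARD('n) * t)"
proof -
  have "(rotm t :: 'n spmat) = block_mat (cos t *\<^sub>R mat 1) (- (sin t *\<^sub>R mat 1)) (sin t *\<^sub>R mat 1) (cos t *\<^sub>R mat 1)"
    by (simp add: rotm_def J0_def block_mat_one[where ?'a = real] block_mat_scaleR block_mat_add)
  then have "det_C (rotm t :: 'n spmat) = det (\<chi> i j::'n. if i = j then cis t else 0)"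
    unfolding det_C_def by (intro arg_cong[where f = det]) (simp add: vec_eq_iff block_mat_def mat_def complex_eq_iff)
  also have "\<dots> = cis t ^ CARD('n)" by (subst det_diagonal) auto
  finally show ?thesis by (simp add: Complex.DeMoivre)
qed

lemma rotm_orthogonal: "orthogonal_matrix (rotm t)"
proof -
  have "orthogonal_transformation ((*v) (rotm t))" by (simp add: orthogonal_transformation_def rotm_isom)
  then show ?thesis by (simp add: orthogonal_transformation_matrix)
qed

text \<open>Along half a turn from the identity the initial crossing form is pi times the inner
  product, so the index is half of 2n; the square of \<rho> winds n times.\<close>

lemma normalized_W_plus:
  fixes \<rho> :: "'n::finite spmat \<Rightarrow> complex" and \<kappa> :: "'n spmat \<Rightarrow> real"
  assumes U: "\<forall>U. orthogonal_matrix U \<and> U \<in> Sp \<longrightarrow> \<rho> U = det_C U"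
    and k: "continuous_on Sp \<kappa>" "\<And>A. A \<in> Sp \<Longrightarrow> gr.souriau (Gr A) = (\<rho> A)\<^sup>2 * circ (\<kappa> A)"
  shows "normalized_at \<kappa> W_plus"
proof -
  let ?\<gamma> = "\<lambda>t. rotm (t * pi) :: 'n spmat"
  have form: "Omega0 x ((pi *\<^sub>R J0) *v y) = pi * (x \<bullet> y)" for x y :: "'n spvec"
    by (simp add: Omega0_eq scaleR_matrix_vector_assoc[symmetric] J0_isom)
  have "normalized_at \<kappa> (?\<gamma> 1)"
  proof (rule normalized_atI[where P = UNIV and N = "{0}" and D = "pi *\<^sub>R J0", OF _ _ _ _ _ _ _ _ _ _ _ k])
    show "continuous_on {0..1} ?\<gamma>" by (intro continuous_on_rotm continuous_intros)
    show "fixspace (?\<gamma> t) = {0}" if "t \<in> {0<..1}" for t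
    proof -
      have "x = 0" if x: "rotm (t * pi) *v x = x" for x :: "'n spvec"
      proof -
        have "x \<bullet> (J0 *v x) = 0" using Omega0_self[of x] by (simp add: Omega0_eq inner_commute)
        then have "x \<bullet> x = cos (t * pi) * (x \<bullet> x)" using arg_cong[OF x, of "\<lambda>z. x \<bullet> z"] by (simp add: rotm_v inner_add_right)
        moreover have "cos (t * pi) < cos 0" using \<open>t \<in> {0<..1}\<close> by (intro cos_monotone_0_pi) auto
        ultimately show "x = 0" by simp
      qed
      then show ?thesis by (auto simp: fixspace_def)
    qed
    have "((\<lambda>t. t * pi) has_vector_derivative pi) (at 0 within {0..1})" by (auto intro!: derivative_eq_intros)
    from rotm_derivative[OF this] show "(?\<gamma> has_vector_derivative pi *\<^sub>R J0) (at 0 within {0..1})" by (simp add: rotm_0)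
    have "circle_degree 0 1 (\<lambda>t. (\<rho> (?\<gamma> t))\<^sup>2) = real CARD('n) * 1 - real CARD('n) * 0"
    proof (rule circle_degree_eq)
      show "(\<rho> (?\<gamma> t))\<^sup>2 = circ (real CARD('n) * t)" for t
      proof -
        have "\<rho> (?\<gamma> t) = cis (real CARD('n) * (t * pi))" using U rotm_orthogonal rotm_Sp det_C_rotm by metis
        then have "(\<rho> (?\<gamma> t))\<^sup>2 = cis (2 * (real CARD('n) * (t * pi)))" by (simp only: power2_eq_square cis_mult mult_2)
        then show ?thesis by (simp add: cis_conv_exp mult_ac)
      qed
    qed (auto intro!: continuous_intros)
    then show "circle_degree 0 1 (\<lambda>t. (\<rho> (?\<gamma> t))\<^sup>2) = (real (dim (UNIV :: ('n spvec) set)) - real (dim {0 :: 'n spvec})) / 2" by simp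
    show "Omega0 x ((pi *\<^sub>R J0) *v y) = Omega0 y ((pi *\<^sub>R J0) *v x)" for x y :: "'n spvec"
      unfolding form by (simp add: inner_commute)
  qed (auto simp: rotm_Sp rotm_0 form pos_def_on_def)
  moreover have "?\<gamma> 1 = W_plus" by (simp add: rotm_def W_plus_def)
  ultimately show ?thesis by simp
qed

section \<open>Block diagonal matrices and the path \<open>psi2_minus\<close>\<close>

lemma diag_mat_mult: "diag_mat f ** diag_mat g = diag_mat (\<lambda>i. f i * g i)" for f g :: "'n::finite \<Rightarrow> 'a::semiring_1"
  by (simp add: vec_eq_iff matrix_matrix_mult_def diag_mat_def if_distrib[of "\<lambda>x. x * _"] cong: if_cong)

lemma diag_mat_simps:
  "diag_mat f + diag_mat g = diag_mat (\<lambda>i. f i + g i :: real)" "- diag_mat f = diag_mat (\<lambda>i. - f i)"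
  "r *\<^sub>R diag_mat f = diag_mat (\<lambda>i. r * f i)" "transpose (diag_mat f) = diag_mat f" "diag_mat (\<lambda>i. 0::real) = 0"
  "mat 1 = diag_mat (\<lambda>i. 1::real)"
  by (auto simp: vec_eq_iff diag_mat_def transpose_def mat_def)

definition block_diag :: "('n \<Rightarrow> real) \<Rightarrow> ('n \<Rightarrow> real) \<Rightarrow> ('n \<Rightarrow> real) \<Rightarrow> ('n \<Rightarrow> real) \<Rightarrow> 'n::finite spmat" where
  "block_diag f g h k = block_mat (diag_mat f) (diag_mat g) (diag_mat h) (diag_mat k)"

lemma block_diag_mult:
  "block_diag f g h k ** block_diag f' g' h' k' =
   block_diag (\<lambda>i. f i * f' i + g i * h' i) (\<lambda>i. f i * g' i + g i * k' i) (\<lambda>i. h i * f' i + k i * h' i) (\<lambda>i. h i * g' i + k i * k' i)"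
  by (simp add: block_diag_def block_mat_mult diag_mat_mult diag_mat_simps(1))

lemma block_diag_scaleR: "r *\<^sub>R block_diag f g h k = block_diag (\<lambda>i. r * f i) (\<lambda>i. r * g i) (\<lambda>i. r * h i) (\<lambda>i. r * k i)"
  by (simp add: block_diag_def block_mat_scaleR diag_mat_simps(3))

lemma block_diag_one: "mat 1 = block_diag (\<lambda>i. 1) (\<lambda>i. 0) (\<lambda>i. 0) (\<lambda>i. 1)"
  by (simp add: block_diag_def block_mat_one[where ?'a = real] diag_mat_simps(5) diag_mat_simps(6))

lemma block_diag_cong:
  "(\<And>i. f i = f' i) \<Longrightarrow> (\<And>i. g i = g' i) \<Longrightarrow> (\<And>i. h i = h' i) \<Longrightarrow> (\<And>i. k i = k' i) \<Longrightarrow> block_diag f g h k = block_diag f' g' h' k'"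
  by (metis ext)

lemma block_diag_nth:
  "block_diag f g h k $ Inl i $ Inl j = (if i = j then f i else 0)" "block_diag f g h k $ Inl i $ Inr j = (if i = j then g i else 0)"
  "block_diag f g h k $ Inr i $ Inl j = (if i = j then h i else 0)" "block_diag f g h k $ Inr i $ Inr j = (if i = j then k i else 0)"
  by (simp_all add: block_diag_def block_mat_def diag_mat_def)

lemma block_diag_v:
  "(block_diag f g h k *v x) $ Inl i = f i * x $ Inl i + g i * x $ Inr i" "(block_diag f g h k *v x) $ Inr i = h i * x $ Inl i + k i * x $ Inr i"
  by (simp_all add: matrix_vector_mult_def sum_UNIV_Plus block_diag_nth if_distrib[of "\<lambda>x. x * _"] cong: if_cong)

lemma J0_block_diag: "J0 = block_diag (\<lambda>i. 0) (\<lambda>i. - 1) (\<lambda>i. 1) (\<lambda>i. 0)"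
  by (simp add: block_diag_def J0_def diag_mat_simps(2,5,6))

text \<open>Hyperbolic with factors \<open>exp a\<close> and \<open>exp (- a)\<close> in the first
  symplectic plane, a rotation by b in each of the others: the closed form of
  \<open>psi2_minus\<close>.\<close>

definition shear_rot :: "real \<Rightarrow> real \<Rightarrow> 'n::{finite,linorder} spmat" where
  "shear_rot a b = block_diag (\<lambda>i. if i = first_index then exp a else cos b) (\<lambda>i. if i = first_index then 0 else - sin b)
     (\<lambda>i. if i = first_index then 0 else sin b) (\<lambda>i. if i = first_index then exp (- a) else cos b)"

lemma shear_rot_nth:
  "(shear_rot a b *v x) $ Inl i = (if i = first_index then exp a * x $ Inl i else cos b * x $ Inl i - sin b * x $ Inr i)"
  "(shear_rot a b *v x) $ Inr i = (if i = first_index then exp (- a) * x $ Inr i else sin b * x $ Inl i + cos b * x $ Inr i)"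
  by (simp_all add: shear_rot_def block_diag_v)

lemma Omega0_sum: "Omega0 x y = (\<Sum>i\<in>UNIV. x $ Inl i * y $ Inr i - x $ Inr i * y $ Inl i)"
  unfolding Omega0_eq inner_vec_def sum_UNIV_Plus sum.distrib[symmetric] J0_block_diag block_diag_v by (intro sum.cong) auto

lemma shear_rot_Sp: "shear_rot a b \<in> Sp"
  unfolding Sp_iff Omega0_sum
proof (intro allI sum.cong refl)
  fix x y :: "'a spvec" and i
  have "(cos b * p - sin b * q) * (sin b * u + cos b * v) - (sin b * p + cos b * q) * (cos b * u - sin b * v)
      = ((cos b)\<^sup>2 + (sin b)\<^sup>2) * (p * v - q * u)" for p q u v
    by algebra
  then have "(cos b * p - sin b * q) * (sin b * u + cos b * v) - (sin b * p + cos b * q) * (cos b * u - sin b * v) = p * v - q * u" for p q u v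
    by simp
  moreover have "exp a * p * (exp (- a) * v) - exp (- a) * q * (exp a * u) = p * v - q * u" for p q u v
    by (simp add: exp_minus field_simps)
  ultimately show "(shear_rot a b *v x) $ Inl i * (shear_rot a b *v y) $ Inr i - (shear_rot a b *v x) $ Inr i * (shear_rot a b *v y) $ Inl i
      = x $ Inl i * y $ Inr i - x $ Inr i * y $ Inl i"
    by (simp add: shear_rot_nth)
qed

text \<open>e and d are complementary indicators of the hyperbolic and the elliptic planes. The
  terms T k collect the Taylor coefficients of exp, cos and sin, and multiplication by the generator
  sends T k to \<open>Suc k\<close> times the next one.\<close>

lemma mat_exp_generator:
  fixes e d :: "'n::finite \<Rightarrow> real" and a b :: real
  assumes e: "\<And>i. e i = 1 \<and> d i = 0 \<or> e i = 0 \<and> d i = 1"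
  shows "mat_exp (block_diag (\<lambda>i. a * e i) (\<lambda>i. - (b * d i)) (\<lambda>i. b * d i) (\<lambda>i. - (a * e i))) =
    block_diag (\<lambda>i. exp a * e i + cos b * d i) (\<lambda>i. - (sin b * d i)) (\<lambda>i. sin b * d i) (\<lambda>i. exp (- a) * e i + cos b * d i)"
    (is "mat_exp ?X = ?R")
proof -
  let ?c = "\<lambda>k::nat. cos_coeff k * b ^ k" and ?s = "\<lambda>k::nat. sin_coeff k * b ^ k" and ?a = "\<lambda>a k::nat. a ^ k /\<^sub>R fact k"
  define T where "T k = block_diag (\<lambda>i. ?a a k * e i + ?c k * d i) (\<lambda>i. - (?s k * d i)) (\<lambda>i. ?s k * d i) (\<lambda>i. ?a (- a) k * e i + ?c k * d i)" for k
  have S: "?X ** T k = real (Suc k) *\<^sub>R T (Suc k)" for k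
  proof -
    have s1: "real (Suc k) * ?a x (Suc k) = x * ?a x k" for x by (simp add: divide_simps del: of_nat_Suc)
    have s2: "real (Suc k) * ?c (Suc k) = - (b * ?s k)" "real (Suc k) * ?s (Suc k) = b * ?c k"
      unfolding cos_coeff_Suc sin_coeff_Suc by (simp_all add: divide_simps del: of_nat_Suc)
    have z: "real (Suc k) * (u * e i + v * d i) = (real (Suc k) * u) * e i + (real (Suc k) * v) * d i"
      "real (Suc k) * (u * d i) = (real (Suc k) * u) * d i" "real (Suc k) * - (u * d i) = - ((real (Suc k) * u) * d i)" for u v i
      by (simp_all add: distrib_left mult.assoc del: of_nat_Suc)
    show ?thesis unfolding T_def block_diag_mult block_diag_scaleR z s1 s2
    proof (rule block_diag_cong)
      fix i
      consider "e i = 1" "d i = 0" | "e i = 0" "d i = 1" using e[of i] by blast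
      note split = this
      show "a * e i * (?a a k * e i + ?c k * d i) + - (b * d i) * (?s k * d i) = a * ?a a k * e i + - (b * ?s k) * d i"
        using split by cases simp_all
      show "a * e i * - (?s k * d i) + - (b * d i) * (?a (- a) k * e i + ?c k * d i) = - (b * ?c k * d i)"
        using split by cases simp_all
      show "b * d i * (?a a k * e i + ?c k * d i) + - (a * e i) * (?s k * d i) = b * ?c k * d i"
        using split by cases simp_all
      show "b * d i * - (?s k * d i) + - (a * e i) * (?a (- a) k * e i + ?c k * d i) = - a * ?a (- a) k * e i + - (b * ?s k) * d i"
        using split by cases simp_all
    qed
  qed
  have pow: "(1 / fact k) *\<^sub>R ((\<lambda>B. ?X ** B) ^^ k) (mat 1) = T k" for k
  proof (induction k)
    case 0
    have "e i + d i = 1" for i using e[of i] by auto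
    then show ?case by (simp add: T_def block_diag_one)
  next
    case (Suc k)
    have "(1 / fact (Suc k)) *\<^sub>R ((\<lambda>B. ?X ** B) ^^ Suc k) (mat 1) = (1 / real (Suc k)) *\<^sub>R (?X ** ((1 / fact k) *\<^sub>R ((\<lambda>B. ?X ** B) ^^ k) (mat 1)))"
      by (simp add: bounded_bilinear.scaleR_right[OF bounded_bilinear_matrix_mult])
    then show ?case unfolding Suc S by simp
  qed
  have "T sums ?R"
    unfolding sums_def
  proof (intro vec_tendstoI)
    fix i j
    have sc: "?c sums cos b" "?s sums sin b" using cos_converges[of b] sin_converges[of b] by simp_all
    have sa: "?a x sums exp x" for x :: real by (rule exp_converges)
    have "(\<lambda>k. T k $ i $ j) sums ?R $ i $ j"
    proof (cases i; cases j)
      fix k l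
      note I = sums_add[OF sums_mult2[OF sa] sums_mult2[OF sc(1)]] sums_mult2[OF sc(2)] sums_minus[OF sums_mult2[OF sc(2)]] sums_zero
      show "i = Inl k \<Longrightarrow> j = Inl l \<Longrightarrow> ?thesis" by (cases "k = l") (simp_all only: T_def block_diag_nth simp_thms if_True if_False I)
      show "i = Inl k \<Longrightarrow> j = Inr l \<Longrightarrow> ?thesis" by (cases "k = l") (simp_all only: T_def block_diag_nth simp_thms if_True if_False I)
      show "i = Inr k \<Longrightarrow> j = Inl l \<Longrightarrow> ?thesis" by (cases "k = l") (simp_all only: T_def block_diag_nth simp_thms if_True if_False I)
      show "i = Inr k \<Longrightarrow> j = Inr l \<Longrightarrow> ?thesis" by (cases "k = l") (simp_all only: T_def block_diag_nth simp_thms if_True if_False I)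
    qed
    then show "((\<lambda>n. (\<Sum>k<n. T k) $ i $ j) \<longlongrightarrow> ?R $ i $ j) sequentially" by (simp add: sums_def)
  qed
  then show ?thesis unfolding mat_exp_def pow by (rule sums_unique[symmetric])
qed

lemma psi2_minus_eq: "psi2_minus t = shear_rot (t * ln 2) (t * pi)"
proof -
  let ?e = "\<lambda>i::'a. if i = first_index then 1 else 0 :: real" and ?d = "\<lambda>i::'a. if i = first_index then 0 else 1 :: real"
    and ?l = "\<lambda>i::'a. if i = first_index then - (ln 2 / pi) else 0"
  have "(t * pi) *\<^sub>R (J0 ** block_mat (diag_mat ?d) (diag_mat ?l) (diag_mat ?l) (diag_mat ?d))
    = block_diag (\<lambda>i. (t * ln 2) * ?e i) (\<lambda>i. - ((t * pi) * ?d i)) (\<lambda>i. (t * pi) * ?d i) (\<lambda>i. - ((t * ln 2) * ?e i))"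
    unfolding J0_block_diag block_diag_def[symmetric] block_diag_mult block_diag_scaleR by (rule block_diag_cong) auto
  then have "psi2_minus t = mat_exp (block_diag (\<lambda>i. (t * ln 2) * ?e i) (\<lambda>i. - ((t * pi) * ?d i)) (\<lambda>i. (t * pi) * ?d i) (\<lambda>i. - ((t * ln 2) * ?e i)))"
    unfolding psi2_minus_def Let_def by simp
  also have "\<dots> = block_diag (\<lambda>i. exp (t * ln 2) * ?e i + cos (t * pi) * ?d i) (\<lambda>i. - (sin (t * pi) * ?d i)) (\<lambda>i. sin (t * pi) * ?d i) (\<lambda>i. exp (- (t * ln 2)) * ?e i + cos (t * pi) * ?d i)"
    by (rule mat_exp_generator) simp
  also have "\<dots> = shear_rot (t * ln 2) (t * pi)"
    unfolding shear_rot_def by (rule block_diag_cong) auto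
  finally show ?thesis .
qed

lemma continuous_on_if_const: "(P \<Longrightarrow> continuous_on S f) \<Longrightarrow> (\<not> P \<Longrightarrow> continuous_on S g) \<Longrightarrow> continuous_on S (\<lambda>x. if P then f x else g x)"
  by (cases P) auto

text \<open>The initial crossing form is indefinite in the first plane and positive in the others:
  2n - 1 positive directions against one negative, so half the signature is n - 1, the prescribed
  degree.\<close>

lemma normalized_W_minus:
  fixes \<rho> :: "'n::{finite,linorder} spmat \<Rightarrow> complex" and \<kappa> :: "'n spmat \<Rightarrow> real"
  assumes deg: "circle_degree 0 1 (\<lambda>t. (\<rho> (psi2_minus t))\<^sup>2) = real CARD('n) - 1"
    and k: "continuous_on Sp \<kappa>" "\<And>A. A \<in> Sp \<Longrightarrow> gr.souriau (Gr A) = (\<rho> A)\<^sup>2 * circ (\<kappa> A)"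
  shows "normalized_at \<kappa> W_minus"
proof -
  let ?\<gamma> = "\<lambda>t. shear_rot (t * ln 2) (t * pi) :: 'n spmat" and ?f = "first_index :: 'n"
  define D :: "'n spmat" where
    "D = block_diag (\<lambda>i. if i = ?f then ln 2 else 0) (\<lambda>i. if i = ?f then 0 else - pi) (\<lambda>i. if i = ?f then 0 else pi) (\<lambda>i. if i = ?f then - ln 2 else 0)"
  have form: "Omega0 x (D *v y) = (\<Sum>i\<in>UNIV. if i = ?f then - ln 2 * (x $ Inr i * y $ Inl i + x $ Inl i * y $ Inr i)
      else pi * (x $ Inl i * y $ Inl i + x $ Inr i * y $ Inr i))" for x y
    unfolding Omega0_sum D_def block_diag_v
    by (intro sum.cong) (auto simp: algebra_simps)
  have form2: "Omega0 x (D *v x) = - 2 * ln 2 * (x $ Inl ?f * x $ Inr ?f) + (\<Sum>i\<in>UNIV - {?f}. pi * ((x $ Inl i)\<^sup>2 + (x $ Inr i)\<^sup>2))" for x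
    unfolding form by (subst sum.remove[of _ ?f]) (auto simp: power2_eq_square algebra_simps intro!: sum.cong)
  \<comment> \<open>In the first plane the form is -2 ln 2 times the product of the coordinates, so
    it is negative on the diagonal direction \<open>?p\<close> and positive on the antidiagonal,
    hence on the hyperplane orthogonal to \<open>?p\<close>.\<close>
  let ?p = "axis (Inl ?f) 1 + axis (Inr ?f) 1 :: 'n spvec"
  have "normalized_at \<kappa> (?\<gamma> 1)"
  proof (rule normalized_atI[where P = "{x. ?p \<bullet> x = 0}" and N = "span {?p}" and D = D, OF _ _ _ _ _ _ _ _ _ _ _ k])
    have "continuous_on {0..1} (\<lambda>t. ?\<gamma> t $ i $ j)" for i j
      unfolding shear_rot_def by (cases i; cases j) (auto simp: block_diag_nth intro!: continuous_on_if_const continuous_intros)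
    then have "continuous_on {0..1} (\<lambda>t. \<chi> i. \<chi> j. ?\<gamma> t $ i $ j)" by (intro continuous_on_vec_lambda)
    then show "continuous_on {0..1} ?\<gamma>" by simp
    show "?\<gamma> 0 = mat 1"
      unfolding shear_rot_def block_diag_one by (rule block_diag_cong) auto
    show "fixspace (?\<gamma> t) = {0}" if t: "t \<in> {0<..1}" for t
    proof -
      have "x = 0" if x: "?\<gamma> t *v x = x" for x :: "'n spvec"
      proof -
        have c: "cos (t * pi) < 1" using cos_monotone_0_pi[of 0 "t * pi"] t by simp
        have "x $ Inl i = 0 \<and> x $ Inr i = 0" for i
        proof (cases "i = ?f")
          case True
          have "exp (t * ln 2) * x $ Inl i = x $ Inl i" "exp (- (t * ln 2)) * x $ Inr i = x $ Inr i"
            using arg_cong[OF x, of "\<lambda>z. z $ Inl i"] arg_cong[OF x, of "\<lambda>z. z $ Inr i"] True by (simp_all add: shear_rot_nth)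
          moreover have "t \<noteq> 0" using t by simp
          ultimately show ?thesis by simp
        next
          case False
          let ?c = "cos (t * pi)" and ?s = "sin (t * pi)" and ?x = "x $ Inl i" and ?y = "x $ Inr i"
          have e: "?c * ?x - ?s * ?y = ?x" "?s * ?x + ?c * ?y = ?y"
            using arg_cong[OF x, of "\<lambda>z. z $ Inl i"] arg_cong[OF x, of "\<lambda>z. z $ Inr i"] False by (simp_all add: shear_rot_nth)
          have "?x\<^sup>2 + ?y\<^sup>2 = ?x * (?c * ?x - ?s * ?y) + ?y * (?s * ?x + ?c * ?y)" unfolding e by (simp add: power2_eq_square)
          also have "\<dots> = ?c * (?x\<^sup>2 + ?y\<^sup>2)" by (simp add: power2_eq_square algebra_simps)
          finally have "?x\<^sup>2 + ?y\<^sup>2 = 0" using c by (metis less_irrefl mult_cancel_right1)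
          then show ?thesis by (simp add: sum_power2_eq_zero_iff)
        qed
        then show "x = 0" unfolding vec_eq_iff by (metis sum.exhaust zero_index)
      qed
      then show ?thesis by (auto simp: fixspace_def)
    qed
    show "(?\<gamma> has_vector_derivative D) (at 0 within {0..1})"
      unfolding has_vector_derivative_within_slope
    proof (intro vec_tendstoI)
      fix i j
      have "((\<lambda>t. ?\<gamma> t $ i $ j) has_vector_derivative D $ i $ j) (at 0 within {0..1})"
        unfolding shear_rot_def D_def has_real_derivative_iff_has_vector_derivative[symmetric]
        by (cases i; cases j) (auto simp: block_diag_nth intro!: derivative_eq_intros)
      then show "((\<lambda>t. ((?\<gamma> t - ?\<gamma> 0) /\<^sub>R (t - 0)) $ i $ j) \<longlongrightarrow> D $ i $ j) (at 0 within {0..1})"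
        unfolding has_vector_derivative_within_slope by simp
    qed
    show "Omega0 x (D *v y) = Omega0 y (D *v x)" for x y unfolding form by (intro sum.cong) auto
    show "subspace {x. ?p \<bullet> x = 0}" by (rule subspace_hyperplane)
    show "pos_def_on {x. ?p \<bullet> x = 0} (\<lambda>x y. Omega0 x (D *v y))"
      unfolding pos_def_on_def
    proof (intro ballI impI)
      fix x :: "'n spvec" assume "x \<in> {x. ?p \<bullet> x = 0}" and x0: "x \<noteq> 0"
      then have xf: "x $ Inr ?f = - x $ Inl ?f" by (simp add: inner_add_left inner_axis')
      have s0: "(\<Sum>i\<in>UNIV - {?f}. pi * ((x $ Inl i)\<^sup>2 + (x $ Inr i)\<^sup>2)) \<ge> 0" by (intro sum_nonneg) simp
      show "0 < Omega0 x (D *v x)"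
      proof (cases "x $ Inl ?f = 0")
        case False
        then have "0 < ln 2 * (x $ Inl ?f)\<^sup>2" by simp
        then show ?thesis using s0 unfolding form2 xf by (simp add: power2_eq_square)
      next
        case True
        obtain j where "x $ j \<noteq> 0" using x0 by (auto simp: vec_eq_iff)
        then obtain i where i: "x $ Inl i \<noteq> 0 \<or> x $ Inr i \<noteq> 0" by (cases j) auto
        then have "i \<noteq> ?f" using True xf by auto
        moreover have "0 < pi * ((x $ Inl i)\<^sup>2 + (x $ Inr i)\<^sup>2)" using i by (simp add: sum_power2_gt_zero_iff)
        ultimately have "0 < (\<Sum>i\<in>UNIV - {?f}. pi * ((x $ Inl i)\<^sup>2 + (x $ Inr i)\<^sup>2))" by (intro sum_pos2[of _ i]) auto
        then show ?thesis unfolding form2 using True by simp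
      qed
    qed
    show "pos_def_on (span {?p}) (\<lambda>x y. - Omega0 x (D *v y))"
      unfolding pos_def_on_def
    proof (intro ballI impI)
      fix x :: "'n spvec" assume "x \<in> span {?p}" and x0: "x \<noteq> 0"
      then obtain r where r: "x = r *\<^sub>R ?p" by (auto simp: span_singleton)
      then have "r \<noteq> 0" using x0 by auto
      have "x $ Inl ?f = r" "x $ Inr ?f = r" "\<And>i. i \<noteq> ?f \<Longrightarrow> x $ Inl i = 0 \<and> x $ Inr i = 0" unfolding r by (simp_all add: axis_def)
      then show "0 < - Omega0 x (D *v x)" unfolding form2 using \<open>r \<noteq> 0\<close> zero_less_power2[of r] by (simp add: power2_eq_square mult.assoc[symmetric])
    qed
    have p0: "?p \<noteq> 0"
    proof
      assume "?p = 0"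
      from arg_cong[OF this, of "\<lambda>x. x $ Inl ?f"] show False by (simp add: axis_def)
    qed
    have d: "dim {x. ?p \<bullet> x = 0} = CARD('n + 'n) - 1" "dim (span {?p}) = 1"
      using dim_hyperplane[OF p0] p0 by (simp_all add: dim_insert)
    show "CARD('n + 'n) \<le> dim {x. ?p \<bullet> x = 0} + dim (span {?p})" unfolding d by simp
    obtain m where "CARD('n) = Suc m" using not0_implies_Suc[OF zero_less_card_finite[THEN less_imp_neq, THEN not_sym]] by blast
    then have c1: "real (CARD('n + 'n) - 1) = 2 * real CARD('n) - 1" by simp
    show "circle_degree 0 1 (\<lambda>t. (\<rho> (?\<gamma> t))\<^sup>2) = (real (dim {x. ?p \<bullet> x = 0}) - real (dim (span {?p}))) / 2"
      using deg unfolding d psi2_minus_eq c1 by simp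
  qed (auto simp: shear_rot_Sp)
  moreover have "?\<gamma> 1 = W_minus"
    unfolding shear_rot_def W_minus_def diag_mat_simps(5)[symmetric] block_diag_def[symmetric] by (rule block_diag_cong) (auto simp: exp_minus)
  ultimately show ?thesis by simp
qed

lemma funpow_commute: "(\<And>x. f (g x) = g (f x)) \<Longrightarrow> (f ^^ k) (g x) = g ((f ^^ k) x)"
  by (induction k) auto

lemma linear_funpow: "linear f \<Longrightarrow> linear (f ^^ k)" for f :: "'a::real_vector \<Rightarrow> 'a"
  by (induction k) (auto simp: linear_id[unfolded id_def] id_def intro: linear_compose)

lemma linear_mv: "linear ((*v) (M :: real^'n::finite^'m::finite))"
  by (rule matrix_vector_mul_linear)

lemma Omega0_span_zero:
  assumes "\<And>x y. x \<in> S \<Longrightarrow> y \<in> T \<Longrightarrow> Omega0 x y = 0" "x \<in> span S" "y \<in> span T" shows "Omega0 x y = 0"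
proof -
  have *: "Omega0 s y = 0" if "s \<in> S" for s
  proof -
    have "span T \<subseteq> {y. Omega0 s y = 0}" using assms(1)[OF that]
      by (intro span_minimal) (auto simp: subspace_def Om_simps)
    then show ?thesis using assms(3) by auto
  qed
  have "span S \<subseteq> {x. Omega0 x y = 0}" using * by (intro span_minimal) (auto simp: subspace_def Om_simps)
  then show ?thesis using assms(2) by auto
qed

section \<open>Deformation on the generalised eigenspace of 1\<close>

locale symplectic_matrix =
  fixes A :: "'n::finite spmat"
  assumes A_Sp: "A \<in> Sp"
begin

abbreviation N where "N \<equiv> (*v) (A - mat 1)"
abbreviation V where "V \<equiv> gen_eigenspace_1 A"
abbreviation Vs where "Vs \<equiv> star_space A"

lemma N_v: "N x = A *v x - x" by (simp add: matrix_vector_mult_diff_rdistrib)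

lemmas Ainv = sp_inv_v[OF A_Sp]

lemma Npow_A: "(N ^^ k) (A *v x) = A *v ((N ^^ k) x)"
  by (rule funpow_commute) (simp add: N_v matrix_vector_mult_diff_distrib)

lemma Npow_Ainv: "(N ^^ k) (sp_inv A *v x) = sp_inv A *v ((N ^^ k) x)"
  by (rule funpow_commute) (simp add: N_v matrix_vector_mult_diff_distrib Ainv)

lemma linear_Npow: "linear (N ^^ k)" by (rule linear_funpow[OF linear_mv])

lemma Npow_add: "(N ^^ k) (x + y) = (N ^^ k) x + (N ^^ k) y" by (rule linear_add[OF linear_Npow])
lemma Npow_scaleR: "(N ^^ k) (r *\<^sub>R x) = r *\<^sub>R (N ^^ k) x" by (rule linear_cmul[OF linear_Npow])
lemma Npow_0: "(N ^^ k) 0 = 0" by (rule linear_0[OF linear_Npow])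

lemma Npow_mono: "(N ^^ j) x = 0 \<Longrightarrow> j \<le> k \<Longrightarrow> (N ^^ k) x = 0"
  using funpow_add[of "k - j" j N] by (simp add: Npow_0)

lemma N_adj: "Omega0 x (N y) = - Omega0 (sp_inv A *v N x) y"
proof -
  have "Omega0 x (A *v y) = Omega0 (sp_inv A *v x) y"
    using Sp_Omega0[OF A_Sp, of "sp_inv A *v x" y] by (simp add: Ainv)
  then show ?thesis by (simp add: N_v matrix_vector_mult_diff_distrib Ainv Om_simps)
qed

lemma V_iff: "x \<in> V \<longleftrightarrow> (\<exists>k. (N ^^ k) x = 0)" by (simp add: gen_eigenspace_1_def)

lemma Vs_iff: "x \<in> Vs \<longleftrightarrow> (\<forall>v\<in>V. Omega0 v x = 0)" by (simp add: star_space_def form_orthogonal_def)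

lemma subspace_V: "subspace V"
  unfolding subspace_def
proof (intro conjI allI ballI)
  show "0 \<in> V" by (auto simp: V_iff Npow_0)
  show "r *\<^sub>R x \<in> V" if "x \<in> V" for r x using that by (auto simp: V_iff Npow_scaleR)
  fix x y assume "x \<in> V" "y \<in> V"
  then obtain j k where "(N ^^ j) x = 0" "(N ^^ k) y = 0" by (auto simp: V_iff)
  then have "(N ^^ max j k) (x + y) = 0" by (simp add: Npow_add Npow_mono[of j x] Npow_mono[of k y])
  then show "x + y \<in> V" unfolding V_iff by blast
qed

lemma subspace_Vs: "subspace Vs"
  unfolding subspace_def by (auto simp: Vs_iff Om_simps)

lemma V_bounded: obtains p where "V = {x. (N ^^ p) x = 0}"
proof -
  obtain B where B: "B \<subseteq> V" "independent B" "V \<subseteq> span B" using maximal_independent_subset by blast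
  have fB: "finite B" using B(2) by (rule independent_imp_finite)
  have "\<forall>b\<in>B. \<exists>k. (N ^^ k) b = 0" using B(1) by (auto simp: V_iff)
  then obtain f where f: "\<And>b. b \<in> B \<Longrightarrow> (N ^^ f b) b = 0" by metis
  have "(N ^^ sum f B) b = 0" if "b \<in> B" for b
    by (rule Npow_mono[OF f[OF that]], rule member_le_sum) (use that fB in auto)
  then have "span B \<subseteq> {x. (N ^^ sum f B) x = 0}"
    by (intro span_minimal) (auto simp: subspace_def Npow_add Npow_0 Npow_scaleR)
  then have "V = {x. (N ^^ sum f B) x = 0}" using B(3) by (auto simp: V_iff)
  then show ?thesis by (rule that)
qed

text \<open>The adjoint of N is minus the inverse of A times N; it commutes with N and so lowers
  kernels of powers as N does.\<close>

lemma Omega0_Npow_kernel: "(N ^^ p) v = 0 \<Longrightarrow> Omega0 v ((N ^^ p) u) = 0"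
proof (induction p arbitrary: v)
  case 0
  then show ?case by (simp add: Om_simps)
next
  case (Suc p)
  have "(N ^^ p) (sp_inv A *v N v) = 0" using Suc.prems by (simp add: Npow_Ainv funpow_swap1)
  then show ?case using Suc.IH by (simp add: N_adj)
qed

text \<open>Fitting decomposition: \<open>V\<close> is the kernel and \<open>Vs\<close> the range of a high power of \<open>A - Id\<close>.\<close>

lemma V_inter_Vs: "V \<inter> Vs = {0}" and V_plus_Vs: "\<exists>v\<in>V. x - v \<in> Vs"
proof -
  obtain p where p: "V = {x. (N ^^ p) x = 0}" by (rule V_bounded)
  have dR: "dim (range (N ^^ p)) + dim V = CARD('n + 'n)"
    using rank_nullity_on[OF linear_Npow subspace_UNIV, of p] by (simp add: p)
  have "dim {w. \<forall>v\<in>V. Omega0 w v = 0} + dim V = CARD('n + 'n) + dim {k \<in> V. \<forall>v. Omega0 v k = 0}"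
    using dim_bilinear_perp[OF bilinear_Omega0 subspace_UNIV subspace_V] by simp
  moreover have "{k \<in> V. \<forall>v. Omega0 v k = 0} = {0}"
  proof -
    have "k = 0" if "\<forall>v. Omega0 v k = 0" for k using Omega0_nondegenerate[of k] that Omega0_skew[of _ k] by (metis neg_equal_0_iff_equal)
    then show ?thesis using subspace_0[OF subspace_V] by (auto simp: Om_simps)
  qed
  moreover have "{w. \<forall>v\<in>V. Omega0 w v = 0} = Vs"
  proof -
    have "Omega0 w v = 0 \<longleftrightarrow> Omega0 v w = 0" for w v using Omega0_skew[of w v] by simp
    then show ?thesis unfolding star_space_def form_orthogonal_def by blast
  qed
  ultimately have dV: "dim Vs + dim V = CARD('n + 'n)" by simp
  have R: "range (N ^^ p) = Vs"
  proof (rule subspace_dim_equal)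
    show "subspace (range (N ^^ p))" by (rule linear_subspace_image[OF linear_Npow subspace_UNIV])
    show "range (N ^^ p) \<subseteq> Vs" using Omega0_Npow_kernel[of p] by (auto simp: Vs_iff p)
    show "dim Vs \<le> dim (range (N ^^ p))" using dV dR by simp
  qed (rule subspace_Vs)
  show i: "V \<inter> Vs = {0}"
  proof -
    have "x = 0" if x: "x \<in> V" "x \<in> Vs" for x
    proof -
      obtain u where u: "x = (N ^^ p) u" using x(2) R by auto
      then have "(N ^^ (p + p)) u = 0" using x(1) by (simp add: p funpow_add)
      then have "u \<in> V" unfolding V_iff by blast
      then show "x = 0" using u by (simp add: p)
    qed
    then show ?thesis using subspace_0[OF subspace_V] subspace_0[OF subspace_Vs] by auto
  qed
  have "{x + y |x y. x \<in> V \<and> y \<in> Vs} = UNIV"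
  proof (rule subspace_dim_equal)
    show "subspace {x + y |x y. x \<in> V \<and> y \<in> Vs}" by (rule subspace_sums[OF subspace_V subspace_Vs])
    show "dim (UNIV :: ('n spvec) set) \<le> dim {x + y |x y. x \<in> V \<and> y \<in> Vs}"
      using dim_sum_le_direct(1)[OF subspace_V subspace_Vs _ subset_UNIV subset_UNIV subspace_UNIV] i dV by simp
  qed auto
  then obtain v w where "v \<in> V" "w \<in> Vs" "x = v + w" by blast
  then show "\<exists>v\<in>V. x - v \<in> Vs" by (intro bexI[of _ v]) auto
qed

lemma Omega0_V_Vs: "v \<in> V \<Longrightarrow> w \<in> Vs \<Longrightarrow> Omega0 v w = 0" "v \<in> V \<Longrightarrow> w \<in> Vs \<Longrightarrow> Omega0 w v = 0"
  using Omega0_skew[of w v] by (auto simp: Vs_iff)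

lemma A_V: "v \<in> V \<Longrightarrow> A *v v \<in> V"
proof -
  assume "v \<in> V"
  then obtain k where "(N ^^ k) v = 0" by (auto simp: V_iff)
  then have "(N ^^ k) (A *v v) = 0" by (simp add: Npow_A)
  then show ?thesis unfolding V_iff by blast
qed

lemma Ainv_V: "v \<in> V \<Longrightarrow> sp_inv A *v v \<in> V"
proof -
  assume "v \<in> V"
  then obtain k where "(N ^^ k) v = 0" by (auto simp: V_iff)
  then have "(N ^^ k) (sp_inv A *v v) = 0" by (simp add: Npow_Ainv)
  then show ?thesis unfolding V_iff by blast
qed

lemma A_Vs: assumes "w \<in> Vs" shows "A *v w \<in> Vs"
  unfolding Vs_iff
proof
  fix v assume "v \<in> V"
  then have "Omega0 (sp_inv A *v v) w = 0" using Ainv_V assms by (auto simp: Vs_iff)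
  then show "Omega0 v (A *v w) = 0" using Sp_Omega0[OF A_Sp, of "sp_inv A *v v" w] by (simp add: Ainv)
qed

lemma V_nondegenerate: assumes "x \<in> V" "\<And>y. y \<in> V \<Longrightarrow> Omega0 x y = 0" shows "x = 0"
proof -
  have "Omega0 y x = 0" if "y \<in> V" for y using assms(2)[OF that] Omega0_skew[of y x] by simp
  then have "x \<in> Vs" by (simp add: Vs_iff)
  then show ?thesis using assms(1) V_inter_Vs by auto
qed

lemma Vs_fixed: assumes "w \<in> Vs" "A *v w = w" shows "w = 0"
proof -
  have "(N ^^ 1) w = 0" using assms(2) by (simp add: N_v)
  then have "w \<in> V" unfolding V_iff by blast
  then show ?thesis using assms(1) V_inter_Vs by auto
qed

lemma decomposition_unique:
  assumes "v \<in> V" "w \<in> Vs" "v' \<in> V" "w' \<in> Vs" "v + w = v' + w'" shows "v = v'" "w = w'"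
proof -
  have "v - v' = w' - w" using assms(5) by (simp add: algebra_simps)
  moreover have "v - v' \<in> V" "w' - w \<in> Vs" using assms by (auto intro: subspace_diff subspace_V subspace_Vs)
  ultimately have "v - v' = 0" using V_inter_Vs by (metis Int_iff singletonD)
  then show "v = v'" "w = w'" using assms(5) by auto
qed

definition P where "P = matrix (\<lambda>x. THE v. v \<in> V \<and> x - v \<in> Vs)"

lemma P_sum: assumes "v \<in> V" "w \<in> Vs" shows "P *v (v + w) = v"
proof -
  define f where "f x = (THE v. v \<in> V \<and> x - v \<in> Vs)" for x
  have f: "f (v + w) = v" if "v \<in> V" "w \<in> Vs" for v w
    unfolding f_def
  proof (rule the_equality)
    fix v' assume "v' \<in> V \<and> v + w - v' \<in> Vs"
    then show "v' = v" using decomposition_unique(1)[OF that, of v' "v + w - v'"] by simp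
  qed (use that in simp)
  have ex: "\<exists>v w. v \<in> V \<and> w \<in> Vs \<and> x = v + w" for x
  proof -
    obtain v where "v \<in> V" "x - v \<in> Vs" using V_plus_Vs by blast
    then show ?thesis by (intro exI[of _ v] exI[of _ "x - v"]) simp
  qed
  have "linear f"
  proof (rule linearI)
    fix x y r
    obtain v w v' w' where d: "v \<in> V" "w \<in> Vs" "x = v + w" "v' \<in> V" "w' \<in> Vs" "y = v' + w'" using ex by metis
    have "f ((v + v') + (w + w')) = v + v'" using d by (intro f) (auto intro: subspace_add subspace_V subspace_Vs)
    then show "f (x + y) = f x + f y" using d f by (simp add: algebra_simps)
    have "f (r *\<^sub>R v + r *\<^sub>R w) = r *\<^sub>R v" using d by (intro f) (auto intro: subspace_scale subspace_V subspace_Vs)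
    then show "f (r *\<^sub>R x) = r *\<^sub>R f x" using d f by (simp add: scaleR_add_right)
  qed
  then have "matrix f *v x = f x" for x using matrix_works[of f x] by (simp add: linear_linear)
  moreover have "P = matrix f" by (simp add: P_def f_def[abs_def])
  ultimately show ?thesis using f[OF assms] by simp
qed

lemma P_V: "v \<in> V \<Longrightarrow> P *v v = v" using P_sum[OF _ subspace_0[OF subspace_Vs], of v] by simp
lemma P_Vs: "w \<in> Vs \<Longrightarrow> P *v w = 0" using P_sum[OF subspace_0[OF subspace_V], of w] by simp

lemma P_in: "P *v x \<in> V" "x - P *v x \<in> Vs"
proof -
  obtain v where v: "v \<in> V" "x - v \<in> Vs" using V_plus_Vs by blast
  have "P *v x = v" using P_sum[OF v] by simp
  then show "P *v x \<in> V" "x - P *v x \<in> Vs" using v by auto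
qed

lemma Omega0_split: "v \<in> V \<Longrightarrow> v' \<in> V \<Longrightarrow> w \<in> Vs \<Longrightarrow> w' \<in> Vs \<Longrightarrow> Omega0 (v + w) (v' + w') = Omega0 v v' + Omega0 w w'"
  by (simp add: Om_simps Omega0_V_Vs)

lemma diamond_v:
  assumes f: "symplectic_endo_on V f" and v: "v \<in> V" and w: "w \<in> Vs"
  shows "diamond Vs ((*v) A) V f *v (v + w) = f v + A *v w"
proof -
  define g where "g x = (THE y. \<exists>w\<in>Vs. \<exists>v\<in>V. x = w + v \<and> y = A *v w + f v)" for x
  have g: "g (v + w) = f v + A *v w" if vw: "v \<in> V" "w \<in> Vs" for v w
    unfolding g_def
  proof (rule the_equality)
    show "\<exists>w'\<in>Vs. \<exists>v'\<in>V. v + w = w' + v' \<and> f v + A *v w = A *v w' + f v'"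
      using vw by (intro bexI[of _ w] bexI[of _ v]) (auto simp: add.commute)
    fix y assume "\<exists>w'\<in>Vs. \<exists>v'\<in>V. v + w = w' + v' \<and> y = A *v w' + f v'"
    then obtain w' v' where d: "w' \<in> Vs" "v' \<in> V" "v + w = v' + w'" "y = A *v w' + f v'" by (metis add.commute)
    then show "y = f v + A *v w" using decomposition_unique[OF vw d(2,1,3)] by (simp add: add.commute)
  qed
  have g': "g x = f (P *v x) + A *v (x - P *v x)" for x using g[OF P_in(1) P_in(2), of x x] by simp
  have "linear g"
  proof (rule linearI)
    fix x y r
    have "f (P *v x + P *v y) = f (P *v x) + f (P *v y)" using f P_in(1) by (auto simp: symplectic_endo_on_def)
    then show "g (x + y) = g x + g y" unfolding g' by (simp add: matrix_vector_right_distrib matrix_vector_mult_diff_distrib)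
    have "f (r *\<^sub>R (P *v x)) = r *\<^sub>R f (P *v x)" using f P_in(1) by (auto simp: symplectic_endo_on_def)
    then show "g (r *\<^sub>R x) = r *\<^sub>R g x" unfolding g'
      by (simp add: matrix_vector_mult_scaleR scaleR_add_right scaleR_diff_right matrix_vector_mult_diff_distrib)
  qed
  then have "matrix g *v x = g x" for x using matrix_works[of g x] by (simp add: linear_linear)
  then show ?thesis using g[OF v w] by (simp add: diamond_def g_def[abs_def])
qed

text \<open>What the argument takes from the interpolating matrices: they differ from A only on V,
  and they have no negative eigenvalue there, which is the sole obstruction to scaling the Cayley
  transform.\<close>

definition admissible :: "'n spmat \<Rightarrow> bool" where
  "admissible B \<longleftrightarrow> B \<in> Sp \<and> (\<forall>w\<in>Vs. B *v w = A *v w) \<and> (\<forall>v\<in>V. B *v v \<in> V) \<and> (\<forall>v\<in>V. \<forall>r<0. B *v v = r *\<^sub>R v \<longrightarrow> v = 0)"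

text \<open>\<open>hat B\<close> is B on V and the identity on \<open>Vs\<close>, while
  \<open>Ahat\<close> is the identity on V and A on \<open>Vs\<close>; their product is B. The
  separation is needed because A may have negative eigenvalues on \<open>Vs\<close>.\<close>

definition hat where "hat B = B ** P + (mat 1 - P)"
definition Ahat where "Ahat = A ** (mat 1 - P) + P"

lemma hat_v: "hat B *v x = B *v (P *v x) + (x - P *v x)"
  by (simp add: hat_def matrix_vector_mult_add_rdistrib matrix_vector_mult_diff_rdistrib matrix_vector_mul_assoc)

lemma Ahat_v: "Ahat *v x = A *v (x - P *v x) + P *v x"
  by (simp add: Ahat_def matrix_vector_mult_add_rdistrib matrix_vector_mult_diff_rdistrib matrix_vector_mul_assoc[symmetric])

lemma Ahat_V: "v \<in> V \<Longrightarrow> Ahat *v v = v" by (simp add: Ahat_v P_V)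
lemma Ahat_Vs: "w \<in> Vs \<Longrightarrow> Ahat *v w = A *v w" by (simp add: Ahat_v P_Vs)


lemma Ahat_Sp: "Ahat \<in> Sp"
  unfolding Sp_iff
proof (intro allI)
  fix x y
  have "Omega0 (Ahat *v x) (Ahat *v y) = Omega0 (P *v x + A *v (x - P *v x)) (P *v y + A *v (y - P *v y))"
    by (simp add: Ahat_v add.commute)
  also have "\<dots> = Omega0 (P *v x) (P *v y) + Omega0 (x - P *v x) (y - P *v y)"
    by (simp add: Omega0_split P_in A_Vs Sp_Omega0[OF A_Sp])
  also have "\<dots> = Omega0 (P *v x + (x - P *v x)) (P *v y + (y - P *v y))" by (rule Omega0_split[symmetric]) (simp_all add: P_in)
  finally show "Omega0 (Ahat *v x) (Ahat *v y) = Omega0 x y" by simp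
qed

context
  fixes B assumes B: "admissible B"
begin

lemma B_Sp: "B \<in> Sp" and B_Vs: "w \<in> Vs \<Longrightarrow> B *v w = A *v w" and B_V: "v \<in> V \<Longrightarrow> B *v v \<in> V"
  and B_neg: "v \<in> V \<Longrightarrow> r < 0 \<Longrightarrow> B *v v = r *\<^sub>R v \<Longrightarrow> v = 0"
  using B by (auto simp: admissible_def)

lemma hat_Sp: "hat B \<in> Sp"
  unfolding Sp_iff
proof (intro allI)
  fix x y
  have "Omega0 (hat B *v x) (hat B *v y) = Omega0 (P *v x) (P *v y) + Omega0 (x - P *v x) (y - P *v y)"
    unfolding hat_v by (subst Omega0_split) (simp_all add: P_in B_V Sp_Omega0[OF B_Sp])
  also have "\<dots> = Omega0 (P *v x + (x - P *v x)) (P *v y + (y - P *v y))" by (rule Omega0_split[symmetric]) (simp_all add: P_in)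
  finally show "Omega0 (hat B *v x) (hat B *v y) = Omega0 x y" by simp
qed

lemma Ahat_hat: "Ahat ** hat B = B"
proof -
  have "Ahat *v (hat B *v x) = B *v x" for x
  proof -
    have "Ahat *v (hat B *v x) = B *v (P *v x) + B *v (x - P *v x)"
      unfolding hat_v matrix_vector_right_distrib by (simp only: Ahat_V[OF B_V[OF P_in(1)]] Ahat_Vs[OF P_in(2)] B_Vs[OF P_in(2)])
    then show ?thesis by (simp flip: matrix_vector_right_distrib)
  qed
  then show ?thesis by (simp add: matrix_eq flip: matrix_vector_mul_assoc)
qed

lemma hat_no_negative: assumes "r < 0" "hat B *v u = r *\<^sub>R u" shows "u = 0"
proof -
  have "B *v (P *v u) + (u - P *v u) = r *\<^sub>R (P *v u) + r *\<^sub>R (u - P *v u)"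
    using assms(2) unfolding hat_v by (simp add: scaleR_diff_right)
  from decomposition_unique[OF B_V[OF P_in(1)] P_in(2) subspace_scale[OF subspace_V P_in(1)] subspace_scale[OF subspace_Vs P_in(2)] this]
  have e: "B *v (P *v u) = r *\<^sub>R (P *v u)" "u - P *v u = r *\<^sub>R (u - P *v u)" .
  have "P *v u = 0" by (rule B_neg[OF P_in(1) assms(1) e(1)])
  moreover have "(1 - r) *\<^sub>R (u - P *v u) = 0" using e(2) by (simp add: scaleR_diff_left)
  then have "u - P *v u = 0" using assms(1) by simp
  ultimately show ?thesis by simp
qed

abbreviation Y where "Y \<equiv> cayinv (hat B)"

lemma hat_dets: "det (hat B + mat 1) \<noteq> 0" "s \<in> {0..1} \<Longrightarrow> det (mat 1 - s *\<^sub>R Y) \<noteq> 0"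
proof -
  show "det (hat B + mat 1) \<noteq> 0" by (rule no_negative_eigenvalue_cay(1)[of _ 0]) (use hat_no_negative in auto)
  show "s \<in> {0..1} \<Longrightarrow> det (mat 1 - s *\<^sub>R Y) \<noteq> 0" by (rule no_negative_eigenvalue_cay(2)) (use hat_no_negative in auto)
qed

lemma Y_alg: "sp_alg Y" by (rule cayinv_sp_alg[OF hat_Sp hat_dets(1)])

lemma Y_skew: "Omega0 (Y *v x) y = - Omega0 x (Y *v y)" using Y_alg by (simp add: sp_alg_def)

lemma hat_onto: obtains u where "x = hat B *v u + u"
proof -
  have "x = (hat B + mat 1) *v (minv (hat B + mat 1) *v x)" by (simp add: minv_v[OF hat_dets(1)])
  then show ?thesis using that by (metis matrix_vector_mult_add_rdistrib matrix_vector_mul_lid)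
qed

lemma Y_hat: "Y *v (hat B *v u + u) = hat B *v u - u" by (rule cayinv_v[OF hat_dets(1)])

lemma Y_V: "Y *v x \<in> V"
proof -
  obtain u where "x = hat B *v u + u" by (rule hat_onto)
  then have "Y *v x = B *v (P *v u) - P *v u" by (simp add: Y_hat) (simp add: hat_v)
  then show ?thesis using subspace_diff[OF subspace_V B_V[OF P_in(1)] P_in(1)] by simp
qed


lemma Y_B: assumes "v \<in> V" shows "Y *v (B *v v + v) = B *v v - v"
  using Y_hat[of v] P_V[OF assms] by (simp add: hat_v)

text \<open>Only the factor living on V is scaled. At s = 0 the result is \<open>Ahat\<close>, the
  same for all admissible B.\<close>

definition deform where "deform s = Ahat ** cay (s *\<^sub>R Y)"

lemma deform_Sp: "s \<in> {0..1} \<Longrightarrow> deform s \<in> Sp"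
proof -
  assume s: "s \<in> {0..1}"
  have "sp_alg (s *\<^sub>R Y)" using sp_alg_comb[OF Y_alg Y_alg, of s 0] by simp
  then show ?thesis unfolding deform_def by (intro Sp_mult Ahat_Sp cay_Sp hat_dets(2)[OF s])
qed

lemma deform_0: "deform 0 = Ahat" by (simp add: deform_def cay_0)
lemma deform_1: "deform 1 = B" using cay_cayinv(2)[OF hat_dets(1)] Ahat_hat by (simp add: deform_def)

lemma deform_v: "s \<in> {0..1} \<Longrightarrow> deform s *v (u - s *\<^sub>R (Y *v u)) = Ahat *v (u + s *\<^sub>R (Y *v u))"
  using cay_v[OF hat_dets(2), of s u] by (simp add: deform_def matrix_vector_mul_assoc[symmetric] scaleR_matrix_vector_assoc)

lemma deform_onto: assumes "s \<in> {0..1}" obtains u where "x = u - s *\<^sub>R (Y *v u)" "u = minv (mat 1 - s *\<^sub>R Y) *v x"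
proof -
  let ?u = "minv (mat 1 - s *\<^sub>R Y) *v x"
  have "x = (mat 1 - s *\<^sub>R Y) *v ?u" by (simp add: minv_v[OF hat_dets(2)[OF assms]])
  also have "\<dots> = ?u - s *\<^sub>R (Y *v ?u)" by (simp only: matrix_vector_mult_diff_rdistrib matrix_vector_mul_lid scaleR_matrix_vector_assoc[symmetric])
  finally show ?thesis using that by blast
qed

lemma fixspace_Ahat: "fixspace Ahat = V"
proof
  show "V \<subseteq> fixspace Ahat" using Ahat_V by (auto simp: fixspace_def)
  show "fixspace Ahat \<subseteq> V"
  proof
    fix x assume "x \<in> fixspace Ahat"
    then have "A *v (x - P *v x) = x - P *v x" by (simp add: fixspace_def Ahat_v algebra_simps)
    then have "x - P *v x = 0" by (rule Vs_fixed[OF P_in(2)])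
    then show "x \<in> V" using P_in(1)[of x] by simp
  qed
qed

text \<open>For \<open>u - s *\<^sub>R (Y *v u)\<close> fixed, the component of the equation in V
  equates \<open>s *\<^sub>R (Y *v u)\<close> with its negative, and the component of u in
  \<open>Vs\<close> is fixed by A, hence 0. As s does not occur in the result, the kernel can change
  only at s = 0.\<close>

lemma fixspace_deform: assumes s: "s \<in> {0<..1}" shows "fixspace (deform s) = {u \<in> V. Y *v u = 0}"
proof -
  have s': "s \<in> {0..1}" "s \<noteq> 0" using s by auto
  show ?thesis
  proof (intro set_eqI iffI)
    fix x assume "x \<in> fixspace (deform s)"
    then have x: "deform s *v x = x" by (simp add: fixspace_def)
    obtain u where u: "x = u - s *\<^sub>R (Y *v u)" by (rule deform_onto[OF s'(1)])
    let ?v = "P *v u" and ?w = "u - P *v u"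
    have VY: "s *\<^sub>R (Y *v u) \<in> V" by (rule subspace_scale[OF subspace_V Y_V])
    have "Ahat *v (u + s *\<^sub>R (Y *v u)) = Ahat *v (?v + s *\<^sub>R (Y *v u)) + Ahat *v ?w" by (simp add: add.commute flip: matrix_vector_right_distrib)
    also have "\<dots> = (?v + s *\<^sub>R (Y *v u)) + A *v ?w"
      by (simp only: Ahat_Vs[OF P_in(2)] Ahat_V[OF subspace_add[OF subspace_V P_in(1) VY]])
    finally have "(?v + s *\<^sub>R (Y *v u)) + A *v ?w = (?v - s *\<^sub>R (Y *v u)) + ?w"
      using x deform_v[OF s'(1), of u] unfolding u[symmetric] by (simp add: u)
    from decomposition_unique[OF subspace_add[OF subspace_V P_in(1) VY] A_Vs[OF P_in(2)] subspace_diff[OF subspace_V P_in(1) VY] P_in(2) this]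
    have e: "?v + s *\<^sub>R (Y *v u) = ?v - s *\<^sub>R (Y *v u)" "A *v ?w = ?w" .
    have "s *\<^sub>R (Y *v u) = - (s *\<^sub>R (Y *v u))" using e(1) by (simp add: algebra_simps)
    then have "(2::real) *\<^sub>R (s *\<^sub>R (Y *v u)) = 0" unfolding scaleR_2 by (rule eq_neg_iff_add_eq_0[THEN iffD1])
    then have "Y *v u = 0" using s'(2) unfolding scaleR_eq_0_iff by simp
    moreover have "?w = 0" by (rule Vs_fixed[OF P_in(2) e(2)])
    ultimately show "x \<in> {u \<in> V. Y *v u = 0}" using u P_in(1)[of u] by simp
  next
    fix x assume "x \<in> {u \<in> V. Y *v u = 0}"
    then show "x \<in> fixspace (deform s)" using deform_v[OF s'(1), of x] Ahat_V by (simp add: fixspace_def)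
  qed
qed

lemma continuous_minv_deform: "continuous_on {0..1} (\<lambda>s. minv (mat 1 - s *\<^sub>R Y))"
  using hat_dets(2) by (intro continuous_on_minv continuous_intros) auto

lemma continuous_deform: "continuous_on {0..1} deform"
  unfolding deform_def cay_def by (intro continuous_on_mm continuous_minv_deform continuous_intros)

lemma deform_derivative:
  assumes x: "x \<in> V" shows "((\<lambda>s. (deform s *v x - x) /\<^sub>R (s - 0)) \<longlongrightarrow> (2 *\<^sub>R Y) *v x) (at 0 within {0..1})"
proof -
  have "((\<lambda>s. (2 *\<^sub>R Y) *v (minv (mat 1 - s *\<^sub>R Y) *v x)) \<longlongrightarrow> (2 *\<^sub>R Y) *v (minv (mat 1 - 0 *\<^sub>R Y) *v x)) (at 0 within {0..1})"
  proof -
    have "continuous_on {0..1} (\<lambda>s. (2 *\<^sub>R Y) *v (minv (mat 1 - s *\<^sub>R Y) *v x))"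
      by (intro continuous_on_mv continuous_minv_deform continuous_on_const)
    then show ?thesis unfolding continuous_on_def by (rule bspec) simp
  qed
  moreover have "minv (mat 1 - 0 *\<^sub>R Y) *v x = x" using minv_v(2)[OF hat_dets(2)[of 0], of x] by simp
  \<comment> \<open>The difference quotient equals \<open>2 *\<^sub>R Y\<close> applied to
    \<open>u = minv (mat 1 - s *\<^sub>R Y) *v x\<close>, so its limit is a matter of continuity of
    \<open>minv\<close>.\<close>
  moreover have "\<forall>\<^sub>F s in at 0 within {0..1}. (2 *\<^sub>R Y) *v (minv (mat 1 - s *\<^sub>R Y) *v x) = (deform s *v x - x) /\<^sub>R (s - 0)"
    unfolding eventually_at_topological
  proof (intro exI[of _ UNIV] conjI ballI impI open_UNIV UNIV_I)
    fix s :: real assume s: "s \<noteq> 0" "s \<in> {0..1}"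
    obtain u where u: "x = u - s *\<^sub>R (Y *v u)" "u = minv (mat 1 - s *\<^sub>R Y) *v x" by (rule deform_onto[OF s(2)])
    have "(2 * s) *\<^sub>R (Y *v u) = s *\<^sub>R (Y *v u) + s *\<^sub>R (Y *v u)" by (simp only: mult_2 scaleR_add_left)
    moreover have "u = x + s *\<^sub>R (Y *v u)" using u(1) by (metis diff_add_cancel)
    ultimately have e: "u + s *\<^sub>R (Y *v u) = x + (2 * s) *\<^sub>R (Y *v u)" by (metis add.assoc)
    have "deform s *v x = Ahat *v (u + s *\<^sub>R (Y *v u))" using deform_v[OF s(2), of u] u(1) by simp
    also have "\<dots> = x + (2 * s) *\<^sub>R (Y *v u)" unfolding e
      by (rule Ahat_V[OF subspace_add[OF subspace_V x subspace_scale[OF subspace_V Y_V]]])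
    finally show "(2 *\<^sub>R Y) *v (minv (mat 1 - s *\<^sub>R Y) *v x) = (deform s *v x - x) /\<^sub>R (s - 0)"
      using s(1) by (simp add: u(2)[symmetric] scaleR_matrix_vector_assoc[symmetric])
  qed
  ultimately show ?thesis by (simp add: tendsto_cong)
qed

definition cayley_sign where "cayley_sign = signature V (\<lambda>x y. Omega0 x (Y *v y))"

lemma Y_sym: "Omega0 x (Y *v y) = Omega0 y (Y *v x)" using Y_skew[of y x] Omega0_skew[of "Y *v y" x] Omega0_skew[of "Y *v x" y] Y_skew[of x y] by linarith

lemma symform_Y: "symform V (\<lambda>x y. Omega0 x (Y *v y))" by (rule symform_Omega_deriv[OF subspace_V Y_sym])

text \<open>At s = 0 the crossing form is twice the Cayley form on V. Its radical is the kernel of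
  Y, which is exactly the kernel that persists for s > 0; so the rank condition holds even where the
  form is degenerate.\<close>

lemma sp_index_deform:
  assumes th: "sp_lift 0 1 deform \<theta>"
  shows "sp_index \<theta> deform 1 - sp_index \<theta> deform 0 = cayley_sign / 2"
proof -
  have D: "Omega0 x ((2 *\<^sub>R Y) *v y) = 2 * Omega0 x (Y *v y)" for x y by (simp add: scaleR_matrix_vector_assoc[symmetric] Om_simps)
  have f0: "fixspace (deform 0) = V" by (simp add: deform_0 fixspace_Ahat)
  have rad: "radical V (\<lambda>x y. Omega0 x ((2 *\<^sub>R Y) *v y)) \<subseteq> {u \<in> V. Y *v u = 0}"
  proof -
    have "Y *v v = 0" if v: "v \<in> radical V (\<lambda>x y. Omega0 x ((2 *\<^sub>R Y) *v y))" for v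
      by (rule V_nondegenerate[OF Y_V]) (use v Y_skew in \<open>auto simp: radical_def D\<close>)
    then show ?thesis by (auto simp: radical_def)
  qed
  have "sp_index \<theta> deform 1 - sp_index \<theta> deform 0 = signature (fixspace (deform 0)) (\<lambda>x y. Omega0 x ((2 *\<^sub>R Y) *v y)) / 2"
    by (rule sp_index_constant_kernel[OF _ continuous_deform deform_Sp th fixspace_deform])
      (use deform_derivative Y_sym dim_subset[OF rad] in \<open>auto simp: f0 D\<close>)
  then show ?thesis unfolding f0 D cayley_sign_def by (simp add: signature_scale[OF symform_Y])
qed

end

end

section \<open>The index along admissible matrices and at the hyperbolic end\<close>

context symplectic_matrix
begin

lemma continuous_hat: "continuous_on S f \<Longrightarrow> continuous_on S (\<lambda>p. hat (f p))"
  unfolding hat_def by (intro continuous_on_add continuous_on_mm continuous_on_const)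

text \<open>The crossings of the path itself are uncontrolled, so it is compared with the other
  three sides of the square of deformations: the side s = 0 is constant at \<open>Ahat\<close>, and
  each vertical side contributes half a \<open>cayley_sign\<close>. A lift over the square matches
  them.\<close>

lemma sp_index_admissible_path:
  assumes ab: "a < b" and cont: "continuous_on {a..b} \<Psi>" and adm: "\<And>t. t \<in> {a..b} \<Longrightarrow> admissible (\<Psi> t)" and th: "sp_lift a b \<Psi> \<theta>"
  shows "sp_index \<theta> \<Psi> b - sp_index \<theta> \<Psi> a = (cayley_sign (\<Psi> b) - cayley_sign (\<Psi> a)) / 2"
proof -
  define H where "H p = deform (\<Psi> (snd p)) (fst p)" for p
  let ?D = "{0..1::real} \<times> {a..b}"
  have cP: "continuous_on ?D (\<lambda>p. \<Psi> (snd p))"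
    by (rule continuous_on_compose2[OF cont continuous_on_snd[OF continuous_on_id]]) auto
  have cY: "continuous_on ?D (\<lambda>p. cayinv (hat (\<Psi> (snd p))))" unfolding cayinv_def
    by (intro continuous_on_mm continuous_on_minv continuous_on_add continuous_on_diff continuous_on_const continuous_hat cP)
      (use hat_dets(1)[OF adm] in auto)
  have "continuous_on ?D (\<lambda>p. Ahat ** cay (fst p *\<^sub>R cayinv (hat (\<Psi> (snd p)))))" unfolding cay_def
    by (intro continuous_on_mm continuous_on_minv continuous_on_add continuous_on_diff continuous_on_const continuous_on_scaleR
        continuous_on_fst continuous_on_id cY) (use hat_dets(2)[OF adm] in auto)
  then have cH: "continuous_on ?D H" by (rule continuous_on_eq) (auto simp: H_def deform_def[OF adm])
  have HSp: "H p \<in> Sp" if "p \<in> ?D" for p unfolding H_def using deform_Sp[OF adm] that by auto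
  have "continuous_on ?D (\<lambda>p. gr.souriau (Gr (H p)))" by (rule gr.continuous_souriau[OF continuous_closest_Gr[OF cH]])
  moreover have "convex ?D" by (intro convex_Times convex_real_interval)
  ultimately obtain \<Theta> where T: "continuous_on ?D \<Theta>" "\<And>p. p \<in> ?D \<Longrightarrow> gr.souriau (Gr (H p)) = circ (\<Theta> p)"
    using circle_lift[of ?D "\<lambda>p. gr.souriau (Gr (H p))"] gr.norm_souriau[OF lagrangian_Gr[OF HSp]] by blast
  have Tt: "continuous_on {a..b} (\<lambda>t. \<Theta> (s, t))" if "s \<in> {0..1}" for s
    by (rule continuous_on_compose2[OF T(1)]) (use that in \<open>auto intro!: continuous_intros\<close>)
  have vert: "(\<Theta> (1, t) + gr.correction (Gr (\<Psi> t))) - (\<Theta> (0, t) + gr.correction (Gr Ahat)) = cayley_sign (\<Psi> t) / 2" if t: "t \<in> {a..b}" for t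
  proof -
    have "continuous_on {0..1} (\<lambda>s. \<Theta> (s, t))"
      by (rule continuous_on_compose2[OF T(1)]) (use t in \<open>auto intro!: continuous_intros\<close>)
    then have "sp_lift 0 1 (deform (\<Psi> t)) (\<lambda>s. \<Theta> (s, t))" using T(2) t by (auto simp: sp_lift_def H_def)
    from sp_index_deform[OF adm[OF t] this] show ?thesis by (simp add: sp_index_def deform_0[OF adm[OF t]] deform_1[OF adm[OF t]])
  qed
  have abI: "a \<in> {a..b}" "b \<in> {a..b}" using ab by auto
  have "\<Theta> (0, b) - 0 = \<Theta> (0, a) - 0"
  proof (rule circle_lift_diff_unique[OF connected_Icc Tt continuous_on_const])
    show "circ (\<Theta> (0, t)) = gr.souriau (Gr Ahat) * circ 0" if "t \<in> {a..b}" for t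
      using T(2)[of "(0, t)"] that deform_0[OF adm[OF that]] by (simp add: H_def)
  qed (use abI in auto)
  moreover have "\<Theta> (1, b) - \<theta> b = \<Theta> (1, a) - \<theta> a"
  proof (rule circle_lift_diff_unique[OF connected_Icc Tt])
    show "circ (\<Theta> (1, t)) = 1 * circ (\<theta> t)" if "t \<in> {a..b}" for t
      using T(2)[of "(1, t)"] that deform_1[OF adm[OF that]] th by (simp add: H_def sp_lift_def)
  qed (use abI th in \<open>auto simp: sp_lift_def\<close>)
  ultimately show ?thesis using vert[OF abI(1)] vert[OF abI(2)] by (simp add: sp_index_def)
qed

lemma admissible_diamond:
  assumes B: "B \<in> Sp" "B = diamond Vs ((*v) A) V f" and f: "symplectic_endo_on V f"
    and ev: "\<And>c. eigenvalue_on V f c \<Longrightarrow> c \<in> \<real> \<and> Re c > 0"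
  shows "admissible B" "v \<in> V \<Longrightarrow> B *v v = f v"
proof -
  have f0: "f 0 = 0" using f subspace_0[OF subspace_V] unfolding symplectic_endo_on_def by (metis scaleR_zero_left)
  have Bv: "B *v v = f v" if "v \<in> V" for v using diamond_v[OF f that subspace_0[OF subspace_Vs]] by (simp add: B(2))
  then show "v \<in> V \<Longrightarrow> B *v v = f v" .
  have Bw: "B *v w = A *v w" if "w \<in> Vs" for w using diamond_v[OF f subspace_0[OF subspace_V] that] by (simp add: B(2) f0)
  have "v = 0" if v: "v \<in> V" "r < 0" "f v = r *\<^sub>R v" for v r
  proof (rule ccontr)
    assume "v \<noteq> 0"
    then have "eigenvalue_on V f (complex_of_real r)" unfolding eigenvalue_on_def
      using v f0 subspace_0[OF subspace_V] by (intro bexI[of _ v] bexI[of _ 0]) auto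
    then show False using ev v(2) by force
  qed
  then show "admissible B" unfolding admissible_def using B(1) Bv Bw f by (auto simp: symplectic_endo_on_def)
qed

text \<open>On the span K of the vectors \<open>p i\<close> the Cayley transform is a nonzero scalar
  c, so K is isotropic for the Cayley form and equal to its own complement; isotropic reduction
  leaves the zero form.\<close>

lemma cayley_sign_hyperbolic:
  assumes B: "admissible B" and h: "standard_hyperbolic_on V f" and Bf: "\<And>v. v \<in> V \<Longrightarrow> B *v v = f v"
  shows "cayley_sign B = 0"
proof -
  let ?Y = "cayinv (hat B)"
  obtain m p q where bas: "symplectic_basis V m p q" and pq: "\<And>i. i < m \<Longrightarrow> f (p i) = exp (- 1) *\<^sub>R p i \<and> f (q i) = exp 1 *\<^sub>R q i"
    using h by (auto simp: standard_hyperbolic_on_def)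
  let ?S = "p ` {..<m}" and ?T = "q ` {..<m}"
  have sp: "span (?S \<union> ?T) = V" and Om: "\<And>i j. i < m \<Longrightarrow> j < m \<Longrightarrow> Omega0 (p i) (p j) = 0 \<and> Omega0 (q i) (q j) = 0 \<and> Omega0 (p i) (q j) = (if i = j then 1 else 0)"
    using bas by (auto simp: symplectic_basis_def)
  have SV: "?S \<subseteq> V" "?T \<subseteq> V" using span_superset[of "?S \<union> ?T"] sp by auto
  let ?K = "span ?S"
  have KV: "?K \<subseteq> V" using span_minimal[OF SV(1) subspace_V] .
  have pp: "Omega0 x y = 0" if "x \<in> ?K" "y \<in> ?K" for x y by (rule Omega0_span_zero[OF _ that]) (use Om in auto)
  \<comment> \<open>The scalar Cayley transform of the eigenvalue \<open>exp (- 1)\<close>.\<close>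
  define c where "c = (exp (- 1) - 1) / (exp (- 1) + 1 :: real)"
  have e1: "exp (- 1) + 1 \<noteq> (0::real)" using exp_gt_zero[of "-1::real"] by linarith
  have c: "(exp (- 1) + 1) * c = exp (- 1) - 1" "c \<noteq> 0"
    using e1 by (auto simp: c_def divide_simps)
  have Yp: "?Y *v x = c *\<^sub>R x" if "x \<in> ?K" for x
  proof -
    have "?Y *v s = c *\<^sub>R s" if "s \<in> ?S" for s
    proof -
      have sV: "s \<in> V" and fs: "f s = exp (- 1) *\<^sub>R s" using that SV pq by auto
      have "?Y *v ((exp (- 1) + 1) *\<^sub>R s) = ((exp (- 1) + 1) * c) *\<^sub>R s"
        using Y_B[OF B sV] fs by (simp add: Bf[OF sV] c(1) scaleR_add_left scaleR_diff_left)
      then have "(exp (- 1) + 1) *\<^sub>R (?Y *v s) = (exp (- 1) + 1) *\<^sub>R (c *\<^sub>R s)" by (simp add: matrix_vector_mult_scaleR)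
      then show ?thesis using e1 by (metis scaleR_cancel_left)
    qed
    then show ?thesis
      using linear_eq_on_span[OF linear_mv linear_scale_self _ that] by blast
  qed
  let ?B = "\<lambda>x y. Omega0 x (?Y *v y)"
  have perp: "{v \<in> V. \<forall>k\<in>?K. ?B v k = 0} \<subseteq> ?K"
  proof
    fix v assume "v \<in> {v \<in> V. \<forall>k\<in>?K. ?B v k = 0}"
    then have v: "v \<in> V" "\<And>k. k \<in> ?K \<Longrightarrow> Omega0 v k = 0" using Yp c(2) by (auto simp: Om_simps)
    obtain x y where xy: "v = x + y" "x \<in> ?K" "y \<in> span ?T" using v(1) sp[symmetric] by (auto simp: span_Un)
    have yV: "y \<in> V" using xy(3) span_minimal[OF SV(2) subspace_V] by auto
    have "Omega0 y z = 0" if "z \<in> V" for z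
    proof -
      obtain z1 z2 where z: "z = z1 + z2" "z1 \<in> ?K" "z2 \<in> span ?T" using \<open>z \<in> V\<close> sp[symmetric] by (auto simp: span_Un)
      have "Omega0 y z1 = 0" using v(2)[OF z(2)] pp[OF xy(2) z(2)] by (simp add: xy(1) Om_simps)
      moreover have "Omega0 y z2 = 0" by (rule Omega0_span_zero[OF _ xy(3) z(3)]) (use Om in auto)
      ultimately show ?thesis by (simp add: z(1) Om_simps)
    qed
    then have "y = 0" by (rule V_nondegenerate[OF yV])
    then show "v \<in> ?K" using xy by simp
  qed
  have iso: "?B x y = 0" if "x \<in> ?K" "y \<in> ?K" for x y using pp[OF that] by (simp add: Yp[OF that(2)] Om_simps)
  have "signature {v \<in> V. \<forall>k\<in>?K. ?B v k = 0} ?B = 0"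
  proof (rule signature_zero_form)
    show "symform {v \<in> V. \<forall>k\<in>?K. ?B v k = 0} ?B"
      by (rule symform_subspace[OF symform_Y[OF B]]) (use symform_Y[OF B] in \<open>auto simp: symform_def intro!: subspace_perp_on\<close>)
  qed (use perp iso in blast)
  then show ?thesis using signature_isotropic_reduction[OF symform_Y[OF B] subspace_span KV iso] by (simp add: cayley_sign_def[OF B])
qed

text \<open>On the last surviving power A acts as the identity, so the inverse of A in the adjoint
  of N disappears and only signs remain.\<close>

lemma Omega0_Npow_right: "N ((N ^^ j) u) = 0 \<Longrightarrow> Omega0 u ((N ^^ j) w) = (-1) ^ j * Omega0 ((N ^^ j) u) w"
proof (induction j arbitrary: u)
  case (Suc j)
  let ?u = "sp_inv A *v N u"
  have e: "(N ^^ j) ?u = (N ^^ Suc j) u"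
  proof -
    have "(N ^^ j) ?u = sp_inv A *v ((N ^^ Suc j) u)" by (simp add: Npow_Ainv funpow_swap1)
    moreover have "A *v ((N ^^ Suc j) u) = (N ^^ Suc j) u" using Suc.prems unfolding N_v by simp
    ultimately show ?thesis using Ainv(1) by metis
  qed
  have "Omega0 u ((N ^^ Suc j) w) = - Omega0 ?u ((N ^^ j) w)" by (simp add: N_adj)
  also have "\<dots> = - ((-1) ^ j * Omega0 ((N ^^ j) ?u) w)" using Suc.IH[of ?u] Suc.prems unfolding e by simp
  finally show ?case unfolding e by simp
qed simp

lemma Qhat_eq: assumes "(N ^^ (2 * k)) v = 0" "k \<ge> 1" shows "Qhat A k v w = (-1) ^ (k - 1) * Omega0 ((N ^^ (2 * k - 1)) v) w"
proof -
  have s: "(N ^^ (k - 1)) ((N ^^ k) v) = (N ^^ (2 * k - 1)) v"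
  proof -
    have "(k - 1) + k = 2 * k - 1" using assms(2) by simp
    then show ?thesis using funpow_add[of "k - 1" k N] by (simp add: o_def)
  qed
  have "N ((N ^^ (2 * k - 1)) v) = (N ^^ Suc (2 * k - 1)) v" by simp
  also have "Suc (2 * k - 1) = 2 * k" using assms(2) by simp
  finally have "N ((N ^^ (k - 1)) ((N ^^ k) v)) = 0" unfolding s using assms(1) by simp
  from Omega0_Npow_right[OF this, of w] show ?thesis unfolding s by (simp add: Qhat_def)
qed

section \<open>Comparison of \<open>Qhat\<close> with powers of the Cayley transform\<close>

context
  assumes adm: "admissible A"
begin

abbreviation Z where "Z \<equiv> (*v) (cayinv (hat A))"

lemma Z_rel: assumes "v \<in> V" shows "Z (N v + 2 *\<^sub>R v) = N v"
proof -
  have "N v + 2 *\<^sub>R v = A *v v + v" by (simp add: N_v scaleR_2)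
  then show ?thesis using Y_B[OF adm assms] by (simp only: N_v)
qed

lemma linear_Zpow: "linear (Z ^^ k)" by (rule linear_funpow[OF linear_mv])

lemma Npow_V: "v \<in> V \<Longrightarrow> (N ^^ k) v \<in> V"
  by (induction k) (auto simp: N_v intro: subspace_diff subspace_V A_V)

text \<open>This is A plus the identity; on V it is invertible, since -1 is no eigenvalue there, it
  commutes with N, and \<open>Z\<close> applied to \<open>M v\<close> is \<open>N v\<close>.\<close>

abbreviation M where "M \<equiv> \<lambda>v. N v + 2 *\<^sub>R v"

lemma M_V: "v \<in> V \<Longrightarrow> M v \<in> V" using Npow_V[of v 1] by (auto intro: subspace_add subspace_scale subspace_V)
lemma Mpow_V: "v \<in> V \<Longrightarrow> (M ^^ k) v \<in> V" by (induction k) (auto intro: M_V simp del: funpow.simps simp add: funpow.simps)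

lemma Npow_M: "(N ^^ k) (M v) = M ((N ^^ k) v)" by (simp add: Npow_add Npow_scaleR funpow_swap1)

lemma Npow_Mpow: "(N ^^ k) ((M ^^ j) v) = (M ^^ j) ((N ^^ k) v)"
  by (rule funpow_commute[of M "N ^^ k", symmetric]) (simp only: Npow_M)

lemma M_zero: assumes "v \<in> V" "M v = 0" shows "v = 0"
proof -
  have "A *v v = (-1) *\<^sub>R v" using assms(2) by (simp add: N_v scaleR_2 algebra_simps eq_neg_iff_add_eq_0)
  then show ?thesis using B_neg[OF adm assms(1), of "-1"] by simp
qed

lemma Mpow_zero: "v \<in> V \<Longrightarrow> (M ^^ k) v = 0 \<Longrightarrow> v = 0"
proof (induction k)
  case (Suc k)
  then show ?case using M_zero[OF Mpow_V[OF Suc.prems(1)], of k] by simp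
qed simp

lemma linear_M: "linear M" by (intro linearI) (simp_all add: matrix_vector_right_distrib matrix_vector_mult_scaleR scaleR_add_right)

lemma Mpow_onto: assumes "v \<in> V" obtains w where "w \<in> V" "v = (M ^^ k) w"
proof -
  have l: "linear (M ^^ k)" by (rule linear_funpow[OF linear_M])
  have "inj_on (M ^^ k) V"
    using Mpow_zero l by (subst linear_injective_on_subspace_0[OF l subspace_V]) auto
  then have "dim ((M ^^ k) ` V) = dim V" using l subspace_V by (intro dim_image_eq) (auto simp: span_eq_iff[THEN iffD2])
  moreover have "(M ^^ k) ` V \<subseteq> V" using Mpow_V by auto
  ultimately have "(M ^^ k) ` V = V"
    by (intro subspace_dim_equal linear_subspace_image[OF l] subspace_V) auto
  then have "v \<in> (M ^^ k) ` V" using assms by (simp only:)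
  then show ?thesis using that by (elim imageE)
qed

lemma Npow_Zpow: "v \<in> V \<Longrightarrow> (N ^^ j) v = (Z ^^ j) ((M ^^ j) v)"
proof (induction j arbitrary: v)
  case (Suc j)
  have "(N ^^ Suc j) v = Z ((N ^^ j) (M v))" unfolding Npow_M using Z_rel[OF Npow_V[OF Suc.prems]] by simp
  also have "\<dots> = Z ((Z ^^ j) ((M ^^ j) (M v)))" using Suc.IH[OF M_V[OF Suc.prems]] by simp
  also have "(M ^^ j) (M v) = (M ^^ Suc j) v" using funpow_swap1[of M j v] by simp
  finally show ?case by simp
qed simp

text \<open>On V, \<open>N ^^ j\<close> is \<open>Z ^^ j\<close> after the bijection
  \<open>M ^^ j\<close>, and M commutes with N.\<close>

lemma Zpow_kernel: assumes "v \<in> V" shows "(Z ^^ j) v = 0 \<longleftrightarrow> (N ^^ j) v = 0"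
proof -
  obtain w where w: "w \<in> V" "v = (M ^^ j) w" by (rule Mpow_onto[OF assms])
  have "(Z ^^ j) v = (N ^^ j) w" using Npow_Zpow[OF w(1)] w(2) by simp
  moreover have "(N ^^ j) v = (M ^^ j) ((N ^^ j) w)" unfolding w(2) by (rule Npow_Mpow)
  moreover have "(M ^^ j) ((N ^^ j) w) = 0 \<longleftrightarrow> (N ^^ j) w = 0"
  proof
    show "(M ^^ j) ((N ^^ j) w) = 0" if "(N ^^ j) w = 0" unfolding that by (rule linear_0[OF linear_funpow[OF linear_M]])
  qed (rule Mpow_zero[OF Npow_V[OF w(1)]])
  ultimately show ?thesis by simp
qed

text \<open>In N = Z (N + 2) the summand N raises the power by one and is killed, so on the highest
  surviving power N acts like 2 Z.\<close>

lemma Npow_eq_Zpow: "v \<in> V \<Longrightarrow> (N ^^ Suc j) v = 0 \<Longrightarrow> (N ^^ j) v = 2 ^ j *\<^sub>R (Z ^^ j) v"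
proof (induction j arbitrary: v)
  case (Suc j)
  have Nv: "N v \<in> V" using Npow_V[OF Suc.prems(1), of 1] by simp
  have "(N ^^ Suc j) (N v) = 0" using Suc.prems(2) by (simp add: funpow_swap1)
  note z = this
  have "(N ^^ Suc j) v = (N ^^ j) (N v)" by (simp add: funpow_swap1)
  also have "\<dots> = 2 ^ j *\<^sub>R (Z ^^ j) (N v)" by (rule Suc.IH[OF Nv z])
  also have "N v = Z (N v + 2 *\<^sub>R v)" using Z_rel[OF Suc.prems(1)] by simp
  also have "(Z ^^ j) (Z (N v + 2 *\<^sub>R v)) = (Z ^^ Suc j) (N v + 2 *\<^sub>R v)" by (simp add: funpow_swap1)
  also have "\<dots> = (Z ^^ Suc j) (N v) + 2 *\<^sub>R (Z ^^ Suc j) v"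
    by (simp only: linear_add[OF linear_Zpow] linear_cmul[OF linear_Zpow])
  also have "(Z ^^ Suc j) (N v) = 0" using Zpow_kernel[OF Nv] z by blast
  finally show ?case by simp
qed simp

text \<open>Both forms reduce to \<open>\<Omega>\<^sub>0\<close> with a power
  \<open>2 * k - 1\<close> on the left. The factor 2 to that power is positive; the signs
  \<open>(-1) ^ (k - 1)\<close> and \<open>(-1) ^ k\<close> differ, which explains the
  minus.\<close>

lemma Qhat_sign_eq: assumes k: "k \<ge> 1"
  shows "Qhat_sign A k = - signature {v \<in> V. (Z ^^ (2 * k)) v = 0} (nil_form Omega0 Z k)"
proof -
  let ?U = "{v. (N ^^ (2 * k)) v = 0}"
  have U: "{v \<in> V. (Z ^^ (2 * k)) v = 0} = ?U" using Zpow_kernel V_iff by blast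
  have sU: "subspace ?U" by (auto simp: subspace_def Npow_0 Npow_add Npow_scaleR)
  have skZ: "Omega0 (Z x) y = - Omega0 x (Z y)" for x y by (rule Y_skew[OF adm])
  note sk = Omega0_skew
  have ZV: "Z ` V \<subseteq> V" using Y_V[OF adm] by auto
  have sn: "symform ?U (nil_form Omega0 Z k)"
    by (rule symform_nil_form[OF bilinear_Omega0 sk linear_mv skZ subspace_V ZV V_nondegenerate sU k])
  have q: "Qhat A k v w = - (2 ^ (2 * k - 1) * nil_form Omega0 Z k v w)" if v: "v \<in> ?U" for v w
  proof -
    have "(N ^^ Suc (2 * k - 1)) v = 0" using v k by (simp del: funpow.simps)
    then have "(N ^^ (2 * k - 1)) v = 2 ^ (2 * k - 1) *\<^sub>R (Z ^^ (2 * k - 1)) v" using v V_iff by (intro Npow_eq_Zpow) auto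
    then have "Qhat A k v w = (-1) ^ (k - 1) * (2 ^ (2 * k - 1) * Omega0 ((Z ^^ (2 * k - 1)) v) w)"
      using Qhat_eq[of k v w] v k by (simp add: Om_simps)
    moreover have "nil_form Omega0 Z k v w = (-1) ^ k * Omega0 ((Z ^^ (2 * k - 1)) v) w"
      by (rule nil_form_eq[OF bilinear_Omega0 sk linear_mv skZ subspace_V ZV V_nondegenerate k])
    moreover have "(-1) ^ k = - ((-1::real) ^ (k - 1))" using k by (cases k) auto
    ultimately show ?thesis by simp
  qed
  have "Qhat_sign A k = signature ?U (\<lambda>v w. - (2 ^ (2 * k - 1) * nil_form Omega0 Z k v w))"
    unfolding Qhat_sign_def by (rule signature_cong) (rule q)
  also have "\<dots> = signature ?U (\<lambda>v w. 2 ^ (2 * k - 1) * - nil_form Omega0 Z k v w)" by simp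
  also have "\<dots> = - signature ?U (nil_form Omega0 Z k)"
    by (simp only: signature_scale[OF symform_uminus[OF sn] zero_less_power[OF zero_less_numeral]] signature_uminus[OF sn])
  finally show ?thesis unfolding U .
qed

lemma infsum_Qhat_sign: "(\<Sum>\<^sub>\<infinity>k\<in>{1..}. real_of_int (Qhat_sign A k)) = - real_of_int (cayley_sign A)"
proof -
  obtain p where p: "V = {x. (N ^^ p) x = 0}" by (rule V_bounded)
  have skZ: "Omega0 (Z x) y = - Omega0 x (Z y)" for x y by (rule Y_skew[OF adm])
  have ZV: "Z ` V \<subseteq> V" using Y_V[OF adm] by auto
  have sum: "cayley_sign A = - (\<Sum>k=1..q. Qhat_sign A k)" if q: "p \<le> q" for q
  proof -
    have nilq: "(Z ^^ q) w = 0" if "w \<in> V" for w using that Zpow_kernel Npow_mono[OF _ q] p by blast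
    have "cayley_sign A = (\<Sum>k=1..q. signature {v \<in> V. (Z ^^ (2 * k)) v = 0} (nil_form Omega0 Z k))"
      unfolding cayley_sign_def[OF adm]
      by (rule signature_nilpotent_sum[OF bilinear_Omega0 Omega0_skew linear_mv skZ subspace_V ZV V_nondegenerate nilq])
    also have "\<dots> = (\<Sum>k=1..q. - Qhat_sign A k)" using Qhat_sign_eq by (intro sum.cong) auto
    finally show ?thesis by (simp add: sum_negf)
  qed
  \<comment> \<open>The partial sums up to any q at least p all have the same value; consecutive
    ones show that the terms beyond p vanish and the infinite sum is finite.\<close>
  have "Qhat_sign A k = 0" if "k > p" for k
    using sum[of "k - 1"] sum[of k] that by (cases k) auto
  then have "(\<Sum>\<^sub>\<infinity>k\<in>{1..}. real_of_int (Qhat_sign A k)) = (\<Sum>\<^sub>\<infinity>k\<in>{1..p}. real_of_int (Qhat_sign A k))"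
    by (intro infsum_cong_neutral) auto
  then show ?thesis using sum[of p] by simp
qed

end

end

section \<open>Assembly of the index formula\<close>

lemma fixspace_admits: "\<not> admits_eigenvalue_1 B \<Longrightarrow> fixspace B = {0}" for B :: "real^'n::finite^'n"
  unfolding admits_eigenvalue_1_def eigenvalue_on_def fixspace_def by force

lemma sp_lift_subset: "sp_lift a b \<gamma> \<theta> \<Longrightarrow> {c..d} \<subseteq> {a..b} \<Longrightarrow> sp_lift c d \<gamma> \<theta>"
  unfolding sp_lift_def by (auto intro: continuous_on_subset)

theorem theorem3:
  fixes \<psi> \<Psi> :: "real \<Rightarrow> real^('n::{finite,linorder} + 'n)^('n + 'n)"
    and \<phi>\<^sub>0 \<phi>\<^sub>1 :: "real \<Rightarrow> real^('n + 'n) \<Rightarrow> real^('n + 'n)"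
    and \<rho> :: "real^('n + 'n)^('n + 'n) \<Rightarrow> complex"
  assumes "continuous_on {0..1} \<psi>" and "\<psi> ` {0..1} \<subseteq> Sp"
    and "continuous_on {-1..2} \<Psi>" and "\<Psi> ` {-1..2} \<subseteq> Sp"
    and "\<forall>t\<in>{0..1}. \<Psi> t = \<psi> t"
    and "\<forall>t\<in>{-1/2..0}. symplectic_endo_on (gen_eigenspace_1 (\<psi> 0)) (\<phi>\<^sub>0 t) \<and>
           (\<forall>c. eigenvalue_on (gen_eigenspace_1 (\<psi> 0)) (\<phi>\<^sub>0 t) c \<longrightarrow> c \<in> \<real> \<and> Re c > 0) \<and>
           \<Psi> t = diamond (star_space (\<psi> 0)) ((*v) (\<psi> 0)) (gen_eigenspace_1 (\<psi> 0)) (\<phi>\<^sub>0 t)"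
    and "standard_hyperbolic_on (gen_eigenspace_1 (\<psi> 0)) (\<phi>\<^sub>0 (-1/2))"
    and "\<forall>t\<in>{1..3/2}. symplectic_endo_on (gen_eigenspace_1 (\<psi> 1)) (\<phi>\<^sub>1 t) \<and>
           (\<forall>c. eigenvalue_on (gen_eigenspace_1 (\<psi> 1)) (\<phi>\<^sub>1 t) c \<longrightarrow> c \<in> \<real> \<and> Re c > 0) \<and>
           \<Psi> t = diamond (star_space (\<psi> 1)) ((*v) (\<psi> 1)) (gen_eigenspace_1 (\<psi> 1)) (\<phi>\<^sub>1 t)"
    and "standard_hyperbolic_on (gen_eigenspace_1 (\<psi> 1)) (\<phi>\<^sub>1 (3/2))"
    and "\<Psi> (-1) \<in> {W_plus, W_minus}" and "\<Psi> 2 \<in> {W_plus, W_minus}"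
    and "\<forall>t\<in>{-1..-1/2} \<union> {3/2..2}. \<not> admits_eigenvalue_1 (\<Psi> t)"
    and "continuous_on Sp \<rho>" and "\<rho> ` Sp \<subseteq> sphere 0 1"
    and "\<forall>U. orthogonal_matrix U \<and> U \<in> Sp \<longrightarrow> \<rho> U = det_C U"
    and "\<rho> W_minus \<in> {1, -1}"
    and "circle_degree 0 1 (\<lambda>t. (\<rho> (psi2_minus t))\<^sup>2) = real CARD('n) - 1"
  shows "rs_index 0 1 \<psi> =
           circle_degree (-1) 2 (\<lambda>t. (\<rho> (\<Psi> t))\<^sup>2)
           + 1/2 * (\<Sum>\<^sub>\<infinity>k\<in>{1..}. real_of_int (Qhat_sign (\<psi> 0) k))
           - 1/2 * (\<Sum>\<^sub>\<infinity>k\<in>{1..}. real_of_int (Qhat_sign (\<psi> 1) k))"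
proof -
  have ps: "\<psi> 0 \<in> Sp" "\<psi> 1 \<in> Sp" using assms(2) by auto
  interpret S0: symplectic_matrix "\<psi> 0" by (rule symplectic_matrix.intro[OF ps(1)])
  interpret S1: symplectic_matrix "\<psi> 1" by (rule symplectic_matrix.intro[OF ps(2)])
  have cont: "continuous_on {a..b} \<Psi>" if "-1 \<le> a" "b \<le> 2" for a b
    by (rule continuous_on_subset[OF assms(3)]) (use that in auto)
  have Sp: "\<Psi> t \<in> Sp" if "t \<in> {-1..2}" for t using assms(4) that by auto
  obtain \<theta> where th0: "sp_lift (-1) 2 \<Psi> \<theta>" by (rule sp_lift_exists[OF assms(3) Sp])
  have th: "sp_lift a b \<Psi> \<theta>" if "-1 \<le> a" "b \<le> 2" for a b by (rule sp_lift_subset[OF th0]) (use that in auto)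
  have p01: "\<Psi> 0 = \<psi> 0" "\<Psi> 1 = \<psi> 1" using assms(5) by auto
  have adm0: "S0.admissible (\<Psi> t)" and phi0: "\<And>v. v \<in> gen_eigenspace_1 (\<psi> 0) \<Longrightarrow> \<Psi> t *v v = \<phi>\<^sub>0 t v" if t: "t \<in> {-1/2..0}" for t
    using S0.admissible_diamond[of "\<Psi> t" "\<phi>\<^sub>0 t"] bspec[OF assms(6) t] Sp[of t] t by auto
  have adm1: "S1.admissible (\<Psi> t)" and phi1: "\<And>v. v \<in> gen_eigenspace_1 (\<psi> 1) \<Longrightarrow> \<Psi> t *v v = \<phi>\<^sub>1 t v" if t: "t \<in> {1..3/2}" for t
    using S1.admissible_diamond[of "\<Psi> t" "\<phi>\<^sub>1 t"] bspec[OF assms(8) t] Sp[of t] t by auto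
  \<comment> \<open>The times 0 and 1 belong to the interpolation intervals, so the end matrices are
    admissible for themselves; their own Cayley transforms carry the nilpotent information.\<close>
  have a0: "S0.admissible (\<psi> 0)" and a1: "S1.admissible (\<psi> 1)" using adm0[of 0] adm1[of 1] p01 by auto
  have "sp_index \<theta> \<Psi> (-1/2) = sp_index \<theta> \<Psi> (-1)"
    by (rule sp_index_no_crossing[OF _ cont Sp th]) (use assms(12) in \<open>auto intro!: fixspace_admits\<close>)
  moreover have "sp_index \<theta> \<Psi> 2 = sp_index \<theta> \<Psi> (3/2)"
    by (rule sp_index_no_crossing[OF _ cont Sp th]) (use assms(12) in \<open>auto intro!: fixspace_admits\<close>)
  moreover have "sp_index \<theta> \<Psi> 0 - sp_index \<theta> \<Psi> (-1/2) = S0.cayley_sign (\<psi> 0) / 2"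
  proof -
    have "S0.cayley_sign (\<Psi> (-1/2)) = 0" by (rule S0.cayley_sign_hyperbolic[OF adm0 assms(7) phi0]) auto
    then show ?thesis using S0.sp_index_admissible_path[OF _ cont adm0 th, of "-1/2" 0] by (simp add: p01)
  qed
  \<comment> \<open>Here the hyperbolic matrix is at the right end, hence the opposite sign from the
    interval before 0.\<close>
  moreover have "sp_index \<theta> \<Psi> (3/2) - sp_index \<theta> \<Psi> 1 = - S1.cayley_sign (\<psi> 1) / 2"
  proof -
    have "S1.cayley_sign (\<Psi> (3/2)) = 0" by (rule S1.cayley_sign_hyperbolic[OF adm1 assms(9) phi1]) auto
    then show ?thesis using S1.sp_index_admissible_path[OF _ cont adm1 th, of 1 "3/2"] by (simp add: p01)
  qed
  moreover have "rs_index 0 1 \<psi> = sp_index \<theta> \<Psi> 1 - sp_index \<theta> \<Psi> 0"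
  proof -
    have "sp_lift 0 1 \<psi> \<theta>" using th[of 0 1] assms(5) by (simp add: sp_lift_def)
    then show ?thesis using rs_index_eq[OF assms(1)] assms(2) by (simp add: sp_index_def p01 image_subset_iff)
  qed
  \<comment> \<open>Both ends of the extended path are normalized, so \<kappa> and the correction
    drop out together.\<close>
  moreover have "sp_index \<theta> \<Psi> 2 - sp_index \<theta> \<Psi> (-1) = circle_degree (-1) 2 (\<lambda>t. (\<rho> (\<Psi> t))\<^sup>2)"
  proof -
    obtain \<kappa> where k: "continuous_on Sp \<kappa>" "\<And>A. A \<in> Sp \<Longrightarrow> gr.souriau (Gr A) = (\<rho> A)\<^sup>2 * circ (\<kappa> A)"
      using rho_log[OF assms(13,14,15)] by blast
    have "normalized_at \<kappa> W_plus" by (rule normalized_W_plus[OF assms(15) k])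
    moreover have "normalized_at \<kappa> W_minus" by (rule normalized_W_minus[OF assms(17) k])
    ultimately have "normalized_at \<kappa> (\<Psi> (-1))" "normalized_at \<kappa> (\<Psi> 2)" using assms(10,11) by auto
    then show ?thesis using degree_sp_lift[OF _ assms(3) Sp th0 k] by (simp add: normalized_at_def sp_index_def)
  qed
  ultimately show ?thesis unfolding S0.infsum_Qhat_sign[OF a0] S1.infsum_Qhat_sign[OF a1] by linarith
qed

end
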